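(* Let $d=d_1+d_2$ with $1\le d_1<d$ and $1\le d_2<d$. Let $A'\in\mathbb R^{d_1\times d_1}$ be diagonalizable with $\mathrm{Sp}(A')\subset\mathbb R$, and let $K_{11}\in\mathbb R^{d_1\times d_1}$, $A_{12},K_{12}\in\mathbb R^{d_1\times d_2}$, $A_{21}\in\mathbb R^{d_2\times d_1}$, $A_{22}\in\mathbb R^{d_2\times d_2}$. Let $\omega$ be a nonempty open subset of $\mathbb T=\mathbb R/(2\pi\mathbb Z)$ and consider the control system $$\begin{cases}(\partial_t+A'\partial_x+K_{11})f_1+(A_{12}\partial_x+K_{12})f_2=u_11_\omega&\text{in }(0,T)\times\mathbb T,\\ (\partial_t-\partial_x^2+A_{22}\partial_x)f_2+A_{21}\partial_xf_1=0&\text{in }(0,T)\times\mathbb T,\end{cases}\qquad f(0,\cdot)=f_0,$$ with state $f=(f_1,f_2)\in\mathbb C^{d_1}\times\mathbb C^{d_2}$. Let $\mu_*=\min\{|\mu|:\mu\in\mathrm{Sp}(A')\}$, $\ell(\omega)=\sup\{|I|: I\text{ connected component of }\mathbb T\setminus\omega\}$ ($|I|$ the Lebesgue measure, $\sup\emptyset=0$), and $T^*=\ell(\omega)/\mu_*$ if $\mu_*>0$, $T^*=+\infty$ if $\mu_*=0$. The following statements are equivalent: - For every $T>T^*$ and every $f_0=(f_{01},f_{02})\in L^2(\mathbb T)^{d_1}\times L^2_{\mathrm m}(\mathbb T)^{d_2}$, there exists $u_1\in L^2((0,T)\times\omega)^{d_1}$ such that the solution of the system satisfies $f(T)=0$.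 - The couple of matrices $(A_{22},A_{21})$ satisfies the Kalman rank condition $$\mathrm{Span}\{A_{22}^jA_{21}X_1:\ X_1\in\mathbb C^{d_1},\ 0\le j\le d_2-1\}=\mathbb C^{d_2}.$$
   Context: $L^2_{\mathrm m}(\mathbb T)$ is the subspace of functions $h\in L^2(\mathbb T)$ (complex valued) with zero mean, $\int_{\mathbb T}h(x)\,dx=0$. $\mathrm{Sp}$ denotes the spectrum of a matrix. Solutions: put $A=\begin{pmatrix}A'&A_{12}\\ A_{21}&A_{22}\end{pmatrix}$, $B=\begin{pmatrix}0&0\\0&I_{d_2}\end{pmatrix}$, $K=\begin{pmatrix}K_{11}&K_{12}\\0&0\end{pmatrix}$ and $\mathcal L=-B\partial_x^2+A\partial_x+K$. The solution is the mild solution $f\in C^0([0,T];L^2(\mathbb T)^d)$, $f(t)=e^{-t\mathcal L}f_0+\int_0^te^{-(t-\tau)\mathcal L}(u_1(\tau)1_\omega,0)\,d\tau$, where $e^{-t\mathcal L}$ acts on the $n$-th Fourier coefficient as multiplication by $\exp(-t(n^2B+\mathrm i nA+K))$, $n\in\mathbb Z$.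
   Formalization: It is additionally assumed that μ_*>0: if μ_*=0 then T*=+∞, the first item is vacuously true, and the equivalence fails whenever the Kalman condition does (e.g. d_1=d_2=1, A'=0, A_{21}=0). *)

theory Defs
  imports "HOL-Analysis.Analysis"
begin

section \<open>The torus\<close>

quotient_type torus = real / "\<lambda>x y. \<exists>k::int. x - y = 2 * pi * of_int k"
  morphisms rep_torus torus_of_real
proof (rule equivpI)
  show "reflp (\<lambda>x y::real. \<exists>k::int. x - y = 2 * pi * of_int k)"
    by (rule reflpI) (rule exI[of _ 0], simp)
  show "symp (\<lambda>x y::real. \<exists>k::int. x - y = 2 * pi * of_int k)"
  proof (rule sympI)
    fix x y :: real assume "\<exists>k::int. x - y = 2 * pi * of_int k"
    then obtain k :: int where "x - y = 2 * pi * of_int k" ..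
    then have "y - x = 2 * pi * of_int (- k)" by simp
    then show "\<exists>k::int. y - x = 2 * pi * of_int k" ..
  qed
  show "transp (\<lambda>x y::real. \<exists>k::int. x - y = 2 * pi * of_int k)"
  proof (rule transpI)
    fix x y z :: real
    assume "\<exists>k::int. x - y = 2 * pi * of_int k" "\<exists>k::int. y - z = 2 * pi * of_int k"
    then obtain k l :: int where "x - y = 2 * pi * of_int k" "y - z = 2 * pi * of_int l" by blast
    then have "x - z = 2 * pi * of_int (k + l)" by (simp add: algebra_simps)
    then show "\<exists>k::int. x - z = 2 * pi * of_int k" ..
  qed
qed

text \<open>The quotient topology.\<close>

instantiation torus :: topological_space
begin

definition open_torus :: "torus set \<Rightarrow> bool"
  where "open_torus U \<longleftrightarrow> open (torus_of_real -` U)"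

instance
proof
  show "open (UNIV :: torus set)" by (simp add: open_torus_def)
  show "open (S \<inter> T)" if "open S" "open T" for S T :: "torus set"
    using that by (simp add: open_torus_def open_Int)
  show "open (\<Union>K)" if "\<forall>S\<in>K. open S" for K :: "torus set set"
    using that by (simp add: open_torus_def vimage_Union open_UN)
qed

end

text \<open>Lebesgue measure on the torus, of total mass \<open>2 * pi\<close>.\<close>

definition torus_measure :: "torus measure"
  where "torus_measure = distr (restrict_space lborel {0..<2 * pi}) borel torus_of_real"

lemma continuous_torus_of_real: "continuous_on UNIV torus_of_real"
  by (simp add: continuous_on_open_vimage open_torus_def)

lemma measurable_torus_of_real:
  "torus_of_real \<in> measurable (restrict_space lborel {0..<2 * pi}) borel"
  by (intro measurable_restrict_space1)
    (simp add: borel_measurable_continuous_onI[OF continuous_torus_of_real])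

lemma emeasure_torus_measure_UNIV: "emeasure torus_measure UNIV = ennreal (2 * pi)"
  by (simp add: torus_measure_def emeasure_distr[OF measurable_torus_of_real]
      emeasure_restrict_space space_restrict_space)

lift_definition torus_exp :: "int \<Rightarrow> torus \<Rightarrow> complex"
  is "\<lambda>n x. cis (of_int n * x)"
proof -
  fix n :: int and x y :: real
  assume "\<exists>k::int. x - y = 2 * pi * of_int k"
  then obtain k :: int where "x - y = 2 * pi * of_int k" ..
  then have "of_int n * x = of_int n * y + 2 * pi * of_int (n * k)"
    by (simp add: diff_eq_eq distrib_left)
  then show "cis (of_int n * x) = cis (of_int n * y)"
    by (simp flip: cis_mult)
qed

definition square_integrable :: "'a measure \<Rightarrow> ('a \<Rightarrow> 'b::real_normed_vector) \<Rightarrow> bool"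
  where "square_integrable M f \<longleftrightarrow>
    f \<in> borel_measurable M \<and> integrable M (\<lambda>x. (norm (f x))\<^sup>2)"

definition L2_norm :: "'a measure \<Rightarrow> ('a \<Rightarrow> 'b::real_normed_vector) \<Rightarrow> real"
  where "L2_norm M f = sqrt (LINT x|M. (norm (f x))\<^sup>2)"

definition fourier_coeff :: "(torus \<Rightarrow> complex^'n) \<Rightarrow> int \<Rightarrow> complex^'n"
  where "fourier_coeff h n = (LINT x|torus_measure. torus_exp (- n) x *s h x) /\<^sub>R (2 * pi)"

section \<open>Matrices\<close>

abbreviation cmat :: "real^'n^'m \<Rightarrow> complex^'n^'m"
  where "cmat \<equiv> map_matrix complex_of_real"

primrec matrix_power :: "'a::comm_ring_1^'n^'n \<Rightarrow> nat \<Rightarrow> 'a^'n^'n"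
  where
    "matrix_power M 0 = mat 1"
  | "matrix_power M (Suc k) = M ** matrix_power M k"

definition matrix_exp :: "complex^'n^'n \<Rightarrow> complex^'n^'n"
  where "matrix_exp M = (\<Sum>k. matrix_power M k /\<^sub>R fact k)"

definition spectrum :: "complex^'n^'n \<Rightarrow> complex set"
  where "spectrum M = {\<mu>. \<exists>v. v \<noteq> 0 \<and> M *v v = \<mu> *s v}"

definition diagonalizable :: "'a::field^'n^'n \<Rightarrow> bool"
  where "diagonalizable M \<longleftrightarrow>
    (\<exists>P D :: 'a^'n^'n. invertible P \<and> (\<forall>i j. i \<noteq> j \<longrightarrow> D $ i $ j = 0) \<and> M = P ** D ** matrix_inv P)"

text \<open>Indices of type \<open>'p + 'q\<close> split a vector of dimension \<open>d = d1 + d2\<close>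
  into its first \<open>d1 = CARD('p)\<close> and last \<open>d2 = CARD('q)\<close> components.\<close>

definition block_vec :: "'a^'p \<Rightarrow> 'a^'q \<Rightarrow> 'a^('p + 'q)"
  where "block_vec v w = (\<chi> i. case i of Inl a \<Rightarrow> v $ a | Inr b \<Rightarrow> w $ b)"

definition block_mat :: "'a^'p^'p \<Rightarrow> 'a^'q^'p \<Rightarrow> 'a^'p^'q \<Rightarrow> 'a^'q^'q \<Rightarrow> 'a^('p + 'q)^('p + 'q)"
  where "block_mat M11 M12 M21 M22 =
    (\<chi> i. case i of Inl a \<Rightarrow> block_vec (M11 $ a) (M12 $ a) | Inr b \<Rightarrow> block_vec (M21 $ b) (M22 $ b))"

definition kalman_rank_condition :: "real^'q^'q \<Rightarrow> real^'p^'q \<Rightarrow> bool"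
  where "kalman_rank_condition A B \<longleftrightarrow>
    vec.span {matrix_power (cmat A) j *v (cmat B *v X) | j X. j \<le> CARD('q) - 1} = UNIV"

section \<open>The minimal time\<close>

definition mu_star :: "real^'n^'n \<Rightarrow> real"
  where "mu_star M = Min (cmod ` spectrum (cmat M))"

definition gap_length :: "torus set \<Rightarrow> ennreal"
  where "gap_length \<omega> = (SUP I \<in> components (- \<omega>). emeasure torus_measure I)"

definition T_star :: "real^'n^'n \<Rightarrow> torus set \<Rightarrow> ennreal"
  where "T_star M \<omega> = (if mu_star M > 0 then gap_length \<omega> / ennreal (mu_star M) else \<infinity>)"

text \<open>If \<open>mu_star M = 0\<close>, a statement about all times \<open>T > T_star M \<omega>\<close> is vacuously true, while
  the Kalman rank condition may fail. An equivalence between the two needs \<open>mu_star M > 0\<close>.\<close>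

lemma spectrum_zero: "spectrum (0 :: complex^'n^'n) = {0}"
proof -
  have "\<exists>v :: complex^'n. v \<noteq> 0"
    by (rule exI[of _ "axis undefined 1"]) (simp add: axis_eq_0_iff)
  then show ?thesis
    by (auto simp: spectrum_def)
qed

lemma T_star_zero: "T_star (0 :: real^'n^'n) \<omega> = \<infinity>"
proof -
  have "cmat (0 :: real^'n^'n) = 0" by (simp add: vec_eq_iff)
  then show ?thesis by (simp add: T_star_def mu_star_def spectrum_zero)
qed

lemma not_kalman_zero: "\<not> kalman_rank_condition (A :: real^'q^'q) (0 :: real^'p^'q)"
proof
  assume k: "kalman_rank_condition A (0 :: real^'p^'q)"
  have z: "cmat (0 :: real^'p^'q) = 0" by (simp add: vec_eq_iff)
  have "{matrix_power (cmat A) j *v (cmat (0 :: real^'p^'q) *v X) | j X. j \<le> CARD('q) - 1} \<subseteq> {0}"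
    by (auto simp: z)
  then have "vec.span {matrix_power (cmat A) j *v (cmat (0 :: real^'p^'q) *v X) | j X. j \<le> CARD('q) - 1}
      \<subseteq> vec.span {0}"
    by (rule vec.span_mono)
  with k have "(UNIV :: (complex^'q) set) \<subseteq> {0}"
    by (simp add: kalman_rank_condition_def)
  moreover have "axis undefined 1 \<noteq> (0 :: complex^'q)" by (simp add: axis_eq_0_iff)
  ultimately show False by blast
qed

lemma unguarded_equivalence_fails:
  "\<not> ((\<forall>T. ennreal T > T_star (0 :: real^'p^'p) \<omega> \<longrightarrow> controllable T)
       \<longleftrightarrow> kalman_rank_condition (A :: real^'q^'q) (0 :: real^'p^'q))"
  by (simp add: T_star_zero not_kalman_zero)

section \<open>Mild solutions\<close>

text \<open>The operator \<open>- B \<partial>\<^sub>x\<^sup>2 + A \<partial>\<^sub>x + K\<close> on the \<open>n\<close>-th Fourier mode.\<close>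

definition mode_matrix :: "real^'d^'d \<Rightarrow> real^'d^'d \<Rightarrow> real^'d^'d \<Rightarrow> int \<Rightarrow> complex^'d^'d"
  where "mode_matrix B A K n =
    map_matrix ((*) ((of_int n)\<^sup>2)) (cmat B) + map_matrix ((*) (\<i> * of_int n)) (cmat A) + cmat K"

text \<open>\<open>f \<in> C\<^sup>0([0,T]; L\<^sup>2)\<close> is the mild solution of
  \<open>\<partial>\<^sub>t f - B \<partial>\<^sub>x\<^sup>2 f + A \<partial>\<^sub>x f + K f = g\<close>, \<open>f(0) = f\<^sub>0\<close>. Both sides of the Duhamel formula are elements
  of \<open>L\<^sup>2\<close>; they are equated through their Fourier coefficients, on which the semigroup is
  defined and with which the \<open>L\<^sup>2\<close>-valued time integral commutes.\<close>

definition mild_solution ::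
  "real^'d^'d \<Rightarrow> real^'d^'d \<Rightarrow> real^'d^'d \<Rightarrow> real \<Rightarrow> (torus \<Rightarrow> complex^'d) \<Rightarrow>
   (real \<Rightarrow> torus \<Rightarrow> complex^'d) \<Rightarrow> (real \<Rightarrow> torus \<Rightarrow> complex^'d) \<Rightarrow> bool"
  where "mild_solution B A K T f0 g f \<longleftrightarrow>
    (\<forall>t\<in>{0..T}. square_integrable torus_measure (f t)) \<and>
    (\<forall>t\<in>{0..T}.
      ((\<lambda>s. L2_norm torus_measure (\<lambda>x. f s x - f t x)) \<longlongrightarrow> 0) (at t within {0..T})) \<and>
    (\<forall>t\<in>{0..T}. \<forall>n.
      fourier_coeff (f t) n =
        matrix_exp (- t *\<^sub>R mode_matrix B A K n) *v fourier_coeff f0 n +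
        (LINT \<tau>:{0..t}|lborel.
          matrix_exp (- (t - \<tau>) *\<^sub>R mode_matrix B A K n) *v fourier_coeff (g \<tau>) n))"

end

theory Submission imports Defs begin

text \<open>
  Controllability in time \<open>T\<close> is dual to an observability inequality for the adjoint modes
  \<open>exp (t G n) v n\<close>: their first blocks, summed into a trigonometric polynomial and observed on \<open>\<omega>\<close>
  during \<open>[0, T]\<close>, bound the final state. It is enough to prove it for trigonometric polynomials. For
  large \<open>n\<close> a Riccati equation block-diagonalizes \<open>G n\<close> into a transport part and a heat part. The
  transport part is observed because every characteristic meets \<open>\<omega>\<close> before \<open>T\<close>. The heat part is
  observed, in arbitrarily short time, by the method of Lebeau and Robbiano: a spectral inequality for
  trigonometric polynomials and the Kalman condition recover the low modes from the first block, and
  the dissipation makes up for the exponential cost. A bounded range of modes is then added by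
  filtering: a polynomial in a short time average kills a given mode and is invertible on the high
  ones. The control comes from Riesz' representation theorem. If the Kalman condition fails, the
  adjoint heat part has an unobservable vector, which already contradicts controllability on the mode
  \<open>n = 1\<close>.
\<close>

text \<open>The obstacle is that the heat component is never observed by itself: at frequency
  \<open>n\<close> it enters the first block through the coupling only, with amplitude of order
  \<open>1 / n\<close>, and on top of a transport component of size one. The two parts are therefore
  observed on different time windows, and each estimate contains the other part as an error. The
  loop closes because, once a short time has passed, the heat part disturbs the observation only by
  \<open>c / N\<close> times its current size, and the frequency threshold \<open>N\<close> is free.
  Powers of \<open>n\<close> lost in the heat part are harmless against its dissipation
  \<open>exp (- n^2 s / 2)\<close>. Every inequality is stated for finite sets of modes with
  constants independent of the set; filtering takes the place of a compactness-uniqueness argument.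
  The mode \<open>0\<close> is special: there the first block of the adjoint evolves alone and the
  second block is invisible, which is where the zero mean of the second component is used.\<close>

notation scaleR (infixr "*R" 75)

abbreviation nsq :: "'a::real_normed_vector => real" where "nsq x \<equiv> (norm x)^2"

abbreviation absr :: "int => real" where "absr n \<equiv> \<bar>of_int n\<bar>"

section \<open>Complex matrices and their exponentials\<close>

lemma norm_vector_smult: "norm (c *s (x :: complex^'n)) = cmod c * norm x"
 by (simp add: norm_vec_def vector_scalar_mult_def norm_mult L2_set_right_distrib)

lemma scaleR_eq_smult: "r *R (x :: complex^'n) = complex_of_real r *s x"
 by (simp add: vec_eq_iff) (simp add: scaleR_conv_of_real)

lemma bounded_bilinear_smult: "bounded_bilinear ((*s) :: complex => complex^'n => complex^'n)"
proof
 show "\<exists>K. \<forall>a (b :: complex^'n). norm (a *s b) \<le> norm a * norm b * K"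
  by (intro exI[of _ 1]) (simp add: norm_vector_smult)
qed (simp_all add: vec_eq_iff vector_scalar_mult_def algebra_simps)

text \<open>The norm of a matrix is Euclidean in its entries, so Cauchy-Schwarz is applied row by
  row. In this norm \<open>mat 1\<close> is larger than 1 in dimension above one; most estimates are
  therefore made on vectors \<open>M *v x\<close> and not on matrices.\<close>

lemma norm_matrix_vector_le: "norm (M *v x) \<le> norm (M :: complex^'n^'m) * norm x"
proof -
 have "norm ((M *v x) $ i) \<le> norm (M $ i) * norm x" for i
 proof -
  have "norm ((M *v x) $ i) \<le> (\<Sum>j\<in>UNIV. cmod (M $ i $ j) * cmod (x $ j))"
   by (simp add: matrix_vector_mult_def norm_mult[symmetric] norm_sum)
  also have "... \<le> norm (M $ i) * norm x" unfolding norm_vec_def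
   using L2_set_mult_ineq[of "\<lambda>j. cmod (M $ i $ j)" "\<lambda>j. cmod (x $ j)" UNIV] by simp
  finally show ?thesis .
 qed
 then have "L2_set (\<lambda>i. norm ((M *v x) $ i)) UNIV \<le> L2_set (\<lambda>i. norm (M $ i) * norm x) UNIV"
  by (intro L2_set_mono) auto
 then show ?thesis by (simp add: norm_vec_def[of "M *v x"] norm_vec_def[of M] L2_set_left_distrib)
qed

lemma norm_transpose: "norm (transpose M) = norm (M :: complex^'n^'m)"
 by (simp add: norm_vec_def L2_set_def transpose_def sum_nonneg) (rule sum.swap)

lemma matrix_mult_row: "(M ** N) $ i = transpose N *v (M $ i)"
 for M :: "complex^'n^'m" and N :: "complex^'k^'n"
 by (simp add: vec_eq_iff matrix_matrix_mult_def matrix_vector_mult_def transpose_def mult.commute)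

lemma norm_matrix_mult_le: "norm (M ** N) \<le> norm M * norm (N :: complex^'k^'n)"
proof -
 have "norm ((M ** N) $ i) \<le> norm (M $ i) * norm N" for i
  using norm_matrix_vector_le[of "transpose N" "M $ i"]
  by (simp add: matrix_mult_row norm_transpose mult.commute)
 then have "L2_set (\<lambda>i. norm ((M ** N) $ i)) UNIV \<le> L2_set (\<lambda>i. norm (M $ i) * norm N) UNIV"
  by (intro L2_set_mono) auto
 then show ?thesis by (simp add: norm_vec_def[of "M ** N"] norm_vec_def[of M] L2_set_left_distrib)
qed

lemma matrix_scaleR_left: "(r *R M) *v x = r *R (M *v x)" for M :: "complex^'n^'m"
 by (simp add: vec_eq_iff matrix_vector_mult_def scaleR_sum_right)

lemma matrix_scaleR_right: "M *v (r *R x) = r *R (M *v x)" for M :: "complex^'n^'m"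
 by (simp add: vec_eq_iff matrix_vector_mult_def scaleR_sum_right)

lemma bounded_bilinear_matrix_vector: "bounded_bilinear ((*v) :: complex^'n^'m => _)"
proof
 show "\<exists>K. \<forall>(a :: complex^'n^'m) b. norm (a *v b) \<le> norm a * norm b * K"
  by (intro exI[of _ 1]) (simp add: norm_matrix_vector_le)
qed (simp_all add: matrix_vector_mult_add_rdistrib matrix_vector_right_distrib
   matrix_scaleR_left matrix_scaleR_right)

lemma bounded_bilinear_matrix_mult:
 "bounded_bilinear ((**) :: complex^'n^'m => complex^'k^'n => _)"
proof
 show "\<exists>K. \<forall>(a :: complex^'n^'m) (b :: complex^'k^'n). norm (a ** b) \<le> norm a * norm b * K"
  by (intro exI[of _ 1]) (simp add: norm_matrix_mult_le)
qed (simp_all add: vec_eq_iff matrix_matrix_mult_def algebra_simps sum.distrib scaleR_sum_right)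

lemmas bounded_linear_matrix_vector =
 bounded_bilinear.bounded_linear_right[OF bounded_bilinear_matrix_vector]

lemma matrix_vector_smult: "M *v (c *s x) = c *s (M *v x)" for M :: "complex^'n^'m"
 by (simp add: vec_eq_iff matrix_vector_mult_def vector_scalar_mult_def sum_distrib_left algebra_simps)

lemma matrix_vector_sum: "M *v (\<Sum>i\<in>S. f i) = (\<Sum>i\<in>S. M *v f i)" for M :: "complex^'n^'m"
 by (rule bounded_linear.linear[OF bounded_linear_matrix_vector, THEN linear_sum])

lemmas continuous_on_matrix_vector =
 bounded_bilinear.continuous_on[OF bounded_bilinear_matrix_vector]

lemma matrix_power_vector_Suc: "matrix_power M (Suc k) *v x = M *v (matrix_power M k *v x)"
 by (simp add: matrix_vector_mul_assoc)

lemma norm_matrix_power_vector_le: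
 "norm (matrix_power M k *v x) \<le> norm M ^ k * norm (x :: complex^'n)"
proof (induction k)
 case (Suc k)
 have "norm (matrix_power M (Suc k) *v x) \<le> norm M * norm (matrix_power M k *v x)"
  unfolding matrix_power_vector_Suc by (rule norm_matrix_vector_le)
 also have "... \<le> norm M * (norm M ^ k * norm x)" by (intro mult_left_mono Suc) auto
 finally show ?case by (simp add: mult.assoc)
qed simp

lemma norm_matrix_power_le:
 "norm (matrix_power M k) \<le> norm (M :: complex^'n^'n) ^ k * norm (mat 1 :: complex^'n^'n)"
proof (induction k)
 case (Suc k)
 have "norm (matrix_power M (Suc k)) \<le> norm M * norm (matrix_power M k)"
  by (simp only: matrix_power.simps norm_matrix_mult_le)
 also have "... \<le> norm M * (norm M ^ k * norm (mat 1 :: complex^'n^'n))"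
  by (intro mult_left_mono Suc) auto
 finally show ?case by (simp add: mult.assoc)
qed simp

lemma summable_matrix_exp: "summable (\<lambda>k. matrix_power (M :: complex^'n^'n) k /\<^sub>R fact k)"
proof (rule summable_comparison_test')
 show "summable (\<lambda>k. norm (mat 1 :: complex^'n^'n) * (norm M ^ k /\<^sub>R fact k))"
  by (intro summable_mult summable_exp_generic)
 show "norm (matrix_power M k /\<^sub>R fact k) \<le> norm (mat 1 :: complex^'n^'n) * (norm M ^ k /\<^sub>R fact k)" for k
  using norm_matrix_power_le[of M k] by (simp add: divide_simps mult.commute)
qed

lemma sums_matrix_exp_vector:
 "(\<lambda>k. (matrix_power M k *v x) /\<^sub>R fact k) sums (matrix_exp M *v (x :: complex^'n))"
proof -
 have "(\<lambda>k. (matrix_power M k /\<^sub>R fact k) *v x) sums (matrix_exp M *v x)"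
  unfolding matrix_exp_def
  by (intro bounded_linear.sums[OF bounded_bilinear.bounded_linear_left[OF bounded_bilinear_matrix_vector]]
    summable_sums summable_matrix_exp)
 then show ?thesis by (simp add: matrix_scaleR_left)
qed

lemma norm_matrix_exp_vector_le: "norm (matrix_exp M *v x) \<le> exp (norm M) * norm (x :: complex^'n)"
proof -
 have s: "(\<lambda>k. (norm M ^ k /\<^sub>R fact k) * norm x) sums (exp (norm M) * norm x)"
  by (intro sums_mult2 exp_converges)
 have b: "norm ((matrix_power M k *v x) /\<^sub>R fact k) \<le> (norm M ^ k /\<^sub>R fact k) * norm x" for k
  using norm_matrix_power_vector_le[of M k x] by (simp add: divide_simps)
 have "norm (\<Sum>k. (matrix_power M k *v x) /\<^sub>R fact k) \<le> (\<Sum>k. (norm M ^ k /\<^sub>R fact k) * norm x)"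
  using b s by (intro norm_suminf_le) (auto simp: sums_iff)
 then show ?thesis using s sums_matrix_exp_vector[of M x] by (simp add: sums_iff)
qed

lemma matrix_power_intertwine:
 assumes "\<And>x. L (H *v x) = G *v L x"
 shows "L (matrix_power H k *v x) = matrix_power G k *v L x"
 by (induction k) (simp_all only: matrix_power_vector_Suc assms, simp)

text \<open>The intertwining relation passes to powers and then through the series. \<open>L\<close>
  is a real-linear map between spaces of possibly different dimension, which covers block
  projections and the embeddings of invariant graphs.\<close>

lemma matrix_exp_intertwine:
 fixes L :: "complex^'n => complex^'m"
 assumes L: "bounded_linear L" and c: "\<And>x. L (H *v x) = G *v L x"
 shows "L (matrix_exp H *v x) = matrix_exp G *v L x"
proof -
 interpret bounded_linear L by fact
 have "(\<lambda>k. L ((matrix_power H k *v x) /\<^sub>R fact k)) sums L (matrix_exp H *v x)"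
  by (intro sums sums_matrix_exp_vector)
 then have "(\<lambda>k. (matrix_power G k *v L x) /\<^sub>R fact k) sums L (matrix_exp H *v x)"
  by (simp add: scaleR matrix_power_intertwine[of L, OF c])
 with sums_matrix_exp_vector[of G "L x"] show ?thesis by (rule sums_unique2[symmetric])
qed

lemma matrix_exp_intertwine_scaleR:
 fixes L :: "complex^'n => complex^'m"
 assumes L: "bounded_linear L" and c: "\<And>x. L (H *v x) = G *v L x"
 shows "L (matrix_exp (t *R H) *v x) = matrix_exp (t *R G) *v L x"
 using L by (rule matrix_exp_intertwine) (simp add: matrix_scaleR_left linear_simps(5)[OF L] c)

lemma matrix_exp_zero_vector [simp]: "matrix_exp 0 *v x = (x :: complex^'n)"
proof -
 have "(matrix_power 0 k *v x) /\<^sub>R fact k = (if k = 0 then x else 0)" for k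
 proof (cases k)
  case (Suc j)
  then show ?thesis by (simp only: matrix_power_vector_Suc) simp
 qed simp
 then have "(\<lambda>k. (matrix_power 0 k *v x) /\<^sub>R fact k) sums x"
  using sums_single[of 0 "\<lambda>_. x"] by simp
 with sums_matrix_exp_vector[of 0 x] show ?thesis by (rule sums_unique2)
qed

text \<open>Conjugate transpose: the adjoint with respect to \<open>inner\<close>, which on complex
  vectors is the real part of the Hermitian product.\<close>

definition adjm :: "complex^'n^'m => complex^'m^'n"
 where "adjm M = (\<chi> i j. cnj (M $ j $ i))"

lemma inner_complex_cnj: "inner a b = Re (cnj a * b)" by (simp add: inner_complex_def)

lemma inner_adjm: "inner (M *v x) y = inner x (adjm M *v y)"
 for M :: "complex^'n^'m"
proof -
 have "inner (M *v x) y = (\<Sum>i\<in>UNIV. \<Sum>j\<in>UNIV. Re (cnj (M $ i $ j * x $ j) * y $ i))"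
  by (simp add: inner_vec_def inner_complex_cnj matrix_vector_mult_def sum_distrib_right)
 also have "... = (\<Sum>j\<in>UNIV. \<Sum>i\<in>UNIV. Re (cnj (x $ j) * (cnj (M $ i $ j) * y $ i)))"
  by (subst sum.swap) (simp add: algebra_simps)
 also have "... = inner x (adjm M *v y)"
  by (simp add: inner_vec_def inner_complex_cnj matrix_vector_mult_def sum_distrib_left adjm_def
    del: Re_complex_of_real)
 finally show ?thesis .
qed

lemma adjm_adjm [simp]: "adjm (adjm M) = M" by (simp add: adjm_def vec_eq_iff)

lemma inner_matrix_exp_adjm: "inner (matrix_exp M *v x) y = inner x (matrix_exp (adjm M) *v y)"
proof -
 have p: "inner (matrix_power M k *v x) y = inner x (matrix_power (adjm M) k *v y)" for k x y
 proof (induction k arbitrary: x y)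
  case (Suc k)
  have comm: "matrix_power (adjm M) k *v (adjm M *v y) = adjm M *v (matrix_power (adjm M) k *v y)"
   by (rule matrix_power_intertwine[symmetric]) simp
  show ?case by (simp only: matrix_power_vector_Suc inner_adjm[of M] Suc comm)
 qed simp
 have "(\<lambda>k. inner ((matrix_power M k *v x) /\<^sub>R fact k) y) sums inner (matrix_exp M *v x) y"
  by (intro bounded_linear.sums[OF bounded_linear_inner_left] sums_matrix_exp_vector)
 moreover have "(\<lambda>k. inner x ((matrix_power (adjm M) k *v y) /\<^sub>R fact k)) sums
   inner x (matrix_exp (adjm M) *v y)"
  by (intro bounded_linear.sums[OF bounded_linear_inner_right] sums_matrix_exp_vector)
 ultimately show ?thesis by (simp add: p sums_unique2)
qed

lemma adjm_scaleR: "adjm (t *R M) = t *R adjm M" by (simp add: adjm_def vec_eq_iff)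

text \<open>Paired with a fixed vector \<open>y\<close>, the exponential is a scalar power series in
  \<open>t\<close> and can be differentiated termwise; the additional factor \<open>M\<close> is
  carried by \<open>y\<close> as \<open>adjm M\<close>. All pairings together give the vector
  statement.\<close>

lemma has_vector_derivative_matrix_exp:
 "((\<lambda>t. matrix_exp (t *R M) *v x) has_vector_derivative M *v (matrix_exp (t *R M) *v (x :: complex^'n))) (at t)"
proof -
 have pow: "matrix_power (s *R M) k *v x = s ^ k *R (matrix_power M k *v x)" for s k
  by (induction k) (simp_all only: matrix_power_vector_Suc matrix_scaleR_left matrix_scaleR_right, simp_all)
 have "((\<lambda>t. inner (matrix_exp (t *R M) *v x) y) has_real_derivative
   inner (M *v (matrix_exp (t *R M) *v x)) y) (at t)" for y
 proof -
  define c where "c = (\<lambda>k. inner (matrix_power M k *v x) y / fact k)"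
  have s: "(\<lambda>k. c k * s ^ k) sums inner (matrix_exp (s *R M) *v x) y" for s
   using bounded_linear.sums[OF bounded_linear_inner_left sums_matrix_exp_vector[of "s *R M" x], of y]
   by (simp add: c_def pow field_simps)
  have d: "diffs c = (\<lambda>k. inner (matrix_power M k *v x) (adjm M *v y) / fact k)"
   by (simp add: diffs_def c_def matrix_power_vector_Suc inner_adjm[of M, symmetric] fun_eq_iff del: matrix_power.simps)
  have s': "(\<lambda>k. diffs c k * t ^ k) sums inner (matrix_exp (t *R M) *v x) (adjm M *v y)"
   using bounded_linear.sums[OF bounded_linear_inner_left sums_matrix_exp_vector[of "t *R M" x], of "adjm M *v y"]
   by (simp add: d pow field_simps)
  have "((\<lambda>s. \<Sum>k. c k * s ^ k) has_real_derivative (\<Sum>k. diffs c k * t ^ k)) (at t)"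
   using s by (intro termdiffs_strong_converges_everywhere) (auto simp: sums_iff)
  then show ?thesis using s s' by (simp add: sums_iff inner_adjm[of M])
 qed
 then show ?thesis unfolding has_vector_derivative_def has_field_derivative_def
  by (subst has_derivative_componentwise_within) (simp add: mult.commute[of _ "inner _ _"] mult_commute_abs)
qed

lemma norm_increment_le:
 fixes f :: "real => 'a::real_normed_vector"
 assumes d: "\<And>s. s \<in> {0..t} ==> (f has_vector_derivative f' s) (at s)"
  and b: "\<And>s. s \<in> {0..t} ==> norm (f' s) \<le> B" and t: "0 \<le> t"
 shows "norm (f t - f 0) \<le> B * t"
proof -
 have "norm (f t - f 0) \<le> B * norm (t - 0)"
 proof (rule differentiable_bound)
  show "(f has_derivative (\<lambda>h. h *R f' s)) (at s within {0..t})" if "s \<in> {0..t}" for s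
   using d[OF that] by (simp add: has_vector_derivative_def has_derivative_at_withinI)
  show "onorm (\<lambda>h. h *R f' s) \<le> B" if "s \<in> {0..t}" for s
   using b[OF that] by (simp add: onorm_scaleR_left[of "\<lambda>x. x"] onorm_id)
 qed (use t in auto)
 with t show ?thesis by simp
qed

text \<open>The squared norm, unlike the norm, is differentiable also where \<open>w\<close>
  vanishes; multiplied by \<open>exp (- 2 * k * s)\<close> it is nonincreasing.\<close>

lemma gronwall_norm:
 fixes w :: "real => 'a::euclidean_space"
 assumes d: "\<And>s. s \<in> {0..t} ==> (w has_vector_derivative w' s) (at s)"
  and b: "\<And>s. s \<in> {0..t} ==> norm (w' s) \<le> k * norm (w s)"
  and t: "0 \<le> t"
 shows "norm (w t) \<le> exp (k * t) * norm (w 0)"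
proof -
 define f where "f = (\<lambda>s. exp (- 2 * k * s) * inner (w s) (w s))"
 have "f t \<le> f 0"
 proof (rule DERIV_nonpos_imp_nonincreasing[OF t])
  fix s assume s: "0 \<le> s" "s \<le> t"
  have w: "((\<lambda>s. inner (w s) (w s)) has_real_derivative 2 * inner (w s) (w' s)) (at s)"
  proof -
   have "(w has_derivative (\<lambda>h. h *R w' s)) (at s)" using d s by (simp add: has_vector_derivative_def)
   from has_derivative_inner[OF this this] show ?thesis unfolding has_field_derivative_def
    by (rule has_derivative_eq_rhs) (auto simp: fun_eq_iff inner_commute algebra_simps)
  qed
  have D: "(f has_real_derivative
    exp (- 2 * k * s) * (2 * inner (w s) (w' s)) + exp (- 2 * k * s) * (- 2 * k) * inner (w s) (w s)) (at s)"
   unfolding f_def by (rule derivative_eq_intros w refl | simp)+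
  have "inner (w s) (w' s) \<le> norm (w s) * norm (w' s)" by (rule norm_cauchy_schwarz)
  also have "... \<le> norm (w s) * (k * norm (w s))" using b s by (intro mult_left_mono) auto
  finally have "inner (w s) (w' s) \<le> k * inner (w s) (w s)"
   by (simp add: power2_norm_eq_inner[symmetric] power2_eq_square mult_ac)
  then have "exp (- 2 * k * s) * (2 * inner (w s) (w' s)) + exp (- 2 * k * s) * (- 2 * k) * inner (w s) (w s) \<le> 0"
   by (simp add: algebra_simps)
  with D show "\<exists>y. (f has_real_derivative y) (at s) \<and> y \<le> 0" by blast
 qed
 then have "exp (- 2 * k * t) * nsq (w t) \<le> nsq (w 0)" by (simp add: f_def power2_norm_eq_inner)
 then have "exp (2 * k * t) * (exp (- 2 * k * t) * nsq (w t)) \<le> exp (2 * k * t) * nsq (w 0)"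
  by (intro mult_left_mono) auto
 then have "nsq (w t) \<le> exp (2 * k * t) * nsq (w 0)"
  by (simp add: mult.assoc[symmetric] exp_add[symmetric])
 also have "... = (exp (k * t) * norm (w 0))^2"
  by (simp add: power_mult_distrib exp_double[symmetric] mult.assoc)
 finally show ?thesis by (rule power2_le_imp_le) simp
qed

text \<open>The difference of two solutions vanishes at positive times by Gronwall and at negative
  times after reflection. Later identities between exponentials are proved by checking the
  differential equation and applying this lemma.\<close>

lemma linear_ode_unique:
 fixes y :: "real => complex^'n"
 assumes d: "\<And>s. (y has_vector_derivative M *v y s) (at s)"
 shows "y t = matrix_exp (t *R M) *v y 0"
proof -
 define w where "w = (\<lambda>s. y s - matrix_exp (s *R M) *v y 0)"
 have w: "(w has_vector_derivative M *v w s) (at s)" for s unfolding w_def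
  by (rule has_vector_derivative_eq_rhs, rule has_vector_derivative_diff[OF d has_vector_derivative_matrix_exp])
   (simp add: matrix_vector_mult_diff_distrib)
 have w0: "w 0 = 0" by (simp add: w_def)
 have "w t = 0"
 proof (cases "0 \<le> t")
  case True
  then have "norm (w t) \<le> exp (norm M * t) * norm (w 0)"
   using w by (intro gronwall_norm[of _ _ "\<lambda>s. M *v w s"]) (auto simp: norm_matrix_vector_le)
  with w0 show ?thesis by simp
 next
  case False
  define v where "v = (\<lambda>s. w (- s))"
  have v: "(v has_vector_derivative - (M *v v s)) (at s)" for s
  proof -
   have "((\<lambda>s. - s :: real) has_vector_derivative - 1) (at s)" by (auto intro!: derivative_eq_intros)
   from vector_diff_chain_at[OF this w[of "- s"]] show ?thesis by (simp add: v_def o_def)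
  qed
  have "norm (v (- t)) \<le> exp (norm M * (- t)) * norm (v 0)"
   using v False by (intro gronwall_norm[of _ _ "\<lambda>s. - (M *v v s)"]) (auto simp: norm_matrix_vector_le)
  with w0 show ?thesis by (simp add: v_def)
 qed
 then show ?thesis by (simp add: w_def)
qed

lemma matrix_exp_add_vector:
 "matrix_exp ((s + t) *R M) *v x = matrix_exp (s *R M) *v (matrix_exp (t *R M) *v (x :: complex^'n))"
proof -
 have "((\<lambda>s. matrix_exp ((s + t) *R M) *v x) has_vector_derivative
   M *v (matrix_exp ((s + t) *R M) *v x)) (at s)" for s
 proof -
  have "((\<lambda>s. s + t) has_vector_derivative 1) (at s)" by (auto intro!: derivative_eq_intros)
  from vector_diff_chain_at[OF this has_vector_derivative_matrix_exp] show ?thesis by (simp add: o_def)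
 qed
 from linear_ode_unique[of "\<lambda>s. matrix_exp ((s + t) *R M) *v x", OF this] show ?thesis by simp
qed

lemma matrix_exp_minus_cancel [simp]:
 "matrix_exp (- (t *R M)) *v (matrix_exp (t *R M) *v x) = x"
 "matrix_exp (t *R M) *v (matrix_exp (- (t *R M)) *v x) = (x :: complex^'n)"
 using matrix_exp_add_vector[of "- t" t M x] matrix_exp_add_vector[of t "- t" M x] by simp_all

lemma matrix_exp_commute:
 assumes "A ** B = B ** A"
 shows "B *v (matrix_exp (t *R A) *v x) = matrix_exp (t *R A) *v (B *v (x :: complex^'n))"
 by (rule matrix_exp_intertwine_scaleR[OF bounded_linear_matrix_vector])
  (simp add: matrix_vector_mul_assoc assms)

lemma has_vector_derivative_matrix:
 fixes E :: "real => complex^'n^'m"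
 assumes "\<And>x. ((\<lambda>t. E t *v x) has_vector_derivative E' *v x) (at t)"
 shows "(E has_vector_derivative E') (at t)"
proof -
 define L :: "'n => complex^'m => complex^'n^'m"
  where "L = (\<lambda>j u. \<chi> i k. if k = j then u $ i else 0)"
 have L: "bounded_linear (L j)" for j by (rule linear_conv_bounded_linear[THEN iffD1])
   (auto simp: linear_iff L_def vec_eq_iff)
 have id: "M = (\<Sum>j\<in>UNIV. L j (M *v axis j 1))" for M :: "complex^'n^'m"
  by (simp add: vec_eq_iff L_def matrix_vector_mult_def axis_def if_distrib cong: if_cong)
 have "((\<lambda>t. \<Sum>j\<in>UNIV. L j (E t *v axis j 1)) has_vector_derivative (\<Sum>j\<in>UNIV. L j (E' *v axis j 1))) (at t)"
  by (intro has_vector_derivative_sum bounded_linear.has_vector_derivative[OF L] assms)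
 then show ?thesis by (simp only: id[symmetric])
qed

lemma has_vector_derivative_matrix_exp_matrix:
 "((\<lambda>t. matrix_exp (t *R M)) has_vector_derivative M ** matrix_exp (t *R M)) (at t)"
 for M :: "complex^'n^'n" by (rule has_vector_derivative_matrix)
  (simp add: matrix_vector_mul_assoc[symmetric] has_vector_derivative_matrix_exp)

lemma continuous_on_matrix_exp [continuous_intros]:
 assumes "continuous_on S f"
 shows "continuous_on S (\<lambda>t. matrix_exp (f t *R (M :: complex^'n^'n)))"
proof (rule continuous_on_compose2[OF _ assms subset_UNIV])
 show "continuous_on UNIV (\<lambda>t. matrix_exp (t *R M))"
  using has_vector_derivative_continuous[OF has_vector_derivative_matrix_exp_matrix]
  by (auto simp: continuous_on_eq_continuous_at)
qed

lemma matrix_exp_add_commuting: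
 assumes c: "A ** B = B ** A"
 shows "matrix_exp (t *R (A + B)) *v x = matrix_exp (t *R A) *v (matrix_exp (t *R B) *v (x :: complex^'n))"
proof -
 define y where "y = (\<lambda>t. matrix_exp (t *R A) *v (matrix_exp (t *R B) *v x))"
 have "(y has_vector_derivative (A + B) *v y t) (at t)" for t unfolding y_def
  by (rule has_vector_derivative_eq_rhs, rule bounded_bilinear.has_vector_derivative[OF bounded_bilinear_matrix_vector
     has_vector_derivative_matrix_exp_matrix has_vector_derivative_matrix_exp])
   (simp add: matrix_vector_mul_assoc[symmetric] matrix_exp_commute[OF c] matrix_vector_mult_add_rdistrib add.commute)
 from linear_ode_unique[of y, OF this] show ?thesis by (simp add: y_def)
qed

lemma norm_matrix_exp_scaleR_le:
 "norm (matrix_exp (t *R M) *v x) \<le> exp (\<bar>t\<bar> * norm M) * norm (x :: complex^'n)"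
 using norm_matrix_exp_vector_le[of "t *R M" x] by simp

section \<open>Taylor and perturbation estimates for matrix exponentials\<close>

lemma matrix_exp_diff_le:
 fixes A :: "complex^'n^'n"
 assumes "0 \<le> h"
 shows "norm (matrix_exp (h *R A) *v x - x) \<le> h * norm A * exp (h * norm A) * norm x"
proof -
 have "norm (matrix_exp (h *R A) *v x - matrix_exp (0 *R A) *v x) \<le> norm A * exp (h * norm A) * norm x * h"
 proof (rule norm_increment_le[of h _ "\<lambda>t. A *v (matrix_exp (t *R A) *v x)"])
  fix t assume t: "t \<in> {0..h}"
  show "((\<lambda>t. matrix_exp (t *R A) *v x) has_vector_derivative A *v (matrix_exp (t *R A) *v x)) (at t)"
   by (rule has_vector_derivative_matrix_exp)
  have "norm (A *v (matrix_exp (t *R A) *v x)) \<le> norm A * (exp (t * norm A) * norm x)"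
   using t norm_matrix_vector_le[of A "matrix_exp (t *R A) *v x"] norm_matrix_exp_scaleR_le[of t A x]
   by (smt (verit, best) atLeastAtMost_iff mult_left_mono norm_ge_zero)
  also have "... \<le> norm A * (exp (h * norm A) * norm x)"
   using t by (intro mult_left_mono mult_right_mono) (auto intro: mult_right_mono)
  finally show "norm (A *v (matrix_exp (t *R A) *v x)) \<le> norm A * exp (h * norm A) * norm x"
   by (simp add: mult.assoc)
 qed (use assms in auto)
 then show ?thesis using assms by (simp add: mult_ac)
qed

lemma matrix_exp_diff2_le:
 fixes A :: "complex^'n^'n"
 assumes "0 \<le> h"
 shows "norm (matrix_exp (h *R A) *v x - x - h *R (A *v x)) \<le> h^2 * nsq A * exp (h * norm A) * norm x"
proof -
 define f where "f = (\<lambda>t. matrix_exp (t *R A) *v x - t *R (A *v x))"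
 have "norm (f h - f 0) \<le> h * nsq A * exp (h * norm A) * norm x * h"
 proof (rule norm_increment_le[of h _ "\<lambda>t. A *v (matrix_exp (t *R A) *v x - x)"])
  fix t assume t: "t \<in> {0..h}"
  show "(f has_vector_derivative A *v (matrix_exp (t *R A) *v x - x)) (at t)" unfolding f_def
   by (rule has_vector_derivative_eq_rhs,
     rule has_vector_derivative_diff[OF has_vector_derivative_matrix_exp has_vector_derivative_scaleR[OF DERIV_ident has_vector_derivative_const]])
    (simp add: matrix_vector_mult_diff_distrib)
  have "norm (A *v (matrix_exp (t *R A) *v x - x)) \<le> norm A * norm (matrix_exp (t *R A) *v x - x)"
   by (rule norm_matrix_vector_le)
  also have "... \<le> norm A * (t * norm A * exp (t * norm A) * norm x)"
   using t by (intro mult_left_mono matrix_exp_diff_le) auto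
  also have "... \<le> norm A * (h * norm A * exp (h * norm A) * norm x)"
   using t by (intro mult_left_mono mult_right_mono mult_mono) (auto intro: mult_right_mono)
  finally show "norm (A *v (matrix_exp (t *R A) *v x - x)) \<le> h * nsq A * exp (h * norm A) * norm x"
   by (simp add: power2_eq_square mult_ac)
 qed (use assms in auto)
 then show ?thesis using assms by (simp add: f_def power2_eq_square mult_ac algebra_simps)
qed

text \<open>Variation of constants: \<open>z t\<close>, the perturbed solution pulled back by the
  exponential of \<open>H\<close>, is driven by \<open>E\<close> alone. Only the bound
  \<open>K\<close> on the exponentials of \<open>H\<close> enters, not \<open>norm H\<close>; later
  \<open>H\<close> contains a transport term of size \<open>n\<close> whose exponentials are
  isometric.\<close>

lemma matrix_exp_perturb:
 fixes H E :: "complex^'n^'n"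
 assumes K: "\<And>s x. \<bar>s\<bar> \<le> T ==> norm (matrix_exp (s *R H) *v x) \<le> K * norm x"
  and K0: "0 \<le> K" and t: "0 \<le> t" "t \<le> T"
 shows "norm (matrix_exp (t *R (H + E)) *v x - matrix_exp (t *R H) *v x)
  \<le> K ^ 3 * norm E * T * exp (K^2 * norm E * T) * norm x"
proof -
 define y where "y = (\<lambda>t. matrix_exp (t *R (H + E)) *v x)"
 define z where "z = (\<lambda>t. matrix_exp ((- t) *R H) *v y t)"
 define z' where "z' = (\<lambda>t. matrix_exp ((- t) *R H) *v (E *v y t))"
 have Hc: "H *v (matrix_exp (s *R H) *v v) = matrix_exp (s *R H) *v (H *v v)" for s v
  by (rule matrix_exp_commute) simp
 have yz: "y s = matrix_exp (s *R H) *v z s" for s by (simp add: z_def)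
 have yv: "matrix_exp (s *R (H + E)) *v x = y s" for s by (simp add: y_def)
 have dz: "(z has_vector_derivative z' s) (at s)" for s
 proof -
  have 1: "((\<lambda>s. matrix_exp ((- s) *R H)) has_vector_derivative - (H ** matrix_exp ((- s) *R H))) (at s)"
  proof -
   have "((\<lambda>s. - s :: real) has_vector_derivative - 1) (at s)" by (auto intro!: derivative_eq_intros)
   from vector_diff_chain_at[OF this has_vector_derivative_matrix_exp_matrix] show ?thesis
    by (simp add: o_def)
  qed
  show ?thesis unfolding z_def
   apply (rule has_vector_derivative_eq_rhs)
   apply (rule bounded_bilinear.has_vector_derivative[OF bounded_bilinear_matrix_vector 1])
   apply (unfold y_def, rule has_vector_derivative_matrix_exp)
   apply (simp only: yv z'_def matrix_vector_mult_add_rdistrib matrix_vector_right_distrib Hc[symmetric]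
     bounded_bilinear.minus_left[OF bounded_bilinear_matrix_vector] matrix_vector_mul_assoc[symmetric])
   apply simp
   done
 qed
 have bz: "norm (z' s) \<le> (K^2 * norm E) * norm (z s)" if "s \<in> {0..T}" for s
 proof -
  have "norm (z' s) \<le> K * norm (E *v y s)" unfolding z'_def using that by (intro K) auto
  also have "... \<le> K * (norm E * norm (y s))" by (intro mult_left_mono norm_matrix_vector_le K0)
  also have "... \<le> K * (norm E * (K * norm (z s)))"
   unfolding yz using that by (intro mult_left_mono K K0) auto
  finally show ?thesis by (simp add: power2_eq_square mult_ac)
 qed
 have z0: "z 0 = x" by (simp add: z_def y_def)
 have gz: "norm (z s) \<le> exp (K^2 * norm E * s) * norm x" if "s \<in> {0..t}" for s
  using gronwall_norm[of s z z' "K^2 * norm E"] dz bz that t by (auto simp: z0)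
 have "norm (z t - z 0) \<le> K^2 * norm E * exp (K^2 * norm E * T) * norm x * t"
 proof (rule norm_increment_le[of t _ z'])
  fix s assume s: "s \<in> {0..t}"
  have "norm (z' s) \<le> (K^2 * norm E) * norm (z s)" using bz s t by auto
  also have "... \<le> (K^2 * norm E) * (exp (K^2 * norm E * s) * norm x)" by (intro mult_left_mono gz s) auto
  also have "... \<le> (K^2 * norm E) * (exp (K^2 * norm E * T) * norm x)"
   using s t by (intro mult_left_mono mult_right_mono) (auto intro!: mult_left_mono)
  finally show "norm (z' s) \<le> K^2 * norm E * exp (K^2 * norm E * T) * norm x" by (simp add: mult.assoc)
 qed (use t dz in auto)
 also have "... \<le> K^2 * norm E * exp (K^2 * norm E * T) * norm x * T"
  using t by (intro mult_left_mono) auto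
 finally have zz: "norm (z t - x) \<le> K^2 * norm E * exp (K^2 * norm E * T) * norm x * T" by (simp add: z0)
 have "y t - matrix_exp (t *R H) *v x = matrix_exp (t *R H) *v (z t - x)"
  by (simp add: yz matrix_vector_mult_diff_distrib)
 also have "norm ... \<le> K * norm (z t - x)" using t by (intro K) auto
 also have "... \<le> K * (K^2 * norm E * exp (K^2 * norm E * T) * norm x * T)"
  by (intro mult_left_mono zz K0)
 finally show ?thesis by (simp add: y_def power2_eq_square power3_eq_cube mult_ac)
qed

section \<open>Trigonometric polynomials\<close>

definition tpoly :: "int set => (int => complex^'k) => real => complex^'k"
 where "tpoly S c x = (\<Sum>n\<in>S. cis (of_int n * x) *s c n)"

text \<open>The observation at one instant of the function with Fourier coefficients
  \<open>c\<close>. The set \<open>S\<close> of modes is an explicit argument so that constants can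
  be stated uniformly in it.\<close>

definition energy :: "real set => int set => (int => complex^'k) => real"
 where "energy X S c = (LINT x:X|lborel. nsq (tpoly S c x))"

text \<open>Hermitian product, conjugate linear in the first argument. Its real part
  \<open>inner\<close> is not enough to expand cross terms that carry complex phases.\<close>

definition cinner :: "complex^'k => complex^'k => complex"
 where "cinner u v = (\<Sum>k\<in>UNIV. cnj (u $ k) * v $ k)"

lemma Re_cinner: "Re (cinner u v) = inner u v"
 by (simp add: cinner_def inner_vec_def inner_complex_cnj del: complex_cnj)

lemma inner_cis: "inner (cis a *s u) (cis b *s v) = Re (cis (b - a) * cinner u v)"
 by (simp add: Re_cinner[symmetric] cinner_def sum_distrib_left cis_cnj cis_divide[symmetric] field_simps
   cis_mult[symmetric] diff_conv_add_uminus del: Re_sum add_uminus_conv_diff)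

lemma norm_add_sq_le: "nsq (x + y) \<le> 2 * nsq x + 2 * nsq (y :: 'a::real_normed_vector)"
proof -
 have "nsq (x + y) \<le> (norm x + norm y)^2" by (intro power_mono norm_triangle_ineq) auto
 also have "... \<le> 2 * nsq x + 2 * nsq y"
  using sum_squares_bound[of "norm x" "norm y"] by (simp add: power2_sum)
 finally show ?thesis .
qed

lemma norm_diff_sq_le: "nsq (x - y) \<le> 2 * nsq x + 2 * nsq (y :: 'a::real_normed_vector)"
 using norm_add_sq_le[of x "- y"] by simp

lemma continuous_on_smult [continuous_intros]:
 "continuous_on S f ==> continuous_on S g ==> continuous_on S (\<lambda>x. f x *s (g x :: complex^'n))"
 by (rule bounded_bilinear.continuous_on[OF bounded_bilinear_smult])

lemma continuous_on_cis' [continuous_intros]: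
 "continuous_on S f ==> continuous_on S (\<lambda>x. cis (f x))"
 by (simp add: cis_conv_exp continuous_intros)

lemma continuous_on_tpoly [continuous_intros]:
 "continuous_on A f ==> continuous_on A (\<lambda>x. tpoly S c (f x))"
 unfolding tpoly_def by (intro continuous_intros)

lemma measurable_tpoly [measurable]: "tpoly S c \<in> borel_measurable borel"
 by (intro borel_measurable_continuous_onI continuous_intros)

lemma norm_tpoly_le: "norm (tpoly S c x) \<le> (\<Sum>n\<in>S. norm (c n))"
 unfolding tpoly_def by (rule order.trans[OF norm_sum]) (simp add: norm_vector_smult)

lemma tpoly_add: "tpoly S (\<lambda>n. c n + d n) x = tpoly S c x + tpoly S d x"
 by (simp add: tpoly_def sum.distrib vec.scale_right_distrib)

lemma tpoly_scaleR: "tpoly S (\<lambda>n. r *R c n) x = r *R tpoly S c x"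
 by (simp add: tpoly_def scaleR_sum_right scaleR_eq_smult vec.scale_scale mult.commute vec.scale_sum_right)

lemma tpoly_matrix: "tpoly S (\<lambda>n. M *v c n) x = M *v tpoly S c x" for M :: "complex^'n^'m"
 by (simp add: tpoly_def matrix_vector_sum matrix_vector_smult)

lemma tpoly_mono_neutral:
 assumes "finite S'" "S \<subseteq> S'" "\<And>n. n \<in> S' - S ==> c n = 0"
 shows "tpoly S c = tpoly S' c" unfolding tpoly_def using assms by (intro ext sum.mono_neutral_left) auto

lemma energy_mono_neutral:
 assumes "finite S'" "S \<subseteq> S'" "\<And>n. n \<in> S' - S ==> c n = 0"
 shows "energy X S c = energy X S' c" using tpoly_mono_neutral[OF assms] by (simp add: energy_def)

lemma energy_cong: "(\<And>n. n \<in> S ==> c n = d n) ==> energy X S c = energy X S d"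
 by (simp add: energy_def tpoly_def cong: sum.cong)

lemma energy_nonneg: "0 \<le> energy X S c"
 unfolding energy_def set_lebesgue_integral_def by (intro integral_nonneg_AE) auto

locale obs_set =
 fixes X :: "real set"
 assumes X_borel [measurable]: "X \<in> sets borel" and X_subset: "X \<subseteq> {0..<2 * pi}"
begin

lemma set_integrable_bounded:
 fixes f :: "real => 'b::{banach, second_countable_topology}"
 assumes [measurable]: "f \<in> borel_measurable borel" and b: "\<And>x. norm (f x) \<le> B"
 shows "set_integrable lborel X f"
proof -
 have "emeasure lborel X \<le> emeasure lborel {0..<2 * pi}" by (intro emeasure_mono X_subset) auto
 also have "... < \<infinity>" by simp
 finally have fin: "emeasure lborel X < \<infinity>" .
 have "integrable lborel (\<lambda>x. indicator X x *R B)"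
  using fin by (intro integrable_real_indicator integrable_scaleR_left) auto
 then show ?thesis unfolding set_integrable_def
 proof (rule Bochner_Integration.integrable_bound)
  show "AE x in lborel. norm (indicator X x *R f x) \<le> norm (indicator X x *R B)"
   using b by (auto simp: indicator_def intro!: AE_I2 order.trans[OF b])
 qed auto
qed

lemma set_integrable_norm_tpoly: "set_integrable lborel X (\<lambda>x. nsq (tpoly S c x))"
 by (rule set_integrable_bounded[where B = "(\<Sum>n\<in>S. norm (c n))^2"])
  (auto intro!: power_mono norm_tpoly_le)

lemma set_integrable_cis: "set_integrable lborel X (\<lambda>x. cis (a * x))"
 by (rule set_integrable_bounded[where B = 1]) (auto intro!: borel_measurable_continuous_onI continuous_intros)

lemma set_integrable_inner_tpoly: "set_integrable lborel X (\<lambda>x. inner (tpoly S c x) (tpoly S' d x))"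
 by (rule set_integrable_bounded[where B = "(\<Sum>n\<in>S. norm (c n)) * (\<Sum>n\<in>S'. norm (d n))"])
  (auto intro!: order.trans[OF Cauchy_Schwarz_ineq2] mult_mono norm_tpoly_le sum_nonneg)

lemma integral_inner_tpoly:
 "(LINT x:X|lborel. inner (tpoly S c x) (tpoly S' d x)) =
  (\<Sum>n\<in>S. \<Sum>m\<in>S'. Re ((LINT x:X|lborel. cis (of_int (m - n) * x)) * cinner (c n) (d m)))"
proof -
 have e: "inner (tpoly S c x) (tpoly S' d x) = (\<Sum>n\<in>S. \<Sum>m\<in>S'. Re (cis (of_int (m - n) * x) * cinner (c n) (d m)))" for x
  by (simp add: tpoly_def inner_sum_left inner_sum_right inner_cis left_diff_distrib)
   (rule sum.swap)
 have i: "integrable lborel (\<lambda>x. indicator X x *R cis (of_int (m - n) * x))" for m n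
  using set_integrable_cis[of "of_int (m - n)"] by (simp add: set_integrable_def)
 have r: "indicator X x *R Re (z * w) = Re ((indicator X x *R z) * w)" for z w and x :: real
  by (simp add: algebra_simps)
 have t: "integrable lborel (\<lambda>x. Re ((indicator X x *R cis (of_int (m - n) * x)) * w))" for m n w
  using i by (intro integrable_Re integrable_mult_left)
 have v: "(LINT x|lborel. Re ((indicator X x *R cis (of_int (m - n) * x)) * w)) =
   Re ((LINT x|lborel. indicator X x *R cis (of_int (m - n) * x)) * w)" for m n w
 proof -
  have "(LINT x|lborel. Re ((indicator X x *R cis (of_int (m - n) * x)) * w)) =
    Re (LINT x|lborel. (indicator X x *R cis (of_int (m - n) * x)) * w)"
   using i by (intro integral_Re integrable_mult_left)
  also have "... = Re ((LINT x|lborel. indicator X x *R cis (of_int (m - n) * x)) * w)"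
   by (subst Bochner_Integration.integral_mult_left) (use i in auto)
  finally show ?thesis .
 qed
 show ?thesis unfolding e set_lebesgue_integral_def scaleR_sum_right r
  by (simp only: Bochner_Integration.integral_sum Bochner_Integration.integrable_sum t v)
qed

text \<open>As a finite sum in the coefficients, the energy is visibly continuous in any parameter
  on which the coefficients depend continuously.\<close>

lemma energy_expand:
 "energy X S c = (\<Sum>n\<in>S. \<Sum>m\<in>S. Re ((LINT x:X|lborel. cis (of_int (m - n) * x)) * cinner (c n) (c m)))"
 unfolding energy_def power2_norm_eq_inner by (rule integral_inner_tpoly)

lemma continuous_on_energy [continuous_intros]:
 assumes "\<And>n. n \<in> S ==> continuous_on A (\<lambda>t. c t n)"
 shows "continuous_on A (\<lambda>t. energy X S (c t))"
 unfolding energy_expand cinner_def using assms by (intro continuous_intros) auto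

lemma energy_add_le: "energy X S (\<lambda>n. c n + d n) \<le> 2 * energy X S c + 2 * energy X S d"
proof -
 have "energy X S (\<lambda>n. c n + d n) \<le> (LINT x:X|lborel. 2 * nsq (tpoly S c x) + 2 * nsq (tpoly S d x))"
  unfolding energy_def by (rule set_integral_mono)
   (auto simp: tpoly_add norm_add_sq_le intro!: set_integrable_norm_tpoly[of S "\<lambda>n. c n + d n", unfolded tpoly_add] set_integrable_norm_tpoly set_integral_add set_integrable_mult_right)
 also have "... = 2 * energy X S c + 2 * energy X S d" unfolding energy_def
  by (subst set_integral_add) (auto intro!: set_integrable_norm_tpoly set_integrable_mult_right)
 finally show ?thesis .
qed

lemma energy_matrix_le: "energy X S (\<lambda>n. M *v c n) \<le> nsq M * energy X S c"
 for M :: "complex^'n^'m"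
proof -
 have "energy X S (\<lambda>n. M *v c n) \<le> (LINT x:X|lborel. nsq M * nsq (tpoly S c x))"
  unfolding energy_def
 proof (rule set_integral_mono[OF set_integrable_norm_tpoly])
  show "set_integrable lborel X (\<lambda>x. nsq M * nsq (tpoly S c x))"
   by (intro set_integrable_mult_right set_integrable_norm_tpoly)
  show "nsq (tpoly S (\<lambda>n. M *v c n) x) \<le> nsq M * nsq (tpoly S c x)" for x
   unfolding tpoly_matrix power_mult_distrib[symmetric] by (intro power_mono norm_matrix_vector_le) auto
 qed
 then show ?thesis by (simp add: energy_def)
qed

lemma energy_minus: "energy X S (\<lambda>n. - c n) = energy X S c"
 using tpoly_scaleR[of S "-1" c] by (simp add: energy_def)

lemma energy_diff_le: "energy X S (\<lambda>n. c n - d n) \<le> 2 * energy X S c + 2 * energy X S d"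
 using energy_add_le[of S c "\<lambda>n. - d n"] by (simp add: energy_minus)

end

lemma obs_set_full: "obs_set {0..<2 * pi}" by standard auto

lemma integral_cis_period: "(LINT x:{0..<2 * pi}|lborel. cis (of_int n * x)) = (if n = 0 then 2 * pi else 0)"
proof (cases "n = 0")
 case True
 then show ?thesis by (simp add: set_lebesgue_integral_def scaleR_conv_of_real)
next
 case False
 define F where "F = (\<lambda>x. cis (of_int n * x) / (\<i> * of_int n))"
 have F: "(F has_vector_derivative cis (of_int n * x)) (at x within {0..2 * pi})" for x
 proof -
  have "((\<lambda>z. exp (\<i> * of_int n * z) / (\<i> * of_int n)) has_field_derivative exp (\<i> * of_int n * of_real x)) (at (of_real x))"
   using False by (auto intro!: derivative_eq_intros)
  from has_vector_derivative_real_field[OF this] show ?thesis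
   by (simp add: F_def cis_conv_exp mult.assoc has_vector_derivative_at_within)
 qed
 have s: "set_integrable lborel {0..2 * pi} (\<lambda>x. cis (of_int n * x))"
  unfolding set_integrable_def by (intro borel_integrable_compact continuous_intros) auto
 have "(LINT x:{0..<2 * pi}|lborel. cis (of_int n * x)) = (LINT x:{0..2 * pi}|lborel. cis (of_int n * x))"
  unfolding set_lebesgue_integral_def
 proof (rule integral_cong_AE)
  show "AE x in lborel. indicator {0..<2 * pi} x *R cis (of_int n * x) = indicator {0..2 * pi} x *R cis (of_int n * x)"
   using AE_lborel_singleton[of "2 * pi"] by eventually_elim (auto simp: indicator_def)
  have "(\<lambda>x. cis (of_int n * x)) \<in> borel_measurable borel"
   by (intro borel_measurable_continuous_onI continuous_intros)
  then show "(\<lambda>x. indicator {0..<2 * pi} x *R cis (of_int n * x)) \<in> borel_measurable lborel"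
    "(\<lambda>x. indicator {0..2 * pi} x *R cis (of_int n * x)) \<in> borel_measurable lborel" by measurable
 qed
 also have "... = integral {0..2 * pi} (\<lambda>x. cis (of_int n * x))"
  by (rule set_borel_integral_eq_integral(2)[OF s])
 also have "... = F (2 * pi) - F 0" by (intro integral_unique fundamental_theorem_of_calculus F) auto
 also have "... = 0" using cis_multiple_2pi[of "of_int n"] by (simp add: F_def mult.commute)
 finally show ?thesis using False by simp
qed

lemma parseval_tpoly:
 assumes "finite S"
 shows "energy {0..<2 * pi} S c = 2 * pi * (\<Sum>n\<in>S. nsq (c n))"
proof -
 interpret obs_set "{0..<2 * pi}" by (rule obs_set_full)
 have "energy {0..<2 * pi} S c = (\<Sum>n\<in>S. \<Sum>m\<in>S. if m = n then 2 * pi * inner (c n) (c n) else 0)"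
  unfolding energy_expand integral_cis_period by (intro sum.cong refl) (auto simp: Re_cinner)
 then show ?thesis using assms by (simp add: power2_norm_eq_inner sum_distrib_left)
qed

lemma (in obs_set) energy_le:
 assumes "finite S"
 shows "energy X S c \<le> 2 * pi * (\<Sum>n\<in>S. nsq (c n))"
proof -
 have "energy X S c \<le> energy {0..<2 * pi} S c" unfolding energy_def set_lebesgue_integral_def
  using set_integrable_norm_tpoly[of S c] obs_set.set_integrable_norm_tpoly[OF obs_set_full, of S c] X_subset
  by (intro integral_mono) (auto simp: set_integrable_def indicator_def)
 with parseval_tpoly[OF assms, of c] show ?thesis by simp
qed

section \<open>The spectral inequality for trigonometric polynomials\<close>

lemma abs_sin_ge_half: assumes "\<bar>x\<bar> \<le> (1::real)" shows "\<bar>x\<bar> / 2 \<le> \<bar>sin x\<bar>"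
proof -
 have *: "x / 2 \<le> sin x" if "0 \<le> x" "x \<le> 1" for x :: real
 proof -
  have "sin 0 - 0 / 2 \<le> sin x - x / 2"
  proof (rule DERIV_nonneg_imp_nondecreasing[OF that(1)])
   fix y assume y: "0 \<le> y" "y \<le> x"
   have "cos y \<ge> cos (pi / 3)" using y that pi_gt3 by (intro cos_monotone_0_pi_le) auto
   then show "\<exists>d. ((\<lambda>x. sin x - x / 2) has_real_derivative d) (at y) \<and> 0 \<le> d"
    by (intro exI[of _ "cos y - 1 / 2"]) (auto intro!: derivative_eq_intros simp: cos_60)
  qed
  then show ?thesis by simp
 qed
 show ?thesis using *[of x] *[of "- x"] assms by (cases "0 \<le> x") auto
qed

lemma cmod_cis_diff_ge:
 assumes "\<bar>x - y\<bar> \<le> 1"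
 shows "\<bar>x - y\<bar> / 2 \<le> cmod (cis x - cis y)"
proof -
 have "cis x - cis y = cis y * (cis (x - y) - 1)" by (simp add: algebra_simps cis_mult)
 then have "cmod (cis x - cis y) = cmod (cis (x - y) - 1)" by (simp add: norm_mult)
 also have "... \<ge> \<bar>sin (x - y)\<bar>" using abs_Im_le_cmod[of "cis (x - y) - 1"] by simp
 finally show ?thesis using abs_sin_ge_half[OF assms] by simp
qed

text \<open>Applying \<open>f \<mapsto> f(\<cdot> + \<beta>) - e\<^sup>i\<^sup>j\<^sup>\<beta> f\<close> removes the mode \<open>j\<close>; after all modes but one are removed
 only a multiple of \<open>e\<^sup>i\<^sup>n\<^sup>x\<close> is left.\<close>

lemma isolate_mode:
 fixes c :: "int => complex^'k" and a l \<beta> :: real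
 assumes "finite S" "n \<notin> S" and b: "0 \<le> \<beta>" and l: "0 \<le> l"
  and "\<And>j. j \<in> S ==> cis (of_int n * \<beta>) \<noteq> cis (of_int j * \<beta>)"
 shows "l * nsq (c n) \<le> (\<Prod>j\<in>S. 4 / (cmod (cis (of_int n * \<beta>) - cis (of_int j * \<beta>)))^2) *
  integral {a..a + l + card S * \<beta>} (\<lambda>x. nsq (tpoly (insert n S) c x))" using assms(1,2,5)
proof (induction S arbitrary: c)
 case empty
 then show ?case using l by (simp add: tpoly_def norm_vector_smult)
next
 case (insert j S)
 define z where "z = cis (of_int n * \<beta>) - cis (of_int j * \<beta>)"
 have z: "z \<noteq> 0" using insert.prems by (auto simp: z_def)
 define c' where "c' = (\<lambda>k. (cis (of_int k * \<beta>) - cis (of_int j * \<beta>)) *s c k)"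
 let ?P = "tpoly (insert n (insert j S)) c"
 let ?Q = "tpoly (insert n S) c'"
 let ?L = "l + card S * \<beta>"
 have Q: "?Q x = ?P (x + \<beta>) - cis (of_int j * \<beta>) *s ?P x" for x
 proof -
  have "?Q x = tpoly (insert n (insert j S)) c' x"
   using insert.hyps by (intro tpoly_mono_neutral[THEN fun_cong]) (auto simp: c'_def)
  also have "... = ?P (x + \<beta>) - cis (of_int j * \<beta>) *s ?P x"
   unfolding tpoly_def vec.scale_sum_right sum_subtractf[symmetric] c'_def
  proof (intro sum.cong refl)
   fix k
   have "cis (of_int k * (x + \<beta>)) = cis (of_int k * x) * cis (of_int k * \<beta>)"
    by (simp add: cis_mult distrib_left)
   moreover have "u *s ((v - w) *s c k) = (u * v) *s c k - w *s (u *s c k)" for u v w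
    by (simp add: vec_eq_iff algebra_simps)
   ultimately show "cis (of_int k * x) *s ((cis (of_int k * \<beta>) - cis (of_int j * \<beta>)) *s c k) =
     cis (of_int k * (x + \<beta>)) *s c k - cis (of_int j * \<beta>) *s (cis (of_int k * x) *s c k)"
    by (simp only:)
  qed
  finally show ?thesis .
 qed
 have int: "(\<lambda>x. nsq (?P x)) integrable_on {u..v}" "(\<lambda>x. nsq (?P (x + \<beta>))) integrable_on {u..v}"
   "(\<lambda>x. nsq (?Q x)) integrable_on {u..v}" for u v
  by (intro integrable_continuous_real continuous_intros)+
 \<comment> \<open>Removing one mode costs the factor 4 = 2 + 2 and lengthens the interval by
   \<open>\<beta>\<close>, because the translate is integrated over the shifted interval.\<close>
 have "integral {a..a + ?L} (\<lambda>x. nsq (?Q x)) \<le>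
   integral {a..a + ?L} (\<lambda>x. 2 * nsq (?P (x + \<beta>)) + 2 * nsq (?P x))"
  using int by (intro integral_le integrable_add integrable_on_mult_right)
   (auto simp: Q norm_vector_smult intro!: norm_diff_sq_le[THEN order.trans])
 also have "... = 2 * integral {a..a + ?L} (\<lambda>x. nsq (?P (x + \<beta>))) + 2 * integral {a..a + ?L} (\<lambda>x. nsq (?P x))"
  using int by (subst Henstock_Kurzweil_Integration.integral_add) auto
 also have "integral {a..a + ?L} (\<lambda>x. nsq (?P (x + \<beta>))) = integral {a + \<beta>..a + ?L + \<beta>} (\<lambda>x. nsq (?P x))"
  using integral_shift_real_ivl[of "a + \<beta>" \<beta> "a + ?L + \<beta>" "\<lambda>x. nsq (?P x)"]
  by (simp only: add_diff_cancel_right')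
 also have "... \<le> integral {a..a + ?L + \<beta>} (\<lambda>x. nsq (?P x))"
  using int b by (intro integral_subset_le) auto
 also have "integral {a..a + ?L} (\<lambda>x. nsq (?P x)) \<le> integral {a..a + ?L + \<beta>} (\<lambda>x. nsq (?P x))"
  using int b by (intro integral_subset_le) auto
 finally have I: "integral {a..a + ?L} (\<lambda>x. nsq (?Q x)) \<le> 4 * integral {a..a + ?L + \<beta>} (\<lambda>x. nsq (?P x))"
  by simp
 let ?p = "\<Prod>j\<in>S. 4 / (cmod (cis (of_int n * \<beta>) - cis (of_int j * \<beta>)))^2"
 have p: "0 \<le> ?p" by (intro prod_nonneg) auto
 have "l * nsq (c' n) \<le> ?p * integral {a..a + l + card S * \<beta>} (\<lambda>x. nsq (?Q x))"
  using insert.prems by (intro insert.IH) auto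
 also have "... \<le> ?p * (4 * integral {a..a + ?L + \<beta>} (\<lambda>x. nsq (?P x)))"
  using I p by (intro mult_left_mono) (auto simp: add.assoc)
 finally have "l * nsq (c' n) \<le> ?p * (4 * integral {a..a + ?L + \<beta>} (\<lambda>x. nsq (?P x)))" .
 moreover have "l * nsq (c' n) = l * nsq (c n) * (cmod z)^2"
 proof -
  have "norm (c' n) = cmod z * norm (c n)" unfolding c'_def z_def by (rule norm_vector_smult)
  then show ?thesis by (simp add: power_mult_distrib)
 qed
 ultimately have "l * nsq (c n) * (cmod z)^2 \<le> ?p * (4 * integral {a..a + ?L + \<beta>} (\<lambda>x. nsq (?P x)))"
  by (simp only:)
 then have "l * nsq (c n) \<le> ?p * (4 * integral {a..a + ?L + \<beta>} (\<lambda>x. nsq (?P x))) / (cmod z)^2"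
  using z by (subst pos_le_divide_eq) auto
 moreover have "p * (4 * I) / z2 = (4 / z2 * p) * I" for p I z2 :: real by simp
 ultimately have "l * nsq (c n) \<le> (4 / (cmod z)^2 * ?p) * integral {a..a + ?L + \<beta>} (\<lambda>x. nsq (?P x))"
  by (simp only:)
 also have "a + ?L + \<beta> = a + l + card (insert j S) * \<beta>"
  using insert.hyps by (simp add: algebra_simps)
 finally show ?case by (simp only: z_def prod.insert[OF insert.hyps(1,2)])
qed

lemma power_le_fact_exp: "(x::real) ^ k \<le> fact k * exp x" if "0 \<le> x"
proof -
 have "x ^ k /\<^sub>R fact k \<le> (\<Sum>j. x ^ j /\<^sub>R fact j)"
  using that by (intro sum_le_suminf[of _ "{k}", simplified] summable_exp_generic) auto
 then have "x ^ k /\<^sub>R fact k \<le> exp x" by (simp only: exp_def)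
 then show ?thesis by (simp add: field_simps)
qed

text \<open>On either side of \<open>n\<close> the distances are 1, 2, 3 and so on, so a side with
  \<open>k\<close> integers contributes \<open>r ^ k / fact k\<close>, which is below
  \<open>exp r\<close> whatever \<open>k\<close> is. Hence the bound does not depend on
  \<open>m\<close>.\<close>

lemma prod_inverse_dist_le:
 fixes r :: real and n :: int
 assumes "0 \<le> r" "\<bar>n\<bar> \<le> int m"
 shows "(\<Prod>j\<in>{- int m..int m} - {n}. r / \<bar>of_int (n - j)\<bar>) \<le> exp (2 * r)"
proof -
 have half: "(\<Prod>j = 1..k. r / real j) \<le> exp r" for k
 proof -
  have "(\<Prod>j = 1..k. r / real j) = r ^ k / fact k" by (simp add: prod_dividef fact_prod)
  also have "... \<le> exp r"
   using power_le_fact_exp[OF assms(1), of k] by (simp add: divide_le_eq mult.commute)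
  finally show ?thesis .
 qed
 have split: "{- int m..int m} - {n} = (\<lambda>j. n - int j) ` {1..nat (n + m)} \<union> (\<lambda>j. n + int j) ` {1..nat (m - n)}" (is "_ = ?A \<union> ?B")
 proof (intro equalityI subsetI)
  fix j assume j: "j \<in> {- int m..int m} - {n}"
  show "j \<in> ?A \<union> ?B"
  proof (cases "j < n")
   case True
   then have "j = n - int (nat (n - j))" "nat (n - j) \<in> {1..nat (n + m)}" using j by auto
   then show ?thesis by blast
  next
   case False
   then have "j = n + int (nat (j - n))" "nat (j - n) \<in> {1..nat (m - n)}" using j by auto
   then show ?thesis by blast
  qed
 qed (use assms in auto)
 have "(\<Prod>j\<in>{- int m..int m} - {n}. r / \<bar>of_int (n - j)\<bar>) = (\<Prod>j\<in>?A. r / \<bar>of_int (n - j)\<bar>) * (\<Prod>j\<in>?B. r / \<bar>of_int (n - j)\<bar>)"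
  unfolding split by (intro prod.union_disjoint) auto
 also have "... = (\<Prod>j = 1..nat (n + m). r / real j) * (\<Prod>j = 1..nat (m - n). r / real j)"
  by (simp add: prod.reindex inj_on_def)
 also have "... \<le> exp r * exp r" by (intro mult_mono half prod_nonneg) (use assms in auto)
 finally show ?thesis by (simp add: mult_exp_exp)
qed

text \<open>All modes other than \<open>n\<close> are removed by \<open>isolate_mode\<close> with
  one small translation; by \<open>prod_inverse_dist_le\<close> the product of the costs is
  exponential in \<open>m\<close> only.\<close>

lemma spectral_inequality_mode:
 fixes c :: "int => complex^'k"
 assumes S: "S \<subseteq> {- int m..int m}" and n: "n \<in> S" and l: "0 < (l::real)" "l \<le> 1"
 shows "l * nsq (c n) \<le> exp (16 * (2 * real m + 1) / l) * integral {a..a + 2 * l} (\<lambda>x. nsq (tpoly S c x))"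
proof -
 \<comment> \<open>With this translation the at most \<open>2 * m\<close> shifts fit into a length
   \<open>l\<close>, and all phase differences are at most 1, a range in which distinct phases are
   separated linearly.\<close>
 define \<beta> where "\<beta> = l / (2 * m + 1)"
 have \<beta>: "0 < \<beta>" using l by (simp add: \<beta>_def)
 have fin: "finite S" using S finite_subset by blast
 have fin': "finite (S - {n})" using fin by simp
 have dist: "\<bar>of_int (n - j)\<bar> * \<beta> \<le> 1" if "j \<in> {- int m..int m}" for j
 proof -
  have "\<bar>n - j\<bar> \<le> 2 * int m" using that subsetD[OF S n] by auto
  then have "\<bar>of_int (n - j)\<bar> \<le> real (2 * m)" by linarith
  then have "\<bar>of_int (n - j)\<bar> * \<beta> \<le> (2 * m) * \<beta>" using \<beta> by (intro mult_right_mono) auto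
  also have "... \<le> l" using l by (simp add: \<beta>_def field_simps)
  finally show ?thesis using l by simp
 qed
 have low: "\<bar>of_int (n - j)\<bar> * \<beta> / 2 \<le> cmod (cis (of_int n * \<beta>) - cis (of_int j * \<beta>))"
  if "j \<in> {- int m..int m}" for j
  using cmod_cis_diff_ge[of "of_int n * \<beta>" "of_int j * \<beta>"] dist[OF that] \<beta>
  by (simp add: left_diff_distrib[symmetric] abs_mult)
 have fac: "4 / (cmod (cis (of_int n * \<beta>) - cis (of_int j * \<beta>)))^2 \<le> (4 / \<beta> / \<bar>of_int (n - j)\<bar>)^2"
  if "j \<in> {- int m..int m} - {n}" for j
 proof -
  have p: "0 < \<bar>of_int (n - j)\<bar> * \<beta> / 2" using that \<beta> by auto
  have p': "0 < cmod (cis (of_int n * \<beta>) - cis (of_int j * \<beta>))"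
   using p low[of j] that by (intro less_le_trans[OF p]) blast
  have "4 / (cmod (cis (of_int n * \<beta>) - cis (of_int j * \<beta>)))^2 \<le> 4 / (\<bar>of_int (n - j)\<bar> * \<beta> / 2)^2"
   using low[of j] that p p' \<beta> by (intro divide_left_mono power_mono mult_pos_pos zero_less_power) auto
  also have "... = (4 / \<beta> / \<bar>of_int (n - j)\<bar>)^2"
   by (simp add: power_divide power_mult_distrib)
  finally show ?thesis .
 qed
 \<comment> \<open>Factors belonging to modes missing from \<open>S\<close> are at least 1, so the
   product may be enlarged to all modes up to \<open>m\<close>.\<close>
 have ge1: "1 \<le> 4 / \<beta> / \<bar>of_int (n - j)\<bar>" if "j \<in> {- int m..int m} - {n}" for j
  using dist[of j] that \<beta> by (simp add: field_simps)
 have "l * nsq (c n) \<le> (\<Prod>j\<in>S - {n}. 4 / (cmod (cis (of_int n * \<beta>) - cis (of_int j * \<beta>)))^2) *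
  integral {a..a + l + card (S - {n}) * \<beta>} (\<lambda>x. nsq (tpoly (insert n (S - {n})) c x))"
 proof (rule isolate_mode[OF fin'])
  fix j assume j: "j \<in> S - {n}"
  then have pos: "0 < \<bar>of_int (n - j)\<bar> * \<beta> / 2" using \<beta> by auto
  show "cis (of_int n * \<beta>) \<noteq> cis (of_int j * \<beta>)"
  proof
   assume "cis (of_int n * \<beta>) = cis (of_int j * \<beta>)"
   then have "\<bar>of_int (n - j)\<bar> * \<beta> / 2 \<le> 0"
    using low[of j] subsetD[OF S, of j] j by (simp only: diff_self norm_zero Diff_iff simp_thms)
   with pos show False by linarith
  qed
 qed (use \<beta> l in auto)
 also have "... \<le> exp (2 * (4 / \<beta>)) ^ 2 * integral {a..a + 2 * l} (\<lambda>x. nsq (tpoly S c x))"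
 proof (rule mult_mono)
  have "(\<Prod>j\<in>S - {n}. 4 / (cmod (cis (of_int n * \<beta>) - cis (of_int j * \<beta>)))^2)
    \<le> (\<Prod>j\<in>S - {n}. (4 / \<beta> / \<bar>of_int (n - j)\<bar>)^2)"
   using S by (intro prod_mono conjI fac) auto
  also have "... \<le> (\<Prod>j\<in>{- int m..int m} - {n}. (4 / \<beta> / \<bar>of_int (n - j)\<bar>)^2)"
  proof (rule prod_mono2)
   show "1 \<le> (4 / \<beta> / \<bar>of_int (n - j)\<bar>)^2" if "j \<in> {- int m..int m} - {n} - (S - {n})" for j
    using ge1[of j] that by (intro one_le_power) auto
  qed (use S in auto)
  also have "... = (\<Prod>j\<in>{- int m..int m} - {n}. 4 / \<beta> / \<bar>of_int (n - j)\<bar>)^2"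
   by (rule prod_power_distrib[symmetric])
  also have "... \<le> exp (2 * (4 / \<beta>)) ^ 2"
   using subsetD[OF S n] \<beta> by (intro power_mono prod_inverse_dist_le prod_nonneg) auto
  finally show "(\<Prod>j\<in>S - {n}. 4 / (cmod (cis (of_int n * \<beta>) - cis (of_int j * \<beta>)))^2) \<le> exp (2 * (4 / \<beta>)) ^ 2" .
  have "card (S - {n}) \<le> card ({- int m..int m} - {n})" using S by (intro card_mono) auto
  also have "... \<le> 2 * m" using n S by (subst card_Diff_singleton) auto
  finally have "card (S - {n}) * \<beta> \<le> real (2 * m) * \<beta>"
   using \<beta> by (intro mult_right_mono) linarith+
  also have "... \<le> l" using l by (simp add: \<beta>_def field_simps)
  finally have "integral {a..a + l + card (S - {n}) * \<beta>} (\<lambda>x. nsq (tpoly S c x)) \<le>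
    integral {a..a + 2 * l} (\<lambda>x. nsq (tpoly S c x))"
   by (intro integral_subset_le integrable_continuous_real continuous_intros) auto
  then show "integral {a..a + l + card (S - {n}) * \<beta>} (\<lambda>x. nsq (tpoly (insert n (S - {n})) c x)) \<le>
    integral {a..a + 2 * l} (\<lambda>x. nsq (tpoly S c x))" using n by (simp add: insert_absorb)
 qed (auto intro!: integral_nonneg integrable_continuous_real continuous_intros)
 also have "exp (2 * (4 / \<beta>)) ^ 2 = exp (16 * (2 * real m + 1) / l)"
  using l by (simp add: exp_double[symmetric] \<beta>_def)
 finally show ?thesis by (simp add: algebra_simps)
qed

locale obs_set_interior = obs_set +
 assumes X_interior: "interior X \<noteq> {}"
begin

text \<open>It is proved on an interval inside \<open>X\<close>. The cost is exponential in the
  largest frequency and uniform in the set of modes; the number of modes and the factor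
  \<open>1 / l\<close> are absorbed into the exponential.\<close>

lemma spectral_inequality:
 obtains C where "0 < C"
  "\<And>m S (c :: int => complex^'k). S \<subseteq> {- int m..int m} ==>
   (\<Sum>n\<in>S. nsq (c n)) \<le> exp (C * (real m + 1)) * energy X S c"
proof -
 obtain a e where e: "0 < e" "cball a e \<subseteq> X" using X_interior mem_interior_cball by blast
 define l where "l = min 1 (e / 2)"
 have l: "0 < l" "l \<le> 1" "2 * l \<le> e" using e by (auto simp: l_def)
 have sub: "{a..a + 2 * l} \<subseteq> X"
  using e l by (intro order.trans[OF _ e(2)]) (auto simp: dist_real_def)
 have "(\<Sum>n\<in>S. nsq (c n)) \<le> exp (34 / l * (real m + 1)) * energy X S c"
  if S: "S \<subseteq> {- int m..int m}" for m S and c :: "int => complex^'k"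
 proof -
  have "integral {a..a + 2 * l} (\<lambda>x. nsq (tpoly S c x)) = (LINT x:{a..a + 2 * l}|lborel. nsq (tpoly S c x))"
   by (rule set_borel_integral_eq_integral(2)[symmetric])
    (unfold set_integrable_def, intro borel_integrable_compact continuous_intros, auto)
  also have "... \<le> energy X S c" unfolding energy_def set_lebesgue_integral_def
  proof (rule integral_mono)
   show "integrable lborel (\<lambda>x. indicator X x *R nsq (tpoly S c x))"
    using set_integrable_norm_tpoly[of S c] by (simp add: set_integrable_def)
   show "integrable lborel (\<lambda>x. indicator {a..a + 2 * l} x *R nsq (tpoly S c x))"
    using set_integrable_subset[OF set_integrable_norm_tpoly[of S c] _ sub] by (simp add: set_integrable_def)
  qed (use sub in \<open>auto simp: indicator_def\<close>)
  finally have I: "integral {a..a + 2 * l} (\<lambda>x. nsq (tpoly S c x)) \<le> energy X S c" .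
  have "l * nsq (c n) \<le> exp (16 * (2 * real m + 1) / l) * energy X S c" if "n \<in> S" for n
   by (rule order.trans[OF spectral_inequality_mode[OF S that l(1,2), of c a]])
    (intro mult_left_mono I, simp)
  then have "nsq (c n) \<le> exp (16 * (2 * real m + 1) / l) * energy X S c / l" if "n \<in> S" for n
   using l that by (simp add: field_simps)
  then have "(\<Sum>n\<in>S. nsq (c n)) \<le> card S * (exp (16 * (2 * real m + 1) / l) * energy X S c / l)"
   by (intro sum_bounded_above) (auto simp only:)
  also have "... \<le> (2 * m + 1) * (exp (16 * (2 * real m + 1) / l) * energy X S c / l)"
  proof (rule mult_right_mono)
   have "card S \<le> card {- int m..int m}" using S by (intro card_mono) auto
   then show "real (card S) \<le> 2 * m + 1" by simp
  qed (use l energy_nonneg[of X S c] in auto)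
  also have "... = ((2 * m + 1) / l) * exp (16 * (2 * real m + 1) / l) * energy X S c" by simp
  also have "... \<le> exp ((2 * m + 1) / l) * exp (16 * (2 * real m + 1) / l) * energy X S c"
   using exp_ge_add_one_self[of "(2 * m + 1) / l"] energy_nonneg[of X S c]
   by (intro mult_right_mono) (linarith | simp)+
  also have "... = exp (17 * (2 * m + 1) / l) * energy X S c"
   by (simp add: mult_exp_exp add_divide_distrib[symmetric])
  also have "... \<le> exp (34 / l * (real m + 1)) * energy X S c"
   using l energy_nonneg[of X S c] by (intro mult_right_mono) (auto simp: field_simps)
  finally show ?thesis .
 qed
 then show ?thesis using l that[of "34 / l"] by simp
qed

end

section \<open>Decoupling of the high frequencies\<close>

definition fst_block :: "'a^('p::finite + 'q::finite) => 'a^'p" where "fst_block v = (\<chi> i. v $ Inl i)"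
definition snd_block :: "'a^('p::finite + 'q::finite) => 'a^'q" where "snd_block v = (\<chi> i. v $ Inr i)"

lemma block_vec_nth [simp]: "block_vec v w $ Inl a = v $ a" "block_vec v w $ Inr b = w $ b"
 by (simp_all add: block_vec_def)

lemma block_vec_eq_iff: "v = w \<longleftrightarrow> fst_block v = fst_block w \<and> snd_block v = snd_block w"
 by (auto simp: vec_eq_iff fst_block_def snd_block_def) (metis sum.exhaust)

lemma block_simps [simp]: "fst_block (block_vec v w) = v" "snd_block (block_vec v w) = w"
  "block_vec (fst_block u) (snd_block u) = u"
  "fst_block 0 = 0" "snd_block 0 = 0" "block_vec 0 0 = 0"
 by (simp_all add: block_vec_eq_iff) (simp_all add: vec_eq_iff fst_block_def snd_block_def)

lemma fst_block_add: "fst_block (v + w) = fst_block v + fst_block w"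
 and snd_block_add: "snd_block (v + w) = snd_block v + snd_block w"
 and fst_block_smult: "fst_block (c *s x) = c *s fst_block x"
 and snd_block_smult: "snd_block (c *s x) = c *s snd_block x"
 and fst_block_scaleR: "fst_block (r *R u) = r *R fst_block u"
 and snd_block_scaleR: "snd_block (r *R u) = r *R snd_block u"
 by (simp_all add: vec_eq_iff fst_block_def snd_block_def)

lemma block_vec_add: "block_vec v w + block_vec v' w' = block_vec (v + v') (w + w')"
 and block_vec_smult: "c *s block_vec x y = block_vec (c *s x) (c *s y)"
 by (simp_all add: block_vec_eq_iff fst_block_add snd_block_add fst_block_smult snd_block_smult)

lemma block_vec_scaleR: "r *R block_vec v w = block_vec (r *R v) (r *R w)"
 by (simp add: block_vec_eq_iff fst_block_scaleR snd_block_scaleR)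

lemma sum_UNIV_plus: "(\<Sum>i\<in>UNIV. f i) = (\<Sum>a\<in>UNIV. f (Inl a)) + (\<Sum>b\<in>UNIV. f (Inr b))"
 for f :: "'p::finite + 'q::finite => 'a::comm_monoid_add"
 by (subst UNIV_Plus_UNIV[symmetric], subst sum.Plus) auto

lemma inner_block_vec: "inner u v = inner (fst_block u) (fst_block v) + inner (snd_block u) (snd_block v)"
 by (simp add: inner_vec_def sum_UNIV_plus fst_block_def snd_block_def)

lemma norm_block_sq: "nsq u = nsq (fst_block u) + nsq (snd_block u)"
 for u :: "'a::real_inner^('p::finite + 'q::finite)" by (simp add: power2_norm_eq_inner inner_block_vec)

lemma norm_fst_block_le: "norm (fst_block u) \<le> norm (u :: 'a::real_inner^('p::finite + 'q::finite))"
 and norm_snd_block_le: "norm (snd_block u) \<le> norm (u :: 'a::real_inner^('p::finite + 'q::finite))"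
 by (rule power2_le_imp_le; simp add: norm_block_sq)+

lemma norm_block_vec_le: "norm (block_vec v w) \<le> norm v + norm (w :: 'a::real_inner^'q)"
 by (rule power2_le_imp_le) (auto simp: norm_block_sq power2_sum)

lemma block_mat_vector:
 "block_mat M11 M12 M21 M22 *v u =
  block_vec (M11 *v fst_block u + M12 *v snd_block u) (M21 *v fst_block u + M22 *v snd_block u)"
 for M11 :: "'a::comm_ring_1^'p^'p" by (simp add: block_vec_eq_iff)
  (simp add: vec_eq_iff matrix_vector_mult_def sum_UNIV_plus block_mat_def fst_block_def snd_block_def)

lemma bounded_linear_fst_block: "bounded_linear (fst_block :: 'a::real_inner^('p::finite + 'q::finite) => _)"
 by (rule bounded_linear_intro[where K = 1]) (simp_all add: fst_block_add fst_block_scaleR norm_fst_block_le)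

lemma bounded_linear_snd_block: "bounded_linear (snd_block :: 'a::real_inner^('p::finite + 'q::finite) => _)"
 by (rule bounded_linear_intro[where K = 1]) (simp_all add: snd_block_add snd_block_scaleR norm_snd_block_le)

lemma bounded_linear_block_vec:
 assumes "bounded_linear f" "bounded_linear g"
 shows "bounded_linear (\<lambda>x. block_vec (f x) (g x :: 'a::real_inner^'q))"
proof -
 obtain F where F: "\<And>x. norm (f x) \<le> norm x * F" using bounded_linear.bounded[OF assms(1)] by blast
 obtain G where G: "\<And>x. norm (g x) \<le> norm x * G" using bounded_linear.bounded[OF assms(2)] by blast
 show ?thesis
 proof (rule bounded_linear_intro[where K = "F + G"])
  show "norm (block_vec (f x) (g x)) \<le> norm x * (F + G)" for x
   using norm_block_vec_le[of "f x" "g x"] F[of x] G[of x] by (simp add: distrib_left)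
 qed (simp_all add: block_vec_add block_vec_scaleR linear_simps(1,5)[OF assms(1)] linear_simps(1,5)[OF assms(2)])
qed

section \<open>Near-identity maps and the Riccati equation\<close>

lemma near_identity_surj:
 fixes L :: "'a::euclidean_space => 'a"
 assumes L: "linear L" and d: "\<And>v. norm (L v - v) \<le> norm v / 2"
 obtains v where "L v = g" "norm v \<le> 2 * norm g"
proof -
 have low: "norm v \<le> 2 * norm (L v)" for v
  using d[of v] norm_triangle_ineq2[of v "L v"] by (simp add: norm_minus_commute)
 have "inj L"
 proof (rule linear_injective_0[OF L, THEN iffD2], intro allI impI)
  show "v = 0" if "L v = 0" for v using low[of v] that by simp
 qed
 then have "surj L" by (rule linear_inj_imp_surj[OF L])
 then obtain v where "L v = g" by (metis surjD)
 with low[of v] show ?thesis by (intro that[of v]) auto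
qed

text \<open>For large \<open>r\<close> the map sending \<open>X\<close> to
  \<open>(1 / r) *R q X\<close> preserves the unit ball and contracts it with ratio 1/2. The last
  estimate says that \<open>S / r\<close> is the leading term of the solution, up to an error of
  order \<open>1 / r^2\<close>.\<close>

lemma riccati_solution:
 fixes S :: "complex^'n^'m"
 assumes c: "norm S \<le> c" "norm U \<le> c" "norm V \<le> c" "norm Z \<le> c"
  and r: "8 * c \<le> \<bar>r\<bar>" "1 \<le> \<bar>r\<bar>"
 obtains X where "r *R X = S + U ** X + X ** V + X ** Z ** X" "norm X \<le> 4 * c / \<bar>r\<bar>"
  "norm (r *R X - S) \<le> 12 * c^2 / \<bar>r\<bar>"
proof -
 interpret mm: bounded_bilinear "(**) :: complex^'n^'m => complex^'n^'n => _" by (rule bounded_bilinear_matrix_mult)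
 interpret mm2: bounded_bilinear "(**) :: complex^'m^'m => complex^'n^'m => _" by (rule bounded_bilinear_matrix_mult)
 interpret mm3: bounded_bilinear "(**) :: complex^'m^'m => complex^'n^'m => _" by (rule bounded_bilinear_matrix_mult)
 interpret mm4: bounded_bilinear "(**) :: complex^'n^'m => complex^'m^'n => _" by (rule bounded_bilinear_matrix_mult)
 have c0: "0 \<le> c" using c(1) norm_ge_zero order_trans by blast
 define q where "q = (\<lambda>X. S + U ** X + X ** V + X ** Z ** X)"
 have m: "norm (P ** Q) \<le> p * q'" if "norm P \<le> p" "norm Q \<le> q'" for P :: "complex^'j^'i" and Q :: "complex^'k^'j" and p q'
  using norm_matrix_mult_le[of P Q] mult_mono[OF that] that by (meson norm_ge_zero order_trans)
 have diff: "norm (q X - S) \<le> 3 * c * norm X" if X: "norm X \<le> 1" for X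
 proof -
  have "norm (X ** Z ** X) \<le> (1 * c) * norm X" using X c by (intro m) auto
  moreover have "norm (U ** X) \<le> c * norm X" using c by (intro m) auto
  moreover have "norm (X ** V) \<le> norm X * c" using c by (intro m) auto
  moreover have "norm (q X - S) \<le> norm (U ** X) + norm (X ** V) + norm (X ** Z ** X)"
   unfolding q_def by (simp add: add.assoc) (meson add_left_mono norm_triangle_ineq order_trans)
  ultimately show ?thesis by (simp add: algebra_simps)
 qed
 have lip: "norm (q X - q Y) \<le> 4 * c * norm (X - Y)" if X: "norm X \<le> 1" and Y: "norm Y \<le> 1" for X Y
 proof -
  have e: "q X - q Y = U ** (X - Y) + ((X - Y) ** V + (X ** Z ** (X - Y) + (X - Y) ** Z ** Y))"
   unfolding q_def by (simp add: mm.diff_left mm2.diff_right mm2.diff_left mm4.diff_left)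
  have "norm (X ** Z ** (X - Y)) \<le> (1 * c) * norm (X - Y)" using X c by (intro m) auto
  moreover have "norm ((X - Y) ** Z ** Y) \<le> (norm (X - Y) * c) * 1" using Y c by (intro m) auto
  moreover have "norm (U ** (X - Y)) \<le> c * norm (X - Y)" using c by (intro m) auto
  moreover have "norm ((X - Y) ** V) \<le> norm (X - Y) * c" using c by (intro m) auto
  moreover have "norm (q X - q Y) \<le> norm (U ** (X - Y)) + (norm ((X - Y) ** V) + (norm (X ** Z ** (X - Y)) + norm ((X - Y) ** Z ** Y)))"
   unfolding e by (intro norm_triangle_mono order.refl)
  ultimately show ?thesis by (simp add: algebra_simps)
 qed
 have bd: "norm (q X) \<le> 4 * c" if X: "norm X \<le> 1" for X
 proof -
  have "norm (q X) \<le> norm (q X - S) + norm S" using norm_triangle_ineq[of "q X - S" S] by simp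
  also have "... \<le> 3 * c * norm X + c" using diff[OF X] c by simp
  also have "... \<le> 3 * c * 1 + c" using X c0 by (intro add_right_mono mult_left_mono) auto
  finally show ?thesis by simp
 qed
 define f where "f = (\<lambda>X. (1 / r) *R q X)"
 have "\<exists>!X\<in>cball 0 1. f X = X"
 proof (rule Banach_fix[where c = "1 / 2"])
  show "f ` cball 0 1 \<subseteq> cball 0 1"
  proof safe
   fix X :: "complex^'n^'m" assume "X \<in> cball 0 1"
   then have "norm (f X) \<le> 4 * c / \<bar>r\<bar>" using bd[of X] r by (simp add: f_def divide_right_mono)
   also have "... \<le> 1" using r c0 by (simp add: divide_le_eq)
   finally show "f X \<in> cball 0 1" by simp
  qed
  show "dist (f X) (f Y) \<le> (1 / 2) * dist X Y" if "X \<in> cball 0 1" "Y \<in> cball 0 1" for X Y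
  proof -
   have "dist (f X) (f Y) = norm (q X - q Y) / \<bar>r\<bar>"
    by (simp add: f_def dist_norm scaleR_diff_right[symmetric])
   also have "... \<le> 4 * c * norm (X - Y) / \<bar>r\<bar>"
    using lip[of X Y] that by (intro divide_right_mono) auto
   also have "... = (4 * c / \<bar>r\<bar>) * norm (X - Y)" by simp
   also have "... \<le> (1 / 2) * norm (X - Y)" using r by (intro mult_right_mono) (auto simp: divide_le_eq)
   finally show ?thesis by (simp add: dist_norm)
  qed
 qed (auto simp: complete_eq_closed)
 then obtain X where X: "norm X \<le> 1" "f X = X" by auto
 have rX: "r *R X = q X" using X(2) r by (simp add: f_def) (metis (no_types, lifting) divide_self_if abs_zero not_one_le_zero scaleR_one scaleR_scaleR times_divide_eq_right mult.right_neutral)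
 have nX: "norm X \<le> 4 * c / \<bar>r\<bar>"
 proof -
  have "norm X = norm (q X) / \<bar>r\<bar>" using arg_cong[OF X(2), of norm] by (simp add: f_def)
  with bd[OF X(1)] show ?thesis by (simp add: divide_right_mono)
 qed
 have "norm (r *R X - S) \<le> 3 * c * norm X" using rX diff[OF X(1)] by simp
 also have "... \<le> 3 * c * (4 * c / \<bar>r\<bar>)" using nX c0 by (intro mult_left_mono) auto
 finally have "norm (r *R X - S) \<le> 12 * c^2 / \<bar>r\<bar>" by (simp add: power2_eq_square)
 with rX nX show ?thesis by (intro that[of X]) (auto simp: q_def)
qed

text \<open>The adjoint modes in abstract form: in the application \<open>A\<close>,
  \<open>B\<close>, \<open>C\<close>, \<open>D\<close> are \<open>\<i>\<close> times the transposes
  of \<open>A'\<close>, \<open>A21\<close>, \<open>A12\<close>, \<open>A22\<close>, and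
  \<open>K\<close>, \<open>E\<close> are minus the transposes of \<open>K11\<close>,
  \<open>K12\<close>. The first block is the observed one, so it is \<open>B\<close> that carries
  the heat component into the observation.\<close>

locale coupled_modes =
 fixes A K :: "complex^'p^'p" and B :: "complex^'q^'p" and C E :: "complex^'p^'q" and D :: "complex^'q^'q"
begin

definition gen :: "int => complex^('p + 'q)^('p + 'q)"
 where "gen n = block_mat (of_int n *R A + K) (of_int n *R B) (of_int n *R C + E)
  (of_int n *R D - (of_int n)^2 *R mat 1)"

text \<open>The graphs of \<open>\<Theta>\<close> and \<open>\<Psi>\<close> are invariant under
  \<open>gen n\<close>; on the first the generator is of transport type with a bounded correction,
  on the second of heat type. The term \<open>B ** C\<close> is the limit of \<open>n\<close> times
  \<open>B ** \<Theta>\<close>, and \<open>R\<close> is the remainder. The bound on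
  \<open>of_int n *R \<Psi> + B\<close> is decisive: the first block of a heat solution is close to
  \<open>- B / n\<close> applied to it, which brings the Kalman condition on \<open>D\<close> and
  \<open>B\<close> into play.\<close>

definition decoupled :: "real => int => complex^'p^'q => complex^'q^'p => complex^'p^'p => complex^'q^'q => bool"
 where "decoupled c n \<Theta> \<Psi> R Z \<longleftrightarrow>
  norm \<Theta> \<le> c / absr n \<and> norm \<Psi> \<le> c / absr n \<and> norm R \<le> c / absr n \<and> norm Z \<le> c \<and>
  norm (of_int n *R \<Psi> + B) \<le> c / absr n \<and>
  (\<forall>a. gen n *v block_vec a (\<Theta> *v a) =
   block_vec ((of_int n *R A + (K + B ** C) + R) *v a) (\<Theta> *v ((of_int n *R A + (K + B ** C) + R) *v a))) \<and>
  (\<forall>b. gen n *v block_vec (\<Psi> *v b) b =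
   block_vec (\<Psi> *v ((of_int n *R D + Z - (of_int n)^2 *R mat 1) *v b))
    ((of_int n *R D + Z - (of_int n)^2 *R mat 1) *v b))"

lemma decoupling:
 obtains c N :: real where "0 < c" "0 < N" "\<And>n. N \<le> absr n ==> \<exists>\<Theta> \<Psi> R Z. decoupled c n \<Theta> \<Psi> R Z"
proof -
 define c0 where "c0 = 1 + norm A + norm K + norm B + norm C + norm E + norm D"
 \<comment> \<open>Leaves room for all the polynomial bounds in \<open>c0\<close> that are collected
   in \<open>cc\<close>.\<close>
 define c where "c = 100 * c0 ^ 3"
 have c0: "1 \<le> c0" by (simp add: c0_def)
 have cc: "4 * c0 \<le> c" "12 * c0^2 \<le> c" "c0 * (13 * c0^2) \<le> c" "8 * c0^2 \<le> c" "13 * c0^2 \<le> c" "c0 + 12 * c0^2 \<le> c"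
 proof -
  have "c0 \<le> c0 ^ 3" "c0^2 \<le> c0 ^ 3" "c0 \<le> c0^2" "0 \<le> c0 ^ 3"
   using c0 power_increasing[of 1 3 c0] power_increasing[of 2 3 c0] power_increasing[of 1 2 c0] by auto
  then show "4 * c0 \<le> c" "12 * c0^2 \<le> c" "8 * c0^2 \<le> c" "13 * c0^2 \<le> c" "c0 + 12 * c0^2 \<le> c"
   unfolding c_def by linarith+
  show "c0 * (13 * c0^2) \<le> c" using c0 unfolding c_def by (simp add: power3_eq_cube power2_eq_square)
 qed
 have "\<exists>\<Theta> \<Psi> R Z. decoupled c n \<Theta> \<Psi> R Z" if n: "8 * c0 \<le> absr n" for n
 proof -
  define r :: real where "r = of_int n"
  have r: "8 * c0 \<le> \<bar>r\<bar>" "1 \<le> \<bar>r\<bar>" using n c0 by (auto simp: r_def)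
  then have r0: "r \<noteq> 0" by auto
  have inv: "norm (inverse r *R M) \<le> norm M" for M :: "complex^'j^'i"
   using r by (simp add: divide_le_eq inverse_eq_divide) (metis mult_left_mono norm_ge_zero mult.right_neutral)
  have tri: "norm (x + inverse r *R y) \<le> norm x + norm y" for x y :: "complex^'j^'i"
   using norm_triangle_ineq[of x "inverse r *R y"] inv[of y] by linarith
  \<comment> \<open>Invariance of the graph of \<open>\<Theta>\<close>, divided by \<open>r\<close>.
    The left side comes from the heat term \<open>- r^2\<close> and makes the equation solvable for
    large \<open>r\<close>; the equation for \<open>\<Psi>\<close> arises in the same way from the
    other graph.\<close>
  obtain \<Theta> where T: "r *R \<Theta> = (C + inverse r *R E) + D ** \<Theta> + \<Theta> ** (- (A + inverse r *R K)) + \<Theta> ** (- B) ** \<Theta>"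
    "norm \<Theta> \<le> 4 * c0 / \<bar>r\<bar>" "norm (r *R \<Theta> - (C + inverse r *R E)) \<le> 12 * c0^2 / \<bar>r\<bar>"
  proof (rule riccati_solution[of "C + inverse r *R E" c0 D "- (A + inverse r *R K)" "- B" r])
   show "norm (C + inverse r *R E) \<le> c0" "norm (- (A + inverse r *R K)) \<le> c0"
    using tri[of C E] tri[of A K] by (auto simp: c0_def norm_minus_cancel intro: order.trans simp del: minus_add_distrib)
  qed (use r in \<open>auto simp: c0_def\<close>)
  obtain \<Psi> where P: "r *R \<Psi> = (- B) + (- (A + inverse r *R K)) ** \<Psi> + \<Psi> ** D + \<Psi> ** (C + inverse r *R E) ** \<Psi>"
    "norm \<Psi> \<le> 4 * c0 / \<bar>r\<bar>" "norm (r *R \<Psi> - (- B)) \<le> 12 * c0^2 / \<bar>r\<bar>"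
  proof (rule riccati_solution[of "- B" c0 "- (A + inverse r *R K)" D "C + inverse r *R E" r])
   show "norm (C + inverse r *R E) \<le> c0" "norm (- (A + inverse r *R K)) \<le> c0"
    using tri[of C E] tri[of A K] by (auto simp: c0_def norm_minus_cancel intro: order.trans simp del: minus_add_distrib)
  qed (use r in \<open>auto simp: c0_def\<close>)
  define R where "R = B ** (r *R \<Theta> - C)"
  define Z where "Z = (r *R C + E) ** \<Psi>"
  have nC: "norm (r *R \<Theta> - C) \<le> 13 * c0^2 / \<bar>r\<bar>"
  proof -
   have "norm (r *R \<Theta> - C) \<le> norm (r *R \<Theta> - (C + inverse r *R E)) + norm (inverse r *R E)"
    using norm_triangle_ineq[of "r *R \<Theta> - (C + inverse r *R E)" "inverse r *R E"] by (simp add: algebra_simps)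
   also have "norm (inverse r *R E) \<le> c0^2 / \<bar>r\<bar>"
   proof -
    have "norm E \<le> c0" by (simp add: c0_def)
    also have "c0 \<le> c0^2" using c0 by (simp add: power2_eq_square)
    finally show ?thesis by (simp add: divide_inverse mult.commute[of _ "inverse _"] mult_left_mono)
   qed
   finally show ?thesis using T(3) by (simp add: add_divide_distrib[symmetric])
  qed
  have "norm R \<le> norm B * norm (r *R \<Theta> - C)" unfolding R_def by (rule norm_matrix_mult_le)
  also have "... \<le> c0 * (13 * c0^2 / \<bar>r\<bar>)" using nC c0 by (intro mult_mono) (auto simp: c0_def)
  also have "... = c0 * (13 * c0^2) / \<bar>r\<bar>" by simp
  also have "... \<le> c / \<bar>r\<bar>" using cc by (intro divide_right_mono) auto
  finally have R: "norm R \<le> c / \<bar>r\<bar>" .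
  have "norm Z \<le> norm (r *R C + E) * norm \<Psi>" unfolding Z_def by (rule norm_matrix_mult_le)
  also have "... \<le> (2 * c0 * \<bar>r\<bar>) * (4 * c0 / \<bar>r\<bar>)"
  proof (intro mult_mono P)
   have "norm (r *R C + E) \<le> \<bar>r\<bar> * norm C + norm E"
    using norm_triangle_ineq[of "r *R C" E] by simp
   also have "... \<le> \<bar>r\<bar> * c0 + c0" by (intro add_mono mult_left_mono) (auto simp: c0_def)
   also have "... \<le> \<bar>r\<bar> * c0 + \<bar>r\<bar> * c0" using r c0 by (intro add_left_mono) (metis mult_right_mono mult_1 order_trans zero_le_one)
   finally show "norm (r *R C + E) \<le> 2 * c0 * \<bar>r\<bar>" by simp
  qed (use c0 in auto)
  also have "... = 8 * c0^2" using r0 by (simp add: power2_eq_square)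
  finally have Z: "norm Z \<le> c" using cc by simp
  have le_c: "x / \<bar>r\<bar> \<le> c / \<bar>r\<bar>" if "x \<le> c" for x using that by (intro divide_right_mono) auto
  have eqT: "(of_int n *R C + E) + (of_int n *R D - (of_int n)^2 *R mat 1) ** \<Theta> =
    \<Theta> ** (of_int n *R A + (K + B ** C) + R)"
  proof -
   have e1: "r *R (r *R \<Theta>) = (r *R C + E) + r *R (D ** \<Theta>) - \<Theta> ** (r *R A + K) - r *R (\<Theta> ** B ** \<Theta>)"
    apply (subst T(1)) using r0 apply (simp add: algebra_simps
     bounded_bilinear.minus_right[OF bounded_bilinear_matrix_mult] bounded_bilinear.minus_left[OF bounded_bilinear_matrix_mult]
     bounded_bilinear.diff_right[OF bounded_bilinear_matrix_mult]
     bounded_bilinear.add_right[OF bounded_bilinear_matrix_mult] bounded_bilinear.scaleR_right[OF bounded_bilinear_matrix_mult])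
    done
   have e2: "\<Theta> ** (of_int n *R A + (K + B ** C) + R) = \<Theta> ** (r *R A + K) + r *R (\<Theta> ** B ** \<Theta>)"
    unfolding R_def r_def[symmetric]
    by (simp add: bounded_bilinear.diff_right[OF bounded_bilinear_matrix_mult] bounded_bilinear.add_right[OF bounded_bilinear_matrix_mult]
     bounded_bilinear.scaleR_right[OF bounded_bilinear_matrix_mult] matrix_mul_assoc)
   have e3: "(of_int n *R D - (of_int n)^2 *R mat 1) ** \<Theta> = r *R (D ** \<Theta>) - r *R (r *R \<Theta>)"
    unfolding r_def[symmetric] by (simp add: bounded_bilinear.diff_left[OF bounded_bilinear_matrix_mult]
     bounded_bilinear.scaleR_left[OF bounded_bilinear_matrix_mult] power2_eq_square)
   show ?thesis unfolding e2 e3 e1 by (simp add: r_def)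
  qed
  have eqP: "(of_int n *R A + K) ** \<Psi> + of_int n *R B = \<Psi> ** (of_int n *R D + Z - (of_int n)^2 *R mat 1)"
  proof -
   have e1: "r *R (r *R \<Psi>) = - (r *R B) - (r *R A + K) ** \<Psi> + r *R (\<Psi> ** D) + \<Psi> ** (r *R C + E) ** \<Psi>"
    apply (subst P(1)) using r0 apply (simp add: algebra_simps
     bounded_bilinear.minus_right[OF bounded_bilinear_matrix_mult] bounded_bilinear.minus_left[OF bounded_bilinear_matrix_mult]
     bounded_bilinear.diff_left[OF bounded_bilinear_matrix_mult] bounded_bilinear.scaleR_left[OF bounded_bilinear_matrix_mult]
     bounded_bilinear.add_right[OF bounded_bilinear_matrix_mult] bounded_bilinear.scaleR_right[OF bounded_bilinear_matrix_mult]
     bounded_bilinear.add_left[OF bounded_bilinear_matrix_mult])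
    done
   have e2: "\<Psi> ** (of_int n *R D + Z - (of_int n)^2 *R mat 1) = r *R (\<Psi> ** D) + \<Psi> ** (r *R C + E) ** \<Psi> - r *R (r *R \<Psi>)"
    unfolding Z_def r_def[symmetric]
    by (simp add: bounded_bilinear.diff_right[OF bounded_bilinear_matrix_mult] bounded_bilinear.add_right[OF bounded_bilinear_matrix_mult]
     bounded_bilinear.scaleR_right[OF bounded_bilinear_matrix_mult] matrix_mul_assoc power2_eq_square)
   show ?thesis unfolding e2 e1 by (simp add: r_def)
  qed
  have "decoupled c n \<Theta> \<Psi> R Z" unfolding decoupled_def
  proof (intro conjI allI)
   show "norm \<Theta> \<le> c / absr n" "norm \<Psi> \<le> c / absr n" "norm (of_int n *R \<Psi> + B) \<le> c / absr n"
    using T(2) P(2,3) le_c cc by (auto simp: r_def intro: order.trans)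
   show "norm R \<le> c / absr n" "norm Z \<le> c" using R Z by (auto simp: r_def)
  next
   fix a
   have "gen n *v block_vec a (\<Theta> *v a) =
     block_vec ((of_int n *R A + K) *v a + (of_int n *R B) *v (\<Theta> *v a))
      (((of_int n *R C + E) + (of_int n *R D - (of_int n)^2 *R mat 1) ** \<Theta>) *v a)"
    by (simp add: gen_def block_mat_vector matrix_vector_mul_assoc matrix_vector_mult_add_rdistrib)
   also have "... = block_vec ((of_int n *R A + (K + B ** C) + R) *v a) (\<Theta> *v ((of_int n *R A + (K + B ** C) + R) *v a))"
    unfolding eqT
    by (simp add: matrix_vector_mul_assoc[symmetric] R_def r_def bounded_bilinear.diff_right[OF bounded_bilinear_matrix_mult]
     bounded_bilinear.scaleR_right[OF bounded_bilinear_matrix_mult] matrix_vector_mult_add_rdistrib matrix_vector_mult_diff_rdistrib matrix_scaleR_left add.assoc)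
   finally show "gen n *v block_vec a (\<Theta> *v a) = ..." .
  next
   fix b
   have "gen n *v block_vec (\<Psi> *v b) b =
     block_vec (((of_int n *R A + K) ** \<Psi> + of_int n *R B) *v b)
      ((of_int n *R C + E) *v (\<Psi> *v b) + (of_int n *R D - (of_int n)^2 *R mat 1) *v b)"
    by (simp add: gen_def block_mat_vector matrix_vector_mul_assoc matrix_vector_mult_add_rdistrib)
   also have "... = block_vec (\<Psi> *v ((of_int n *R D + Z - (of_int n)^2 *R mat 1) *v b))
    ((of_int n *R D + Z - (of_int n)^2 *R mat 1) *v b)" unfolding eqP
    by (simp add: matrix_vector_mul_assoc[symmetric] Z_def r_def matrix_vector_mult_add_rdistrib matrix_vector_mult_diff_rdistrib algebra_simps)
   finally show "gen n *v block_vec (\<Psi> *v b) b = ..." .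
  qed
  then show ?thesis by blast
 qed
 then show ?thesis using that[of c "8 * c0"] c0 cc by auto
qed

end

section \<open>Observability of the parabolic part\<close>

text \<open>The columns are the images of unit vectors, so a bound on vectors becomes one on the
  matrix norm at the price of the dimension.\<close>

lemma norm_matrix_le_columns:
 fixes M :: "complex^'n^'m" and b :: real
 assumes "\<And>x. norm (M *v x) \<le> b * norm x"
 shows "norm M \<le> CARD('n) * b"
proof -
 have col: "transpose M $ j = M *v axis j 1" for j
  by (simp add: vec_eq_iff transpose_def matrix_vector_mult_def axis_def if_distrib cong: if_cong)
 have "norm M = norm (transpose M)" by (simp add: norm_transpose)
 also have "... \<le> (\<Sum>j\<in>UNIV. norm (transpose M $ j))"
  unfolding norm_vec_def by (rule L2_set_le_sum) simp
 also have "(\<Sum>j\<in>UNIV. norm (transpose M $ j)) \<le> (\<Sum>j\<in>(UNIV :: 'n set). b)"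
 proof (rule sum_mono)
  fix j
  show "norm (transpose M $ j) \<le> b"
   using assms[of "axis j 1"] by (simp add: col norm_eq_sqrt_inner[of "axis j (1 :: complex)"] inner_axis_axis)
 qed
 finally show ?thesis by simp
qed

lemma continuous_on_matrix_power [continuous_intros]:
 "continuous_on S f ==> continuous_on S (\<lambda>x. matrix_power (f x :: complex^'n^'n) k)"
 by (induction k) (auto intro!: bounded_bilinear.continuous_on[OF bounded_bilinear_matrix_mult] continuous_intros)

text \<open>The pair that governs a heat mode at frequency \<open>n\<close> differs from its limit
  by terms of order \<open>1 / n\<close>. The lower bound involves finitely many continuous matrix
  products and is therefore stable.\<close>

lemma kalman_bound_perturb:
 fixes A0 :: "complex^'n^'n" and C0 :: "complex^'n^'m"
 assumes k: "0 < \<kappa>" and K: "\<And>c. \<kappa> * norm c \<le> (\<Sum>j\<le>J. norm (C0 *v (matrix_power A0 j *v c)))"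
 obtains \<epsilon> where "0 < \<epsilon>"
  "\<And>A C c. norm (A - A0) < \<epsilon> ==> norm (C - C0) < \<epsilon> ==>
   \<kappa> / 2 * norm c \<le> (\<Sum>j\<le>J. norm (C *v (matrix_power A j *v c)))"
proof -
 \<comment> \<open>Each of the \<open>J + 1\<close> terms may lose \<open>\<theta>\<close>; half of
   \<open>\<kappa>\<close> remains.\<close>
 define \<theta> where "\<theta> = \<kappa> / (2 * real (J + 1))"
 have t: "0 < \<theta>" using k by (simp add: \<theta>_def)
 have "\<exists>\<epsilon>>0. \<forall>p. dist p (A0, C0) < \<epsilon> \<longrightarrow>
   dist (snd p ** matrix_power (fst p) j) (C0 ** matrix_power A0 j) < \<theta>" for j
 proof -
  have "continuous_on UNIV (\<lambda>p :: (complex^'n^'n) \<times> (complex^'n^'m). snd p ** matrix_power (fst p) j)"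
   by (intro bounded_bilinear.continuous_on[OF bounded_bilinear_matrix_mult] continuous_intros)
  then show ?thesis using t unfolding continuous_on_iff by (metis UNIV_I fst_conv snd_conv)
 qed
 then obtain e where e: "\<And>j. 0 < e j" "\<And>j p. dist p (A0, C0) < e j ==>
   dist (snd p ** matrix_power (fst p) j) (C0 ** matrix_power A0 j) < \<theta>" by metis
 define \<epsilon> where "\<epsilon> = Min (e ` {..J}) / 2"
 have pos: "0 < \<epsilon>" using e(1) by (auto simp: \<epsilon>_def)
 show ?thesis
 proof (rule that[OF pos])
  fix A :: "complex^'n^'n" and C :: "complex^'n^'m" and c :: "complex^'n"
  assume A: "norm (A - A0) < \<epsilon>" and C: "norm (C - C0) < \<epsilon>"
  have d: "norm (C ** matrix_power A j - C0 ** matrix_power A0 j) < \<theta>" if "j \<le> J" for j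
  proof -
   have "dist (A, C) (A0, C0) \<le> norm (A - A0) + norm (C - C0)"
    using sqrt_sum_squares_le_sum[of "dist A A0" "dist C C0"]
    by (simp only: dist_Pair_Pair) (simp add: dist_norm)
   also have "... < 2 * \<epsilon>" using A C by simp
   also have "... \<le> e j" using that by (simp add: \<epsilon>_def Min_le)
   finally show ?thesis using e(2)[of "(A, C)" j] by (simp add: dist_norm)
  qed
  have "norm (C0 *v (matrix_power A0 j *v c)) \<le> norm (C *v (matrix_power A j *v c)) + \<theta> * norm c" if "j \<le> J" for j
  proof -
   have "norm ((C ** matrix_power A j - C0 ** matrix_power A0 j) *v c) \<le> \<theta> * norm c"
    using norm_matrix_vector_le[of "C ** matrix_power A j - C0 ** matrix_power A0 j" c] d[OF that]
    by (meson less_imp_le mult_right_mono norm_ge_zero order_trans)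
   moreover have "C0 *v (matrix_power A0 j *v c) = C *v (matrix_power A j *v c) - (C ** matrix_power A j - C0 ** matrix_power A0 j) *v c"
    by (simp add: matrix_vector_mult_diff_rdistrib matrix_vector_mul_assoc)
   ultimately show ?thesis
    using norm_triangle_ineq4[of "C *v (matrix_power A j *v c)" "(C ** matrix_power A j - C0 ** matrix_power A0 j) *v c"] by simp
  qed
  then have "(\<Sum>j\<le>J. norm (C0 *v (matrix_power A0 j *v c))) \<le> (\<Sum>j\<le>J. norm (C *v (matrix_power A j *v c)) + \<theta> * norm c)"
   by (intro sum_mono) auto
  also have "... = (\<Sum>j\<le>J. norm (C *v (matrix_power A j *v c))) + \<kappa> / 2 * norm c"
  proof -
   have "real (card {..J}) * \<theta> = \<kappa> / 2" by (simp add: \<theta>_def field_simps)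
   then have "(\<Sum>j\<le>J. \<theta> * norm c) = \<kappa> / 2 * norm c" by (simp only: sum_constant mult.assoc[symmetric])
   then show ?thesis by (simp add: sum.distrib)
  qed
  finally show "\<kappa> / 2 * norm c \<le> (\<Sum>j\<le>J. norm (C *v (matrix_power A j *v c)))"
   using K[of c] by simp
 qed
qed

text \<open>The quotients \<open>(e\<^sup>h\<^sup>A - 1) / h\<close> are close to \<open>A\<close>, so that a perturbed Kalman condition bounds the
 state by finitely many samples of the output.\<close>

lemma sampled_observability:
 fixes A0 :: "complex^'n^'n" and C0 :: "complex^'n^'m"
 assumes k: "0 < \<kappa>" and K: "\<And>c. \<kappa> * norm c \<le> (\<Sum>j\<le>J. norm (C0 *v (matrix_power A0 j *v c)))"
 obtains \<epsilon> h0 M where "0 < \<epsilon>" "0 < h0" "h0 \<le> 1" "0 < M"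
  "\<And>A C h c. norm (A - A0) < \<epsilon> ==> norm (C - C0) < \<epsilon> ==> 0 < h ==> h \<le> h0 ==>
   norm c \<le> M / h ^ J * (\<Sum>k\<le>J. norm (C *v (matrix_exp ((real k * h) *R A) *v c)))"
proof -
 obtain \<epsilon> where e: "0 < \<epsilon>" "\<And>A C c. norm (A - A0) < \<epsilon> ==> norm (C - C0) < \<epsilon> ==>
   \<kappa> / 2 * norm c \<le> (\<Sum>j\<le>J. norm (C *v (matrix_power A j *v c)))"
  using kalman_bound_perturb[OF k K] by blast
 define a where "a = norm A0 + \<epsilon>"
 have a: "0 < a" using e by (simp add: a_def add_nonneg_pos)
 \<comment> \<open>\<open>h * q\<close> bounds the distance between the difference quotient and
   \<open>A\<close> in matrix norm; \<open>h0\<close> keeps it below \<open>\<epsilon> / 2\<close>.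
   The factor \<open>CARD('n)\<close> comes from passing from vectors to the matrix norm.\<close>
 define q where "q = real CARD('n) * a^2 * exp a"
 have q: "0 < q" using a by (simp add: q_def)
 define h0 where "h0 = min 1 (\<epsilon> / (2 * q))"
 have h0: "0 < h0" "h0 \<le> 1" "h0 * q \<le> \<epsilon> / 2"
  using e q by (auto simp: h0_def min_def field_simps)
 define M where "M = 2 / \<kappa> * (real (J + 1) * 2 ^ J)"
 have M: "0 < M" using k by (simp add: M_def)
 have main: "norm c \<le> M / h ^ J * (\<Sum>k\<le>J. norm (C *v (matrix_exp ((real k * h) *R A) *v c)))"
  if A: "norm (A - A0) < \<epsilon> / 2" and C: "norm (C - C0) < \<epsilon> / 2" and h: "0 < h" "h \<le> h0"
  for A :: "complex^'n^'n" and C :: "complex^'n^'m" and h c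
 proof -
  have nA: "norm A \<le> a" using A e norm_triangle_ineq[of "A - A0" A0] by (simp add: a_def)
  define Y where "Y = matrix_exp (h *R A) - mat 1"
  have Yv: "Y *v x = matrix_exp (h *R A) *v x - x" for x by (simp add: Y_def matrix_vector_mult_diff_rdistrib)
  have "norm (((1 / h) *R Y - A) *v x) \<le> (h * a^2 * exp a) * norm x" for x
  proof -
   have "h *R (((1 / h) *R Y - A) *v x) = matrix_exp (h *R A) *v x - x - h *R (A *v x)"
    using h by (simp add: matrix_vector_mult_diff_rdistrib matrix_scaleR_left Yv scaleR_diff_right)
   then have "h * norm (((1 / h) *R Y - A) *v x) = norm (matrix_exp (h *R A) *v x - x - h *R (A *v x))"
    using h by (metis abs_of_pos norm_scaleR)
   also have "... \<le> h^2 * nsq A * exp (h * norm A) * norm x" using h by (intro matrix_exp_diff2_le) auto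
   also have "... \<le> h^2 * a^2 * exp a * norm x"
   proof -
    have "h * norm A \<le> 1 * a" using h h0 nA a by (intro mult_mono) auto
    then show ?thesis using nA a h by (intro mult_right_mono mult_mono power_mono) auto
   qed
   finally have "h * norm (((1 / h) *R Y - A) *v x) \<le> h * ((h * a^2 * exp a) * norm x)"
    by (simp add: power2_eq_square mult_ac)
   then show ?thesis using h by (simp only: mult_le_cancel_left_pos)
  qed
  then have "norm ((1 / h) *R Y - A) \<le> CARD('n) * (h * a^2 * exp a)" by (rule norm_matrix_le_columns)
  also have "... = h * q" by (simp add: q_def)
  also have "... \<le> h0 * q" using h q by (intro mult_right_mono) auto
  finally have "norm ((1 / h) *R Y - A) \<le> \<epsilon> / 2" using h0 by linarith
  then have "norm ((1 / h) *R Y - A0) < \<epsilon>"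
   using A norm_triangle_ineq[of "(1 / h) *R Y - A" "A - A0"] by simp
  then have 1: "\<kappa> / 2 * norm c \<le> (\<Sum>j\<le>J. norm (C *v (matrix_power ((1 / h) *R Y) j *v c)))"
   using e C by (intro e(2)) auto
  \<comment> \<open>A power of the difference \<open>exp (h A) - 1\<close> is an alternating
    binomial sum of samples, whose coefficients add up to \<open>2 ^ j\<close> in modulus.\<close>
  have dif: "norm (C *v (matrix_power Y j *v x)) \<le> 2 ^ j * (\<Sum>k\<le>j. norm (C *v (matrix_exp ((real k * h) *R A) *v x)))" for j x
  proof (induction j arbitrary: x)
   case (Suc j)
   let ?e = "\<lambda>k. norm (C *v (matrix_exp ((real k * h) *R A) *v x))"
   have sh: "matrix_exp ((real k * h) *R A) *v (matrix_exp (h *R A) *v x) = matrix_exp ((real (Suc k) * h) *R A) *v x" for k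
    using matrix_exp_add_vector[of "real k * h" h A x] by (simp add: algebra_simps)
   have "matrix_power Y (Suc j) *v x = matrix_power Y j *v (Y *v x)"
    unfolding matrix_power_vector_Suc by (rule matrix_power_intertwine) simp
   also have "... = matrix_power Y j *v (matrix_exp (h *R A) *v x) - matrix_power Y j *v x"
    by (simp add: Yv matrix_vector_mult_diff_distrib)
   finally have "norm (C *v (matrix_power Y (Suc j) *v x)) \<le>
     norm (C *v (matrix_power Y j *v (matrix_exp (h *R A) *v x))) + norm (C *v (matrix_power Y j *v x))"
    by (simp only: matrix_vector_mult_diff_distrib norm_triangle_ineq4)
   also have "... \<le> 2 ^ j * (\<Sum>k\<le>j. ?e (Suc k)) + 2 ^ j * (\<Sum>k\<le>j. ?e k)"
    using Suc[of "matrix_exp (h *R A) *v x"] Suc[of x] unfolding sh by (rule add_mono)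
   also have "(\<Sum>k\<le>j. ?e (Suc k)) \<le> (\<Sum>k\<le>Suc j. ?e k)"
    by (simp add: sum.atMost_Suc_shift del: sum.atMost_Suc of_nat_Suc)
   also have "(\<Sum>k\<le>j. ?e k) \<le> (\<Sum>k\<le>Suc j. ?e k)" by simp
   finally show ?case by simp
  qed simp
  have pw: "matrix_power ((1 / h) *R Y) j *v x = (1 / h) ^ j *R (matrix_power Y j *v x)" for j x
   by (induction j) (simp_all only: matrix_power_vector_Suc matrix_scaleR_left matrix_scaleR_right, simp_all)
  let ?s = "\<Sum>k\<le>J. norm (C *v (matrix_exp ((real k * h) *R A) *v c))"
  have "(\<Sum>j\<le>J. norm (C *v (matrix_power ((1 / h) *R Y) j *v c))) \<le> (\<Sum>j\<le>J. (1 / h) ^ J * (2 ^ J * ?s))"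
  proof (rule sum_mono)
   fix j assume j: "j \<in> {..J}"
   have "norm (C *v (matrix_power ((1 / h) *R Y) j *v c)) = (1 / h) ^ j * norm (C *v (matrix_power Y j *v c))"
    using h by (simp add: pw matrix_scaleR_right)
   also have "... \<le> (1 / h) ^ J * (2 ^ J * ?s)"
   proof (intro mult_mono)
    show "(1 / h) ^ j \<le> (1 / h) ^ J" using j h h0 by (intro power_increasing) auto
    have "norm (C *v (matrix_power Y j *v c)) \<le> 2 ^ j * (\<Sum>k\<le>j. norm (C *v (matrix_exp ((real k * h) *R A) *v c)))"
     by (rule dif)
    also have "... \<le> 2 ^ J * ?s" using j by (intro mult_mono power_increasing sum_mono2 sum_nonneg) auto
    finally show "norm (C *v (matrix_power Y j *v c)) \<le> 2 ^ J * ?s" .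
   qed (use h in auto)
   finally show "norm (C *v (matrix_power ((1 / h) *R Y) j *v c)) \<le> (1 / h) ^ J * (2 ^ J * ?s)" .
  qed
  with 1 have "\<kappa> / 2 * norm c \<le> real (J + 1) * ((1 / h) ^ J * (2 ^ J * ?s))" by simp
  then have "2 / \<kappa> * (\<kappa> / 2 * norm c) \<le> 2 / \<kappa> * (real (J + 1) * ((1 / h) ^ J * (2 ^ J * ?s)))"
   using k by (intro mult_left_mono) auto
  then show ?thesis using k by (simp add: M_def power_divide mult_ac)
 qed
 show ?thesis using e h0 M main by (intro that[of "\<epsilon> / 2" h0 M]) auto
qed

lemma matrix_exp_diff_scalar:
 "matrix_exp (t *R (M - r *R mat 1)) *v x = exp (- r * t) *R (matrix_exp (t *R M) *v (x :: complex^'n))"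
proof -
 have "((\<lambda>t. exp (- r * t) *R (matrix_exp (t *R M) *v x)) has_vector_derivative
   (M - r *R mat 1) *v (exp (- r * s) *R (matrix_exp (s *R M) *v x))) (at s)" for s
  by (rule has_vector_derivative_eq_rhs, rule has_vector_derivative_scaleR[OF _ has_vector_derivative_matrix_exp])
   (auto intro!: derivative_eq_intros simp: matrix_vector_mult_diff_rdistrib matrix_scaleR_left matrix_scaleR_right algebra_simps)
 from linear_ode_unique[of "\<lambda>t. exp (- r * t) *R (matrix_exp (t *R M) *v x)", OF this] show ?thesis
  by simp
qed

lemma pow_exp_bound: "x ^ k * exp (c * x) \<le> fact k * exp ((c + 1) * (x::real))" if "0 \<le> x"
proof -
 have "x ^ k * exp (c * x) \<le> (fact k * exp x) * exp (c * x)"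
  using that by (intro mult_right_mono power_le_fact_exp) auto
 then show ?thesis by (simp add: mult.assoc mult_exp_exp algebra_simps)
qed

text \<open>What the decoupled heat modes \<open>b\<close> and their outputs \<open>y\<close>
  provide, with constants uniform in the modes. The sampling step is measured in units of
  \<open>1 / \<bar>n\<bar>\<close> because \<open>D\<close> is multiplied by \<open>n\<close>; the
  weights \<open>exp (n^2 k \<eta>)\<close> undo the dissipation between samples; the factor
  \<open>absr n\<close> is the price of an output of relative size \<open>1 / n\<close>.\<close>

definition parabolic_output ::
 "real => real => nat => int set => (int => real => complex^'q) => (int => real => complex^'p) => bool"
 where "parabolic_output h0 M J S b y \<longleftrightarrow> finite S \<and> (\<forall>n\<in>S. n \<noteq> 0 \<and> continuous_on UNIV (y n) \<and>
  (\<forall>s t. 0 \<le> s \<longrightarrow> 0 \<le> t \<longrightarrow> norm (b n (t + s)) \<le> exp (- ((of_int n)^2 * s / 2)) * norm (b n t)) \<and>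
  (\<forall>t \<eta>. 0 \<le> t \<longrightarrow> 0 < \<eta> \<longrightarrow> absr n * \<eta> \<le> h0 \<longrightarrow>
   norm (b n t) \<le> M * absr n / (absr n * \<eta>) ^ J *
    (\<Sum>k\<le>J. exp ((of_int n)^2 * (real k * \<eta>)) * norm (y n (t + real k * \<eta>)))) \<and>
  (\<forall>t. 0 \<le> t \<longrightarrow> norm (y n t) \<le> norm (b n t)))"

context obs_set_interior
begin

text \<open>Frequencies are cut at \<open>K / \<sigma>\<close>. Above the cut, half of the interval
  dissipates the squared norm by the factor \<open>exp (- K^2 / (2 \<sigma>))\<close>. Below it, the
  spectral inequality and the samples recover the state at a cost exponential in
  \<open>K / \<sigma>\<close>. The gain is quadratic in \<open>K\<close> and the cost linear, so a
  large \<open>K\<close> wins.\<close>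

lemma lebeau_robbiano_step:
 fixes h0 M :: real and J :: nat
 assumes h0: "0 < h0" "h0 \<le> 1" and M: "0 < M"
 obtains A where "1 \<le> A"
  "\<And>S (b :: int => real => complex^'q) (y :: int => real => complex^'p) K \<sigma> t0.
   parabolic_output h0 M J S b y ==>
   1 \<le> K ==> 0 < \<sigma> ==> \<sigma> \<le> 1 ==> 0 \<le> t0 ==>
   (\<Sum>n\<in>S. nsq (b n (t0 + \<sigma>))) \<le>
    A * exp (A * K / \<sigma>) * integral {t0..t0 + \<sigma>} (\<lambda>t. energy X S (\<lambda>n. y n t)) +
    A * exp (A * K / \<sigma> - K^2 / (2 * \<sigma>)) * (\<Sum>n\<in>S. nsq (b n t0))"
proof -
 obtain Cs where Cs: "0 < Cs" "\<And>m S (c :: int => complex^'p). S \<subseteq> {- int m..int m} ==>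
   (\<Sum>n\<in>S. nsq (c n)) \<le> exp (Cs * (real m + 1)) * energy X S c" using spectral_inequality by blast
 define j1 where "j1 = real (J + 1)"
 have j1: "1 \<le> j1" by (simp add: j1_def)
 define A1 where "A1 = M^2 * j1 * (4 * j1 / h0) ^ (2 * J) * fact (2 * J + 2)"
 define A2 where "A2 = 3 + 2 * Cs"
 define A where "A = 3 + A2 + j1 * A1 * (8 + 4 * pi)"
 have A1: "0 < A1" using M j1 h0 by (simp add: A1_def)
 have A2: "0 < A2" using Cs by (simp add: A2_def)
 have A: "1 \<le> A" "A2 + 1 \<le> A" "8 * j1 * A1 \<le> A" "4 * pi * j1 * A1 + 1 \<le> A"
 proof -
  have "0 \<le> j1 * A1 * 8" "0 \<le> j1 * A1 * (4 * pi)" using A1 j1 pi_gt_zero by auto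
  then show "1 \<le> A" "A2 + 1 \<le> A" "8 * j1 * A1 \<le> A" "4 * pi * j1 * A1 + 1 \<le> A"
   using A2 by (auto simp: A_def distrib_left mult_ac)
 qed
 show ?thesis
 proof (rule that[OF A(1)])
  fix S and b :: "int => real => complex^'q" and y :: "int => real => complex^'p" and K \<sigma> t0 :: real
  assume po: "parabolic_output h0 M J S b y"
   and K: "1 \<le> K" and \<sigma>: "0 < \<sigma>" "\<sigma> \<le> 1" and t0: "0 \<le> t0"
  have fin: "finite S" and nz: "\<And>n. n \<in> S ==> n \<noteq> 0"
   and diss: "\<And>n s t. n \<in> S ==> 0 \<le> s ==> 0 \<le> t ==> norm (b n (t + s)) \<le> exp (- ((of_int n)^2 * s / 2)) * norm (b n t)"
   and samp: "\<And>n t (\<eta>::real). n \<in> S ==> 0 \<le> t ==> 0 < \<eta> ==> absr n * \<eta> \<le> h0 ==>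
    norm (b n t) \<le> M * absr n / (absr n * \<eta>) ^ J *
     (\<Sum>k\<le>J. exp ((of_int n)^2 * (k * \<eta>)) * norm (y n (t + k * \<eta>)))"
   and yb: "\<And>n t. n \<in> S ==> 0 \<le> t ==> norm (y n t) \<le> norm (b n t)"
   and cont: "\<And>n. n \<in> S ==> continuous_on UNIV (y n)"
   using po by (auto simp: parabolic_output_def)
  define x where "x = K / \<sigma>"
  have x: "1 \<le> x" "1 / \<sigma> \<le> x" using K \<sigma> by (auto simp: x_def field_simps)
  define m where "m = nat \<lfloor>x\<rfloor>"
  have m: "real m \<le> x" "x < real m + 1" "1 \<le> real m" using x by (auto simp: m_def le_floor_iff)
  \<comment> \<open>All samples then lie within \<open>\<sigma> / 4\<close> of the first one, and
    for modes below the cut \<open>n^2 k \<eta>\<close> is at most \<open>m\<close>, so that the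
    weights cost no more than \<open>exp m\<close>.\<close>
  define \<eta> where "\<eta> = h0 / (4 * j1 * x)"
  have \<eta>: "0 < \<eta>" using h0 j1 x by (simp add: \<eta>_def)
  have \<eta>J: "real k * \<eta> \<le> \<sigma> / 4" if "k \<le> J" for k
  proof -
   have "real k * \<eta> \<le> j1 * \<eta>" using that \<eta> by (intro mult_right_mono) (auto simp: j1_def)
   also have "... = h0 / (4 * x)" using j1 by (simp add: \<eta>_def)
   also have "... \<le> 1 / (4 * x)" using h0 x by (intro divide_right_mono) auto
   also have "... \<le> \<sigma> / 4" using x \<sigma> by (simp add: field_simps)
   finally show ?thesis .
  qed
  define L where "L = S \<inter> {- int m..int m}"
  define H where "H = S - L"
  have Lm: "L \<subseteq> {- int m..int m}" and LS: "L \<subseteq> S" and finL: "finite L" "finite H" and HS: "H \<subseteq> S"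
   using fin by (auto simp: L_def H_def)
  have low: "absr n \<le> real m" "1 \<le> absr n" if "n \<in> L" for n
  proof -
   show "absr n \<le> real m" using that Lm by (auto simp: L_def)
   have "n \<noteq> 0" using that LS nz by auto
   then show "1 \<le> absr n" by linarith
  qed
  have high: "x^2 \<le> (of_int n)^2" if "n \<in> H" for n
  proof -
   have "n \<notin> {- int m..int m}" using that by (auto simp: H_def L_def)
   then have "real m + 1 \<le> absr n" by auto
   then show ?thesis using m x abs_le_square_iff[of x "of_int n"] by linarith
  qed
  define \<phi> where "\<phi> = (\<lambda>t. \<Sum>n\<in>S. nsq (b n t))"
  define e where "e = exp (- (K^2 / (2 * \<sigma>)))"
  define En where "En = (\<lambda>t. energy X S (\<lambda>n. y n t))"
  have En0: "0 \<le> En t" for t by (simp add: En_def energy_nonneg)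
  have contE: "continuous_on UNIV En" unfolding En_def using cont by (intro continuous_intros)
  have \<phi>0: "0 \<le> \<phi> t" for t by (simp add: \<phi>_def sum_nonneg)
  have bdec: "nsq (b n (t + s)) \<le> exp (- ((of_int n)^2 * s)) * nsq (b n t)" if "n \<in> S" "0 \<le> s" "0 \<le> t" for n s t
  proof -
   have "nsq (b n (t + s)) \<le> (exp (- ((of_int n)^2 * s / 2)) * norm (b n t))^2"
    using diss[OF that] by (intro power_mono) auto
   then show ?thesis by (simp add: power_mult_distrib exp_double[symmetric])
  qed
  have highsum: "(\<Sum>n\<in>H. nsq (b n t)) \<le> e * \<phi> t0" if t: "t0 + \<sigma> / 2 \<le> t" for t
  proof -
   have "nsq (b n t) \<le> e * nsq (b n t0)" if n: "n \<in> H" for n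
   proof -
    have "nsq (b n (t0 + (t - t0))) \<le> exp (- ((of_int n)^2 * (t - t0))) * nsq (b n t0)"
     using n HS t t0 \<sigma> by (intro bdec) auto
    also have "... \<le> e * nsq (b n t0)"
    proof (rule mult_right_mono)
     have "K^2 / (2 * \<sigma>) = x^2 * (\<sigma> / 2)" using \<sigma> by (simp add: x_def power2_eq_square)
     also have "... \<le> (of_int n)^2 * (t - t0)" using high[OF n] t \<sigma> by (intro mult_mono) auto
     finally show "exp (- ((of_int n)^2 * (t - t0))) \<le> e" by (simp add: e_def)
    qed simp
    finally show ?thesis by simp
   qed
   then have "(\<Sum>n\<in>H. nsq (b n t)) \<le> (\<Sum>n\<in>H. e * nsq (b n t0))" by (intro sum_mono)
   also have "... \<le> (\<Sum>n\<in>S. e * nsq (b n t0))"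
    using fin HS by (intro sum_mono2) (auto simp: e_def)
   finally show ?thesis by (simp add: \<phi>_def sum_distrib_left)
  qed
  \<comment> \<open>The observation contains all modes. The high ones are subtracted; after half of
    the interval their energy is already dissipated.\<close>
  have lowE: "(\<Sum>n\<in>L. nsq (y n t)) \<le> exp (Cs * (real m + 1)) * (2 * En t + 4 * pi * (e * \<phi> t0))"
   if t: "t0 + \<sigma> / 2 \<le> t" for t
  proof -
   have tp: "0 \<le> t" using t t0 \<sigma> by simp
   have "(\<Sum>n\<in>L. nsq (y n t)) \<le> exp (Cs * (real m + 1)) * energy X L (\<lambda>n. y n t)"
    by (rule Cs(2)[OF Lm])
   also have "energy X L (\<lambda>n. y n t) = energy X L (\<lambda>n. y n t - (if n \<in> H then y n t else 0))"
    by (intro energy_cong) (auto simp: H_def)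
   also have "... = energy X S (\<lambda>n. y n t - (if n \<in> H then y n t else 0))"
    using fin LS by (intro energy_mono_neutral) (auto simp: H_def)
   also have "... \<le> 2 * En t + 2 * energy X S (\<lambda>n. if n \<in> H then y n t else 0)"
    unfolding En_def by (rule energy_diff_le)
   also have "energy X S (\<lambda>n. if n \<in> H then y n t else 0) \<le> 2 * pi * (\<Sum>n\<in>S. nsq (if n \<in> H then y n t else 0))"
    by (rule energy_le[OF fin])
   also have "(\<Sum>n\<in>S. nsq (if n \<in> H then y n t else 0)) = (\<Sum>n\<in>H. nsq (y n t))"
    using fin HS by (intro sum.mono_neutral_cong_right) auto
   also have "... \<le> (\<Sum>n\<in>H. nsq (b n t))" using HS yb tp by (intro sum_mono power_mono) auto
   also have "... \<le> e * \<phi> t0" by (rule highsum[OF t])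
   finally show ?thesis by (simp add: mult.assoc)
  qed
  define Q where "Q = A1 * exp (A2 * x)"
  have Q0: "0 \<le> Q" using A1 by (simp add: Q_def)
  have lowb: "(\<Sum>n\<in>L. nsq (b n t)) \<le> Q * (\<Sum>k\<le>J. 2 * En (t + k * \<eta>) + 4 * pi * (e * \<phi> t0))"
   if t: "t0 + \<sigma> / 2 \<le> t" for t
  proof -
   have tp: "0 \<le> t" using t t0 \<sigma> by simp
   define P where "P = (M * m / \<eta> ^ J * exp m)^2 * j1"
   have bn: "nsq (b n t) \<le> P * (\<Sum>k\<le>J. nsq (y n (t + k * \<eta>)))" if n: "n \<in> L" for n
   proof -
    have nm: "absr n \<le> real m" "1 \<le> absr n" using low[OF n] by auto
    have m\<eta>: "real m * \<eta> \<le> h0 / (4 * j1)"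
    proof -
     have "real m * \<eta> \<le> x * \<eta>" using m \<eta> by (intro mult_right_mono) auto
     then show ?thesis using x j1 by (simp add: \<eta>_def)
    qed
    have n\<eta>: "absr n * \<eta> \<le> h0"
    proof -
     have "absr n * \<eta> \<le> real m * \<eta>" using nm \<eta> by (intro mult_right_mono) auto
     also have "... \<le> h0 / (4 * j1)" by (rule m\<eta>)
     also have "... \<le> h0 / 1" using j1 h0 by (intro divide_left_mono) auto
     finally show ?thesis by simp
    qed
    have "norm (b n t) \<le> M * absr n / (absr n * \<eta>) ^ J *
     (\<Sum>k\<le>J. exp ((of_int n)^2 * (k * \<eta>)) * norm (y n (t + k * \<eta>)))"
     using n LS tp \<eta> n\<eta> by (intro samp) auto
    also have "... \<le> (M * m / \<eta> ^ J) * (\<Sum>k\<le>J. exp m * norm (y n (t + k * \<eta>)))"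
    proof (intro mult_mono sum_mono)
     have "\<eta> ^ J \<le> (absr n * \<eta>) ^ J"
      using nm \<eta> by (intro power_mono) (auto simp: mult_le_cancel_right1)
     then show "M * absr n / (absr n * \<eta>) ^ J \<le> M * m / \<eta> ^ J"
      using M nm \<eta> by (intro frac_le mult_mono) auto
    next
     fix k assume k: "k \<in> {..J}"
     have "(of_int n)^2 * (k * \<eta>) \<le> (real m)^2 * (j1 * \<eta>)"
     proof (intro mult_mono)
      show "(of_int n)^2 \<le> (real m)^2" using nm power_mono[of "absr n" "real m" 2] by simp
     qed (use k \<eta> in \<open>auto simp: j1_def\<close>)
     also have "... = real m * (j1 * (real m * \<eta>))" by (simp add: power2_eq_square)
     also have "... \<le> real m * (j1 * (h0 / (4 * j1)))" using m\<eta> j1 by (intro mult_left_mono) auto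
     also have "... \<le> real m * 1" using j1 h0 by (intro mult_left_mono) auto
     finally show "exp ((of_int n)^2 * (k * \<eta>)) \<le> exp m" by simp
    qed (use M \<eta> in \<open>auto intro!: sum_nonneg\<close>)
    also have "... = (M * m / \<eta> ^ J * exp m) * (\<Sum>k\<le>J. norm (y n (t + k * \<eta>)))"
     by (simp add: sum_distrib_left mult_ac)
    finally have "nsq (b n t) \<le> ((M * m / \<eta> ^ J * exp m) * (\<Sum>k\<le>J. norm (y n (t + k * \<eta>))))^2"
     by (intro power_mono) auto
    also have "... = (M * m / \<eta> ^ J * exp m)^2 * (\<Sum>k\<le>J. norm (y n (t + k * \<eta>)))^2"
     by (rule power_mult_distrib)
    also have "... \<le> (M * m / \<eta> ^ J * exp m)^2 * (j1 * (\<Sum>k\<le>J. nsq (y n (t + k * \<eta>))))"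
     using sum_squared_le_sum_of_squares[of "\<lambda>k. norm (y n (t + k * \<eta>))" "{..J}"]
     by (intro mult_left_mono) (auto simp: j1_def mult.commute)
    finally show ?thesis by (simp add: P_def mult.assoc)
   qed
   have P0: "0 \<le> P" using j1 by (simp add: P_def)
   have "(\<Sum>n\<in>L. nsq (b n t)) \<le> (\<Sum>n\<in>L. P * (\<Sum>k\<le>J. nsq (y n (t + k * \<eta>))))"
    by (intro sum_mono bn)
   also have "... = P * (\<Sum>k\<le>J. \<Sum>n\<in>L. nsq (y n (t + k * \<eta>)))"
    by (subst sum.swap) (simp add: sum_distrib_left)
   also have "... \<le> P * (\<Sum>k\<le>J. exp (Cs * (real m + 1)) * (2 * En (t + k * \<eta>) + 4 * pi * (e * \<phi> t0)))"
    using t \<eta> P0 by (intro mult_left_mono sum_mono lowE) (auto intro: add_increasing2)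
   also have "... = (P * exp (Cs * (real m + 1))) * (\<Sum>k\<le>J. 2 * En (t + k * \<eta>) + 4 * pi * (e * \<phi> t0))"
    by (simp add: sum_distrib_left mult.assoc)
   also have "... \<le> Q * (\<Sum>k\<le>J. 2 * En (t + k * \<eta>) + 4 * pi * (e * \<phi> t0))"
   proof (rule mult_right_mono)
    have "M * m / \<eta> ^ J * exp m \<le> M * x / \<eta> ^ J * exp x"
     using m M \<eta> by (intro mult_mono divide_right_mono) auto
    then have "P \<le> (M * x / \<eta> ^ J * exp x)^2 * j1"
     unfolding P_def using j1 M \<eta> by (intro mult_right_mono power_mono) auto
    also have "... = M^2 * j1 * (4 * j1 / h0) ^ (2 * J) * (x ^ (2 * J + 2) * exp (2 * x))" using h0 j1 x
     by (simp add: \<eta>_def power_mult_distrib power_divide power_add power_mult[symmetric] exp_double[symmetric] mult_ac power2_eq_square[of x])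
    also have "... \<le> M^2 * j1 * (4 * j1 / h0) ^ (2 * J) * (fact (2 * J + 2) * exp ((2 + 1) * x))"
     using x j1 h0 by (intro mult_left_mono pow_exp_bound) auto
    finally have "P \<le> A1 * exp (3 * x)" by (simp add: A1_def mult.assoc)
    moreover have "exp (Cs * (real m + 1)) \<le> exp (2 * Cs * x)"
     using m x Cs by (simp add: mult.commute[of Cs] mult.assoc[symmetric])
    ultimately have "P * exp (Cs * (real m + 1)) \<le> (A1 * exp (3 * x)) * exp (2 * Cs * x)"
     using A1 by (intro mult_mono) auto
    then show "P * exp (Cs * (real m + 1)) \<le> Q"
     by (simp add: Q_def A2_def mult.assoc mult_exp_exp distrib_right)
   qed (auto intro!: sum_nonneg add_nonneg_nonneg En0 mult_nonneg_nonneg \<phi>0 simp: e_def)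
   finally show ?thesis .
  qed
  have pt: "\<phi> (t0 + \<sigma>) \<le> (\<Sum>k\<le>J. Q * 2 * En (t + k * \<eta>)) + (Q * (4 * pi * j1) + 1) * (e * \<phi> t0)"
   if t: "t0 + \<sigma> / 2 \<le> t" "t \<le> t0 + 3 * \<sigma> / 4" for t
  proof -
   have tp: "0 \<le> t" using t t0 \<sigma> by simp
   have "nsq (b n (t0 + \<sigma>)) \<le> nsq (b n t)" if "n \<in> S" for n
   proof -
    have "nsq (b n (t + (t0 + \<sigma> - t))) \<le> exp (- ((of_int n)^2 * (t0 + \<sigma> - t))) * nsq (b n t)"
     using that t tp \<sigma> by (intro bdec) auto
    also have "... \<le> 1 * nsq (b n t)" using t \<sigma> by (intro mult_right_mono) auto
    finally show ?thesis by simp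
   qed
   then have 1: "(\<Sum>n\<in>L. nsq (b n (t0 + \<sigma>))) \<le> (\<Sum>n\<in>L. nsq (b n t))"
    using LS by (intro sum_mono) auto
   have 2: "\<phi> (t0 + \<sigma>) = (\<Sum>n\<in>L. nsq (b n (t0 + \<sigma>))) + (\<Sum>n\<in>H. nsq (b n (t0 + \<sigma>)))"
    unfolding \<phi>_def H_def using fin LS by (subst sum.subset_diff[OF LS fin]) simp
   have "\<phi> (t0 + \<sigma>) \<le> Q * (\<Sum>k\<le>J. 2 * En (t + k * \<eta>) + 4 * pi * (e * \<phi> t0)) + e * \<phi> t0"
    unfolding 2 using 1 lowb[OF t(1)] highsum[of "t0 + \<sigma>"] \<sigma> by simp
   also have "... = (\<Sum>k\<le>J. Q * 2 * En (t + k * \<eta>)) + (Q * (4 * pi * j1) + 1) * (e * \<phi> t0)"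
    by (simp add: sum.distrib sum_distrib_left algebra_simps j1_def)
   finally show ?thesis .
  qed
  define I where "I = integral {t0..t0 + \<sigma>} En"
  have intE: "En integrable_on {u..v}" for u v
   by (intro integrable_continuous_real continuous_on_subset[OF contE]) auto
  have intEs: "(\<lambda>t. Q * 2 * En (t + k * \<eta>)) integrable_on {u..v}" for u v k
   by (intro integrable_continuous_real continuous_intros continuous_on_compose2[OF contE]) auto
  have I0: "0 \<le> I" unfolding I_def by (intro integral_nonneg intE En0)
  have shiftI: "integral {t0 + \<sigma> / 2..t0 + 3 * \<sigma> / 4} (\<lambda>t. En (t + k * \<eta>)) \<le> I" if "k \<le> J" for k
  proof -
   have "integral {t0 + \<sigma> / 2..t0 + 3 * \<sigma> / 4} (\<lambda>t. En (t + k * \<eta>)) =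
     integral {t0 + \<sigma> / 2 + k * \<eta>..t0 + 3 * \<sigma> / 4 + k * \<eta>} En"
    using integral_shift_real_ivl[of "t0 + \<sigma> / 2 + k * \<eta>" "k * \<eta>" "t0 + 3 * \<sigma> / 4 + k * \<eta>" En]
    by (simp only: add_diff_cancel_right')
   also have "... \<le> I" unfolding I_def
   proof (intro integral_subset_le intE)
    have "t0 + 3 * \<sigma> / 4 + k * \<eta> \<le> t0 + \<sigma>" using \<eta>J[OF that] \<sigma> by simp
    moreover have "0 \<le> real k * \<eta>" using \<eta> by simp
    ultimately show "{t0 + \<sigma> / 2 + k * \<eta>..t0 + 3 * \<sigma> / 4 + k * \<eta>} \<subseteq> {t0..t0 + \<sigma>}"
     using \<sigma> by auto
   qed (use En0 in auto)
   finally show ?thesis .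
  qed
  \<comment> \<open>\<open>t\<close> runs over the third quarter of the interval, so that samples
    taken up to \<open>\<sigma> / 4\<close> later stay inside it. The average brings in
    \<open>4 / \<sigma>\<close>, which the exponential absorbs since
    \<open>1 / \<sigma> \<le> x\<close>.\<close>
  have "integral {t0 + \<sigma> / 2..t0 + 3 * \<sigma> / 4} (\<lambda>t. \<phi> (t0 + \<sigma>)) \<le>
    integral {t0 + \<sigma> / 2..t0 + 3 * \<sigma> / 4} (\<lambda>t. (\<Sum>k\<le>J. Q * 2 * En (t + k * \<eta>)) + (Q * (4 * pi * j1) + 1) * (e * \<phi> t0))"
   using intEs by (intro integral_le integrable_add integrable_sum integrable_const_ivl pt) auto
  also have "... = (\<Sum>k\<le>J. Q * 2 * integral {t0 + \<sigma> / 2..t0 + 3 * \<sigma> / 4} (\<lambda>t. En (t + k * \<eta>))) +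
    \<sigma> / 4 * ((Q * (4 * pi * j1) + 1) * (e * \<phi> t0))" using intEs \<sigma>
   by (subst Henstock_Kurzweil_Integration.integral_add) (auto intro!: integrable_sum simp: Henstock_Kurzweil_Integration.integral_sum)
  also have "(\<Sum>k\<le>J. Q * 2 * integral {t0 + \<sigma> / 2..t0 + 3 * \<sigma> / 4} (\<lambda>t. En (t + k * \<eta>))) \<le> (\<Sum>k\<le>J. Q * 2 * I)"
   using Q0 by (intro sum_mono mult_left_mono shiftI) auto
  also have "... = j1 * (Q * 2 * I)" by (simp add: j1_def)
  also have "integral {t0 + \<sigma> / 2..t0 + 3 * \<sigma> / 4} (\<lambda>t. \<phi> (t0 + \<sigma>)) = \<sigma> / 4 * \<phi> (t0 + \<sigma>)"
   using \<sigma> by simp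
  finally have "\<sigma> / 4 * \<phi> (t0 + \<sigma>) \<le> \<sigma> / 4 * (4 / \<sigma> * (j1 * (Q * 2 * I)) + (Q * (4 * pi * j1) + 1) * (e * \<phi> t0))"
   using \<sigma> by (simp add: distrib_left mult.commute mult.left_commute)
  then have main: "\<phi> (t0 + \<sigma>) \<le> 4 / \<sigma> * (j1 * (Q * 2 * I)) + (Q * (4 * pi * j1) + 1) * (e * \<phi> t0)"
   using \<sigma> by (subst (asm) mult_le_cancel_left_pos) auto
  have "4 / \<sigma> * (j1 * (Q * 2 * I)) = (8 * j1 * A1) * (1 / \<sigma>) * exp (A2 * x) * I"
   by (simp add: Q_def)
  also have "... \<le> A * exp x * exp (A2 * x) * I"
  proof -
   have "1 / \<sigma> \<le> exp x" using x exp_ge_add_one_self[of x] by linarith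
   then show ?thesis using A A1 j1 I0 \<sigma> by (intro mult_right_mono mult_mono) auto
  qed
  also have "... = A * exp ((A2 + 1) * x) * I" by (simp add: mult_exp_exp algebra_simps)
  also have "... \<le> A * exp (A * x) * I"
   using A I0 x by (intro mult_right_mono mult_left_mono) (auto intro!: mult_right_mono)
  finally have 1: "4 / \<sigma> * (j1 * (Q * 2 * I)) \<le> A * exp (A * x) * I" .
  have "Q * (4 * pi * j1) + 1 \<le> (4 * pi * j1 * A1 + 1) * exp (A2 * x)"
  proof -
   have "1 \<le> exp (A2 * x)" using A2 x by simp
   then show ?thesis by (simp add: Q_def algebra_simps)
  qed
  also have "... \<le> A * exp (A * x)"
   using A A2 x j1 A1 by (intro mult_mono) (auto intro!: mult_right_mono add_nonneg_nonneg)
  finally have "(Q * (4 * pi * j1) + 1) * (e * \<phi> t0) \<le> (A * exp (A * x)) * (e * \<phi> t0)"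
   using \<phi>0 by (intro mult_right_mono) (auto simp: e_def)
  also have "... = A * exp (A * x - K^2 / (2 * \<sigma>)) * \<phi> t0"
  proof -
   have "exp (A * x) * e = exp (A * x - K^2 / (2 * \<sigma>))" by (simp add: e_def mult_exp_exp)
   then show ?thesis by (simp only: mult.assoc[symmetric]) (simp only: mult.assoc)
  qed
  finally have "\<phi> (t0 + \<sigma>) \<le> A * exp (A * x) * I + A * exp (A * x - K^2 / (2 * \<sigma>)) * \<phi> t0"
   using main 1 by linarith
  then show "(\<Sum>n\<in>S. nsq (b n (t0 + \<sigma>))) \<le>
    A * exp (A * K / \<sigma>) * integral {t0..t0 + \<sigma>} (\<lambda>t. energy X S (\<lambda>n. y n t)) +
    A * exp (A * K / \<sigma> - K^2 / (2 * \<sigma>)) * (\<Sum>n\<in>S. nsq (b n t0))"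
   by (simp add: \<phi>_def I_def En_def[abs_def] x_def)
 qed
qed

text \<open>With the weight \<open>w(\<sigma>) = e\<^sup>-\<^sup>A\<^sup>K\<^sup>/\<^sup>\<sigma>\<close> and \<open>K\<close> large, the one-step estimates on the intervals
 \<open>[\<delta> 2\<^sup>-\<^sup>j\<^sup>-\<^sup>1, \<delta> 2\<^sup>-\<^sup>j]\<close> telescope.\<close>

lemma lebeau_robbiano:
 fixes h0 M \<delta> :: real and J :: nat
 assumes h0: "0 < h0" "h0 \<le> 1" and M: "0 < M" and \<delta>: "0 < \<delta>" "\<delta> \<le> 1"
 obtains C2 where "0 < C2"
  "\<And>S (b :: int => real => complex^'q) (y :: int => real => complex^'p).
   parabolic_output h0 M J S b y ==>
   (\<Sum>n\<in>S. nsq (b n \<delta>)) \<le> C2 * integral {0..\<delta>} (\<lambda>t. energy X S (\<lambda>n. y n t))"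
proof -
 obtain A where A: "1 \<le> A" and step:
  "\<And>S (b :: int => real => complex^'q) (y :: int => real => complex^'p) K \<sigma> t0.
   parabolic_output h0 M J S b y ==>
   1 \<le> K ==> 0 < \<sigma> ==> \<sigma> \<le> 1 ==> 0 \<le> t0 ==>
   (\<Sum>n\<in>S. nsq (b n (t0 + \<sigma>))) \<le>
    A * exp (A * K / \<sigma>) * integral {t0..t0 + \<sigma>} (\<lambda>t. energy X S (\<lambda>n. y n t)) +
    A * exp (A * K / \<sigma> - K^2 / (2 * \<sigma>)) * (\<Sum>n\<in>S. nsq (b n t0))"
  using lebeau_robbiano_step[OF h0 M, of J] by blast
 \<comment> \<open>With this value \<open>K^2 / 2 - 2 * A * K = K\<close>, so the dissipation beats
   both the constant \<open>A\<close> and the weight of the interval half as long.\<close>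
 define K where "K = 4 * A + 2"
 have K: "1 \<le> K" using A by (simp add: K_def)
 define w where "w = (\<lambda>\<sigma>. exp (- (A * K / \<sigma>)))"
 define C2 where "C2 = A / w (\<delta> / 2)"
 have C2: "0 < C2" using A by (simp add: C2_def w_def)
 show ?thesis
 proof (rule that[OF C2])
  fix S and b :: "int => real => complex^'q" and y :: "int => real => complex^'p"
  assume po: "parabolic_output h0 M J S b y"
  have diss: "\<And>n s t. n \<in> S ==> 0 \<le> s ==> 0 \<le> t ==> norm (b n (t + s)) \<le> exp (- ((of_int n)^2 * s / 2)) * norm (b n t)"
   and cont: "\<And>n. n \<in> S ==> continuous_on UNIV (y n)"
   using po by (auto simp: parabolic_output_def)
  define \<phi> where "\<phi> = (\<lambda>t. \<Sum>n\<in>S. nsq (b n t))"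
  define En where "En = (\<lambda>t. energy X S (\<lambda>n. y n t))"
  have \<phi>0: "0 \<le> \<phi> t" for t by (simp add: \<phi>_def sum_nonneg)
  have intE: "En integrable_on {u..v}" for u v unfolding En_def using cont
   by (intro integrable_continuous_real continuous_intros) (auto intro: continuous_on_subset)
  have En0: "0 \<le> En t" for t by (simp add: En_def energy_nonneg)
  have one: "w \<sigma> * \<phi> (t0 + \<sigma>) \<le> A * integral {t0..t0 + \<sigma>} En + w (\<sigma> / 2) * \<phi> t0"
   if \<sigma>: "0 < \<sigma>" "\<sigma> \<le> 1" and t0: "0 \<le> t0" for \<sigma> t0
  proof -
   have "\<phi> (t0 + \<sigma>) \<le> A * exp (A * K / \<sigma>) * integral {t0..t0 + \<sigma>} En + A * exp (A * K / \<sigma> - K^2 / (2 * \<sigma>)) * \<phi> t0"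
    unfolding \<phi>_def En_def by (rule step[OF po K \<sigma> t0])
   then have "w \<sigma> * \<phi> (t0 + \<sigma>) \<le> w \<sigma> * (A * exp (A * K / \<sigma>) * integral {t0..t0 + \<sigma>} En + A * exp (A * K / \<sigma> - K^2 / (2 * \<sigma>)) * \<phi> t0)"
    by (intro mult_left_mono) (auto simp: w_def)
   also have "... = A * integral {t0..t0 + \<sigma>} En + A * exp (- (K^2 / (2 * \<sigma>))) * \<phi> t0"
   proof -
    have e: "w \<sigma> * exp (A * K / \<sigma>) = 1" "w \<sigma> * exp (A * K / \<sigma> - K^2 / (2 * \<sigma>)) = exp (- (K^2 / (2 * \<sigma>)))"
     by (simp_all add: w_def mult_exp_exp)
    have "u * (A * v * i + A * v' * p) = A * i + A * v'' * p" if "u * v = 1" "u * v' = v''" for u v v' v'' i p :: real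
    proof -
     have "u * (A * v * i + A * v' * p) = (u * v) * (A * i) + (u * v') * (A * p)" by (simp add: distrib_left)
     then show ?thesis by (simp add: that)
    qed
    from this[OF e] show ?thesis .
   qed
   also have "A * exp (- (K^2 / (2 * \<sigma>))) * \<phi> t0 \<le> w (\<sigma> / 2) * \<phi> t0"
   proof (rule mult_right_mono)
    have "A \<le> exp A" using exp_ge_add_one_self[of A] by linarith
    then have "A * exp (- (K^2 / (2 * \<sigma>))) \<le> exp A * exp (- (K^2 / (2 * \<sigma>)))" by (intro mult_right_mono) auto
    also have "... = exp (A - K^2 / (2 * \<sigma>))" by (simp add: mult_exp_exp)
    also have "... \<le> exp (- (A * K / (\<sigma> / 2)))"
    proof -
     have "A * \<sigma> \<le> A * 1" using A \<sigma> by (intro mult_left_mono) auto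
     also have "A * 1 \<le> K" using A by (simp add: K_def)
     also have "K = K^2 / 2 - 2 * A * K" by (simp add: K_def power2_eq_square algebra_simps)
     finally have "A * \<sigma> + 2 * A * K \<le> K^2 / 2" by simp
     then have "(A * \<sigma> + 2 * A * K) / \<sigma> \<le> (K^2 / 2) / \<sigma>" using \<sigma> by (intro divide_right_mono) auto
     moreover have "(A * \<sigma> + 2 * A * K) / \<sigma> = A + A * K / (\<sigma> / 2)"
      using \<sigma> by (simp add: add_divide_distrib)
     moreover have "(K^2 / 2) / \<sigma> = K^2 / (2 * \<sigma>)" by simp
     ultimately have "A + A * K / (\<sigma> / 2) \<le> K^2 / (2 * \<sigma>)" by (simp only:)
     then show ?thesis by (subst exp_le_cancel_iff) linarith
    qed
    finally show "A * exp (- (K^2 / (2 * \<sigma>))) \<le> w (\<sigma> / 2)" by (simp add: w_def)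
   qed (rule \<phi>0)
   finally show ?thesis by simp
  qed
  have tel: "w (\<delta> / 2) * \<phi> \<delta> \<le> A * integral {\<delta> / 2 ^ j..\<delta>} En + w (\<delta> / 2 ^ Suc j) * \<phi> (\<delta> / 2 ^ j)" for j
  proof (induction j)
   case (Suc j)
   define s where "s = \<delta> / 2 ^ Suc j"
   have s: "0 < s" "s \<le> 1" "s + s = \<delta> / 2 ^ j"
   proof -
    have "(1::real) \<le> 2 ^ Suc j" by (rule one_le_power) simp
    then have "\<delta> \<le> 2 ^ Suc j" using \<delta> by linarith
    then show "0 < s" "s \<le> 1" "s + s = \<delta> / 2 ^ j" using \<delta> by (auto simp: s_def divide_le_eq)
   qed
   have sd: "s + s \<le> \<delta>" using \<delta> by (simp add: s(3) divide_le_eq mult_le_cancel_left1)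
   have "w s * \<phi> (s + s) \<le> A * integral {s..s + s} En + w (s / 2) * \<phi> s"
    using s by (intro one) auto
   then have "w (\<delta> / 2) * \<phi> \<delta> \<le> A * (integral {s..s + s} En + integral {s + s..\<delta>} En) + w (s / 2) * \<phi> s"
    using Suc s by (simp add: s_def distrib_left)
   also have "integral {s..s + s} En + integral {s + s..\<delta>} En = integral {s..\<delta>} En"
    using s sd intE by (intro Henstock_Kurzweil_Integration.integral_combine) auto
   finally show ?case by (simp add: s_def)
  qed simp
  have bound: "w (\<delta> / 2) * \<phi> \<delta> \<le> A * integral {0..\<delta>} En + w (\<delta> / 2 ^ Suc j) * \<phi> 0" for j
  proof -
   have "\<phi> (\<delta> / 2 ^ j) \<le> \<phi> 0" unfolding \<phi>_def
   proof (intro sum_mono power_mono)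
    fix n assume n: "n \<in> S"
    have "norm (b n (0 + \<delta> / 2 ^ j)) \<le> exp (- ((of_int n)^2 * (\<delta> / 2 ^ j) / 2)) * norm (b n 0)"
     using \<delta> n by (intro diss) auto
    also have "... \<le> 1 * norm (b n 0)" using \<delta> by (intro mult_right_mono) auto
    finally show "norm (b n (\<delta> / 2 ^ j)) \<le> norm (b n 0)" by simp
   qed auto
   moreover have "integral {\<delta> / 2 ^ j..\<delta>} En \<le> integral {0..\<delta>} En"
    using \<delta> En0 by (intro integral_subset_le intE) auto
   ultimately have "A * integral {\<delta> / 2 ^ j..\<delta>} En + w (\<delta> / 2 ^ Suc j) * \<phi> (\<delta> / 2 ^ j) \<le>
     A * integral {0..\<delta>} En + w (\<delta> / 2 ^ Suc j) * \<phi> 0"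
    using A by (intro add_mono mult_left_mono) (auto simp: w_def)
   with tel[of j] show ?thesis by (rule order.trans)
  qed
  \<comment> \<open>The state near time 0 is only known to be bounded by the initial one, but its
    weight tends to zero.\<close>
  have "(\<lambda>j. w (\<delta> / 2 ^ Suc j)) \<longlonglongrightarrow> 0"
  proof (rule tendsto_sandwich[of "\<lambda>_. 0" _ _ "\<lambda>j. (1 / 2) ^ j"])
   show "\<forall>\<^sub>F j in sequentially. w (\<delta> / 2 ^ Suc j) \<le> (1 / 2) ^ j"
   proof (intro always_eventually allI)
    fix j
    have "(2::real) ^ j \<le> A * K / (\<delta> / 2 ^ Suc j)"
    proof -
     have "1 * 1 \<le> A * K" using A K by (intro mult_mono) auto
     then have "1 \<le> A * K / \<delta>" using \<delta> by (simp add: le_divide_eq)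
     then have "2 ^ j * 1 \<le> 2 ^ Suc j * (A * K / \<delta>)" by (intro mult_mono) auto
     then show ?thesis by (simp add: mult_ac)
    qed
    then have "2 ^ j \<le> exp (A * K / (\<delta> / 2 ^ Suc j))"
     using exp_ge_add_one_self[of "A * K / (\<delta> / 2 ^ Suc j)"] by linarith
    then have "inverse (exp (A * K / (\<delta> / 2 ^ Suc j))) \<le> inverse (2 ^ j)" by (intro le_imp_inverse_le) auto
    then show "w (\<delta> / 2 ^ Suc j) \<le> (1 / 2) ^ j"
     by (simp only: w_def exp_minus power_one_over inverse_eq_divide)
   qed
  qed (auto simp: w_def intro!: LIMSEQ_realpow_zero)
  then have "(\<lambda>j. A * integral {0..\<delta>} En + w (\<delta> / 2 ^ Suc j) * \<phi> 0) \<longlonglongrightarrow> A * integral {0..\<delta>} En + 0 * \<phi> 0"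
   by (intro tendsto_intros)
  then have "w (\<delta> / 2) * \<phi> \<delta> \<le> A * integral {0..\<delta>} En + 0 * \<phi> 0"
   by (rule LIMSEQ_le_const) (use bound in auto)
  then have "\<phi> \<delta> \<le> C2 * integral {0..\<delta>} En" by (simp add: C2_def w_def field_simps)
  then show "(\<Sum>n\<in>S. nsq (b n \<delta>)) \<le> C2 * integral {0..\<delta>} (\<lambda>t. energy X S (\<lambda>n. y n t))"
   by (simp add: \<phi>_def En_def[abs_def])
 qed
qed

end

text \<open>Kalman bounds are insensitive to the sign of \<open>D\<close>, which allows negative
  frequencies to be treated with positive sampling steps.\<close>

lemma matrix_power_uminus_vector: "norm (C *v (matrix_power (- D) j *v c)) = norm (C *v (matrix_power D j *v c))"
 for C :: "complex^'n^'m"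
proof -
 have neg: "(- M) *v x = - (M *v x)" "M *v (- x) = - (M *v x)" for M :: "complex^'k^'l" and x
  by (simp_all add: bounded_bilinear.minus_left[OF bounded_bilinear_matrix_vector]
    bounded_bilinear.minus_right[OF bounded_bilinear_matrix_vector])
 have "matrix_power (- D) j *v c = (- 1) ^ j *R (matrix_power D j *v c)"
 proof (induction j)
  case (Suc j)
  then show ?case by (simp only: matrix_power_vector_Suc neg matrix_scaleR_right) simp
 qed simp
 then show ?thesis by (simp add: matrix_scaleR_right)
qed

locale coupled_modes_observed = coupled_modes A K B C E D + obs_set_interior X
 for A K :: "complex^'p^'p" and B :: "complex^'q^'p" and C E :: "complex^'p^'q" and D :: "complex^'q^'q"
  and X :: "real set"
begin

abbreviation parabolic_gen :: "int => complex^'q^'q => complex^'q^'q"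
 where "parabolic_gen n Z \<equiv> of_int n *R D + Z - (of_int n)^2 *R mat 1"

text \<open>For large \<open>n\<close> the terms of lower order have norm at most
  \<open>n^2 / 2\<close>, so half of the dissipation survives.\<close>

lemma parabolic_decay:
 assumes Z: "norm Z \<le> c" and n: "2 * (norm D + c) \<le> absr n" "1 \<le> absr n" and s: "0 \<le> s"
 shows "norm (matrix_exp (s *R parabolic_gen n Z) *v x) \<le> exp (- ((of_int n)^2 * s / 2)) * norm x"
proof -
 have c: "0 \<le> c" using Z norm_ge_zero order_trans by blast
 let ?r = "absr n"
 have "norm (of_int n *R D + Z) \<le> ?r * norm D + c"
  using norm_triangle_ineq[of "of_int n *R D" Z] Z by simp
 also have "... \<le> ?r * norm D + ?r * c" using n c by (simp add: mult_le_cancel_right1)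
 also have "... = ?r * (norm D + c)" by (simp add: distrib_left)
 also have "... \<le> ?r * (?r / 2)" using n by (intro mult_left_mono) auto
 finally have m: "norm (of_int n *R D + Z) \<le> (of_int n)^2 / 2" by (simp add: power2_eq_square)
 have "norm (matrix_exp (s *R parabolic_gen n Z) *v x) \<le>
   exp (- ((of_int n)^2) * s) * (exp (s * norm (of_int n *R D + Z)) * norm x)"
  using norm_matrix_exp_scaleR_le[of s "of_int n *R D + Z" x] s by (simp add: matrix_exp_diff_scalar)
 also have "... \<le> exp (- ((of_int n)^2) * s) * (exp (s * ((of_int n)^2 / 2)) * norm x)"
  using mult_left_mono[OF m s] by (intro mult_left_mono mult_right_mono) (auto simp only: exp_le_cancel_iff exp_ge_zero norm_ge_zero)
 also have "... = exp (- ((of_int n)^2 * s / 2)) * norm x" by (simp add: mult.assoc[symmetric] mult_exp_exp)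
 finally show ?thesis .
qed

text \<open>In the time unit \<open>1 / \<bar>n\<bar>\<close> the generator of a heat mode, freed of
  its scalar part, is \<open>D + Z / n\<close> up to sign, and the output matrix multiplied by
  \<open>- n\<close> is \<open>- n \<Psi>\<close>. They are close to \<open>D\<close> and
  \<open>B\<close>, so sampled observability holds uniformly in \<open>n\<close> and the
  Lebeau-Robbiano iteration applies.\<close>

lemma parabolic_observability:
 assumes k: "0 < \<kappa>" and K: "\<And>c. \<kappa> * norm c \<le> (\<Sum>j\<le>J. norm (B *v (matrix_power D j *v c)))"
  and c: "0 < c" and \<delta>: "0 < \<delta>" "\<delta> \<le> 1"
 obtains C2 N :: real where "0 < C2" "0 < N"
  "\<And>S \<Theta> \<Psi> R Z b. finite S ==> (\<And>n. n \<in> S ==> N \<le> absr n) ==>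
   (\<And>n. n \<in> S ==> decoupled c n (\<Theta> n) (\<Psi> n) (R n) (Z n)) ==>
   (\<Sum>n\<in>S. nsq (matrix_exp (\<delta> *R parabolic_gen n (Z n)) *v b n)) \<le>
    C2 * integral {0..\<delta>} (\<lambda>t. energy X S (\<lambda>n. \<Psi> n *v (matrix_exp (t *R parabolic_gen n (Z n)) *v b n)))"
proof -
 obtain \<epsilon>1 h1 M1 where s1: "0 < \<epsilon>1" "0 < h1" "h1 \<le> 1" "0 < M1"
  "\<And>A C h c. norm (A - D) < \<epsilon>1 ==> norm (C - B) < \<epsilon>1 ==> 0 < h ==> h \<le> h1 ==>
   norm c \<le> M1 / h ^ J * (\<Sum>k\<le>J. norm (C *v (matrix_exp ((real k * h) *R A) *v c)))"
  using sampled_observability[OF k K] by metis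
 \<comment> \<open>The second application, with \<open>- D\<close>, serves the negative
   frequencies.\<close>
 have K': "\<kappa> * norm c \<le> (\<Sum>j\<le>J. norm (B *v (matrix_power (- D) j *v c)))" for c
  using K[of c] by (simp add: matrix_power_uminus_vector)
 obtain \<epsilon>2 h2 M2 where s2: "0 < \<epsilon>2" "0 < h2" "h2 \<le> 1" "0 < M2"
  "\<And>A C h c. norm (A - (- D)) < \<epsilon>2 ==> norm (C - B) < \<epsilon>2 ==> 0 < h ==> h \<le> h2 ==>
   norm c \<le> M2 / h ^ J * (\<Sum>k\<le>J. norm (C *v (matrix_exp ((real k * h) *R A) *v c)))"
  using sampled_observability[OF k K'] by metis
 define \<epsilon> where "\<epsilon> = min \<epsilon>1 \<epsilon>2"
 define h0 where "h0 = min h1 h2"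
 define M where "M = max M1 M2"
 have e: "0 < \<epsilon>" and h0: "0 < h0" "h0 \<le> 1" and M: "0 < M"
  using s1 s2 by (auto simp: \<epsilon>_def h0_def M_def)
 obtain C2 where C2: "0 < C2" and LR:
  "\<And>S (b :: int => real => complex^'q) (y :: int => real => complex^'p). parabolic_output h0 M J S b y ==>
   (\<Sum>n\<in>S. nsq (b n \<delta>)) \<le> C2 * integral {0..\<delta>} (\<lambda>t. energy X S (\<lambda>n. y n t))"
  using lebeau_robbiano[OF h0 M \<delta>, of J] by blast
 \<comment> \<open>Beyond \<open>N\<close> the perturbation \<open>c / \<bar>n\<bar>\<close> is
   below \<open>\<epsilon>\<close> and at most 1, and \<open>parabolic_decay\<close> is
   available.\<close>
 define N where "N = 1 + 2 * (c / \<epsilon>) + c + 2 * (norm D + c)"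
 have N: "1 \<le> N" "c / \<epsilon> < N" "c \<le> N" "2 * (norm D + c) \<le> N"
 proof -
  have "0 \<le> c / \<epsilon>" using c e by simp
  then show "1 \<le> N" "c / \<epsilon> < N" "c \<le> N" "2 * (norm D + c) \<le> N"
   using c norm_ge_zero[of D] unfolding N_def distrib_left by linarith+
 qed
 show ?thesis
 proof (rule that[OF C2, of N])
  show "0 < N" using N by simp
  fix S \<Theta> \<Psi> R Z b
  assume fin: "finite S" and n: "\<And>n. n \<in> S ==> N \<le> absr n"
   and dec: "\<And>n. n \<in> S ==> decoupled c n (\<Theta> n) (\<Psi> n) (R n) (Z n)"
  define bt where "bt = (\<lambda>n t. matrix_exp (t *R parabolic_gen n (Z n)) *v b n)"
  define y where "y = (\<lambda>n t. \<Psi> n *v bt n t)"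
  have "parabolic_output h0 M J S bt y" unfolding parabolic_output_def
  proof (intro conjI ballI allI impI fin)
   fix n assume nS: "n \<in> S"
   let ?r = "of_int n :: real"
   have r: "N \<le> \<bar>?r\<bar>" "1 \<le> \<bar>?r\<bar>" using n[OF nS] N by auto
   then show "n \<noteq> 0" by auto
   show "continuous_on UNIV (y n)" unfolding y_def bt_def
    by (intro continuous_on_matrix_vector continuous_intros)
   have d: "norm (\<Psi> n) \<le> c / \<bar>?r\<bar>" "norm (Z n) \<le> c" "norm (?r *R \<Psi> n + B) \<le> c / \<bar>?r\<bar>"
    using dec[OF nS] by (auto simp: decoupled_def)
   have small: "c / \<bar>?r\<bar> < \<epsilon>" "c / \<bar>?r\<bar> \<le> 1"
   proof -
    have "c / \<epsilon> < \<bar>?r\<bar>" "c \<le> \<bar>?r\<bar>" "0 < \<bar>?r\<bar>" using r N by auto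
    then show "c / \<bar>?r\<bar> < \<epsilon>" "c / \<bar>?r\<bar> \<le> 1" using e by (auto simp: divide_less_eq mult.commute)
   qed
   show "norm (y n t) \<le> norm (bt n t)" for t
   proof -
    have "norm (y n t) \<le> norm (\<Psi> n) * norm (bt n t)" unfolding y_def by (rule norm_matrix_vector_le)
    also have "... \<le> 1 * norm (bt n t)" using d small by (intro mult_right_mono) auto
    finally show ?thesis by simp
   qed
   show "norm (bt n (t + s)) \<le> exp (- (?r^2 * s / 2)) * norm (bt n t)" if "0 \<le> s" for s t
   proof -
    have "bt n (t + s) = matrix_exp (s *R parabolic_gen n (Z n)) *v bt n t"
     unfolding bt_def using matrix_exp_add_vector[of s t "parabolic_gen n (Z n)" "b n"] by (simp add: add.commute)
    then show ?thesis using parabolic_decay[OF d(2) _ r(2) that] r N by simp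
   qed
   fix t \<eta> assume \<eta>: "0 < \<eta>" "\<bar>?r\<bar> * \<eta> \<le> h0"
   define h where "h = \<bar>?r\<bar> * \<eta>"
   have h: "0 < h" "h \<le> h0" using \<eta> r by (auto simp: h_def)
   define W where "W = ?r *R D + Z n"
   define v where "v = matrix_exp (t *R W) *v b n"
   define C' where "C' = - ?r *R \<Psi> n"
   have C': "norm (C' - B) < \<epsilon>"
   proof -
    have "C' - B = - (?r *R \<Psi> n + B)" by (simp add: C'_def)
    then have "norm (C' - B) = norm (?r *R \<Psi> n + B)" by (metis norm_minus_cancel)
    with d small show ?thesis by simp
   qed
   have bt: "bt n s = exp (- (?r^2) * s) *R (matrix_exp (s *R W) *v b n)" for s
    by (simp add: bt_def W_def matrix_exp_diff_scalar)
   have Zr: "norm ((1 / ?r) *R Z n) < \<epsilon>"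
   proof -
    have "norm ((1 / ?r) *R Z n) \<le> c / \<bar>?r\<bar>" using d by (simp add: divide_right_mono)
    with small show ?thesis by linarith
   qed
   have "norm v \<le> M / h ^ J * (\<Sum>k\<le>J. norm (C' *v (matrix_exp ((real k * \<eta>) *R W) *v v)))"
   proof (cases "0 < ?r")
    case True
    have 1: "h *R (D + (1 / ?r) *R Z n) = \<eta> *R W" using True by (simp add: h_def W_def scaleR_add_right)
    have "norm v \<le> M1 / h ^ J * (\<Sum>k\<le>J. norm (C' *v (matrix_exp ((real k * h) *R (D + (1 / ?r) *R Z n)) *v v)))"
     using h C' Zr by (intro s1(5)) (auto simp: \<epsilon>_def h0_def)
    also have "... \<le> M / h ^ J * (\<Sum>k\<le>J. norm (C' *v (matrix_exp ((real k * \<eta>) *R W) *v v)))"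
     using h by (simp only: scaleR_scaleR[symmetric] 1)
      (intro mult_right_mono divide_right_mono sum_nonneg, auto simp: M_def)
    finally show ?thesis .
   next
    case False
    then have neg: "?r < 0" using r by auto
    have 1: "h *R (- (D + (1 / ?r) *R Z n)) = \<eta> *R W"
     using neg by (simp add: h_def W_def scaleR_add_right scaleR_diff_right)
    have "norm v \<le> M2 / h ^ J * (\<Sum>k\<le>J. norm (C' *v (matrix_exp ((real k * h) *R (- (D + (1 / ?r) *R Z n))) *v v)))"
     using h C' Zr by (intro s2(5)) (auto simp: \<epsilon>_def h0_def)
    also have "... \<le> M / h ^ J * (\<Sum>k\<le>J. norm (C' *v (matrix_exp ((real k * \<eta>) *R W) *v v)))"
     using h by (simp only: scaleR_scaleR[symmetric] 1)
      (intro mult_right_mono divide_right_mono sum_nonneg, auto simp: M_def)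
    finally show ?thesis .
   qed
   moreover have "norm (C' *v (matrix_exp ((real k * \<eta>) *R W) *v v)) =
     \<bar>?r\<bar> * (exp (?r^2 * t) * (exp (?r^2 * (real k * \<eta>)) * norm (y n (t + real k * \<eta>))))" for k
   proof -
    have "matrix_exp ((real k * \<eta>) *R W) *v v = matrix_exp ((t + real k * \<eta>) *R W) *v b n"
     unfolding v_def using matrix_exp_add_vector[of "real k * \<eta>" t W "b n"] by (simp add: add.commute)
    moreover have "norm (y n s) = exp (- (?r^2) * s) * norm (\<Psi> n *v (matrix_exp (s *R W) *v b n))" for s
     by (simp add: y_def bt matrix_scaleR_right)
    moreover have "exp (?r^2 * t) * (exp (?r^2 * (real k * \<eta>)) * (exp (- (?r^2) * (t + real k * \<eta>)) * z)) = z" for z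
    proof -
     have "exp u * (exp v * (exp (- (u + v)) * z)) = z" for u v :: real
      by (simp add: mult.assoc[symmetric] mult_exp_exp)
     moreover have "- (?r^2) * (t + real k * \<eta>) = - (?r^2 * t + ?r^2 * (real k * \<eta>))"
      by (simp add: distrib_left)
     ultimately show ?thesis by (simp only:)
    qed
    moreover have "norm (C' *v u) = \<bar>?r\<bar> * norm (\<Psi> n *v u)" for u
     by (simp add: C'_def matrix_scaleR_left bounded_bilinear.minus_left[OF bounded_bilinear_matrix_vector])
    ultimately show ?thesis by (simp only:)
   qed
   moreover have "norm (bt n t) = exp (- (?r^2) * t) * norm v" by (simp add: bt v_def)
   ultimately have "norm (bt n t) \<le> exp (- (?r^2) * t) * (M / h ^ J *
     (\<Sum>k\<le>J. \<bar>?r\<bar> * (exp (?r^2 * t) * (exp (?r^2 * (real k * \<eta>)) * norm (y n (t + real k * \<eta>))))))"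
    by (simp only: mult_left_mono exp_ge_zero)
   also have "... = (exp (- (?r^2) * t) * exp (?r^2 * t)) * (M * \<bar>?r\<bar> / h ^ J *
     (\<Sum>k\<le>J. exp (?r^2 * (real k * \<eta>)) * norm (y n (t + real k * \<eta>))))"
   proof -
    have "(\<Sum>k\<le>J. \<bar>?r\<bar> * (exp (?r^2 * t) * (exp (?r^2 * (real k * \<eta>)) * norm (y n (t + real k * \<eta>))))) =
     \<bar>?r\<bar> * (exp (?r^2 * t) * (\<Sum>k\<le>J. exp (?r^2 * (real k * \<eta>)) * norm (y n (t + real k * \<eta>))))"
     by (simp only: sum_distrib_left)
    then show ?thesis by simp
   qed
   also have "exp (- (?r^2) * t) * exp (?r^2 * t) = 1" by (simp add: mult_exp_exp)
   finally show "norm (bt n t) \<le> M * \<bar>?r\<bar> / (\<bar>?r\<bar> * \<eta>) ^ J *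
    (\<Sum>k\<le>J. exp (?r^2 * (real k * \<eta>)) * norm (y n (t + real k * \<eta>)))" by (simp add: h_def)
  qed
  from LR[OF this]
  show "(\<Sum>n\<in>S. nsq (matrix_exp (\<delta> *R parabolic_gen n (Z n)) *v b n)) \<le>
    C2 * integral {0..\<delta>} (\<lambda>t. energy X S (\<lambda>n. \<Psi> n *v (matrix_exp (t *R parabolic_gen n (Z n)) *v b n)))"
   by (simp add: y_def bt_def)
 qed
qed

end

section \<open>Observability of the hyperbolic part\<close>

lemma periodic_int:
 assumes "\<And>x. F (x + 2 * pi) = F x"
 shows "F (x + 2 * pi * of_int k) = F x"
proof -
 have nat: "F (x + 2 * pi * of_nat j) = F x" for j x
 proof (induction j)
  case (Suc j)
  have "F (x + 2 * pi * of_nat (Suc j)) = F ((x + 2 * pi * of_nat j) + 2 * pi)" by (simp add: algebra_simps)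
  then show ?case by (simp only: assms Suc)
 qed simp
 show ?thesis
 proof (cases "0 \<le> k")
  case True
  then show ?thesis using nat[of x "nat k"] by simp
 next
  case False
  then show ?thesis using nat[of "x + 2 * pi * of_int k" "nat (- k)"] by simp
 qed
qed

lemma periodic_integral_shift:
 fixes F :: "real => real"
 assumes m[measurable]: "F \<in> borel_measurable borel" and b: "\<And>x. \<bar>F x\<bar> \<le> B" and p: "\<And>x. F (x + 2 * pi) = F x"
 shows "(LINT x:{0..<2 * pi}|lborel. F (x + s)) = (LINT x:{0..<2 * pi}|lborel. F x)"
proof -
 have si: "set_integrable lborel {u..<v} (\<lambda>x. F (x + w))" for u v w
 proof -
  have "emeasure lborel {u..<v} < \<infinity>" by (cases "u \<le> v") auto
  then have "integrable lborel (\<lambda>x. indicator {u..<v} x *R B)"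
   by (intro integrable_scaleR_left integrable_real_indicator) auto
  then show ?thesis unfolding set_integrable_def
  proof (rule Bochner_Integration.integrable_bound)
   show "AE x in lborel. norm (indicator {u..<v} x *R F (x + w)) \<le> norm (indicator {u..<v} x *R B)"
    using b by (auto simp: indicator_def intro!: AE_I2 order.trans[OF b])
  qed simp
 qed
 have sh: "(LINT x:{u..<v}|lborel. F (x + w)) = (LINT x:{u + w..<v + w}|lborel. F x)" for u v w
 proof -
  have "(LINT x:{u + w..<v + w}|lborel. F x) = (LINT x|lborel. indicator {u + w..<v + w} (w + 1 * x) *R F (w + 1 * x))"
   unfolding set_lebesgue_integral_def by (subst lborel_integral_real_affine[of 1 _ w]) auto
  also have "... = (LINT x:{u..<v}|lborel. F (x + w))" unfolding set_lebesgue_integral_def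
   by (intro Bochner_Integration.integral_cong) (auto simp: indicator_def add.commute)
  finally show ?thesis by simp
 qed
 define k where "k = \<lfloor>s / (2 * pi)\<rfloor>"
 define a where "a = s - 2 * pi * of_int k"
 have a: "0 \<le> a" "a < 2 * pi"
  using floor_divide_lower[of "2 * pi" s] floor_divide_upper[of "2 * pi" s] by (auto simp: a_def k_def algebra_simps)
 have "F (x + s) = F (x + a)" for x using periodic_int[of F "x + a" k] p by (simp add: a_def)
 then have "(LINT x:{0..<2 * pi}|lborel. F (x + s)) = (LINT x:{0..<2 * pi}|lborel. F (x + a))" by simp
 also have "... = (LINT x:{a..<2 * pi + a}|lborel. F x)" by (simp add: sh)
 also have "... = (LINT x:{a..<2 * pi} \<union> {2 * pi..<2 * pi + a}|lborel. F x)"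
  using a by (simp add: ivl_disj_un)
 also have "... = (LINT x:{a..<2 * pi}|lborel. F x) + (LINT x:{2 * pi..<2 * pi + a}|lborel. F x)"
  using si[of _ _ 0] by (intro set_integral_Un) auto
 also have "(LINT x:{2 * pi..<2 * pi + a}|lborel. F x) = (LINT x:{0..<a}|lborel. F (x + 2 * pi))"
  by (simp add: sh add.commute)
 also have "... = (LINT x:{0..<a}|lborel. F x)" by (simp add: p)
 also have "(LINT x:{a..<2 * pi}|lborel. F x) + (LINT x:{0..<a}|lborel. F x) = (LINT x:{a..<2 * pi} \<union> {0..<a}|lborel. F x)"
  using si[of _ _ 0] by (intro set_integral_Un[symmetric]) auto
 also have "{a..<2 * pi} \<union> {0..<a} = {0..<2 * pi}" using a by auto
 finally show ?thesis .
qed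

text \<open>\<open>\<Omega>\<close> is the lift of the control region to the line, where
  characteristics are straight; its intersection with \<open>{0..<2 * pi}\<close> represents the
  region itself.\<close>

locale periodic_open =
 fixes \<Omega> :: "real set"
 assumes open_\<Omega>: "open \<Omega>" and per: "x + 2 * pi \<in> \<Omega> \<longleftrightarrow> x \<in> \<Omega>"
begin

lemma obs_set: "obs_set (\<Omega> \<inter> {0..<2 * pi})" using open_\<Omega> by unfold_locales auto

lemma tpoly_shift: "tpoly S (\<lambda>n. cis (of_int n * s) *s c n) x = tpoly S c (x + s)"
 by (simp add: tpoly_def vec.scale_scale cis_mult distrib_left)

lemma tpoly_periodic: "tpoly S c (x + 2 * pi) = tpoly S c x"
proof -
 have "cis (of_int n * (x + 2 * pi)) = cis (of_int n * x)" for n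
  using cis_multiple_2pi[of "of_int n"] by (simp add: distrib_left cis_mult[symmetric] mult.commute)
 then show ?thesis by (simp add: tpoly_def)
qed

text \<open>After a translation the energy at time \<open>t\<close> is the integral of a fixed
  density over the points \<open>x\<close> with \<open>x - \<mu> * t \<in> \<Omega>\<close>. Every
  point is hit at some time; by openness a whole neighbourhood is hit during a time interval, and by
  compactness of a period finitely many such neighbourhoods suffice.\<close>

lemma transport_observability:
 assumes t: "t1 < t2" and \<mu>: "\<mu> \<noteq> 0"
  and hit: "\<And>y. \<exists>t\<in>{t1<..<t2}. y - \<mu> * t \<in> \<Omega>"
 obtains \<theta> where "0 < \<theta>"
  "\<And>S (c :: int => complex^'k). finite S ==> \<theta> * (\<Sum>n\<in>S. nsq (c n)) \<le>
   integral {t1..t2} (\<lambda>t. energy (\<Omega> \<inter> {0..<2 * pi}) S (\<lambda>n. cis (of_int n * (\<mu> * t)) *s c n))"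
proof -
 interpret X: obs_set "\<Omega> \<inter> {0..<2 * pi}" by (rule obs_set)
 have "\<exists>r \<tau>. 0 < r \<and> \<tau> \<in> {t1<..<t2} \<and> cball \<tau> r \<subseteq> {t1<..<t2} \<and> (\<forall>z\<in>ball y r. \<forall>t\<in>cball \<tau> r. z - \<mu> * t \<in> \<Omega>)" for y
 proof -
  obtain \<tau> where \<tau>: "\<tau> \<in> {t1<..<t2}" "y - \<mu> * \<tau> \<in> \<Omega>" using hit by blast
  obtain e where e: "0 < e" "ball (y - \<mu> * \<tau>) e \<subseteq> \<Omega>" using open_\<Omega> \<tau>(2) openE by blast
  obtain d where d: "0 < d" "cball \<tau> d \<subseteq> {t1<..<t2}"
   using \<tau>(1) open_contains_cball[of "{t1<..<t2}"] open_greaterThanLessThan by metis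
  define r where "r = min d (e / (2 * (1 + \<bar>\<mu>\<bar>)))"
  have r: "0 < r" "r \<le> d" "r * (1 + \<bar>\<mu>\<bar>) < e"
  proof -
   show "0 < r" "r \<le> d" using d e by (auto simp: r_def add_pos_nonneg)
   have "r * (1 + \<bar>\<mu>\<bar>) \<le> e / (2 * (1 + \<bar>\<mu>\<bar>)) * (1 + \<bar>\<mu>\<bar>)"
    by (intro mult_right_mono) (auto simp: r_def)
   also have "... = e / 2" by (simp add: field_simps add_nonneg_eq_0_iff)
   finally show "r * (1 + \<bar>\<mu>\<bar>) < e" using e by simp
  qed
  have "z - \<mu> * t \<in> \<Omega>" if z: "z \<in> ball y r" and t: "t \<in> cball \<tau> r" for z t
  proof -
   have "\<bar>(y - \<mu> * \<tau>) - (z - \<mu> * t)\<bar> \<le> \<bar>y - z\<bar> + \<bar>\<mu>\<bar> * \<bar>t - \<tau>\<bar>"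
   proof -
    have "(y - \<mu> * \<tau>) - (z - \<mu> * t) = (y - z) + \<mu> * (t - \<tau>)" by (simp add: algebra_simps)
    then show ?thesis using abs_triangle_ineq[of "y - z" "\<mu> * (t - \<tau>)"] by (simp only: abs_mult)
   qed
   also have "... \<le> r + \<bar>\<mu>\<bar> * r"
    using z t by (intro add_mono mult_left_mono) (auto simp: dist_real_def abs_minus_commute)
   also have "... < e" using r by (simp add: algebra_simps)
   finally show ?thesis using e by (auto simp: dist_real_def)
  qed
  moreover have "cball \<tau> r \<subseteq> {t1<..<t2}" using d r by (meson order_trans subset_cball)
  ultimately show ?thesis using r \<tau> by blast
 qed
 then obtain r \<tau> where rt: "\<And>y. 0 < r y" "\<And>y. cball (\<tau> y) (r y) \<subseteq> {t1<..<t2}"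
   "\<And>y z t. z \<in> ball y (r y) ==> t \<in> cball (\<tau> y) (r y) ==> z - \<mu> * t \<in> \<Omega>"
  by metis
 obtain Y where Y: "finite Y" "{0..2 * pi} \<subseteq> (\<Union>y\<in>Y. ball y (r y))"
 proof -
  have c1: "compact {0..2 * pi}" by simp
  have c2: "{0..2 * pi} \<subseteq> (\<Union>y\<in>{0..2 * pi}. ball y (r y))" using rt(1) by auto
  show ?thesis by (rule compactE_image[OF c1 _ c2]) (auto intro: that)
 qed
 have Yne: "Y \<noteq> {}" using Y(2) by auto
 define \<rho> where "\<rho> = Min (r ` Y)"
 have \<rho>: "0 < \<rho>" "\<And>y. y \<in> Y ==> \<rho> \<le> r y" using Y(1) Yne rt(1) by (auto simp: \<rho>_def)
 \<comment> \<open>Each ball is observed for a time of at least \<open>2 * \<rho>\<close>; summing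
   over the balls uses the time integral \<open>card Y\<close> times, and \<open>2 * pi\<close> is
   Parseval's factor.\<close>
 define \<theta> where "\<theta> = 2 * \<rho> * (2 * pi) / card Y"
 have \<theta>: "0 < \<theta>" using \<rho> Y Yne by (simp add: \<theta>_def card_gt_0_iff)
 show ?thesis
 proof (rule that[OF \<theta>])
  fix S :: "int set" and c :: "int => complex^'k" assume fin: "finite S"
  define En where "En = (\<lambda>t. energy (\<Omega> \<inter> {0..<2 * pi}) S (\<lambda>n. cis (of_int n * (\<mu> * t)) *s c n))"
  define g where "g = (\<lambda>x. nsq (tpoly S c x))"
  have gm[measurable]: "g \<in> borel_measurable borel" by (simp add: g_def)
  have g0: "0 \<le> g x" for x by (simp add: g_def)
  have gb: "g x \<le> (\<Sum>n\<in>S. norm (c n))^2" for x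
   unfolding g_def by (intro power_mono norm_tpoly_le) auto
  have [measurable]: "\<Omega> \<in> sets borel" using open_\<Omega> by simp
  have gint: "set_integrable lborel U g" if [measurable]: "U \<in> sets borel" and U: "U \<subseteq> {0..<2 * pi}" for U
   using obs_set.set_integrable_norm_tpoly[OF obs_set.intro[OF that], of S c] by (simp add: g_def)
  have intE: "En integrable_on {u..v}" for u v
   unfolding En_def by (intro integrable_continuous_real continuous_intros)
  have En0: "0 \<le> En t" for t by (simp add: En_def energy_nonneg)
  have loc: "2 * \<rho> * (LINT x:{0..<2 * pi} \<inter> ball y (r y)|lborel. g x) \<le> integral {t1..t2} En" if y: "y \<in> Y" for y
  proof -
   have low: "(LINT x:{0..<2 * pi} \<inter> ball y (r y)|lborel. g x) \<le> En t" if t: "t \<in> cball (\<tau> y) (r y)" for t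
   proof -
    define F where "F = (\<lambda>x. indicator \<Omega> x * g (x + \<mu> * t))"
    have "En t = (LINT x:{0..<2 * pi}|lborel. F x)"
     unfolding En_def energy_def tpoly_shift set_lebesgue_integral_def F_def g_def
     by (intro Bochner_Integration.integral_cong) (auto simp: indicator_def)
    also have "... = (LINT x:{0..<2 * pi}|lborel. F (x + (- \<mu> * t)))"
    proof (rule periodic_integral_shift[symmetric])
     show "F \<in> borel_measurable borel" by (simp add: F_def)
     show "\<bar>F x\<bar> \<le> (\<Sum>n\<in>S. norm (c n))^2" for x
      using gb[of "x + \<mu> * t"] g0[of "x + \<mu> * t"] by (auto simp: F_def indicator_def)
     have "g (x + 2 * pi + \<mu> * t) = g (x + \<mu> * t)" for x
      using tpoly_periodic[of S c "x + \<mu> * t"] by (simp add: g_def add_ac)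
     then show "F (x + 2 * pi) = F x" for x by (simp add: F_def indicator_def per)
    qed
    also have "... = (LINT x:{0..<2 * pi}|lborel. indicator \<Omega> (x - \<mu> * t) * g x)"
     by (simp add: F_def)
    finally have 1: "En t = (LINT x:{0..<2 * pi}|lborel. indicator \<Omega> (x - \<mu> * t) * g x)" .
    have i1: "set_integrable lborel ({0..<2 * pi} \<inter> ball y (r y)) g" by (intro gint) auto
    have i2: "set_integrable lborel {0..<2 * pi} (\<lambda>x. indicator \<Omega> (x - \<mu> * t) * g x)"
    proof (rule obs_set.set_integrable_bounded[OF obs_set_full])
     show "norm (indicator \<Omega> (x - \<mu> * t) * g x) \<le> (\<Sum>n\<in>S. norm (c n))^2" for x
      using gb[of x] g0[of x] by (auto simp: indicator_def)
    qed simp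
    show ?thesis unfolding 1 set_lebesgue_integral_def
    proof (rule integral_mono)
     show "indicator ({0..<2 * pi} \<inter> ball y (r y)) x *R g x \<le> indicator {0..<2 * pi} x *R (indicator \<Omega> (x - \<mu> * t) * g x)" for x
      using rt(3)[OF _ t, of x] g0[of x] by (auto simp: indicator_def)
    qed (use i1 i2 in \<open>auto simp: set_integrable_def\<close>)
   qed
   let ?L = "LINT x:{0..<2 * pi} \<inter> ball y (r y)|lborel. g x"
   have L0: "0 \<le> ?L" unfolding set_lebesgue_integral_def using g0 by (intro integral_nonneg_AE) auto
   have sub: "{\<tau> y - r y..\<tau> y + r y} \<subseteq> {t1..t2}" using rt(2)[of y] by (auto simp: cball_eq_atLeastAtMost subset_eq less_imp_le)
   have "2 * \<rho> * ?L \<le> 2 * r y * ?L" using \<rho>(2)[OF y] L0 by (intro mult_right_mono) auto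
   also have "... = integral {\<tau> y - r y..\<tau> y + r y} (\<lambda>t. ?L)" using rt(1)[of y] by simp
   also have "... \<le> integral {\<tau> y - r y..\<tau> y + r y} En"
    using low by (intro integral_le intE) (auto simp: cball_eq_atLeastAtMost)
   also have "... \<le> integral {t1..t2} En" using sub En0 by (intro integral_subset_le intE) auto
   finally show ?thesis .
  qed
  have "2 * pi * (\<Sum>n\<in>S. nsq (c n)) = (LINT x:{0..<2 * pi}|lborel. g x)"
   using parseval_tpoly[OF fin, of c] by (simp add: energy_def g_def)
  also have "... \<le> (\<Sum>y\<in>Y. (LINT x:{0..<2 * pi} \<inter> ball y (r y)|lborel. g x))"
  proof -
   have i: "integrable lborel (\<lambda>x. indicator ({0..<2 * pi} \<inter> ball y (r y)) x *R g x)" for y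
    using gint[of "{0..<2 * pi} \<inter> ball y (r y)"] by (simp add: set_integrable_def)
   have "(LINT x:{0..<2 * pi}|lborel. g x) \<le> (LINT x|lborel. (\<Sum>y\<in>Y. indicator ({0..<2 * pi} \<inter> ball y (r y)) x *R g x))"
    unfolding set_lebesgue_integral_def
   proof (rule integral_mono)
    fix x
    show "indicator {0..<2 * pi} x *R g x \<le> (\<Sum>y\<in>Y. indicator ({0..<2 * pi} \<inter> ball y (r y)) x *R g x)"
    proof (cases "x \<in> {0..<2 * pi}")
     case True
     then obtain y where y: "y \<in> Y" "x \<in> ball y (r y)" using Y(2) by force
     have "indicator {0..<2 * pi} x *R g x = (\<Sum>y\<in>{y}. indicator ({0..<2 * pi} \<inter> ball y (r y)) x *R g x)"
      using y True by simp
     also have "... \<le> (\<Sum>y\<in>Y. indicator ({0..<2 * pi} \<inter> ball y (r y)) x *R g x)"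
      using y Y(1) g0[of x] by (intro sum_mono2) auto
     finally show ?thesis .
    qed (use g0[of x] in \<open>auto intro!: sum_nonneg\<close>)
   qed (use i gint[of "{0..<2 * pi}"] in \<open>auto simp: set_integrable_def\<close>)
   also have "... = (\<Sum>y\<in>Y. (LINT x:{0..<2 * pi} \<inter> ball y (r y)|lborel. g x))"
    unfolding set_lebesgue_integral_def using i by (intro Bochner_Integration.integral_sum) auto
   finally show ?thesis .
  qed
  finally have "2 * \<rho> * (2 * pi * (\<Sum>n\<in>S. nsq (c n))) \<le> 2 * \<rho> * (\<Sum>y\<in>Y. (LINT x:{0..<2 * pi} \<inter> ball y (r y)|lborel. g x))"
   using \<rho> by (intro mult_left_mono) auto
  also have "... \<le> (\<Sum>y\<in>Y. integral {t1..t2} En)"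
   unfolding sum_distrib_left by (intro sum_mono loc)
  also have "... = card Y * integral {t1..t2} En" by simp
  finally have "\<theta> * (\<Sum>n\<in>S. nsq (c n)) \<le> integral {t1..t2} En"
   using Y(1) Yne by (simp add: \<theta>_def field_simps card_gt_0_iff)
  then show "\<theta> * (\<Sum>n\<in>S. nsq (c n)) \<le>
   integral {t1..t2} (\<lambda>t. energy (\<Omega> \<inter> {0..<2 * pi}) S (\<lambda>n. cis (of_int n * (\<mu> * t)) *s c n))"
   by (simp add: En_def[abs_def])
 qed
qed

end

section \<open>Diagonal matrices and the normal form of the transport part\<close>

definition diagm :: "('n => complex) => complex^'n^'n"
 where "diagm f = (\<chi> i j. if i = j then f i else 0)"

lemma diagm_vector: "(diagm f *v x) $ i = f i * x $ i"
 by (simp add: diagm_def matrix_vector_mult_def if_distrib if_distribR cong: if_cong)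

lemma diagm_left: "(diagm f ** M) $ i $ j = f i * M $ i $ j"
 and diagm_right: "(N ** diagm f) $ k $ i = N $ k $ i * f i"
 by (simp_all add: diagm_def matrix_matrix_mult_def if_distrib if_distribR cong: if_cong)

lemma matrix_exp_diagm: "(matrix_exp (t *R diagm f) *v x) $ i = exp (of_real t * f i) * x $ i"
proof -
 have p: "(matrix_power (t *R diagm f) k *v x) $ i = (of_real t * f i) ^ k * x $ i" for k
  by (induction k) (simp_all only: matrix_power_vector_Suc matrix_scaleR_left, simp_all add: diagm_vector scaleR_conv_of_real[where 'a = complex])
 have "(\<lambda>k. ((matrix_power (t *R diagm f) k *v x) /\<^sub>R fact k) $ i) sums (matrix_exp (t *R diagm f) *v x) $ i"
  by (intro bounded_linear.sums[OF bounded_linear_vec_nth] sums_matrix_exp_vector)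
 moreover have "(\<lambda>k. ((matrix_power (t *R diagm f) k *v x) /\<^sub>R fact k) $ i) =
   (\<lambda>k. ((of_real t * f i) ^ k /\<^sub>R fact k) * x $ i)" by (simp add: p)
 ultimately have "(\<lambda>k. ((of_real t * f i) ^ k /\<^sub>R fact k) * x $ i) sums (matrix_exp (t *R diagm f) *v x) $ i"
  by simp
 moreover have "(\<lambda>k. ((of_real t * f i) ^ k /\<^sub>R fact k) * x $ i) sums (exp (of_real t * f i) * x $ i)"
  by (intro sums_mult2 exp_converges)
 ultimately show ?thesis by (rule sums_unique2)
qed

text \<open>The equation is solved column by column, which yields the bound on \<open>E\<close>
  without an explicit inverse of \<open>Y\<close>.\<close>

lemma near_identity_solve:
 fixes Y F :: "complex^'n^'n"
 assumes Y: "\<And>v. norm (Y *v v - v) \<le> norm v / 2"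
 obtains E where "Y ** E = F" "norm E \<le> 2 * real CARD('n) * norm F"
proof -
 have lin: "linear ((*v) Y)" by (rule bounded_linear.linear[OF bounded_linear_matrix_vector])
 have "\<exists>v. Y *v v = g \<and> norm v \<le> 2 * norm g" for g
  using near_identity_surj[OF lin Y, of g] by blast
 then obtain u where u: "\<And>g. Y *v u g = g" "\<And>g. norm (u g) \<le> 2 * norm g" by metis
 define c where "c = (\<lambda>j. F *v axis j 1)"
 define E where "E = transpose (\<chi> j. u (c j))"
 have "norm E = norm (\<chi> j. u (c j))" by (simp add: E_def norm_transpose)
 also have "... \<le> (\<Sum>j\<in>UNIV. norm (u (c j)))"
  by (subst norm_vec_def, rule order.trans[OF L2_set_le_sum]) auto
 also have "... \<le> (\<Sum>j\<in>(UNIV :: 'n set). 2 * norm F)"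
 proof (rule sum_mono)
  fix j :: 'n
  have "norm (axis j (1 :: complex)) = 1" by (simp add: norm_eq_sqrt_inner[of "axis j (1 :: complex)"] inner_axis_axis)
  then have "norm (c j) \<le> norm F" using norm_matrix_vector_le[of F "axis j 1"] by (simp add: c_def)
  with u(2)[of "c j"] show "norm (u (c j)) \<le> 2 * norm F" by simp
 qed
 finally have n: "norm E \<le> 2 * real CARD('n) * norm F" by simp
 have "(Y ** E) $ i $ j = F $ i $ j" for i j
 proof -
  have "(Y ** E) $ i $ j = (Y *v u (c j)) $ i"
   by (simp add: matrix_matrix_mult_def matrix_vector_mult_def E_def transpose_def)
  also have "... = c j $ i" by (simp only: u(1))
  also have "... = F $ i $ j" by (simp add: c_def matrix_vector_mult_def axis_def if_distrib cong: if_cong)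
  finally show ?thesis .
 qed
 then have "Y ** E = F" by (simp add: vec_eq_iff)
 with n show ?thesis by (intro that[of E])
qed

text \<open>Conjugation by \<open>1 + X / n\<close> removes from the bounded perturbation \<open>K\<close> the entries coupling
 different velocities, up to \<open>O(1 / n)\<close>; what remains commutes with the transport part.\<close>

lemma transport_normal_form:
 fixes \<mu> :: "'p::finite => real" and Q Q' K :: "complex^'p^'p"
 assumes Q: "Q ** Q' = mat 1" "Q' ** Q = mat 1" and T: "0 \<le> T" and c: "0 \<le> c"
 obtains Rb and N C3 :: real where "0 < N" "0 < C3"
  "\<And>n R a. N \<le> absr n ==> norm R \<le> c / absr n ==>
   \<exists>\<zeta>. norm \<zeta> \<le> C3 * norm a \<and> norm a \<le> C3 * norm \<zeta> \<and> (\<forall>t\<in>{0..T}.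
    norm (matrix_exp (t *R (of_int n *R (Q ** diagm (\<lambda>k. \<i> * of_real (\<mu> k)) ** Q') + K + R)) *v a -
     Q *v (matrix_exp (t *R Rb) *v (\<chi> k. cis (of_int n * (\<mu> k * t)) * \<zeta> $ k))) \<le> C3 / absr n * norm \<zeta>)"
proof -
 define Dg where "Dg = diagm (\<lambda>k. \<i> * of_real (\<mu> k))"
 define Rh where "Rh = Q' ** K ** Q"
 \<comment> \<open>Entries between equal velocities cannot be removed; kept in \<open>Rb\<close>,
   they commute with \<open>Dg\<close>. The others are divided by the velocity difference and enter
   \<open>X\<close>.\<close>
 define Rb :: "complex^'p^'p" where "Rb = (\<chi> k l. if \<mu> k = \<mu> l then Rh $ k $ l else 0)"
 define X :: "complex^'p^'p" where "X = (\<chi> k l. if \<mu> k = \<mu> l then 0 else \<i> * Rh $ k $ l / of_real (\<mu> k - \<mu> l))"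
 have comm: "Rb ** Dg = Dg ** Rb" by (simp add: vec_eq_iff Dg_def diagm_left diagm_right Rb_def)
 \<comment> \<open>The homological equation: it makes the terms of order zero in \<open>r\<close>
   agree in the conjugation by \<open>1 + X / r\<close>.\<close>
 have DX: "Dg ** X + Rh = X ** Dg + Rb"
 proof -
  have "\<i> * of_real (\<mu> k) * X $ k $ l + Rh $ k $ l = X $ k $ l * (\<i> * of_real (\<mu> l)) + Rb $ k $ l" for k l
  proof (cases "\<mu> k = \<mu> l")
   case False
   then have nz: "complex_of_real (\<mu> k - \<mu> l) \<noteq> 0" by simp
   have "X $ k $ l * (\<i> * of_real (\<mu> l)) - \<i> * of_real (\<mu> k) * X $ k $ l = - \<i> * X $ k $ l * of_real (\<mu> k - \<mu> l)"
    by (simp add: algebra_simps)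
   also have "... = Rh $ k $ l" using False nz by (simp add: X_def)
   finally show ?thesis using False by (simp add: Rb_def algebra_simps)
  qed (simp add: X_def Rb_def)
  then show ?thesis by (simp add: vec_eq_iff Dg_def diagm_left diagm_right)
 qed
 define p where "p = real CARD('p)"
 have p: "1 \<le> p" by (simp add: p_def Suc_leI)
 define c1 where "c1 = norm Rh * norm X + norm X * norm Rb + norm Q' * c * norm Q * (norm (mat 1 :: complex^'p^'p) + norm X)"
 have c1: "0 \<le> c1" using c by (simp add: c1_def)
 define c2 where "c2 = 2 * p * c1"
 have c2: "0 \<le> c2" using c1 p by (simp add: c2_def)
 define KT where "KT = exp (T * norm Rb)"
 have KT: "1 \<le> KT" using T by (simp add: KT_def)
 define e1 where "e1 = KT ^ 3 * c2 * T * exp (KT^2 * c2 * T)"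
 have e1: "0 \<le> e1" using KT c2 T by (simp add: e1_def)
 define C3 where "C3 = 1 + 2 * norm Q' + 2 * norm Q + norm Q * (norm X * (e1 + KT) + e1)"
 have C3: "0 < C3" "2 * norm Q' \<le> C3" "2 * norm Q \<le> C3" "norm Q * (norm X * (e1 + KT) + e1) \<le> C3"
 proof -
  have "0 \<le> norm Q * (norm X * (e1 + KT) + e1)" using e1 KT by simp
  then show "0 < C3" "2 * norm Q' \<le> C3" "2 * norm Q \<le> C3" "norm Q * (norm X * (e1 + KT) + e1) \<le> C3"
   by (auto simp: C3_def add_pos_nonneg)
 qed
 define N where "N = 1 + 2 * norm X"
 show ?thesis
 proof (rule that[of N C3 Rb])
  show "0 < N" by (simp add: N_def add_pos_nonneg)
  show "0 < C3" by fact
  fix n :: int and R :: "complex^'p^'p" and a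
  assume n: "N \<le> absr n" and R: "norm R \<le> c / absr n"
  define r where "r = (of_int n :: real)"
  have r: "1 \<le> \<bar>r\<bar>" "2 * norm X \<le> \<bar>r\<bar>" using n norm_ge_zero[of X] unfolding r_def N_def by linarith+
  have r0: "r \<noteq> 0" using r by auto
  define Y where "Y = mat 1 + (1 / r) *R X"
  have Yv: "Y *v v - v = (1 / r) *R (X *v v)" for v
   by (simp add: Y_def matrix_vector_mult_add_rdistrib matrix_scaleR_left)
  have Xr: "norm X / \<bar>r\<bar> \<le> 1 / 2" using r by (simp add: divide_le_eq)
  have Yd: "norm (Y *v v - v) \<le> norm X / \<bar>r\<bar> * norm v" for v
   using norm_matrix_vector_le[of X v] by (simp add: Yv divide_right_mono)
  have Y2: "norm (Y *v v - v) \<le> norm v / 2" for v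
   using order.trans[OF Yd mult_right_mono[OF Xr norm_ge_zero]] by simp
  have nY: "norm Y \<le> norm (mat 1 :: complex^'p^'p) + norm X"
  proof -
   have "norm Y \<le> norm (mat 1 :: complex^'p^'p) + norm X / \<bar>r\<bar>"
    using norm_triangle_ineq[of "mat 1 :: complex^'p^'p" "(1 / r) *R X"] by (simp add: Y_def)
   also have "norm X / \<bar>r\<bar> \<le> norm X / 1" using r by (intro divide_left_mono) auto
   finally show ?thesis by simp
  qed
  \<comment> \<open>What remains of order \<open>1 / r\<close> after the conjugation. Solving
    \<open>Y ** E = F\<close> moves it to the right of \<open>Y\<close>, where it becomes a
    perturbation of the normal form \<open>H\<close>.\<close>
  define F where "F = (1 / r) *R (Rh ** X - X ** Rb) + Q' ** R ** Q ** Y"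
  have nF: "norm F \<le> c1 / \<bar>r\<bar>"
  proof -
   have "norm (Rh ** X - X ** Rb) \<le> norm Rh * norm X + norm X * norm Rb"
    using norm_triangle_ineq4[of "Rh ** X" "X ** Rb"] norm_matrix_mult_le[of Rh X] norm_matrix_mult_le[of X Rb] by linarith
   then have "norm ((1 / r) *R (Rh ** X - X ** Rb)) \<le> (norm Rh * norm X + norm X * norm Rb) / \<bar>r\<bar>"
    by (simp add: divide_right_mono)
   moreover have "norm (Q' ** R ** Q ** Y) \<le> (norm Q' * c * norm Q * (norm (mat 1 :: complex^'p^'p) + norm X)) / \<bar>r\<bar>"
   proof -
    have "norm (Q' ** R ** Q ** Y) \<le> norm (Q' ** R ** Q) * norm Y" by (rule norm_matrix_mult_le)
    also have "... \<le> (norm Q' * (c / \<bar>r\<bar>) * norm Q) * (norm (mat 1 :: complex^'p^'p) + norm X)"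
    proof (rule mult_mono[OF _ nY])
     have "norm (Q' ** R ** Q) \<le> norm (Q' ** R) * norm Q" by (rule norm_matrix_mult_le)
     also have "... \<le> (norm Q' * norm R) * norm Q" by (intro mult_right_mono norm_matrix_mult_le) auto
     also have "... \<le> (norm Q' * (c / \<bar>r\<bar>)) * norm Q"
      using R by (intro mult_right_mono mult_left_mono) (auto simp: r_def)
     finally show "norm (Q' ** R ** Q) \<le> norm Q' * (c / \<bar>r\<bar>) * norm Q" .
    qed (use c in auto)
    finally show ?thesis by simp
   qed
   ultimately show ?thesis
    unfolding F_def c1_def add_divide_distrib[of _ _ "\<bar>r\<bar>"] using norm_triangle_ineq[of "(1 / r) *R (Rh ** X - X ** Rb)" "Q' ** R ** Q ** Y"]
    by linarith
  qed
  obtain E where E: "Y ** E = F" "norm E \<le> 2 * p * norm F"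
   using near_identity_solve[OF Y2, of F] by (auto simp: p_def)
  have nE: "norm E \<le> c2 / \<bar>r\<bar>"
  proof -
   have "2 * p * norm F \<le> 2 * p * (c1 / \<bar>r\<bar>)" using nF p by (intro mult_left_mono) auto
   with E(2) show ?thesis by (simp add: c2_def)
  qed
  define H where "H = r *R Dg + Rb"
  define G where "G = r *R (Q ** Dg ** Q') + K + R"
  note mm = bounded_bilinear.add_left[OF bounded_bilinear_matrix_mult] bounded_bilinear.add_right[OF bounded_bilinear_matrix_mult]
   bounded_bilinear.diff_left[OF bounded_bilinear_matrix_mult] bounded_bilinear.diff_right[OF bounded_bilinear_matrix_mult]
   bounded_bilinear.scaleR_left[OF bounded_bilinear_matrix_mult] bounded_bilinear.scaleR_right[OF bounded_bilinear_matrix_mult]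
  have QG: "Q' ** G ** Q = r *R Dg + Rh + Q' ** R ** Q"
  proof -
   have "Q' ** (Q ** Dg ** Q') ** Q = (Q' ** Q) ** Dg ** (Q' ** Q)" by (simp only: matrix_mul_assoc)
   then have "Q' ** (Q ** Dg ** Q') ** Q = Dg" by (simp add: Q)
   then show ?thesis by (simp add: G_def mm Rh_def)
  qed
  have key: "(r *R Dg + Rh + Q' ** R ** Q) ** Y = Y ** (H + E)"
  proof -
   have 1: "(r *R Dg + Rh + Q' ** R ** Q) ** Y = r *R Dg + (Dg ** X + Rh) + (1 / r) *R (Rh ** X) + Q' ** R ** Q ** Y"
    using r0 by (simp add: mm Y_def algebra_simps)
   have 2: "Y ** (H + E) = r *R Dg + (X ** Dg + Rb) + (1 / r) *R (X ** Rb) + F"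
    using r0 E(1) by (simp add: mm H_def) (simp add: mm Y_def algebra_simps)
   show ?thesis unfolding 1 2 DX by (simp add: F_def scaleR_diff_right)
  qed
  have GQY: "G ** (Q ** Y) = (Q ** Y) ** (H + E)"
  proof -
   have "G ** (Q ** Y) = Q ** ((Q' ** G ** Q) ** Y)" by (simp add: matrix_mul_assoc Q)
   then show ?thesis by (simp add: QG key matrix_mul_assoc)
  qed
  have lin: "linear ((*v) Y)" by (rule bounded_linear.linear[OF bounded_linear_matrix_vector])
  obtain \<zeta> where z: "Y *v \<zeta> = Q' *v a" "norm \<zeta> \<le> 2 * norm (Q' *v a)"
   by (rule near_identity_surj[OF lin Y2])
  have QYz: "(Q ** Y) *v \<zeta> = a"
   by (simp add: matrix_vector_mul_assoc[symmetric] z) (simp add: matrix_vector_mul_assoc Q)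
  have nz: "norm \<zeta> \<le> C3 * norm a"
  proof -
   have "norm \<zeta> \<le> 2 * (norm Q' * norm a)" using z(2) norm_matrix_vector_le[of Q' a] by linarith
   also have "... \<le> C3 * norm a" using C3(2) by (simp add: mult.assoc[symmetric] mult_right_mono)
   finally show ?thesis .
  qed
  have na: "norm a \<le> C3 * norm \<zeta>"
  proof -
   have "norm a \<le> norm Q * norm (Y *v \<zeta>)"
    using norm_matrix_vector_le[of Q "Y *v \<zeta>"] QYz by (simp add: matrix_vector_mul_assoc)
   also have "norm (Y *v \<zeta>) \<le> 2 * norm \<zeta>"
    using Y2[of \<zeta>] norm_triangle_ineq[of "Y *v \<zeta> - \<zeta>" \<zeta>] norm_ge_zero[of \<zeta>] unfolding diff_add_cancel by linarith
   then have "norm Q * norm (Y *v \<zeta>) \<le> norm Q * (2 * norm \<zeta>)" by (rule mult_left_mono) simp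
   also have "norm Q * (2 * norm \<zeta>) = 2 * norm Q * norm \<zeta>" by simp
   also have "... \<le> C3 * norm \<zeta>" using C3(3) by (intro mult_right_mono) auto
   finally show ?thesis .
  qed
  have expD: "matrix_exp (s *R (r *R Dg)) *v v = (\<chi> k. cis (r * (\<mu> k * s)) * v $ k)" for s v
   by (simp add: vec_eq_iff Dg_def matrix_exp_diagm cis_conv_exp mult_ac)
  have nD: "norm (matrix_exp (s *R (r *R Dg)) *v v) = norm v" for s v
   unfolding expD by (simp add: norm_vec_def norm_mult)
  have comm': "Rb ** (r *R Dg) = (r *R Dg) ** Rb" by (simp add: mm comm)
  have expH: "matrix_exp (s *R H) *v v = matrix_exp (s *R Rb) *v (matrix_exp (s *R (r *R Dg)) *v v)" for s v
   using matrix_exp_add_commuting[OF comm', of s v] by (simp add: H_def add.commute)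
  \<comment> \<open>The transport factor is isometric, so this bound does not depend on
    \<open>n\<close>; it is the bound fed into \<open>matrix_exp_perturb\<close>.\<close>
  have nH: "norm (matrix_exp (s *R H) *v v) \<le> KT * norm v" if "\<bar>s\<bar> \<le> T" for s v
  proof -
   have "norm (matrix_exp (s *R H) *v v) \<le> exp (\<bar>s\<bar> * norm Rb) * norm v"
    unfolding expH using norm_matrix_exp_scaleR_le[of s Rb "matrix_exp (s *R (r *R Dg)) *v v"] nD by simp
   also have "... \<le> KT * norm v" using that by (intro mult_right_mono) (auto simp: KT_def intro: mult_right_mono)
   finally show ?thesis .
  qed
  have fin: "norm (matrix_exp (t *R G) *v a - Q *v (matrix_exp (t *R Rb) *v (\<chi> k. cis (r * (\<mu> k * t)) * \<zeta> $ k)))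
    \<le> C3 / \<bar>r\<bar> * norm \<zeta>" if t: "t \<in> {0..T}" for t
  proof -
   define u where "u = matrix_exp (t *R (H + E)) *v \<zeta>"
   define w where "w = matrix_exp (t *R H) *v \<zeta>"
   have G: "matrix_exp (t *R G) *v a = Q *v (Y *v u)"
   proof -
    have "(Q ** Y) *v u = matrix_exp (t *R G) *v ((Q ** Y) *v \<zeta>)" unfolding u_def
     by (rule matrix_exp_intertwine_scaleR[OF bounded_linear_matrix_vector]) (simp add: matrix_vector_mul_assoc GQY)
    then show ?thesis by (simp add: QYz matrix_vector_mul_assoc)
   qed
   have uw: "norm (u - w) \<le> e1 / \<bar>r\<bar> * norm \<zeta>"
   proof -
    have "norm (u - w) \<le> KT ^ 3 * norm E * T * exp (KT^2 * norm E * T) * norm \<zeta>"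
     unfolding u_def w_def using t KT by (intro matrix_exp_perturb nH) auto
    also have "... \<le> KT ^ 3 * (c2 / \<bar>r\<bar>) * T * exp (KT^2 * c2 * T) * norm \<zeta>"
    proof -
     have "c2 / \<bar>r\<bar> \<le> c2 / 1" using r c2 by (intro divide_left_mono) auto
     then have "norm E \<le> c2" using nE by simp
     then show ?thesis using nE KT T c2
      by (intro mult_right_mono mult_mono mult_left_mono) (auto intro!: mult_right_mono mult_left_mono)
    qed
    also have "... = e1 / \<bar>r\<bar> * norm \<zeta>" by (simp add: e1_def)
    finally show ?thesis .
   qed
   have "norm u \<le> norm (u - w) + norm w" using norm_triangle_ineq[of "u - w" w] by simp
   also have "... \<le> e1 / \<bar>r\<bar> * norm \<zeta> + KT * norm \<zeta>"
    using uw nH[of t \<zeta>] t by (auto simp: w_def)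
   also have "e1 / \<bar>r\<bar> \<le> e1 / 1" using r e1 by (intro divide_left_mono) auto
   finally have nu: "norm u \<le> (e1 + KT) * norm \<zeta>" by (simp add: distrib_right mult_right_mono)
   have "matrix_exp (t *R G) *v a - Q *v w = Q *v ((Y *v u - u) + (u - w))"
    by (simp add: G matrix_vector_mult_diff_distrib)
   also have "norm ... \<le> norm Q * norm ((Y *v u - u) + (u - w))" by (rule norm_matrix_vector_le)
   also have "... \<le> norm Q * (norm X / \<bar>r\<bar> * ((e1 + KT) * norm \<zeta>) + e1 / \<bar>r\<bar> * norm \<zeta>)"
   proof (rule mult_left_mono)
    have "norm ((Y *v u - u) + (u - w)) \<le> norm (Y *v u - u) + norm (u - w)" by (rule norm_triangle_ineq)
    also have "... \<le> norm X / \<bar>r\<bar> * norm u + e1 / \<bar>r\<bar> * norm \<zeta>" by (intro add_mono Yd uw)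
    also have "... \<le> norm X / \<bar>r\<bar> * ((e1 + KT) * norm \<zeta>) + e1 / \<bar>r\<bar> * norm \<zeta>"
     using nu by (intro add_right_mono mult_left_mono) auto
    finally show "norm ((Y *v u - u) + (u - w)) \<le> norm X / \<bar>r\<bar> * ((e1 + KT) * norm \<zeta>) + e1 / \<bar>r\<bar> * norm \<zeta>" .
   qed simp
   also have "... = (norm Q * (norm X * (e1 + KT) + e1)) / \<bar>r\<bar> * norm \<zeta>"
    using r0 by (simp add: field_simps)
   also have "... \<le> C3 / \<bar>r\<bar> * norm \<zeta>"
    using C3(4) by (intro mult_right_mono divide_right_mono) auto
   finally show ?thesis by (simp only: w_def expH expD)
  qed
  show "\<exists>\<zeta>. norm \<zeta> \<le> C3 * norm a \<and> norm a \<le> C3 * norm \<zeta> \<and> (\<forall>t\<in>{0..T}.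
    norm (matrix_exp (t *R (of_int n *R (Q ** diagm (\<lambda>k. \<i> * of_real (\<mu> k)) ** Q') + K + R)) *v a -
     Q *v (matrix_exp (t *R Rb) *v (\<chi> k. cis (of_int n * (\<mu> k * t)) * \<zeta> $ k))) \<le> C3 / absr n * norm \<zeta>)"
   using nz na fin by (auto simp: G_def r_def Dg_def)
 qed
qed

lemma norm_axis_eq: "norm (axis k z :: complex^'n) = norm z" by (simp add: norm_eq_sqrt_inner inner_axis_axis)

lemma (in obs_set) energy_components:
 "energy X S c = (\<Sum>k\<in>UNIV. energy X S (\<lambda>n. axis k (c n $ k)))" for c :: "int => complex^'k"
proof -
 have t: "tpoly S (\<lambda>n. axis k (c n $ k)) x = axis k (tpoly S c x $ k)" for k x
  by (simp add: vec_eq_iff tpoly_def axis_def)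
 have "nsq (tpoly S c x) = (\<Sum>k\<in>UNIV. nsq (tpoly S (\<lambda>n. axis k (c n $ k)) x))" for x
  unfolding t norm_axis_eq by (simp add: norm_vec_def L2_set_def sum_nonneg)
 then have "energy X S c = (LINT x|lborel. (\<Sum>k\<in>UNIV. indicator X x *R nsq (tpoly S (\<lambda>n. axis k (c n $ k)) x)))"
  unfolding energy_def set_lebesgue_integral_def by (simp add: sum_distrib_left)
 also have "... = (\<Sum>k\<in>UNIV. energy X S (\<lambda>n. axis k (c n $ k)))"
  unfolding energy_def set_lebesgue_integral_def
  using set_integrable_norm_tpoly by (intro Bochner_Integration.integral_sum) (auto simp: set_integrable_def)
 finally show ?thesis .
qed

text \<open>In the normal form the part of size \<open>n\<close> acts by factors of modulus one. The
  exponential is therefore bounded uniformly in \<open>n\<close>, although its generator is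
  not.\<close>

lemma transport_bounded:
 fixes \<mu> :: "'p::finite => real" and Q Q' K :: "complex^'p^'p"
 assumes Q: "Q ** Q' = mat 1" "Q' ** Q = mat 1" and T: "0 \<le> T" and c: "0 \<le> c"
 obtains Ka N :: real where "1 \<le> Ka" "0 < N"
  "\<And>n R a t. N \<le> absr n ==> norm R \<le> c / absr n ==> t \<in> {0..T} ==>
   norm (matrix_exp (t *R (of_int n *R (Q ** diagm (\<lambda>k. \<i> * of_real (\<mu> k)) ** Q') + K + R)) *v a) \<le> Ka * norm a"
proof (rule transport_normal_form[OF Q T c])
 fix Rb and N C3 :: real
 assume N: "0 < N" and C3: "0 < C3"
  and nf: "\<And>n R a. N \<le> absr n ==> norm R \<le> c / absr n ==>
   \<exists>\<zeta>. norm \<zeta> \<le> C3 * norm a \<and> norm a \<le> C3 * norm \<zeta> \<and> (\<forall>t\<in>{0..T}.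
    norm (matrix_exp (t *R (of_int n *R (Q ** diagm (\<lambda>k. \<i> * of_real (\<mu> k)) ** Q') + K + R)) *v a -
     Q *v (matrix_exp (t *R Rb) *v (\<chi> k. cis (of_int n * (\<mu> k * t)) * \<zeta> $ k))) \<le> C3 / absr n * norm \<zeta>)"
 define q where "q = norm Q * exp (T * norm Rb)"
 define Ka where "Ka = 1 + (C3 / N + q) * C3"
 have q: "0 \<le> q" by (simp add: q_def)
 show thesis
 proof (rule that[of Ka N])
  show "1 \<le> Ka" using N C3 q by (simp add: Ka_def)
  show "0 < N" by fact
  fix n :: int and R :: "complex^'p^'p" and a t
  assume n: "N \<le> absr n" and R: "norm R \<le> c / absr n" and t: "t \<in> {0..T}"
  let ?e = "matrix_exp (t *R (of_int n *R (Q ** diagm (\<lambda>k. \<i> * of_real (\<mu> k)) ** Q') + K + R)) *v a"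
  obtain \<zeta> where z: "norm \<zeta> \<le> C3 * norm a"
    "norm (?e - Q *v (matrix_exp (t *R Rb) *v (\<chi> k. cis (of_int n * (\<mu> k * t)) * \<zeta> $ k))) \<le> C3 / absr n * norm \<zeta>"
   using nf[OF n R] t by blast
  let ?w = "\<chi> k. cis (of_int n * (\<mu> k * t)) * \<zeta> $ k"
  have w: "norm ?w = norm \<zeta>" by (simp add: norm_vec_def norm_mult)
  have "norm (Q *v (matrix_exp (t *R Rb) *v ?w)) \<le> norm Q * (exp (\<bar>t\<bar> * norm Rb) * norm ?w)"
   by (intro order.trans[OF norm_matrix_vector_le] mult_left_mono norm_matrix_exp_scaleR_le) auto
  also have "... \<le> norm Q * (exp (T * norm Rb) * norm \<zeta>)"
   unfolding w using t by (intro mult_left_mono mult_right_mono) (auto intro: mult_right_mono)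
  finally have 1: "norm (Q *v (matrix_exp (t *R Rb) *v ?w)) \<le> q * norm \<zeta>" by (simp add: q_def)
  have "C3 / absr n * norm \<zeta> \<le> C3 / N * norm \<zeta>"
   using n N C3 by (intro mult_right_mono divide_left_mono) auto
  with z(2) 1 have "norm ?e \<le> (C3 / N + q) * norm \<zeta>"
   using norm_triangle_ineq[of "?e - Q *v (matrix_exp (t *R Rb) *v ?w)" "Q *v (matrix_exp (t *R Rb) *v ?w)"]
   unfolding diff_add_cancel distrib_right by linarith
  also have "... \<le> (C3 / N + q) * (C3 * norm a)" using z(1) N C3 q by (intro mult_left_mono) auto
  also have "... \<le> Ka * norm a" by (simp add: Ka_def distrib_right mult.assoc)
  finally show "norm ?e \<le> Ka * norm a" .
 qed
qed

context periodic_open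
begin

text \<open>In the normal form the solution is a matrix depending on time alone, applied to
  componentwise pure transport. A matrix independent of the mode commutes with forming trigonometric
  polynomials, so it can be undone on the observation, after which each component is observed along
  its own characteristics.\<close>

lemma hyperbolic_observability:
 fixes \<mu> :: "'p::finite => real" and Q Q' K :: "complex^'p^'p"
 assumes Q: "Q ** Q' = mat 1" "Q' ** Q = mat 1" and c: "0 \<le> c" and t: "0 \<le> t1" "t1 < t2"
  and \<mu>: "\<And>k. \<mu> k \<noteq> 0" and hit: "\<And>k y. \<exists>t\<in>{t1<..<t2}. y - \<mu> k * t \<in> \<Omega>"
 obtains C1 N :: real where "0 < C1" "0 < N"
  "\<And>S R a. finite S ==> (\<And>n. n \<in> S ==> N \<le> absr n) ==> (\<And>n. n \<in> S ==> norm (R n) \<le> c / absr n) ==>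
   (\<Sum>n\<in>S. nsq (a n)) \<le> C1 * integral {t1..t2} (\<lambda>t. energy (\<Omega> \<inter> {0..<2 * pi}) S
    (\<lambda>n. matrix_exp (t *R (of_int n *R (Q ** diagm (\<lambda>k. \<i> * of_real (\<mu> k)) ** Q') + K + R n)) *v a n))"
proof -
 interpret X: obs_set "\<Omega> \<inter> {0..<2 * pi}" by (rule obs_set)
 let ?E = "\<lambda>S :: int set. energy (\<Omega> \<inter> {0..<2 * pi}) S"
 define \<Phi> where "\<Phi> = (\<lambda>k \<theta>. 0 < \<theta> \<and> (\<forall>S (c :: int => complex^'p). finite S \<longrightarrow> \<theta> * (\<Sum>n\<in>S. nsq (c n)) \<le>
   integral {t1..t2} (\<lambda>t. ?E S (\<lambda>n. cis (of_int n * (\<mu> k * t)) *s c n))))"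
 have "\<exists>\<theta>. \<Phi> k \<theta>" for k
  unfolding \<Phi>_def by (rule transport_observability[OF t(2) \<mu>[of k] hit[where k = k]]) blast
 then obtain \<theta>f where f: "\<And>k. \<Phi> k (\<theta>f k)" by metis
 have \<theta>f: "\<And>k. 0 < \<theta>f k" "\<And>k S (c :: int => complex^'p). finite S ==>
   \<theta>f k * (\<Sum>n\<in>S. nsq (c n)) \<le> integral {t1..t2} (\<lambda>t. ?E S (\<lambda>n. cis (of_int n * (\<mu> k * t)) *s c n))"
  using f unfolding \<Phi>_def by blast+
 define \<theta> where "\<theta> = Min (range \<theta>f)"
 have \<theta>: "0 < \<theta>" "\<And>k. \<theta> \<le> \<theta>f k" using \<theta>f(1) by (auto simp: \<theta>_def)
 have t20: "0 \<le> t2" using t by simp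
 obtain Rb and N0 C3 :: real where N0: "0 < N0" and C3: "0 < C3" and
  nf: "\<And>n R a. N0 \<le> absr n ==> norm R \<le> c / absr n ==>
   \<exists>\<zeta>. norm \<zeta> \<le> C3 * norm a \<and> norm a \<le> C3 * norm \<zeta> \<and> (\<forall>t\<in>{0..t2}.
    norm (matrix_exp (t *R (of_int n *R (Q ** diagm (\<lambda>k. \<i> * of_real (\<mu> k)) ** Q') + K + R)) *v a -
     Q *v (matrix_exp (t *R Rb) *v (\<chi> k. cis (of_int n * (\<mu> k * t)) * \<zeta> $ k))) \<le> C3 / absr n * norm \<zeta>)"
 proof (rule transport_normal_form[OF Q t20 c])
  fix Rb and N C3 :: real
  assume "0 < N" "0 < C3"
   and nf: "\<And>n R a. N \<le> absr n ==> norm R \<le> c / absr n ==>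
    \<exists>\<zeta>. norm \<zeta> \<le> C3 * norm a \<and> norm a \<le> C3 * norm \<zeta> \<and> (\<forall>t\<in>{0..t2}.
     norm (matrix_exp (t *R (of_int n *R (Q ** diagm (\<lambda>k. \<i> * of_real (\<mu> k)) ** Q') + K + R)) *v a -
      Q *v (matrix_exp (t *R Rb) *v (\<chi> k. cis (of_int n * (\<mu> k * t)) * \<zeta> $ k))) \<le> C3 / absr n * norm \<zeta>)"
  then show thesis by (intro that[of N C3 Rb] nf)
 qed
 define pb where "pb = real CARD('p) * (exp (t2 * norm Rb) * norm Q')"
 \<comment> \<open>Inverse of \<open>Q ** matrix_exp (t *R Rb)\<close>, the same for all
   modes.\<close>
 define P where "P = (\<lambda>t. matrix_exp ((- t) *R Rb) ** Q')"
 have P: "norm (P t) \<le> pb" if "t \<in> {0..t2}" for t unfolding pb_def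
 proof (rule norm_matrix_le_columns)
  fix x
  have "norm (P t *v x) \<le> exp (\<bar>- t\<bar> * norm Rb) * norm (Q' *v x)"
   unfolding P_def matrix_vector_mul_assoc[symmetric] by (rule norm_matrix_exp_scaleR_le)
  also have "... \<le> exp (t2 * norm Rb) * (norm Q' * norm x)"
   using that by (intro mult_mono norm_matrix_vector_le) (auto intro: mult_right_mono)
  finally show "norm (P t *v x) \<le> exp (t2 * norm Rb) * norm Q' * norm x" by simp
 qed
 define L where "L = 4 * pi * pb^2 * C3^2 * (t2 - t1)"
 have L: "0 \<le> L" using t by (simp add: L_def)
 \<comment> \<open>From this threshold on the error of the normal form is at most half of the left
   side, where it is absorbed.\<close>
 define N where "N = N0 + 1 + 2 * L / \<theta>"
 have N: "N0 \<le> N" "1 \<le> N" "2 * L / \<theta> \<le> N" using N0 L \<theta> by (auto simp: N_def)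
 have LN: "L / N^2 \<le> \<theta> / 2"
 proof -
  have "N * 1 \<le> N * N" using N by (intro mult_left_mono) auto
  then have "2 * L / \<theta> \<le> N^2" using N(3) unfolding power2_eq_square by linarith
  then show ?thesis using \<theta> N by (simp add: field_simps)
 qed
 define C1 where "C1 = C3^2 * (2 / \<theta>) * (2 * pb^2) + 1"
 have C1: "0 < C1" using \<theta> by (simp add: C1_def add_nonneg_pos)
 show ?thesis
 proof (rule that[OF C1, of N])
  show "0 < N" using N by simp
  fix S and R :: "int => complex^'p^'p" and a :: "int => complex^'p"
  assume fin: "finite S" and nS: "\<And>n. n \<in> S ==> N \<le> absr n" and R: "\<And>n. n \<in> S ==> norm (R n) \<le> c / absr n"
  define av where "av = (\<lambda>n t. matrix_exp (t *R (of_int n *R (Q ** diagm (\<lambda>k. \<i> * of_real (\<mu> k)) ** Q') + K + R n)) *v a n)"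
  define \<Xi> where "\<Xi> = (\<lambda>n \<zeta>. norm (a n) \<le> C3 * norm \<zeta> \<and> (\<forall>t\<in>{0..t2}.
    norm (av n t - Q *v (matrix_exp (t *R Rb) *v (\<chi> k. cis (of_int n * (\<mu> k * t)) * \<zeta> $ k))) \<le> C3 / absr n * norm \<zeta>))"
  have "\<exists>\<zeta>. \<Xi> n \<zeta>" if n: "n \<in> S" for n
   using nf[OF order.trans[OF N(1) nS[OF n]] R[OF n], of "a n"] unfolding \<Xi>_def av_def by blast
  then obtain \<zeta> where \<zeta>: "\<And>n. n \<in> S ==> \<Xi> n (\<zeta> n)" by metis
  have z: "norm (a n) \<le> C3 * norm (\<zeta> n)" "\<And>t. t \<in> {0..t2} ==>
    norm (av n t - Q *v (matrix_exp (t *R Rb) *v (\<chi> k. cis (of_int n * (\<mu> k * t)) * \<zeta> n $ k))) \<le> C3 / absr n * norm (\<zeta> n)"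
   if "n \<in> S" for n using \<zeta>[OF that] unfolding \<Xi>_def by blast+
  define w where "w = (\<lambda>t n. \<chi> k. cis (of_int n * (\<mu> k * t)) * \<zeta> n $ k)"
  define err where "err = (\<lambda>t n. av n t - Q *v (matrix_exp (t *R Rb) *v w t n))"
  have wP: "w t n = P t *v (av n t - err t n)" for t n
  proof -
   have "P t *v (av n t - err t n) = matrix_exp ((- t) *R Rb) *v ((Q' ** Q) *v (matrix_exp (t *R Rb) *v w t n))"
    by (simp add: err_def P_def matrix_vector_mul_assoc[symmetric])
   then show ?thesis by (simp add: Q)
  qed
  let ?Z = "\<Sum>n\<in>S. nsq (\<zeta> n)"
  have Z0: "0 \<le> ?Z" by (simp add: sum_nonneg)
  have contw: "continuous_on U (\<lambda>t. ?E S (w t))" for U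
  proof (rule X.continuous_on_energy)
   fix n
   have "continuous_on U (\<lambda>t. \<chi> k. cis (of_int n * (\<mu> k * t)) * \<zeta> n $ k)"
    by (intro continuous_on_vec_lambda continuous_intros)
   then show "continuous_on U (\<lambda>t. w t n)" by (simp add: w_def)
  qed
  have conta: "continuous_on U (\<lambda>t. ?E S (\<lambda>n. av n t))" for U unfolding av_def
   by (intro X.continuous_on_energy continuous_on_matrix_vector continuous_intros)
  have up: "?E S (w t) \<le> 2 * pb^2 * ?E S (\<lambda>n. av n t) + (4 * pi * pb^2 * C3^2) / N^2 * ?Z" if t: "t \<in> {t1..t2}" for t
  proof -
   have t': "t \<in> {0..t2}" using t \<open>0 \<le> t1\<close> by auto
   have "?E S (w t) = ?E S (\<lambda>n. P t *v (av n t - err t n))" by (simp only: wP[symmetric])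
   also have "... \<le> nsq (P t) * ?E S (\<lambda>n. av n t - err t n)" by (rule X.energy_matrix_le)
   also have "... \<le> pb^2 * (2 * ?E S (\<lambda>n. av n t) + 2 * (2 * pi * (C3^2 / N^2 * ?Z)))"
   proof (intro mult_mono power_mono P t')
    have "?E S (err t) \<le> 2 * pi * (\<Sum>n\<in>S. nsq (err t n))" by (rule X.energy_le[OF fin])
    also have "... \<le> 2 * pi * (\<Sum>n\<in>S. (C3 / N * norm (\<zeta> n))^2)"
    proof (intro mult_left_mono sum_mono power_mono)
     fix n assume n: "n \<in> S"
     have "norm (err t n) \<le> C3 / absr n * norm (\<zeta> n)" unfolding err_def w_def by (rule z(2)[OF n t'])
     also have "... \<le> C3 / N * norm (\<zeta> n)"
      using nS[OF n] N C3 by (intro mult_right_mono divide_left_mono) auto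
     finally show "norm (err t n) \<le> C3 / N * norm (\<zeta> n)" .
    qed auto
    also have "... = 2 * pi * (C3^2 / N^2 * ?Z)"
     by (simp add: power_mult_distrib power_divide sum_distrib_left)
    finally show "?E S (\<lambda>n. av n t - err t n) \<le> 2 * ?E S (\<lambda>n. av n t) + 2 * (2 * pi * (C3^2 / N^2 * ?Z))"
     using X.energy_diff_le[of S "\<lambda>n. av n t" "err t"] by linarith
   qed (auto simp: energy_nonneg)
   finally show ?thesis by (simp add: algebra_simps)
  qed
  have comp: "\<theta> * (\<Sum>n\<in>S. (cmod (\<zeta> n $ k))^2) \<le> integral {t1..t2} (\<lambda>t. ?E S (\<lambda>n. axis k (w t n $ k)))" for k
  proof -
   have "axis k (w t n $ k) = cis (of_int n * (\<mu> k * t)) *s axis k (\<zeta> n $ k)" for t n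
    by (simp add: w_def vec_eq_iff axis_def)
   then have "integral {t1..t2} (\<lambda>t. ?E S (\<lambda>n. axis k (w t n $ k))) \<ge> \<theta>f k * (\<Sum>n\<in>S. nsq (axis k (\<zeta> n $ k) :: complex^'p))"
    using \<theta>f(2)[OF fin, of k "\<lambda>n. axis k (\<zeta> n $ k)"] by simp
   moreover have "\<theta> * (\<Sum>n\<in>S. (cmod (\<zeta> n $ k))^2) \<le> \<theta>f k * (\<Sum>n\<in>S. (cmod (\<zeta> n $ k))^2)"
    by (intro mult_right_mono \<theta> sum_nonneg) auto
   ultimately show ?thesis by (simp add: norm_axis_eq)
  qed
  have "\<theta> * ?Z = (\<Sum>k\<in>UNIV. \<theta> * (\<Sum>n\<in>S. (cmod (\<zeta> n $ k))^2))"
   by (subst sum_distrib_left[symmetric], subst sum.swap) (simp add: norm_vec_def L2_set_def sum_nonneg)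
  also have "... \<le> (\<Sum>k\<in>UNIV. integral {t1..t2} (\<lambda>t. ?E S (\<lambda>n. axis k (w t n $ k))))"
   by (intro sum_mono comp)
  also have "... = integral {t1..t2} (\<lambda>t. \<Sum>k\<in>UNIV. ?E S (\<lambda>n. axis k (w t n $ k)))"
  proof (rule Henstock_Kurzweil_Integration.integral_sum[symmetric])
   fix k
   have "continuous_on {t1..t2} (\<lambda>t. ?E S (\<lambda>n. axis k (w t n $ k)))"
   proof (rule X.continuous_on_energy)
    fix n
    have "continuous_on {t1..t2} (\<lambda>t. \<chi> i. if i = k then cis (of_int n * (\<mu> k * t)) * \<zeta> n $ k else 0)"
    proof (rule continuous_on_vec_lambda)
     show "continuous_on {t1..t2} (\<lambda>t. if i = k then cis (of_int n * (\<mu> k * t)) * \<zeta> n $ k else 0)" for i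
      by (cases "i = k") (auto intro!: continuous_intros)
    qed
    then show "continuous_on {t1..t2} (\<lambda>t. axis k (w t n $ k))" by (simp add: w_def axis_def)
   qed
   then show "(\<lambda>t. ?E S (\<lambda>n. axis k (w t n $ k))) integrable_on {t1..t2}"
    by (rule integrable_continuous_real)
  qed simp
  also have "... = integral {t1..t2} (\<lambda>t. ?E S (w t))" by (simp only: X.energy_components[symmetric])
  also have "... \<le> integral {t1..t2} (\<lambda>t. 2 * pb^2 * ?E S (\<lambda>n. av n t) + (4 * pi * pb^2 * C3^2) / N^2 * ?Z)"
   using up by (intro integral_le integrable_continuous_real continuous_intros contw conta) auto
  also have "... = 2 * pb^2 * integral {t1..t2} (\<lambda>t. ?E S (\<lambda>n. av n t)) + L / N^2 * ?Z"
   using t by (subst Henstock_Kurzweil_Integration.integral_add)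
    (auto intro!: integrable_continuous_real continuous_intros conta simp: L_def)
  also have "L / N^2 * ?Z \<le> \<theta> / 2 * ?Z" by (intro mult_right_mono LN Z0)
  finally have "?Z \<le> (2 / \<theta>) * (2 * pb^2) * integral {t1..t2} (\<lambda>t. ?E S (\<lambda>n. av n t))"
   using \<theta> by (simp add: field_simps)
  then have "C3^2 * ?Z \<le> C3^2 * ((2 / \<theta>) * (2 * pb^2) * integral {t1..t2} (\<lambda>t. ?E S (\<lambda>n. av n t)))"
   by (rule mult_left_mono) simp
  also have "... \<le> C1 * integral {t1..t2} (\<lambda>t. ?E S (\<lambda>n. av n t))"
  proof -
   have "0 \<le> integral {t1..t2} (\<lambda>t. ?E S (\<lambda>n. av n t))"
    by (intro integral_nonneg integrable_continuous_real conta energy_nonneg)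
   then show ?thesis by (simp add: C1_def distrib_right mult.assoc)
  qed
  finally have Zb: "C3^2 * ?Z \<le> C1 * integral {t1..t2} (\<lambda>t. ?E S (\<lambda>n. av n t))" .
  have "(\<Sum>n\<in>S. nsq (a n)) \<le> (\<Sum>n\<in>S. (C3 * norm (\<zeta> n))^2)"
   using z(1) by (intro sum_mono power_mono) auto
  also have "... = C3^2 * ?Z" by (simp add: power_mult_distrib sum_distrib_left)
  finally show "(\<Sum>n\<in>S. nsq (a n)) \<le> C1 * integral {t1..t2} (\<lambda>t. ?E S
    (\<lambda>n. matrix_exp (t *R (of_int n *R (Q ** diagm (\<lambda>k. \<i> * of_real (\<mu> k)) ** Q') + K + R n)) *v a n))"
   using Zb by (simp add: av_def)
 qed
qed

end

section \<open>Observability of the coupled system\<close>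

text \<open>The minimum over the compact unit sphere is positive. This is how qualitative
  injectivity is turned into a constant below.\<close>

lemma positive_homogeneous_bound:
 fixes f :: "'a::euclidean_space => real"
 assumes c: "continuous_on UNIV f" and h: "\<And>r x. f (r *R x) = \<bar>r\<bar> * f x" and p: "\<And>x. x \<noteq> 0 ==> 0 < f x"
 obtains \<kappa> where "0 < \<kappa>" "\<And>x. \<kappa> * norm x \<le> f x"
proof -
 have "compact (sphere (0::'a) 1)" "sphere (0::'a) 1 \<noteq> {}" by auto
 then obtain z where z: "z \<in> sphere 0 1" "\<And>x. x \<in> sphere 0 1 ==> f z \<le> f x"
  using continuous_attains_inf[of "sphere (0::'a) 1" f] continuous_on_subset[OF c] by blast
 show ?thesis
 proof (rule that[of "f z"])
  show "0 < f z" using z(1) by (intro p) auto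
  show "f z * norm x \<le> f x" for x
  proof (cases "x = 0")
   case True
   then show ?thesis using h[of 0 x] by simp
  next
   case False
   then have "f z \<le> f ((1 / norm x) *R x)" by (intro z(2)) auto
   also have "... = f x / norm x" by (simp add: h)
   finally show ?thesis using False by (simp add: field_simps)
  qed
 qed
qed

text \<open>The numbers \<open>\<mu> k\<close> are the velocities: \<open>A\<close> is
  \<open>\<i>\<close> times a matrix that is diagonalizable with real eigenvalues. The Kalman
  condition enters in quantitative form, which survives perturbations of size
  \<open>1 / n\<close>.\<close>

locale observed_system = periodic_open \<Omega> + coupled_modes A K B C E D
 for \<Omega> :: "real set" and A K :: "complex^'p^'p" and B :: "complex^'q^'p"
  and C E :: "complex^'p^'q" and D :: "complex^'q^'q" +
 fixes \<mu> :: "'p => real" and Q Q' :: "complex^'p^'p" and \<kappa> :: real and J :: nat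
 assumes A_eq: "A = Q ** diagm (\<lambda>k. \<i> * of_real (\<mu> k)) ** Q'"
  and Q: "Q ** Q' = mat 1" "Q' ** Q = mat 1" and \<mu>: "\<mu> k \<noteq> 0" and \<Omega>_ne: "\<Omega> \<noteq> {}"
  and kalman: "0 < \<kappa>" "\<kappa> * norm c \<le> (\<Sum>j\<le>J. norm (B *v (matrix_power D j *v c)))"
begin

abbreviation X :: "real set" where "X \<equiv> \<Omega> \<inter> {0..<2 * pi}"

text \<open>A point of \<open>\<Omega>\<close> is translated into the period and then moved slightly
  to the right, since it may have landed on the endpoint 0.\<close>

lemma interior_X: "interior X \<noteq> {}"
proof -
 obtain x where x: "x \<in> \<Omega>" using \<Omega>_ne by blast
 define k where "k = \<lfloor>x / (2 * pi)\<rfloor>"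
 define a where "a = x - 2 * pi * of_int k"
 have a: "0 \<le> a" "a < 2 * pi"
  using floor_divide_lower[of "2 * pi" x] floor_divide_upper[of "2 * pi" x] by (auto simp: a_def k_def algebra_simps)
 have "(x + 2 * pi * of_int (- k) \<in> \<Omega>) = (x \<in> \<Omega>)"
  by (rule periodic_int[of "\<lambda>x. x \<in> \<Omega>"]) (rule per)
 then have "a \<in> \<Omega>" using x by (simp add: a_def)
 then obtain e where e: "0 < e" "ball a e \<subseteq> \<Omega>" using open_\<Omega> openE by blast
 define m where "m = min e (2 * pi - a)"
 define b where "b = a + m / 2"
 have m: "0 < m" "m \<le> e" "m \<le> 2 * pi - a" using e a by (auto simp: m_def)
 then have "b \<in> ball a e" "0 < b" "b < 2 * pi" using a unfolding b_def by (simp add: dist_real_def, linarith+)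
 then have "b \<in> \<Omega> \<inter> {0<..<2 * pi}" using e by auto
 moreover have "open (\<Omega> \<inter> {0<..<2 * pi})" using open_\<Omega> by auto
 moreover have "\<Omega> \<inter> {0<..<2 * pi} \<subseteq> X" by auto
 ultimately show ?thesis by (metis emptyE interior_maximal subsetD)
qed

sublocale coupled_modes_observed A K B C E D X using open_\<Omega> interior_X by unfold_locales auto

definition flow :: "real => int => complex^('p + 'q) => complex^('p + 'q)"
 where "flow t n v = matrix_exp (t *R gen n) *v v"

definition obs :: "real => real => int set => (int => complex^('p + 'q)) => real"
 where "obs t1 t2 S v = integral {t1..t2} (\<lambda>t. energy X S (\<lambda>n. fst_block (flow t n (v n))))"

lemma continuous_on_flow [continuous_intros]:
 "continuous_on U f ==> continuous_on U (\<lambda>t. flow (f t) n v)" unfolding flow_def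
 by (intro continuous_on_matrix_vector continuous_intros)

lemma continuous_on_fst_block [continuous_intros]:
 "continuous_on U f ==> continuous_on U (\<lambda>t. fst_block (f t :: complex^('p + 'q)))"
 by (rule bounded_linear.continuous_on[OF bounded_linear_fst_block])

lemma flow_add: "flow (s + t) n v = flow s n (flow t n v)" by (simp add: flow_def matrix_exp_add_vector)

lemma flow_zero [simp]: "flow 0 n v = v" by (simp add: flow_def)

lemma bounded_linear_flow: "bounded_linear (flow t n)"
 unfolding flow_def by (rule bounded_linear_matrix_vector)

lemma continuous_on_obs_integrand: "continuous_on U (\<lambda>t. energy X S (\<lambda>n. fst_block (flow t n (v n))))"
 by (intro continuous_intros)

lemma integrable_obs: "(\<lambda>t. energy X S (\<lambda>n. fst_block (flow t n (v n)))) integrable_on {t1..t2}"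
 by (intro integrable_continuous_real continuous_on_obs_integrand)

lemma obs_mono:
 assumes "t1' \<le> t1" "t2 \<le> t2'"
 shows "obs t1 t2 S v \<le> obs t1' t2' S v"
 unfolding obs_def using assms by (intro integral_subset_le integrable_obs) (auto simp: energy_nonneg)

lemma obs_nonneg: "0 \<le> obs t1 t2 S v"
 unfolding obs_def by (intro integral_nonneg integrable_obs energy_nonneg)

lemma obs_add_le: "obs t1 t2 S (\<lambda>n. v n + w n) \<le> 2 * obs t1 t2 S v + 2 * obs t1 t2 S w"
proof -
 have "obs t1 t2 S (\<lambda>n. v n + w n) \<le> integral {t1..t2} (\<lambda>t. 2 * energy X S (\<lambda>n. fst_block (flow t n (v n))) +
   2 * energy X S (\<lambda>n. fst_block (flow t n (w n))))" unfolding obs_def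
 proof (rule integral_le[OF integrable_obs])
  fix t
  show "energy X S (\<lambda>n. fst_block (flow t n (v n + w n))) \<le> 2 * energy X S (\<lambda>n. fst_block (flow t n (v n))) +
   2 * energy X S (\<lambda>n. fst_block (flow t n (w n)))"
   using energy_add_le[of S "\<lambda>n. fst_block (flow t n (v n))" "\<lambda>n. fst_block (flow t n (w n))"]
   by (simp add: flow_def matrix_vector_right_distrib fst_block_add)
 qed (intro integrable_continuous_real continuous_intros)
 also have "... = 2 * obs t1 t2 S v + 2 * obs t1 t2 S w"
  unfolding obs_def using integrable_obs by (subst Henstock_Kurzweil_Integration.integral_add) auto
 finally show ?thesis .
qed

lemma obs_scaleR: "obs t1 t2 S (\<lambda>n. r *R v n) = r^2 * obs t1 t2 S v"
proof -
 have "energy X S (\<lambda>n. fst_block (flow t n (r *R v n))) = r^2 * energy X S (\<lambda>n. fst_block (flow t n (v n)))" for t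
  using tpoly_scaleR[of S r "\<lambda>n. fst_block (flow t n (v n))"]
  by (simp add: energy_def flow_def matrix_scaleR_right fst_block_scaleR power_mult_distrib)
 then show ?thesis by (simp add: obs_def)
qed

lemma obs_mono_neutral:
 assumes "finite S'" "S \<subseteq> S'" "\<And>n. n \<in> S' - S ==> v n = 0"
 shows "obs t1 t2 S v = obs t1 t2 S' v"
proof -
 have "energy X S (\<lambda>n. fst_block (flow t n (v n))) = energy X S' (\<lambda>n. fst_block (flow t n (v n)))" for t
  using assms by (intro energy_mono_neutral) (auto simp: flow_def)
 then show ?thesis by (simp add: obs_def)
qed

lemma obs_cong: "(\<And>n. n \<in> S ==> v n = w n) ==> obs t1 t2 S v = obs t1 t2 S w"
 unfolding obs_def by (intro integral_cong energy_cong) auto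

text \<open>In coordinates along the two invariant graphs the solution splits. The change of
  coordinates is within 1/2 of the identity once \<open>4 * c \<le> absr n\<close>, hence invertible
  with bounds independent of \<open>n\<close>.\<close>

lemma decoupled_solution:
 assumes d: "decoupled c n \<Theta> \<Psi> R Z" and n: "4 * c \<le> absr n" "0 < absr n"
 obtains a b where "norm a \<le> 2 * norm v" "norm b \<le> 2 * norm v"
  "\<And>t. flow t n v = block_vec
   (matrix_exp (t *R (of_int n *R A + (K + B ** C) + R)) *v a + \<Psi> *v (matrix_exp (t *R parabolic_gen n Z) *v b))
   (\<Theta> *v (matrix_exp (t *R (of_int n *R A + (K + B ** C) + R)) *v a) + matrix_exp (t *R parabolic_gen n Z) *v b)"
  "\<And>x y. norm (block_vec (x + \<Psi> *v y) (\<Theta> *v x + y)) \<le> 2 * (norm x + norm y)"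
proof -
 let ?Ga = "of_int n *R A + (K + B ** C) + R"
 have nT: "norm \<Theta> \<le> 1 / 4" "norm \<Psi> \<le> 1 / 4"
 proof -
  have "c / absr n \<le> 1 / 4" using n by (simp add: divide_le_eq)
  moreover have "norm \<Theta> \<le> c / absr n" "norm \<Psi> \<le> c / absr n" using d by (auto simp: decoupled_def)
  ultimately show "norm \<Theta> \<le> 1 / 4" "norm \<Psi> \<le> 1 / 4" by linarith+
 qed
 have pert: "norm (block_vec (\<Psi> *v y) (\<Theta> *v x)) \<le> (norm x + norm y) / 4" for x y
 proof -
  have "norm (\<Psi> *v y) \<le> 1 / 4 * norm y" "norm (\<Theta> *v x) \<le> 1 / 4 * norm x"
   by (rule order.trans[OF norm_matrix_vector_le] mult_right_mono nT norm_ge_zero)+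
  then show ?thesis using norm_block_vec_le[of "\<Psi> *v y" "\<Theta> *v x"] by simp
 qed
 define L where "L = (\<lambda>u. block_vec (fst_block u + \<Psi> *v snd_block u) (\<Theta> *v fst_block u + snd_block u))"
 have lin: "linear L" unfolding linear_iff L_def
  by (simp add: block_vec_add block_vec_scaleR fst_block_add snd_block_add fst_block_scaleR snd_block_scaleR
    matrix_vector_right_distrib matrix_scaleR_right scaleR_add_right add_ac)
 have Ld: "norm (L u - u) \<le> norm u / 2" for u
 proof -
  have "L u = u + block_vec (\<Psi> *v snd_block u) (\<Theta> *v fst_block u)"
   by (simp add: L_def block_vec_eq_iff fst_block_add snd_block_add add.commute)
  then have "norm (L u - u) \<le> (norm (fst_block u) + norm (snd_block u)) / 4" using pert by simp
  also have "... \<le> norm u / 2" using norm_fst_block_le[of u] norm_snd_block_le[of u] by simp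
  finally show ?thesis .
 qed
 obtain u where u: "L u = v" "norm u \<le> 2 * norm v" by (rule near_identity_surj[OF lin Ld])
 have ia: "block_vec (matrix_exp (t *R ?Ga) *v a) (\<Theta> *v (matrix_exp (t *R ?Ga) *v a)) = flow t n (block_vec a (\<Theta> *v a))" for t a
  unfolding flow_def by (rule matrix_exp_intertwine_scaleR[of "\<lambda>a. block_vec a (\<Theta> *v a)"])
   (use d in \<open>auto simp: decoupled_def intro!: bounded_linear_block_vec bounded_linear_ident bounded_linear_matrix_vector\<close>)
 have ib: "block_vec (\<Psi> *v (matrix_exp (t *R parabolic_gen n Z) *v b)) (matrix_exp (t *R parabolic_gen n Z) *v b) = flow t n (block_vec (\<Psi> *v b) b)" for t b
  unfolding flow_def by (rule matrix_exp_intertwine_scaleR[of "\<lambda>b. block_vec (\<Psi> *v b) b"])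
   (use d in \<open>auto simp: decoupled_def intro!: bounded_linear_block_vec bounded_linear_ident bounded_linear_matrix_vector\<close>)
 show ?thesis
 proof (rule that[of "fst_block u" "snd_block u"])
  show "norm (fst_block u) \<le> 2 * norm v" "norm (snd_block u) \<le> 2 * norm v"
   using u(2) norm_fst_block_le[of u] norm_snd_block_le[of u] by auto
  fix t
  have v: "v = block_vec (fst_block u) (\<Theta> *v fst_block u) + block_vec (\<Psi> *v snd_block u) (snd_block u)"
   using u(1) by (simp add: L_def block_vec_add)
  have "flow t n v = flow t n (block_vec (fst_block u) (\<Theta> *v fst_block u)) + flow t n (block_vec (\<Psi> *v snd_block u) (snd_block u))"
   by (subst v, rule linear_simps(1)[OF bounded_linear_flow])
  then show "flow t n v = block_vec
   (matrix_exp (t *R ?Ga) *v fst_block u + \<Psi> *v (matrix_exp (t *R parabolic_gen n Z) *v snd_block u))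
   (\<Theta> *v (matrix_exp (t *R ?Ga) *v fst_block u) + matrix_exp (t *R parabolic_gen n Z) *v snd_block u)"
   by (simp only: ia[symmetric] ib[symmetric] block_vec_add)
 next
  fix x y
  have "block_vec (x + \<Psi> *v y) (\<Theta> *v x + y) = block_vec x y + block_vec (\<Psi> *v y) (\<Theta> *v x)"
   by (simp add: block_vec_add add.commute)
  then have "norm (block_vec (x + \<Psi> *v y) (\<Theta> *v x + y)) \<le> norm (block_vec x y) + norm (block_vec (\<Psi> *v y) (\<Theta> *v x))"
   by (simp add: norm_triangle_ineq)
  then show "norm (block_vec (x + \<Psi> *v y) (\<Theta> *v x + y)) \<le> 2 * (norm x + norm y)"
   using norm_block_vec_le[of x y] pert[of y x] norm_ge_zero[of x] norm_ge_zero[of y] by argo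
 qed
qed

text \<open>The bound is uniform in \<open>n\<close>: at high frequency through the decoupled form,
  for the finitely many remaining modes through the crude exponential bound.\<close>

lemma flow_bounded:
 assumes T: "0 \<le> T"
 obtains Kb where "1 \<le> Kb" "\<And>n t v. t \<in> {0..T} ==> norm (flow t n v) \<le> Kb * norm v"
proof -
 obtain c N1 :: real where c: "0 < c" and N1: "0 < N1" and dec: "\<And>n. N1 \<le> absr n ==> \<exists>\<Theta> \<Psi> R Z. decoupled c n \<Theta> \<Psi> R Z"
  using decoupling by blast
 obtain Ka N2 :: real where Ka: "1 \<le> Ka" and N2: "0 < N2" and tb: "\<And>n R a t. N2 \<le> absr n ==> norm R \<le> c / absr n ==> t \<in> {0..T} ==>
   norm (matrix_exp (t *R (of_int n *R A + (K + B ** C) + R)) *v a) \<le> Ka * norm a"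
  using transport_bounded[OF Q T less_imp_le[OF c], of \<mu> "K + B ** C", folded A_eq] by blast
 define N where "N = N1 + N2 + 4 * c + 2 * (norm D + c) + 1"
 define F where "F = {n :: int. absr n < N}"
 have "F \<subseteq> {- \<lceil>N\<rceil>..\<lceil>N\<rceil>}" by (auto simp: F_def) linarith+
 then have finF: "finite F" using finite_subset by blast
 define Kb where "Kb = 4 * (Ka + 1) * 2 + (\<Sum>n\<in>F. exp (T * norm (gen n)))"
 have s0: "0 \<le> (\<Sum>n\<in>F. exp (T * norm (gen n)))" by (intro sum_nonneg) auto
 show ?thesis
 proof (rule that[of Kb])
  show "1 \<le> Kb" using Ka s0 by (simp add: Kb_def)
  fix n t v assume t: "t \<in> {0..T}"
  show "norm (flow t n v) \<le> Kb * norm v"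
  proof (cases "n \<in> F")
   case True
   have "norm (flow t n v) \<le> exp (\<bar>t\<bar> * norm (gen n)) * norm v" unfolding flow_def by (rule norm_matrix_exp_scaleR_le)
   also have "... \<le> exp (T * norm (gen n)) * norm v" using t by (intro mult_right_mono) (auto intro: mult_right_mono)
   also have "... \<le> Kb * norm v"
   proof (rule mult_right_mono)
    have "exp (T * norm (gen n)) \<le> (\<Sum>n\<in>F. exp (T * norm (gen n)))" using True finF by (intro member_le_sum) auto
    then show "exp (T * norm (gen n)) \<le> Kb" using Ka by (simp add: Kb_def)
   qed simp
   finally show ?thesis .
  next
   case False
   then have n: "N \<le> absr n" by (simp add: F_def)
   have nn: "N1 \<le> absr n" "N2 \<le> absr n" "4 * c \<le> absr n" "2 * (norm D + c) \<le> absr n" "1 \<le> absr n"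
   proof -
    have "N1 \<le> N" "N2 \<le> N" "4 * c \<le> N" "2 * (norm D + c) \<le> N" "1 \<le> N"
     using N1 N2 c by (auto simp: N_def)
    with n show "N1 \<le> absr n" "N2 \<le> absr n" "4 * c \<le> absr n" "2 * (norm D + c) \<le> absr n" "1 \<le> absr n"
     by linarith+
   qed
   obtain \<Theta> \<Psi> R Z where d: "decoupled c n \<Theta> \<Psi> R Z" using dec[OF nn(1)] by blast
   have R: "norm R \<le> c / absr n" "norm Z \<le> c" using d by (auto simp: decoupled_def)
   have n0: "0 < absr n" using nn(5) by linarith
   obtain a b where ab: "norm a \<le> 2 * norm v" "norm b \<le> 2 * norm v" and
    fl: "\<And>t. flow t n v = block_vec
     (matrix_exp (t *R (of_int n *R A + (K + B ** C) + R)) *v a + \<Psi> *v (matrix_exp (t *R parabolic_gen n Z) *v b))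
     (\<Theta> *v (matrix_exp (t *R (of_int n *R A + (K + B ** C) + R)) *v a) + matrix_exp (t *R parabolic_gen n Z) *v b)" and
    bl: "\<And>x y. norm (block_vec (x + \<Psi> *v y) (\<Theta> *v x + y)) \<le> 2 * (norm x + norm y)"
    using decoupled_solution[OF d nn(3) n0, of v] by metis
   have "norm (flow t n v) \<le> 2 * (norm (matrix_exp (t *R (of_int n *R A + (K + B ** C) + R)) *v a) +
     norm (matrix_exp (t *R parabolic_gen n Z) *v b))" unfolding fl by (rule bl)
   also have "... \<le> 2 * (Ka * norm a + 1 * norm b)"
   proof (intro mult_left_mono add_mono tb nn R t)
    have "norm (matrix_exp (t *R parabolic_gen n Z) *v b) \<le> exp (- ((of_int n)^2 * t / 2)) * norm b"
     using t by (intro parabolic_decay[OF R(2) nn(4,5)]) auto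
    also have "... \<le> 1 * norm b" using t by (intro mult_right_mono) auto
    finally show "norm (matrix_exp (t *R parabolic_gen n Z) *v b) \<le> 1 * norm b" .
   qed simp
   also have "... \<le> 2 * (Ka * (2 * norm v) + 1 * (2 * norm v))"
    using ab Ka by (intro mult_left_mono add_mono) auto
   also have "... = 4 * (Ka + 1) * norm v" by (simp add: algebra_simps)
   also have "... \<le> Kb * norm v" using Ka s0 by (intro mult_right_mono) (auto simp: Kb_def)
   finally show ?thesis .
  qed
 qed
qed

text \<open>The transport part \<open>\<alpha>\<close> is observed on
  \<open>[\<delta>, T0 + \<delta>]\<close>, where the heat part disturbs by no more than
  \<open>c / N\<close> times its size at \<open>\<delta>\<close>; the heat part
  \<open>\<beta>\<close> is observed on \<open>[0, \<delta>]\<close>, where the transport part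
  disturbs by a bounded factor. The product of the two couplings is small for large
  \<open>N\<close>, so the pair of inequalities can be solved for \<open>\<alpha>\<close> and
  \<open>\<beta>\<close>.\<close>

lemma high_frequency_observability:
 assumes T0: "0 < T0" and hit: "\<And>k y. \<exists>t\<in>{0<..<T0}. y - \<mu> k * t \<in> \<Omega>" and \<delta>: "0 < \<delta>" "\<delta> \<le> 1"
 obtains M N :: real where "0 < M" "0 < N"
  "\<And>S v. finite S ==> (\<And>n. n \<in> S ==> N \<le> absr n) ==>
   (\<Sum>n\<in>S. nsq (flow (T0 + \<delta>) n (v n))) \<le> M * obs 0 (T0 + \<delta>) S v"
proof -
 let ?T = "T0 + \<delta>"
 have T: "0 \<le> ?T" "\<delta> < ?T" "0 \<le> \<delta>" using T0 \<delta> by auto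
 obtain c N1 :: real where c: "0 < c" and N1: "0 < N1" and dec: "\<And>n. N1 \<le> absr n ==> \<exists>\<Theta> \<Psi> R Z. decoupled c n \<Theta> \<Psi> R Z"
  using decoupling by blast
 note c0 = less_imp_le[OF c]
 obtain Ka N2 :: real where Ka: "1 \<le> Ka" and N2: "0 < N2" and tb: "\<And>n R a t. N2 \<le> absr n ==> norm R \<le> c / absr n ==> t \<in> {0..?T} ==>
   norm (matrix_exp (t *R (of_int n *R A + (K + B ** C) + R)) *v a) \<le> Ka * norm a"
  using transport_bounded[OF Q T(1) c0, of \<mu> "K + B ** C", folded A_eq] by blast
 \<comment> \<open>Delaying the window by \<open>\<delta>\<close> amounts to shifting the starting
   point of the characteristic.\<close>
 have hit': "\<exists>t\<in>{\<delta><..<?T}. y - \<mu> k * t \<in> \<Omega>" for k y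
 proof -
  obtain s where "s \<in> {0<..<T0}" "(y - \<mu> k * \<delta>) - \<mu> k * s \<in> \<Omega>" using hit by blast
  then show ?thesis by (intro bexI[of _ "\<delta> + s"]) (auto simp: algebra_simps)
 qed
 obtain C1 N3 :: real where C1: "0 < C1" and N3: "0 < N3" and hyp:
  "\<And>S R a. finite S ==> (\<And>n. n \<in> S ==> N3 \<le> absr n) ==> (\<And>n. n \<in> S ==> norm (R n) \<le> c / absr n) ==>
   (\<Sum>n\<in>S. nsq (a n)) \<le> C1 * integral {\<delta>..?T} (\<lambda>t. energy X S
    (\<lambda>n. matrix_exp (t *R (of_int n *R A + (K + B ** C) + R n)) *v a n))"
 proof (rule hyperbolic_observability[where \<mu> = \<mu> and K = "K + B ** C", OF Q c0 T(3,2) \<mu> hit', folded A_eq])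
  fix C1 N3 :: real
  assume h: "0 < C1" "0 < N3" "\<And>S R a. finite S ==> (\<And>n. n \<in> S ==> N3 \<le> absr n) ==> (\<And>n. n \<in> S ==> norm (R n) \<le> c / absr n) ==>
   (\<Sum>n\<in>S. nsq (a n)) \<le> C1 * integral {\<delta>..?T} (\<lambda>t. energy X S
    (\<lambda>n. matrix_exp (t *R (of_int n *R A + (K + B ** C) + R n)) *v a n))"
  show thesis by (rule that[of C1 N3]; fact)
 qed
 obtain C2 N4 :: real where C2: "0 < C2" and N4: "0 < N4" and par:
  "\<And>S \<Theta> \<Psi> R Z b. finite S ==> (\<And>n. n \<in> S ==> N4 \<le> absr n) ==>
   (\<And>n. n \<in> S ==> decoupled c n (\<Theta> n) (\<Psi> n) (R n) (Z n)) ==>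
   (\<Sum>n\<in>S. nsq (matrix_exp (\<delta> *R parabolic_gen n (Z n)) *v b n)) \<le>
    C2 * integral {0..\<delta>} (\<lambda>t. energy X S (\<lambda>n. \<Psi> n *v (matrix_exp (t *R parabolic_gen n (Z n)) *v b n)))"
  using parabolic_observability[OF kalman c \<delta>] by blast
 define H1 where "H1 = 4 * pi * c^2 * T0 * C1"
 define H2 where "H2 = 4 * pi * Ka^2 * \<delta> * C2"
 have H: "0 \<le> H1" "0 \<le> H2" using T0 C1 C2 \<delta> by (auto simp: H1_def H2_def)
 \<comment> \<open>\<open>H1\<close> and \<open>H2\<close> are the coupling constants of the two
   estimates; the last summands ensure \<open>H1 / N^2 \<le> 1\<close> and
   \<open>H1 / N^2 * H2 \<le> 1 / 2\<close>.\<close>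
 define N where "N = N1 + N2 + N3 + N4 + 4 * c + 2 * (norm D + c) + 1 + H1 + 2 * H1 * H2"
 have Nb: "N1 \<le> N" "N2 \<le> N" "N3 \<le> N" "N4 \<le> N" "4 * c \<le> N" "2 * (norm D + c) \<le> N" "1 \<le> N" "H1 \<le> N" "2 * H1 * H2 \<le> N"
 proof -
  have "0 \<le> 2 * H1 * H2" using H by simp
  then show "N1 \<le> N" "N2 \<le> N" "N3 \<le> N" "N4 \<le> N" "4 * c \<le> N" "2 * (norm D + c) \<le> N" "1 \<le> N" "H1 \<le> N" "2 * H1 * H2 \<le> N"
   using N1 N2 N3 N4 c H by (auto simp: N_def)
 qed
 have NN: "N \<le> N^2" using Nb(7) by (simp add: power2_eq_square)
 define CC where "CC = 4 * C1 + 4 * C2"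
 have CC: "0 < CC" using C1 C2 by (simp add: CC_def)
 define Cf where "Cf = 8 * Ka^2 * CC + 8 * (2 * C2 + H2 * CC)"
 have Cf: "0 < Cf" using CC C2 H Ka by (auto simp: Cf_def intro!: add_pos_nonneg)
 show ?thesis
 proof (rule that[OF Cf, of N])
  show "0 < N" using Nb by simp
  fix S and v :: "int => complex^('p + 'q)"
  assume fin: "finite S" and nS: "\<And>n. n \<in> S ==> N \<le> absr n"
  have nn: "N1 \<le> absr n" "N2 \<le> absr n" "N3 \<le> absr n" "N4 \<le> absr n" "4 * c \<le> absr n"
    "2 * (norm D + c) \<le> absr n" "1 \<le> absr n" "0 < absr n" if "n \<in> S" for n
   using nS[OF that] Nb by - linarith+
  have "\<forall>n\<in>S. \<exists>p. decoupled c n (fst p) (fst (snd p)) (fst (snd (snd p))) (snd (snd (snd p)))"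
   using dec nn(1) by (metis fst_conv snd_conv)
  from bchoice[OF this] obtain p where p: "\<forall>n\<in>S. decoupled c n (fst (p n)) (fst (snd (p n))) (fst (snd (snd (p n)))) (snd (snd (snd (p n))))"
   by blast
  define \<Theta> \<Psi> R Z where "\<Theta> = (\<lambda>n. fst (p n))" and "\<Psi> = (\<lambda>n. fst (snd (p n)))" and "R = (\<lambda>n. fst (snd (snd (p n))))"
   and "Z = (\<lambda>n. snd (snd (snd (p n))))"
  have d: "decoupled c n (\<Theta> n) (\<Psi> n) (R n) (Z n)" if "n \<in> S" for n
   using p that by (simp add: \<Theta>_def \<Psi>_def R_def Z_def)
  have dn: "norm (\<Psi> n) \<le> c / absr n" "norm (R n) \<le> c / absr n" "norm (Z n) \<le> c" if "n \<in> S" for n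
   using d[OF that] by (auto simp: decoupled_def)
  define ga where "ga = (\<lambda>n t a. matrix_exp (t *R (of_int n *R A + (K + B ** C) + R n)) *v a)"
  define gb where "gb = (\<lambda>n t b. matrix_exp (t *R parabolic_gen n (Z n)) *v b)"
  define sol where "sol = (\<lambda>n p. (\<forall>t. flow t n (v n) = block_vec (ga n t (fst p) + \<Psi> n *v gb n t (snd p)) (\<Theta> n *v ga n t (fst p) + gb n t (snd p))) \<and>
   (\<forall>x y. norm (block_vec (x + \<Psi> n *v y) (\<Theta> n *v x + y)) \<le> 2 * (norm x + norm y)))"
  have "\<forall>n\<in>S. \<exists>p. sol n p"
  proof
   fix n assume n: "n \<in> S"
   show "\<exists>p. sol n p"
    by (rule decoupled_solution[OF d[OF n] nn(5)[OF n] nn(8)[OF n], of "v n"]) (auto simp: sol_def ga_def gb_def)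
  qed
  from bchoice[OF this] obtain ab where ab: "\<forall>n\<in>S. sol n (ab n)" by blast
  define a b where "a = (\<lambda>n. ga n 0 (fst (ab n)))" and "b = (\<lambda>n. snd (ab n))"
  have a: "fst (ab n) = a n" for n by (simp add: a_def ga_def)
  have fl: "flow t n (v n) = block_vec (ga n t (a n) + \<Psi> n *v gb n t (b n)) (\<Theta> n *v ga n t (a n) + gb n t (b n))"
   and bl: "norm (block_vec (x + \<Psi> n *v y) (\<Theta> n *v x + y)) \<le> 2 * (norm x + norm y)" if "n \<in> S" for n t x y
   using ab that by (auto simp: sol_def a b_def)
  let ?E = "energy X S"
  define g1 where "g1 = (\<lambda>t n. fst_block (flow t n (v n)))"
  define av where "av = (\<lambda>t n. ga n t (a n))"
  define pb where "pb = (\<lambda>t n. \<Psi> n *v gb n t (b n))"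
  have g1: "g1 t n = av t n + pb t n" if "n \<in> S" for t n
   using fl[OF that] by (simp add: g1_def av_def pb_def)
  define \<alpha> where "\<alpha> = (\<Sum>n\<in>S. nsq (a n))"
  define \<beta> where "\<beta> = (\<Sum>n\<in>S. nsq (gb n \<delta> (b n)))"
  define Ob where "Ob = obs 0 ?T S v"
  have Ob: "0 \<le> Ob" by (simp add: Ob_def obs_nonneg)
  have pos: "0 \<le> \<alpha>" "0 \<le> \<beta>" by (auto simp: \<alpha>_def \<beta>_def sum_nonneg)
  have c1: "continuous_on U (\<lambda>t. ?E (g1 t))" "continuous_on U (\<lambda>t. ?E (av t))" "continuous_on U (\<lambda>t. ?E (pb t))" for U
   unfolding g1_def av_def pb_def ga_def gb_def
   by (intro continuous_intros continuous_on_matrix_vector)+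
  note int = c1[THEN integrable_continuous_real]
  have ga_bd: "norm (av t n) \<le> Ka * norm (a n)" if "n \<in> S" "t \<in> {0..?T}" for n t
   unfolding av_def ga_def using that nn dn by (intro tb) auto
  have gb_dec: "norm (gb n t (b n)) \<le> norm (gb n \<delta> (b n))" if n: "n \<in> S" and t: "\<delta> \<le> t" for n t
  proof -
   have "gb n t (b n) = matrix_exp ((t - \<delta>) *R parabolic_gen n (Z n)) *v gb n \<delta> (b n)"
    unfolding gb_def using matrix_exp_add_vector[of "t - \<delta>" \<delta> "parabolic_gen n (Z n)" "b n"] by simp
   then have "norm (gb n t (b n)) \<le> exp (- ((of_int n)^2 * (t - \<delta>) / 2)) * norm (gb n \<delta> (b n))"
    using parabolic_decay[OF dn(3)[OF n] nn(6,7)[OF n], of "t - \<delta>"] t by simp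
   also have "... \<le> 1 * norm (gb n \<delta> (b n))" using t by (intro mult_right_mono) auto
   finally show ?thesis by simp
  qed
  have Ea: "?E (av t) \<le> 2 * ?E (g1 t) + 2 * ?E (pb t)" and Eb: "?E (pb t) \<le> 2 * ?E (g1 t) + 2 * ?E (av t)" for t
  proof -
   have e1: "?E (av t) = ?E (\<lambda>n. g1 t n - pb t n)" by (intro energy_cong) (simp add: g1)
   show "?E (av t) \<le> 2 * ?E (g1 t) + 2 * ?E (pb t)" by (subst e1) (rule energy_diff_le)
   have e2: "?E (pb t) = ?E (\<lambda>n. g1 t n - av t n)" by (intro energy_cong) (simp add: g1)
   show "?E (pb t) \<le> 2 * ?E (g1 t) + 2 * ?E (av t)" by (subst e2) (rule energy_diff_le)
  qed
  have Epb: "?E (pb t) \<le> 2 * pi * c^2 / N^2 * \<beta>" if t: "t \<in> {\<delta>..?T}" for t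
  proof -
   have "?E (pb t) \<le> 2 * pi * (\<Sum>n\<in>S. nsq (pb t n))" by (rule energy_le[OF fin])
   also have "... \<le> 2 * pi * (\<Sum>n\<in>S. (c / N * norm (gb n \<delta> (b n)))^2)"
   proof (intro mult_left_mono sum_mono power_mono)
    fix n assume n: "n \<in> S"
    have "norm (pb t n) \<le> norm (\<Psi> n) * norm (gb n t (b n))" unfolding pb_def by (rule norm_matrix_vector_le)
    also have "... \<le> c / N * norm (gb n \<delta> (b n))"
    proof (rule mult_mono[OF _ gb_dec])
     have "c / absr n \<le> c / N" using nS[OF n] Nb c by (intro divide_left_mono) auto
     with dn(1)[OF n] show "norm (\<Psi> n) \<le> c / N" by linarith
    qed (use n t c Nb in auto)
    finally show "norm (pb t n) \<le> c / N * norm (gb n \<delta> (b n))" .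
   qed auto
   also have "... = 2 * pi * c^2 / N^2 * \<beta>"
    by (simp add: \<beta>_def power_mult_distrib power_divide sum_distrib_left mult.assoc)
   finally show ?thesis .
  qed
  have Eat: "?E (av t) \<le> 2 * pi * Ka^2 * \<alpha>" if t: "t \<in> {0..\<delta>}" for t
  proof -
   have "?E (av t) \<le> 2 * pi * (\<Sum>n\<in>S. nsq (av t n))" by (rule energy_le[OF fin])
   also have "... \<le> 2 * pi * (\<Sum>n\<in>S. (Ka * norm (a n))^2)"
    using t T0 by (intro mult_left_mono sum_mono power_mono ga_bd) auto
   finally show ?thesis by (simp add: \<alpha>_def power_mult_distrib sum_distrib_left mult.assoc)
  qed
  have I1: "integral {\<delta>..?T} (\<lambda>t. ?E (g1 t)) \<le> Ob" "integral {0..\<delta>} (\<lambda>t. ?E (g1 t)) \<le> Ob"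
   using obs_mono[of 0 \<delta> ?T ?T S v] obs_mono[of 0 0 \<delta> ?T S v] T0 \<delta> by (auto simp: Ob_def obs_def g1_def)
  have "\<alpha> \<le> C1 * integral {\<delta>..?T} (\<lambda>t. ?E (av t))"
   unfolding \<alpha>_def av_def ga_def by (intro hyp fin nn dn)
  also have "integral {\<delta>..?T} (\<lambda>t. ?E (av t)) \<le> integral {\<delta>..?T} (\<lambda>t. 2 * ?E (g1 t) + 2 * (2 * pi * c^2 / N^2 * \<beta>))"
  proof (rule integral_le)
   show "?E (av t) \<le> 2 * ?E (g1 t) + 2 * (2 * pi * c^2 / N^2 * \<beta>)" if "t \<in> {\<delta>..?T}" for t
    using Ea[of t] Epb[OF that] by linarith
  qed (intro integrable_continuous_real continuous_intros c1)+
  also have "... = 2 * integral {\<delta>..?T} (\<lambda>t. ?E (g1 t)) + T0 * (2 * (2 * pi * c^2 / N^2 * \<beta>))"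
   using T0 int by (subst Henstock_Kurzweil_Integration.integral_add) auto
  also have "... \<le> 2 * Ob + T0 * (2 * (2 * pi * c^2 / N^2 * \<beta>))" using I1 by simp
  finally have A1: "\<alpha> \<le> C1 * (2 * Ob + T0 * (2 * (2 * pi * c^2 / N^2 * \<beta>)))" using C1 by simp
  have "C1 * (2 * Ob + T0 * (2 * (2 * pi * c^2 / N^2 * \<beta>))) = 2 * C1 * Ob + H1 / N^2 * \<beta>"
   by (simp add: H1_def algebra_simps)
  with A1 have A2: "\<alpha> \<le> 2 * C1 * Ob + H1 / N^2 * \<beta>" by linarith
  have "\<beta> \<le> C2 * integral {0..\<delta>} (\<lambda>t. ?E (pb t))"
   unfolding \<beta>_def pb_def gb_def by (intro par[OF fin _ d] nn)
  also have "integral {0..\<delta>} (\<lambda>t. ?E (pb t)) \<le> integral {0..\<delta>} (\<lambda>t. 2 * ?E (g1 t) + 2 * (2 * pi * Ka^2 * \<alpha>))"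
  proof (rule integral_le)
   show "?E (pb t) \<le> 2 * ?E (g1 t) + 2 * (2 * pi * Ka^2 * \<alpha>)" if "t \<in> {0..\<delta>}" for t
    using Eb[of t] Eat[OF that] by linarith
  qed (intro integrable_continuous_real continuous_intros c1)+
  also have "... = 2 * integral {0..\<delta>} (\<lambda>t. ?E (g1 t)) + \<delta> * (2 * (2 * pi * Ka^2 * \<alpha>))"
   using \<delta> int by (subst Henstock_Kurzweil_Integration.integral_add) auto
  also have "... \<le> 2 * Ob + \<delta> * (2 * (2 * pi * Ka^2 * \<alpha>))" using I1 by simp
  finally have B1: "\<beta> \<le> C2 * (2 * Ob + \<delta> * (2 * (2 * pi * Ka^2 * \<alpha>)))" using C2 by simp
  have "C2 * (2 * Ob + \<delta> * (2 * (2 * pi * Ka^2 * \<alpha>))) = 2 * C2 * Ob + H2 * \<alpha>"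
   by (simp add: H2_def algebra_simps)
  with B1 have B2: "\<beta> \<le> 2 * C2 * Ob + H2 * \<alpha>" by linarith
  have h1: "H1 / N^2 \<le> 1" "H1 / N^2 * H2 \<le> 1 / 2"
  proof -
   have "0 < N^2" using Nb by simp
   then show "H1 / N^2 \<le> 1" "H1 / N^2 * H2 \<le> 1 / 2" using Nb(8,9) NN by (auto simp: divide_le_eq)
  qed
  have "H1 / N^2 * \<beta> \<le> H1 / N^2 * (2 * C2 * Ob + H2 * \<alpha>)"
   using B2 H by (intro mult_left_mono) auto
  also have "... = H1 / N^2 * (2 * C2 * Ob) + (H1 / N^2 * H2) * \<alpha>" by (simp add: distrib_left)
  also have "... \<le> 1 * (2 * C2 * Ob) + 1 / 2 * \<alpha>"
   using h1 C2 Ob pos by (intro add_mono mult_right_mono) auto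
  finally have \<alpha>: "\<alpha> \<le> CC * Ob" using A2 by (simp add: CC_def algebra_simps)
  have "H2 * \<alpha> \<le> H2 * (CC * Ob)" using \<alpha> H by (intro mult_left_mono) auto
  with B2 have \<beta>: "\<beta> \<le> (2 * C2 + H2 * CC) * Ob" by (simp add: algebra_simps)
  have "(\<Sum>n\<in>S. nsq (flow ?T n (v n))) \<le> (\<Sum>n\<in>S. 8 * Ka^2 * nsq (a n) + 8 * nsq (gb n \<delta> (b n)))"
  proof (rule sum_mono)
   fix n assume n: "n \<in> S"
   have "norm (flow ?T n (v n)) \<le> 2 * (norm (ga n ?T (a n)) + norm (gb n ?T (b n)))"
    unfolding fl[OF n] by (rule bl[OF n])
   also have "... \<le> 2 * (Ka * norm (a n) + norm (gb n \<delta> (b n)))"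
    using ga_bd[OF n, of ?T] gb_dec[OF n, of ?T] T by (intro mult_left_mono add_mono) (auto simp: av_def)
   finally have "nsq (flow ?T n (v n)) \<le> (2 * (Ka * norm (a n) + norm (gb n \<delta> (b n))))^2"
    by (intro power_mono) auto
   also have "... = 4 * nsq (Ka * norm (a n) + norm (gb n \<delta> (b n)))"
    by (simp only: power_mult_distrib real_norm_def power2_abs) simp
   also have "... \<le> 4 * (2 * nsq (Ka * norm (a n)) + 2 * nsq (norm (gb n \<delta> (b n))))"
    by (intro mult_left_mono norm_add_sq_le) auto
   finally show "nsq (flow ?T n (v n)) \<le> 8 * Ka^2 * nsq (a n) + 8 * nsq (gb n \<delta> (b n))"
    by (simp add: power_mult_distrib)
  qed
  also have "... = 8 * Ka^2 * \<alpha> + 8 * \<beta>"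
   by (simp add: \<alpha>_def \<beta>_def sum.distrib sum_distrib_left)
  also have "... \<le> 8 * Ka^2 * (CC * Ob) + 8 * ((2 * C2 + H2 * CC) * Ob)"
   using \<alpha> \<beta> by (intro add_mono mult_left_mono) auto
  also have "... = Cf * Ob" by (simp add: Cf_def algebra_simps)
  finally show "(\<Sum>n\<in>S. nsq (flow ?T n (v n))) \<le> Cf * obs 0 ?T S v" by (simp add: Ob_def)
 qed
qed

end

section \<open>Low frequencies\<close>

text \<open>Convexity of a quadratic form. With \<open>m\<close> the mean,
  \<open>2 * I (c s) - energy X S m\<close> lies below the energy of \<open>c s\<close>; the first
  term is linear in the coefficients, so integrating in \<open>s\<close> replaces \<open>c s\<close>
  by \<open>m\<close>.\<close>

lemma (in obs_set) energy_average_le: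
 fixes c :: "real => int => complex^'k"
 assumes fin: "finite S" and c: "\<And>n. n \<in> S ==> continuous_on {0..h} (\<lambda>s. c s n)" and h: "0 < h"
 shows "energy X S (\<lambda>n. (1 / h) *R integral {0..h} (\<lambda>s. c s n)) \<le> (1 / h) * integral {0..h} (\<lambda>s. energy X S (c s))"
proof -
 define m where "m = (\<lambda>n. (1 / h) *R integral {0..h} (\<lambda>s. c s n))"
 define I where "I = (\<lambda>d :: int => complex^'k. LINT x:X|lborel. inner (tpoly S d x) (tpoly S m x))"
 define l where "l = (\<lambda>n u. \<Sum>k\<in>S. Re ((LINT x:X|lborel. cis (of_int (k - n) * x)) * cinner u (m k)))"
 have I: "I d = (\<Sum>n\<in>S. l n (d n))" for d unfolding I_def l_def by (rule integral_inner_tpoly)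
 have bl: "bounded_linear (l n)" for n
 proof (rule linear_conv_bounded_linear[THEN iffD1], unfold linear_iff, intro conjI allI)
  show "l n (x + y) = l n x + l n y" for x y
   by (simp add: l_def cinner_def algebra_simps sum.distrib sum_subtractf sum_distrib_left)
  show "l n (r *R x) = r *R l n x" for r x unfolding l_def cinner_def scaleR_sum_right
   by (simp add: sum_distrib_left algebra_simps)
 qed
 have cE: "continuous_on {0..h} (\<lambda>s. energy X S (c s))" using c by (rule continuous_on_energy)
 have cl: "continuous_on {0..h} (\<lambda>s. l n (c s n))" if "n \<in> S" for n
  by (rule bounded_linear.continuous_on[OF bl c[OF that]])
 have "2 * I (c s) - energy X S m \<le> energy X S (c s)" for s
 proof -
  have "(LINT x:X|lborel. 2 * inner (tpoly S (c s) x) (tpoly S m x) - nsq (tpoly S m x)) \<le> energy X S (c s)"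
   unfolding energy_def
  proof (rule set_integral_mono)
   show "2 * inner (tpoly S (c s) x) (tpoly S m x) - nsq (tpoly S m x) \<le> nsq (tpoly S (c s) x)" for x
    using zero_le_power2[of "norm (tpoly S (c s) x - tpoly S m x)"]
    unfolding power2_norm_eq_inner by (simp add: inner_diff inner_commute)
  qed (intro set_integral_diff set_integrable_mult_right set_integrable_inner_tpoly set_integrable_norm_tpoly)+
  moreover have "(LINT x:X|lborel. 2 * inner (tpoly S (c s) x) (tpoly S m x) - nsq (tpoly S m x)) = 2 * I (c s) - energy X S m"
   unfolding I_def energy_def
   by (subst set_integral_diff(2)) (auto intro!: set_integrable_mult_right set_integrable_inner_tpoly set_integrable_norm_tpoly)
  ultimately show ?thesis by simp
 qed
 then have "integral {0..h} (\<lambda>s. 2 * I (c s) - energy X S m) \<le> integral {0..h} (\<lambda>s. energy X S (c s))"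
  unfolding I using cl cE by (intro integral_le integrable_continuous_real) (auto intro!: continuous_intros)
 moreover have "integral {0..h} (\<lambda>s. 2 * I (c s) - energy X S m) = 2 * (\<Sum>n\<in>S. integral {0..h} (\<lambda>s. l n (c s n))) - h * energy X S m"
  unfolding I using cl h fin by (subst Henstock_Kurzweil_Integration.integral_diff)
   (auto intro!: integrable_continuous_real continuous_intros simp: Henstock_Kurzweil_Integration.integral_sum integrable_continuous_real)
 moreover have "(\<Sum>n\<in>S. integral {0..h} (\<lambda>s. l n (c s n))) = h * energy X S m"
 proof -
  have "integral {0..h} (\<lambda>s. l n (c s n)) = h * l n (m n)" if "n \<in> S" for n
  proof -
   have "integral {0..h} (\<lambda>s. l n (c s n)) = l n (integral {0..h} (\<lambda>s. c s n))"
    using integral_linear[OF integrable_continuous_real[OF c[OF that]] bl[of n]] by (simp add: o_def)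
   also have "integral {0..h} (\<lambda>s. c s n) = h *R m n" using h by (simp add: m_def)
   also have "l n (h *R m n) = h * l n (m n)" by (simp add: linear_simps(5)[OF bl])
   finally show ?thesis .
  qed
  then have "(\<Sum>n\<in>S. integral {0..h} (\<lambda>s. l n (c s n))) = h * I m"
   by (simp add: I sum_distrib_left)
  then show ?thesis by (simp add: I_def energy_def power2_norm_eq_inner)
 qed
 ultimately have "h * energy X S m \<le> integral {0..h} (\<lambda>s. energy X S (c s))" by simp
 then show ?thesis using h by (simp add: m_def[symmetric] field_simps)
qed

section \<open>Filters built from time averages\<close>

lemma linear_dependence_sequence:
 fixes f :: "nat => 'a::euclidean_space"
 obtains c k where "k \<le> DIM('a)" "c k \<noteq> 0" "(\<Sum>k\<le>DIM('a). c k *R f k) = (0::'a)"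
proof (cases "inj_on f {..DIM('a)}")
 case True
 then have "card (f ` {..DIM('a)}) > DIM('a)" by (simp add: card_image)
 then have "dependent (f ` {..DIM('a)})" by (intro dependent_biggerset) auto
 then obtain u v where u: "v \<in> f ` {..DIM('a)}" "u v \<noteq> 0" "(\<Sum>v\<in>f ` {..DIM('a)}. u v *R v) = 0"
  using dependent_finite[of "f ` {..DIM('a)}"] by auto
 then obtain k where "k \<le> DIM('a)" "v = f k" by auto
 then show ?thesis using u True by (intro that[of k "\<lambda>k. u (f k)"]) (auto simp: sum.reindex)
next
 case False
 then obtain i j where ij: "i \<le> DIM('a)" "j \<le> DIM('a)" "i \<noteq> j" "f i = f j" by (auto simp: inj_on_def)
 have "(\<Sum>k\<le>DIM('a). ((if k = i then 1 else 0) - (if k = j then 1 else 0)) *R f k) =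
   (\<Sum>k\<le>DIM('a). if k = i then f k else 0) - (\<Sum>k\<le>DIM('a). if k = j then f k else 0)"
  by (subst sum_subtractf[symmetric]) (intro sum.cong refl, auto)
 also have "... = 0" using ij by simp
 finally show ?thesis using ij by (intro that[of i "\<lambda>k. (if k = i then 1 else 0) - (if k = j then 1 else 0)"]) auto
qed

text \<open>The powers of \<open>M\<close> are linearly dependent over the reals. As
  \<open>M\<close> is injective, the lowest power that occurs can be cancelled, and the constant
  coefficient is then normalized to 1. This constant term is what keeps the filter invertible on
  modes whose average is small.\<close>

lemma annihilating_polynomial:
 fixes M :: "complex^'n^'n"
 assumes inv: "\<And>x. norm (M *v x - x) \<le> norm x / 2"
 obtains p :: "nat => real" where "p 0 = 1"
  "\<And>x. (\<Sum>k\<le>DIM(complex^'n^'n). p k *R (matrix_power M k *v x)) = 0"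
proof -
 define d where "d = DIM(complex^'n^'n)"
 obtain c k where k: "k \<le> d" "c k \<noteq> 0" and z: "(\<Sum>k\<le>d. c k *R matrix_power M k) = 0"
  unfolding d_def by (rule linear_dependence_sequence[of "matrix_power M"])
 define j where "j = (LEAST k. c k \<noteq> 0)"
 have j: "c j \<noteq> 0" "\<And>i. i < j ==> c i = 0" "j \<le> d"
  unfolding j_def using k LeastI[of "\<lambda>k. c k \<noteq> 0", OF k(2)] not_less_Least[of _ "\<lambda>k. c k \<noteq> 0"]
   Least_le[of "\<lambda>k. c k \<noteq> 0", OF k(2)] by (blast, blast, linarith)
 have inj: "x = 0" if "matrix_power M i *v x = 0" for i x using that
 proof (induction i)
  case (Suc i)
  have "matrix_power M i *v x = 0"
   using inv[of "matrix_power M i *v x"] Suc.prems unfolding matrix_power_vector_Suc by simp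
  then show ?case by (rule Suc.IH)
 qed simp
 have add: "matrix_power M (i + l) *v x = matrix_power M i *v (matrix_power M l *v x)" for i l x
  by (induction i) (simp_all only: add_Suc matrix_power_vector_Suc, simp)
 define p where "p = (\<lambda>k. if k + j \<le> d then c (k + j) / c j else 0)"
 show ?thesis
 proof (rule that[of p])
  show "p 0 = 1" using j by (simp add: p_def)
  fix x
  have "0 = (\<Sum>k\<le>d. c k *R matrix_power M k) *v x" by (simp add: z)
  also have "... = (\<Sum>k\<le>d. c k *R (matrix_power M k *v x))"
   by (simp add: bounded_bilinear.sum_left[OF bounded_bilinear_matrix_vector] matrix_scaleR_left)
  also have "... = (\<Sum>k\<in>{j..d}. c k *R (matrix_power M k *v x))"
   using j by (intro sum.mono_neutral_right) auto
  also have "... = (\<Sum>k\<in>{0..d - j}. c (k + j) *R (matrix_power M (k + j) *v x))"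
   using sum.shift_bounds_cl_nat_ivl[of "\<lambda>k. c k *R (matrix_power M k *v x)" 0 j "d - j"] j(3) by simp
  also have "... = matrix_power M j *v (\<Sum>k\<in>{0..d - j}. c (k + j) *R (matrix_power M k *v x))"
   by (simp add: matrix_vector_sum matrix_scaleR_right add add.commute[of _ j])
  finally have "(\<Sum>k\<in>{0..d - j}. c (k + j) *R (matrix_power M k *v x)) = 0" using inj by metis
  moreover have "(\<Sum>k\<le>d. p k *R (matrix_power M k *v x)) = (\<Sum>k\<in>{0..d - j}. p k *R (matrix_power M k *v x))"
   by (intro sum.mono_neutral_right) (auto simp: p_def)
  moreover have "... = (1 / c j) *R (\<Sum>k\<in>{0..d - j}. c (k + j) *R (matrix_power M k *v x))"
   unfolding scaleR_sum_right by (intro sum.cong) (use j(3) in \<open>auto simp: p_def\<close>)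
  ultimately show "(\<Sum>k\<le>DIM(complex^'n^'n). p k *R (matrix_power M k *v x)) = 0" by (simp add: d_def)
 qed
qed

context observed_system
begin

text \<open>Averaging along the flow commutes with the flow, and its observation is controlled by
  that of the data over a time longer by \<open>h\<close>. At high frequency it damps the mode
  \<open>n\<close> to the order \<open>1 / \<bar>n\<bar>\<close>.\<close>

definition avg :: "real => int => complex^('p + 'q)^('p + 'q)"
 where "avg h n = (1 / h) *R integral {0..h} (\<lambda>s. matrix_exp (s *R gen n))"

lemma avg_vector: "avg h n *v v = (1 / h) *R integral {0..h} (\<lambda>s. flow s n v)"
proof -
 have "(\<lambda>s. matrix_exp (s *R gen n)) integrable_on {0..h}"
  by (intro integrable_continuous_real continuous_intros)
 from integral_linear[OF this bounded_bilinear.bounded_linear_left[OF bounded_bilinear_matrix_vector, of v]]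
 show ?thesis by (simp add: avg_def flow_def matrix_scaleR_left o_def)
qed

lemma flow_avg: "flow t n (avg h n *v v) = avg h n *v flow t n v"
proof -
 have "(\<lambda>s. flow s n v) integrable_on {0..h}" by (intro integrable_continuous_real continuous_intros)
 from integral_linear[OF this bounded_linear_flow, of t n]
 have "flow t n (integral {0..h} (\<lambda>s. flow s n v)) = integral {0..h} (\<lambda>s. flow t n (flow s n v))" by (simp add: o_def)
 then show ?thesis
  by (simp add: avg_vector linear_simps(5)[OF bounded_linear_flow] flow_add[symmetric] add.commute)
qed

lemma flow_avg_power: "flow t n (matrix_power (avg h n) k *v v) = matrix_power (avg h n) k *v flow t n v"
 by (rule matrix_power_intertwine) (rule flow_avg)

text \<open>Convexity bounds the energy of the average by the average of the energies; exchanging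
  the two time integrals leaves shifted windows, all inside \<open>[t1, t2 + h]\<close>.\<close>

lemma obs_avg_le:
 assumes fin: "finite S" and h: "0 < h" and t: "t1 \<le> t2"
 shows "obs t1 t2 S (\<lambda>n. avg h n *v v n) \<le> obs t1 (t2 + h) S v"
proof -
 define F where "F = (\<lambda>t. energy X S (\<lambda>n. fst_block (flow t n (v n))))"
 have cF: "continuous_on U F" for U unfolding F_def by (rule continuous_on_obs_integrand)
 have cF2: "continuous_on U (\<lambda>(t, s). F (t + s))" for U
  unfolding split_beta by (rule continuous_on_compose2[OF cF[of UNIV]]) (auto intro!: continuous_intros)
 have "energy X S (\<lambda>n. fst_block (flow t n (avg h n *v v n))) \<le> (1 / h) * integral {0..h} (\<lambda>s. F (t + s))" for t
 proof -
  have "fst_block (flow t n (avg h n *v v n)) = (1 / h) *R integral {0..h} (\<lambda>s. fst_block (flow (t + s) n (v n)))" for n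
  proof -
   have "(\<lambda>s. flow (t + s) n (v n)) integrable_on {0..h}" by (intro integrable_continuous_real continuous_intros)
   from integral_linear[OF this bounded_linear_fst_block]
   have "integral {0..h} (\<lambda>s. fst_block (flow (t + s) n (v n))) = fst_block (integral {0..h} (\<lambda>s. flow (t + s) n (v n)))"
    by (simp add: o_def)
   moreover have "flow t n (avg h n *v v n) = (1 / h) *R integral {0..h} (\<lambda>s. flow (t + s) n (v n))"
    by (subst flow_avg) (simp add: avg_vector flow_add[symmetric] add.commute)
   ultimately show ?thesis by (simp add: fst_block_scaleR)
  qed
  then show ?thesis using energy_average_le[OF fin _ h, of "\<lambda>s n. fst_block (flow (t + s) n (v n))"]
   by (simp add: F_def continuous_intros)
 qed
 then have "obs t1 t2 S (\<lambda>n. avg h n *v v n) \<le> integral {t1..t2} (\<lambda>t. (1 / h) * integral {0..h} (\<lambda>s. F (t + s)))"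
  unfolding obs_def by (intro integral_le integrable_obs integrable_continuous_real continuous_intros
    integral_continuous_on_param[of _ 0 h, unfolded cbox_interval] cF2) auto
 also have "... = (1 / h) * integral {0..h} (\<lambda>s. integral {t1..t2} (\<lambda>t. F (t + s)))"
  using integral_swap_continuous[of t1 0 t2 h "\<lambda>t s. F (t + s)", unfolded cbox_interval, OF cF2] by simp
 also have "... \<le> (1 / h) * integral {0..h} (\<lambda>s. obs t1 (t2 + h) S v)"
 proof (intro mult_left_mono integral_le)
  have "continuous_on ({0..h} \<times> cbox t1 t2) (\<lambda>(s, t). F (t + s))"
   unfolding split_beta by (rule continuous_on_compose2[OF cF[of UNIV]]) (auto intro!: continuous_intros)
  from integral_continuous_on_param[OF this]
  show "(\<lambda>s. integral {t1..t2} (\<lambda>t. F (t + s))) integrable_on {0..h}"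
   by (intro integrable_continuous_real) (simp add: cbox_interval)
  fix s assume s: "s \<in> {0..h}"
  have "integral {t1..t2} (\<lambda>t. F (t + s)) = integral {t1 + s..t2 + s} F"
   using integral_shift_real_ivl[of "t1 + s" s "t2 + s" F] by (simp only: add_diff_cancel_right')
  also have "... \<le> integral {t1..t2 + h} F"
   using s by (intro integral_subset_le integrable_continuous_real cF) (auto simp: F_def energy_nonneg)
  finally show "integral {t1..t2} (\<lambda>t. F (t + s)) \<le> obs t1 (t2 + h) S v" by (simp add: obs_def F_def)
 qed (use h in auto)
 also have "... = obs t1 (t2 + h) S v" using h by simp
 finally show ?thesis .
qed

lemma obs_avg_power_le:
 assumes fin: "finite S" and h: "0 < h" and t: "t1 \<le> t2"
 shows "obs t1 t2 S (\<lambda>n. matrix_power (avg h n) k *v v n) \<le> obs t1 (t2 + k * h) S v" using t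
proof (induction k arbitrary: t2)
 case (Suc k)
 have "obs t1 t2 S (\<lambda>n. matrix_power (avg h n) (Suc k) *v v n) \<le> obs t1 (t2 + h) S (\<lambda>n. matrix_power (avg h n) k *v v n)"
  unfolding matrix_power_vector_Suc using Suc.prems by (intro obs_avg_le fin h)
 also have "... \<le> obs t1 (t2 + h + k * h) S v" using Suc.prems h by (intro Suc.IH) auto
 finally show ?case by (simp add: algebra_simps)
qed simp

lemma obs_sum_le:
 "obs t1 t2 S (\<lambda>n. \<Sum>k\<le>m. w k n) \<le> 2 ^ m * (\<Sum>k\<le>m. obs t1 t2 S (w k))"
proof (induction m)
 case (Suc m)
 have "obs t1 t2 S (\<lambda>n. \<Sum>k\<le>Suc m. w k n) \<le> 2 * obs t1 t2 S (\<lambda>n. \<Sum>k\<le>m. w k n) + 2 * obs t1 t2 S (w (Suc m))"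
  using obs_add_le[of t1 t2 S "\<lambda>n. \<Sum>k\<le>m. w k n" "w (Suc m)"] by simp
 also have "... \<le> 2 * (2 ^ m * (\<Sum>k\<le>m. obs t1 t2 S (w k))) + 2 ^ Suc m * obs t1 t2 S (w (Suc m))"
  using Suc obs_nonneg[of t1 t2 S "w (Suc m)"] by (intro add_mono mult_left_mono mult_right_mono) auto
 finally show ?case by (simp add: algebra_simps)
qed simp

text \<open>\<open>A\<close> is invertible because no velocity vanishes, and in the second row
  \<open>n^2\<close> dominates. The second row bounds the second component by the first one and the
  image; inserted into the first row, this leaves \<open>n\<close> times \<open>A\<close> as the
  leading term.\<close>

lemma gen_lower_bound:
 obtains \<gamma> N :: real where "0 < \<gamma>" "1 \<le> N" "\<And>n x. N \<le> absr n ==> \<gamma> * absr n * norm x \<le> norm (gen n *v x)"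
proof -
 have inj: "a = 0" if "A *v a = 0" for a
 proof -
  have "Q' *v (A *v a) = (Q' ** Q) *v (diagm (\<lambda>k. \<i> * of_real (\<mu> k)) *v (Q' *v a))"
   by (simp only: A_eq matrix_vector_mul_assoc matrix_mul_assoc)
  with that have "diagm (\<lambda>k. \<i> * of_real (\<mu> k)) *v (Q' *v a) = 0" by (simp add: Q)
  then have "(Q' *v a) $ k = 0" for k
   using diagm_vector[of "\<lambda>k. \<i> * of_real (\<mu> k)" "Q' *v a" k] \<mu>[of k] by simp
  then have "Q' *v a = 0" by (simp add: vec_eq_iff)
  then have "Q *v (Q' *v a) = 0" by simp
  then show ?thesis by (simp add: matrix_vector_mul_assoc Q)
 qed
 obtain g where g: "0 < g" "\<And>a. g * norm a \<le> norm (A *v a)"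
 proof (rule positive_homogeneous_bound[of "\<lambda>a. norm (A *v a)"])
  show "continuous_on UNIV (\<lambda>a. norm (A *v a))"
   by (intro continuous_intros continuous_on_matrix_vector)
  show "norm (A *v (r *R x)) = \<bar>r\<bar> * norm (A *v x)" for r x by (simp add: matrix_scaleR_right)
  show "0 < norm (A *v x)" if "x \<noteq> 0" for x using inj[of x] that by auto
 qed blast
 define c0 where "c0 = 1 + norm K + norm B + norm C + norm E + norm D"
 have c0: "1 \<le> c0" "norm K \<le> c0" "norm B \<le> c0" "norm C \<le> c0" "norm E \<le> c0" "norm D \<le> c0" by (auto simp: c0_def)
 define c1 where "c1 = (1 + 4 * c0) * (2 / g) * (1 + 2 * c0) + 2"
 have c1: "0 < c1" using c0 g by (auto simp: c1_def intro!: add_nonneg_pos mult_nonneg_nonneg)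
 \<comment> \<open>The first term lets \<open>n^2\<close> absorb the first order term in the second
   row, the other one lets the lower bound \<open>g\<close> of \<open>A\<close> absorb what is of
   lower order in the first row.\<close>
 define N where "N = 2 * c0 + 2 * (c0 + 4 * c0^2) / g"
 show ?thesis
 proof (rule that[of "1 / c1" N])
  show "0 < 1 / c1" using c1 by simp
  have q: "0 \<le> 2 * (c0 + 4 * c0^2) / g" using c0 g by auto
  then show "1 \<le> N" using c0 by (simp add: N_def)
  fix n x assume n: "N \<le> absr n"
  define m where "m = absr n"
  have m: "2 * c0 \<le> m" "2 * (c0 + 4 * c0^2) \<le> m * g" "1 \<le> m"
  proof -
   show "2 * c0 \<le> m" using n q by (simp add: N_def m_def)
   have "2 * (c0 + 4 * c0^2) / g \<le> m" using n c0 by (simp add: N_def m_def)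
   then show "2 * (c0 + 4 * c0^2) \<le> m * g" using g by (simp add: divide_le_eq)
   show "1 \<le> m" using n q c0 by (simp add: N_def m_def)
  qed
  define a b f r where "a = fst_block x" and "b = snd_block x" and "f = fst_block (gen n *v x)" and "r = snd_block (gen n *v x)"
  have f: "f = of_int n *R (A *v a) + K *v a + of_int n *R (B *v b)"
   and r: "r = of_int n *R (C *v a) + E *v a + of_int n *R (D *v b) - (of_int n)^2 *R b"
   by (simp_all add: f_def r_def a_def b_def gen_def block_mat_vector matrix_vector_mult_add_rdistrib
     matrix_vector_mult_diff_rdistrib matrix_scaleR_left add.assoc)
  have mv: "norm (M *v z) \<le> c0 * norm z" if "norm M \<le> c0" for M :: "complex^'i^'j" and z
   using norm_matrix_vector_le[of M z] that by (meson mult_right_mono norm_ge_zero order_trans)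
  have r1: "m^2 * norm b \<le> 2 * m * c0 * norm a + m * c0 * norm b + norm r"
  proof -
   have "(of_int n)^2 *R b = (of_int n *R (C *v a) + E *v a) + (of_int n *R (D *v b) - r)" by (simp add: r)
   then have "norm ((of_int n)^2 *R b) \<le> (norm (of_int n *R (C *v a)) + norm (E *v a)) + (norm (of_int n *R (D *v b)) + norm r)"
    by (metis norm_triangle_mono norm_triangle_ineq norm_triangle_ineq4)
   also have "... \<le> (m * (c0 * norm a) + c0 * norm a) + (m * (c0 * norm b) + norm r)"
    using c0 by (auto simp: m_def intro!: add_mono mult_left_mono mv)
   finally have "m^2 * norm b \<le> (m * (c0 * norm a) + c0 * norm a) + (m * (c0 * norm b) + norm r)"
    by (simp add: m_def)
   moreover have "c0 * norm a \<le> m * (c0 * norm a)" using mult_right_mono[of 1 m "c0 * norm a"] m c0 by auto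
   ultimately show ?thesis by (simp add: algebra_simps)
  qed
  have r2: "m * norm b \<le> 4 * c0 * norm a + 2 * norm r"
  proof -
   have "m * c0 * norm b \<le> m^2 / 2 * norm b"
    using m by (intro mult_right_mono) (auto simp: power2_eq_square)
   with r1 have "m^2 * norm b \<le> 4 * m * c0 * norm a + 2 * norm r" by simp
   also have "2 * norm r \<le> 2 * (m * norm r)" using m by (simp add: mult_le_cancel_right1)
   finally have "m * (m * norm b) \<le> m * (4 * c0 * norm a + 2 * norm r)"
    by (simp add: power2_eq_square algebra_simps)
   then show ?thesis using m by simp
  qed
  have f1: "m * g * norm a \<le> norm f + c0 * norm a + c0 * (m * norm b)"
  proof -
   have "m * g * norm a \<le> norm (of_int n *R (A *v a))" using g(2)[of a] by (simp add: m_def mult.assoc mult_left_mono)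
   also have "of_int n *R (A *v a) = (f - K *v a) - of_int n *R (B *v b)" by (simp add: f)
   also have "norm ... \<le> (norm f + norm (K *v a)) + norm (of_int n *R (B *v b))"
    by (meson add_mono norm_triangle_ineq4 order.refl order_trans)
   also have "... \<le> (norm f + c0 * norm a) + m * (c0 * norm b)"
    using c0 by (auto simp: m_def intro!: add_mono mult_left_mono mv)
   finally show ?thesis by (simp add: algebra_simps)
  qed
  have a1: "m * norm a \<le> (2 / g) * (norm f + 2 * c0 * norm r)"
  proof -
   have "c0 * (m * norm b) \<le> c0 * (4 * c0 * norm a + 2 * norm r)" using r2 c0 by (intro mult_left_mono) auto
   with f1 have "m * g * norm a \<le> norm f + (c0 + 4 * c0^2) * norm a + 2 * c0 * norm r"
    by (simp add: power2_eq_square algebra_simps)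
   moreover have "2 * ((c0 + 4 * c0^2) * norm a) \<le> m * g * norm a"
    using m(2) by (simp add: mult.assoc[symmetric] mult_right_mono)
   ultimately have "m * g * norm a \<le> 2 * (norm f + 2 * c0 * norm r)" by simp
   then show ?thesis using g by (simp add: field_simps)
  qed
  have fr: "norm f \<le> norm (gen n *v x)" "norm r \<le> norm (gen n *v x)"
   unfolding f_def r_def by (rule norm_fst_block_le norm_snd_block_le)+
  have "m * norm x \<le> m * (norm a + norm b)"
   using norm_block_vec_le[of a b] m by (intro mult_left_mono) (auto simp: a_def b_def)
  also have "... \<le> m * norm a + (4 * c0 * (m * norm a) + 2 * norm r)"
  proof -
   have "c0 * norm a \<le> c0 * (m * norm a)" using m c0 by (intro mult_left_mono) (auto simp: mult_le_cancel_right1)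
   then show ?thesis using r2 by (simp add: distrib_left)
  qed
  also have "... = (1 + 4 * c0) * (m * norm a) + 2 * norm r" by (simp add: algebra_simps)
  also have "... \<le> (1 + 4 * c0) * ((2 / g) * (norm f + 2 * c0 * norm r)) + 2 * norm r"
   using a1 c0 by (intro add_right_mono mult_left_mono) auto
  also have "... \<le> (1 + 4 * c0) * ((2 / g) * (norm (gen n *v x) + 2 * c0 * norm (gen n *v x))) + 2 * norm (gen n *v x)"
   using fr c0 g by (intro add_mono mult_left_mono) auto
  also have "... = c1 * norm (gen n *v x)" by (simp add: c1_def algebra_simps add_divide_distrib)
  finally show "1 / c1 * absr n * norm x \<le> norm (gen n *v x)" using c1 by (simp add: m_def field_simps)
 qed
qed

text \<open>By the fundamental theorem of calculus \<open>gen n\<close> maps the average of an orbit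
  to \<open>(flow h - 1) / h\<close>, which is bounded uniformly in \<open>n\<close>, while
  \<open>gen n\<close> itself is bounded below by a multiple of
  \<open>\<bar>n\<bar>\<close>.\<close>

lemma avg_small:
 assumes h: "0 < h"
 obtains M N :: real where "0 < M" "1 \<le> N" "\<And>n x. N \<le> absr n ==> norm (avg h n *v x) \<le> M / absr n * norm x"
proof -
 obtain \<gamma> N :: real where \<gamma>: "0 < \<gamma>" "1 \<le> N" "\<And>n x. N \<le> absr n ==> \<gamma> * absr n * norm x \<le> norm (gen n *v x)"
  using gen_lower_bound by blast
 obtain Kb where Kb: "1 \<le> Kb" "\<And>n t v. t \<in> {0..h} ==> norm (flow t n v) \<le> Kb * norm v"
  using flow_bounded[of h] h by (metis less_imp_le)
 define M where "M = (Kb + 1) / (h * \<gamma>)"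
 show ?thesis
 proof (rule that[of M N])
  show "0 < M" using Kb h \<gamma> by (simp add: M_def)
  show "1 \<le> N" by fact
  fix n x assume n: "N \<le> absr n"
  have "((\<lambda>s. gen n *v flow s n x) has_integral flow h n x - flow 0 n x) {0..h}"
   using h by (intro fundamental_theorem_of_calculus)
    (auto simp: flow_def intro!: has_vector_derivative_at_within has_vector_derivative_matrix_exp)
  then have 1: "integral {0..h} (\<lambda>s. gen n *v flow s n x) = flow h n x - x" by (simp add: integral_unique)
  have "(\<lambda>s. flow s n x) integrable_on {0..h}" by (intro integrable_continuous_real continuous_intros)
  from integral_linear[OF this bounded_linear_matrix_vector, of "gen n"]
  have "gen n *v integral {0..h} (\<lambda>s. flow s n x) = flow h n x - x" by (simp add: o_def 1)
  then have "h *R (gen n *v (avg h n *v x)) = flow h n x - x" using h by (simp add: avg_vector matrix_scaleR_right)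
  then have "h * norm (gen n *v (avg h n *v x)) = norm (flow h n x - x)" using h by (metis abs_of_pos norm_scaleR)
  also have "... \<le> Kb * norm x + norm x" using norm_triangle_ineq4[of "flow h n x" x] Kb(2)[of h n x] h by simp
  finally have "h * norm (gen n *v (avg h n *v x)) \<le> (Kb + 1) * norm x" by (simp add: distrib_right)
  moreover have "h * (\<gamma> * absr n * norm (avg h n *v x)) \<le> h * norm (gen n *v (avg h n *v x))"
   using \<gamma>(3)[OF n] h by (intro mult_left_mono) auto
  ultimately have "h * (\<gamma> * absr n * norm (avg h n *v x)) \<le> (Kb + 1) * norm x" by linarith
  then show "norm (avg h n *v x) \<le> M / absr n * norm x"
   using h \<gamma> n by (simp add: M_def field_simps)
 qed
qed

end

text \<open>When \<open>M\<close> is small, the constant term 1 dominates all the others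
  together.\<close>

lemma polynomial_filter_lower_bound:
 fixes M :: "complex^'n^'n" and p :: "nat => real"
 assumes p0: "p 0 = 1" and q: "0 \<le> q" "q \<le> 1" "q * (\<Sum>k\<le>d. \<bar>p k\<bar>) \<le> 1 / 2" and M: "\<And>x. norm (M *v x) \<le> q * norm x"
 shows "norm x / 2 \<le> norm (\<Sum>k\<le>d. p k *R (matrix_power M k *v x))"
proof -
 have pw: "norm (matrix_power M k *v x) \<le> q ^ k * norm x" for k
 proof (induction k)
  case (Suc k)
  have "norm (matrix_power M (Suc k) *v x) \<le> q * norm (matrix_power M k *v x)"
   unfolding matrix_power_vector_Suc by (rule M)
  also have "... \<le> q * (q ^ k * norm x)" using Suc q by (intro mult_left_mono)
  finally show ?case by (simp add: mult.assoc)
 qed simp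
 have "(\<Sum>k\<le>d. p k *R (matrix_power M k *v x)) = x + (\<Sum>k\<in>{1..d}. p k *R (matrix_power M k *v x))"
  using p0 by (simp add: atMost_atLeast0 sum.atLeast_Suc_atMost)
 moreover have "norm (\<Sum>k\<in>{1..d}. p k *R (matrix_power M k *v x)) \<le> norm x / 2"
 proof -
  have "norm (\<Sum>k\<in>{1..d}. p k *R (matrix_power M k *v x)) \<le> (\<Sum>k\<in>{1..d}. \<bar>p k\<bar> * (q * norm x))"
  proof (rule order.trans[OF norm_sum sum_mono])
   fix k assume k: "k \<in> {1..d}"
   then have "q ^ k \<le> q" using power_decreasing[of 1 k q] q by auto
   then have "norm (matrix_power M k *v x) \<le> q * norm x"
    using pw[of k] by (meson mult_right_mono norm_ge_zero order_trans)
   then show "norm (p k *R (matrix_power M k *v x)) \<le> \<bar>p k\<bar> * (q * norm x)"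
    by (simp add: mult_left_mono)
  qed
  also have "... \<le> (\<Sum>k\<le>d. \<bar>p k\<bar> * (q * norm x))" using q by (intro sum_mono2) auto
  also have "... = (q * (\<Sum>k\<le>d. \<bar>p k\<bar>)) * norm x"
   by (simp add: sum_distrib_left sum_distrib_right algebra_simps)
  also have "... \<le> (1 / 2) * norm x" using q by (intro mult_right_mono) auto
  finally show ?thesis by simp
 qed
 ultimately show ?thesis
  using norm_diff_ineq[of x "\<Sum>k\<in>{1..d}. p k *R (matrix_power M k *v x)"] by simp
qed

context observed_system
begin

text \<open>Only modes beyond some threshold are estimated, for data without modes in
  \<open>F\<close>. The threshold may depend on \<open>e\<close> and grows each time a mode is taken
  out of \<open>F\<close>; the low modes are recovered separately at the end. The additional time
  \<open>e\<close> is allowed because every filter consumes some.\<close>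

definition obs_modulo :: "real => int set => bool"
 where "obs_modulo T F \<longleftrightarrow> (\<forall>e>0. \<exists>M N :: real. 0 < M \<and> (\<forall>S v. finite S \<longrightarrow> S \<inter> F = {} \<longrightarrow>
  (\<Sum>n\<in>{n \<in> S. N \<le> absr n}. nsq (flow (T + e) n (v n))) \<le> M * obs 0 (T + e) S v))"

lemma avg_near_identity:
 assumes "0 < e"
 obtains h where "0 < h" "h \<le> e" "\<And>x. norm (avg h n *v x - x) \<le> norm x / 2"
proof -
 define c where "c = norm (gen n) * exp (norm (gen n))"
 have c: "0 \<le> c" by (simp add: c_def)
 define h where "h = min (min e 1) (1 / (2 * (c + 1)))"
 have h: "0 < h" "h \<le> e" "h \<le> 1" "h \<le> 1 / (2 * (c + 1))" using assms c by (auto simp: h_def)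
 have hc: "h * c \<le> 1 / 2"
 proof -
  have "h * c \<le> 1 / (2 * (c + 1)) * c" using h c by (intro mult_right_mono)
  also have "... \<le> 1 / 2" using c by (simp add: field_simps)
  finally show ?thesis .
 qed
 show ?thesis
 proof (rule that[OF h(1,2)])
  fix x
  have "continuous_on {0..h} (\<lambda>s. flow s n x - x)" by (intro continuous_intros)
  moreover have "norm (flow s n x - x) \<le> norm x / 2" if s: "s \<in> {0..h}" for s
  proof -
   have "norm (flow s n x - x) \<le> s * norm (gen n) * exp (s * norm (gen n)) * norm x"
    unfolding flow_def using s by (intro matrix_exp_diff_le) auto
   also have "... \<le> h * norm (gen n) * exp (1 * norm (gen n)) * norm x"
    using s h by (intro mult_right_mono mult_mono) (auto intro: mult_left_le_one_le)
   also have "... = (h * c) * norm x" by (simp add: c_def)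
   also have "... \<le> (1 / 2) * norm x" using hc by (intro mult_right_mono) auto
   finally show ?thesis by simp
  qed
  ultimately have "norm (integral {0..h} (\<lambda>s. flow s n x - x)) \<le> norm x / 2 * h"
   using integral_bound[of 0 h "\<lambda>s. flow s n x - x" "norm x / 2"] h by auto
  moreover have "avg h n *v x - x = (1 / h) *R integral {0..h} (\<lambda>s. flow s n x - x)"
  proof -
   have "integral {0..h} (\<lambda>s. flow s n x - x) = integral {0..h} (\<lambda>s. flow s n x) - h *R x"
    using h by (subst Henstock_Kurzweil_Integration.integral_diff)
     (auto intro!: integrable_continuous_real continuous_intros)
   then show ?thesis using h by (simp add: avg_vector scaleR_diff_right)
  qed
  ultimately show "norm (avg h n *v x - x) \<le> norm x / 2" using h by (simp add: field_simps)
 qed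
qed

text \<open>A polynomial in the time average annihilates the mode \<open>n0\<close> and is bounded below at
 high frequency, because averages are of size \<open>1 / \<bar>n\<bar>\<close> there; it delays the observation
 by an arbitrarily small time.\<close>

lemma obs_modulo_insert:
 assumes T: "0 \<le> T" and o: "obs_modulo T (insert n0 F)"
 shows "obs_modulo T F" unfolding obs_modulo_def
proof (intro allI impI)
 fix e :: real assume e: "0 < e"
 define d where "d = DIM(complex^('p + 'q)^('p + 'q))"
 obtain M N :: real where M: "0 < M" and obs: "\<And>S v. finite S ==> S \<inter> insert n0 F = {} ==>
   (\<Sum>n\<in>{n \<in> S. N \<le> absr n}. nsq (flow (T + e / 2) n (v n))) \<le> M * obs 0 (T + e / 2) S v"
  using o e unfolding obs_modulo_def by (meson half_gt_zero)
 \<comment> \<open>A polynomial of degree \<open>d\<close> in the average prolongs the observation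
   by at most \<open>d * h\<close>, hence by at most \<open>e / 2\<close>; the other half of
   \<open>e\<close> is spent in the hypothesis on \<open>insert n0 F\<close>.\<close>
 obtain h where h: "0 < h" "h \<le> e / (2 * (real d + 1))" "\<And>x. norm (avg h n0 *v x - x) \<le> norm x / 2"
  using avg_near_identity[of "e / (2 * (real d + 1))" n0] e by auto
 have dh: "real k * h \<le> e / 2" if "k \<le> d" for k
 proof -
  have "real k * h \<le> (real d + 1) * (e / (2 * (real d + 1)))" using h that by (intro mult_mono) auto
  also have "... = e / 2" by (simp add: field_simps)
  finally show ?thesis .
 qed
 obtain p :: "nat => real" where p: "p 0 = 1" "\<And>x. (\<Sum>k\<le>d. p k *R (matrix_power (avg h n0) k *v x)) = 0"
  using annihilating_polynomial[OF h(3)] unfolding d_def by blast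
 obtain Ma Na :: real where Ma: "0 < Ma" "1 \<le> Na" "\<And>n x. Na \<le> absr n ==> norm (avg h n *v x) \<le> Ma / absr n * norm x"
  using avg_small[OF h(1)] by blast
 obtain Kb where Kb: "1 \<le> Kb" "\<And>n t v. t \<in> {0..e / 2} ==> norm (flow t n v) \<le> Kb * norm v"
  using flow_bounded[of "e / 2"] e by (metis half_gt_zero less_imp_le)
 define P where "P = (\<Sum>k\<le>d. \<bar>p k\<bar>)"
 have P: "0 \<le> P" by (simp add: P_def sum_nonneg)
 \<comment> \<open>Beyond \<open>N'\<close> the filter is bounded below by 1/2, the threshold of the
   hypothesis is passed, and \<open>n0\<close> itself is excluded.\<close>
 define N' where "N' = \<bar>N\<bar> + Na + Ma + 2 * Ma * P + \<bar>of_int n0\<bar> + 1"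
 have N': "N \<le> N'" "Na \<le> N'" "Ma \<le> N'" "2 * Ma * P \<le> N'" "\<bar>of_int n0\<bar> < N'" "0 < N'"
 proof -
  have "0 \<le> Ma * P" using Ma P by simp
  then show "N \<le> N'" "Na \<le> N'" "Ma \<le> N'" "2 * Ma * P \<le> N'" "\<bar>of_int n0\<bar> < N'" "0 < N'"
   using Ma unfolding N'_def by simp_all
 qed
 define W where "W = (\<lambda>n x. \<Sum>k\<le>d. p k *R (matrix_power (avg h n) k *v x))"
 have flow_W: "flow t n (W n x) = W n (flow t n x)" for t n x using bounded_linear_flow[of t n]
  by (simp add: W_def linear_sum bounded_linear.linear linear_simps(5) flow_avg_power)
 have W: "norm x \<le> 2 * norm (W n x)" if n: "N' \<le> absr n" for n x
 proof -
  have "norm x / 2 \<le> norm (W n x)" unfolding W_def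
  proof (rule polynomial_filter_lower_bound[of p "Ma / absr n"])
   show "Ma / absr n * (\<Sum>k\<le>d. \<bar>p k\<bar>) \<le> 1 / 2"
    using N' n by (simp add: P_def[symmetric] field_simps)
   show "norm (avg h n *v x) \<le> Ma / absr n * norm x" for x using N' n by (intro Ma(3)) auto
  qed (use p Ma N' n in \<open>auto simp: divide_simps\<close>)
  then show ?thesis by simp
 qed
 define M' where "M' = Kb^2 * 4 * (M * (2 ^ d * (\<Sum>k\<le>d. (p k)^2)))"
 have "0 < (\<Sum>k\<le>d. (p k)^2)" by (rule sum_pos2[of _ 0]) (auto simp: p)
 then have M': "0 < M'" using Kb M by (simp add: M'_def)
 have "(\<Sum>n\<in>{n \<in> S. N' \<le> absr n}. nsq (flow (T + e) n (v n))) \<le> M' * obs 0 (T + e) S v"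
  if S: "finite S" "S \<inter> F = {}" for S v
 proof -
  define w where "w = (\<lambda>n. W n (v n))"
  have "(\<Sum>n\<in>{n \<in> S. N' \<le> absr n}. nsq (flow (T + e) n (v n))) \<le>
    (\<Sum>n\<in>{n \<in> S. N' \<le> absr n}. Kb^2 * 4 * nsq (flow (T + e / 2) n (w n)))"
  proof (rule sum_mono)
   fix n assume n: "n \<in> {n \<in> S. N' \<le> absr n}"
   have "flow (T + e) n (v n) = flow (e / 2) n (flow (T + e / 2) n (v n))"
    by (simp add: flow_add[symmetric] add.commute)
   then have "norm (flow (T + e) n (v n)) \<le> Kb * norm (flow (T + e / 2) n (v n))"
    using Kb(2)[of "e / 2" n] e by simp
   also have "... \<le> Kb * (2 * norm (flow (T + e / 2) n (w n)))"
    unfolding w_def flow_W using n Kb by (intro mult_left_mono W) auto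
   finally have "nsq (flow (T + e) n (v n)) \<le> (Kb * (2 * norm (flow (T + e / 2) n (w n))))^2"
    by (intro power_mono) auto
   then show "nsq (flow (T + e) n (v n)) \<le> Kb^2 * 4 * nsq (flow (T + e / 2) n (w n))"
    by (simp add: power_mult_distrib)
  qed
  also have "... = Kb^2 * 4 * (\<Sum>n\<in>{n \<in> S. N' \<le> absr n}. nsq (flow (T + e / 2) n (w n)))"
   by (simp add: sum_distrib_left)
  also have "(\<Sum>n\<in>{n \<in> S. N' \<le> absr n}. nsq (flow (T + e / 2) n (w n))) \<le>
   (\<Sum>n\<in>{n \<in> S - {n0}. N \<le> absr n}. nsq (flow (T + e / 2) n (w n)))"
   using S N' by (intro sum_mono2) auto
  also have "... \<le> M * obs 0 (T + e / 2) (S - {n0}) w" using S by (intro obs) auto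
  also have "obs 0 (T + e / 2) (S - {n0}) w = obs 0 (T + e / 2) S w"
   using S p by (intro obs_mono_neutral) (auto simp: w_def W_def)
  also have "obs 0 (T + e / 2) S w \<le> 2 ^ d * (\<Sum>k\<le>d. obs 0 (T + e / 2) S (\<lambda>n. p k *R (matrix_power (avg h n) k *v v n)))"
   unfolding w_def W_def by (rule obs_sum_le)
  also have "(\<Sum>k\<le>d. obs 0 (T + e / 2) S (\<lambda>n. p k *R (matrix_power (avg h n) k *v v n))) \<le>
    (\<Sum>k\<le>d. (p k)^2 * obs 0 (T + e) S v)"
  proof (rule sum_mono)
   fix k assume k: "k \<in> {..d}"
   have "obs 0 (T + e / 2) S (\<lambda>n. matrix_power (avg h n) k *v v n) \<le> obs 0 (T + e / 2 + k * h) S v"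
    using T e by (intro obs_avg_power_le S h) auto
   also have "... \<le> obs 0 (T + e) S v" using dh[of k] k by (intro obs_mono) auto
   finally show "obs 0 (T + e / 2) S (\<lambda>n. p k *R (matrix_power (avg h n) k *v v n)) \<le> (p k)^2 * obs 0 (T + e) S v"
    by (simp add: obs_scaleR mult_left_mono)
  qed
  also have "... = (\<Sum>k\<le>d. (p k)^2) * obs 0 (T + e) S v" by (simp add: sum_distrib_right)
  finally show ?thesis using M by (simp add: M'_def mult_left_mono mult.assoc)
 qed
 with M' show "\<exists>M N :: real. 0 < M \<and> (\<forall>S v. finite S \<longrightarrow> S \<inter> F = {} \<longrightarrow>
   (\<Sum>n\<in>{n \<in> S. N \<le> absr n}. nsq (flow (T + e) n (v n))) \<le> M * obs 0 (T + e) S v)"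
  by blast
qed

lemma obs_modulo_finite:
 assumes "finite F" "0 \<le> T" "obs_modulo T F"
 shows "obs_modulo T {}"
 using assms(1,3) by (induction F rule: finite_induct) (auto intro: obs_modulo_insert[OF assms(2)])

text \<open>When \<open>F\<close> consists of all modes below the threshold, the claim is the high
  frequency estimate; these finitely many modes are then taken out of \<open>F\<close> one at a
  time.\<close>

lemma obs_modulo_empty:
 assumes T0: "0 < T0" and hit: "\<And>k y. \<exists>t\<in>{0<..<T0}. y - \<mu> k * t \<in> \<Omega>" and \<delta>: "0 < \<delta>" "\<delta> \<le> 1"
 shows "obs_modulo (T0 + \<delta>) {}"
proof -
 obtain M N :: real where M: "0 < M" "0 < N" and obs: "\<And>S v. finite S ==> (\<And>n. n \<in> S ==> N \<le> absr n) ==>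
   (\<Sum>n\<in>S. nsq (flow (T0 + \<delta>) n (v n))) \<le> M * obs 0 (T0 + \<delta>) S v"
  using high_frequency_observability[OF T0 hit \<delta>] by blast
 define F where "F = {n :: int. absr n < N}"
 have "F \<subseteq> {- \<lceil>N\<rceil>..\<lceil>N\<rceil>}" by (auto simp: F_def) linarith+
 then have finF: "finite F" using finite_subset by blast
 have "obs_modulo (T0 + \<delta>) F" unfolding obs_modulo_def
 proof (intro allI impI)
  fix e :: real assume e: "0 < e"
  obtain Kb where Kb: "1 \<le> Kb" "\<And>n t v. t \<in> {0..e} ==> norm (flow t n v) \<le> Kb * norm v"
   using flow_bounded[of e] e by (metis less_imp_le)
  have "(\<Sum>n\<in>{n \<in> S. N \<le> absr n}. nsq (flow (T0 + \<delta> + e) n (v n))) \<le> Kb^2 * M * obs 0 (T0 + \<delta> + e) S v"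
   if S: "finite S" "S \<inter> F = {}" for S v
  proof -
   have "{n \<in> S. N \<le> absr n} = S" using S by (auto simp: F_def)
   moreover have "(\<Sum>n\<in>S. nsq (flow (T0 + \<delta> + e) n (v n))) \<le> (\<Sum>n\<in>S. Kb^2 * nsq (flow (T0 + \<delta>) n (v n)))"
   proof (rule sum_mono)
    fix n
    have "flow (T0 + \<delta> + e) n (v n) = flow e n (flow (T0 + \<delta>) n (v n))"
     by (simp add: flow_add[symmetric] add.commute)
    then have "norm (flow (T0 + \<delta> + e) n (v n)) \<le> Kb * norm (flow (T0 + \<delta>) n (v n))"
     using Kb(2)[of e n] e by simp
    from power_mono[OF this norm_ge_zero, of 2]
    show "nsq (flow (T0 + \<delta> + e) n (v n)) \<le> Kb^2 * nsq (flow (T0 + \<delta>) n (v n))"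
     by (simp add: power_mult_distrib)
   qed
   moreover have "... = Kb^2 * (\<Sum>n\<in>S. nsq (flow (T0 + \<delta>) n (v n)))" by (simp add: sum_distrib_left)
   moreover have "... \<le> Kb^2 * (M * obs 0 (T0 + \<delta>) S v)"
    using S by (intro mult_left_mono obs) (auto simp: F_def not_less[symmetric])
   moreover have "... \<le> Kb^2 * (M * obs 0 (T0 + \<delta> + e) S v)"
    using M e by (intro mult_left_mono obs_mono) auto
   ultimately show ?thesis by (simp add: mult.assoc)
  qed
  moreover have "0 < Kb^2 * M" using Kb M by auto
  ultimately show "\<exists>M N :: real. 0 < M \<and> (\<forall>S v. finite S \<longrightarrow> S \<inter> F = {} \<longrightarrow>
   (\<Sum>n\<in>{n \<in> S. N \<le> absr n}. nsq (flow (T0 + \<delta> + e) n (v n))) \<le> M * obs 0 (T0 + \<delta> + e) S v)"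
   by blast
 qed
 then show ?thesis using obs_modulo_finite[OF finF] T0 \<delta> by simp
qed

text \<open>The mode \<open>0\<close> of the second block is not observed.\<close>

definition hnorm :: "int => complex^('p + 'q) => real"
 where "hnorm n x = (if n = 0 then norm (fst_block x) else norm x)"

lemma hnorm_nonneg: "0 \<le> hnorm n x" by (simp add: hnorm_def)

text \<open>In the mode 0 the coupling \<open>of_int n *R B\<close> vanishes, so the first block
  evolves alone.\<close>

lemma flow_zero_mode: "fst_block (flow t 0 x) = matrix_exp (t *R K) *v fst_block x" unfolding flow_def
proof (rule matrix_exp_intertwine_scaleR[OF bounded_linear_fst_block])
 fix x :: "complex^('p + 'q)"
 have "gen 0 *v block_vec (fst_block x) (snd_block x) = block_vec (K *v fst_block x) (E *v fst_block x)"
  by (simp add: gen_def block_mat_vector)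
 then show "fst_block (gen 0 *v x) = K *v fst_block x" by simp
qed

lemma hnorm_flow_le:
 obtains k where "1 \<le> k" "\<And>t x. 0 \<le> t ==> t \<le> T ==> hnorm n (flow t n x) \<le> k * hnorm n x"
proof
 let ?k = "exp (\<bar>T\<bar> * (norm K + norm (gen n)))"
 show "1 \<le> ?k" by simp
 fix t x assume t: "0 \<le> t" "t \<le> T"
 show "hnorm n (flow t n x) \<le> ?k * hnorm n x"
 proof (cases "n = 0")
  case True
  have "norm (fst_block (flow t 0 x)) \<le> exp (\<bar>t\<bar> * norm K) * norm (fst_block x)"
   unfolding flow_zero_mode by (rule norm_matrix_exp_scaleR_le)
  also have "... \<le> ?k * norm (fst_block x)" using t by (intro mult_right_mono) (auto intro!: mult_mono)
  finally show ?thesis using True by (simp add: hnorm_def)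
 next
  case False
  have "norm (flow t n x) \<le> exp (\<bar>t\<bar> * norm (gen n)) * norm x"
   unfolding flow_def by (rule norm_matrix_exp_scaleR_le)
  also have "... \<le> ?k * norm x" using t by (intro mult_right_mono) (auto intro!: mult_mono)
  finally show ?thesis using False by (simp add: hnorm_def)
 qed
qed

text \<open>If the first block vanishes along the iterates, the second block iterates by
  \<open>n D - n^2\<close> and stays in the kernel of \<open>B\<close>. As \<open>D\<close> is an
  affine function of that matrix, \<open>B\<close> also kills the iterates of \<open>D\<close>, and
  the Kalman bound applies. Reading off \<open>B *v b J = 0\<close> takes one iterate more than
  \<open>J\<close>.\<close>

lemma kalman_gen:
 assumes n: "n \<noteq> 0" and c: "\<And>j. j \<le> Suc J ==> fst_block (matrix_power (gen n) j *v c) = 0"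
 shows "c = 0"
proof -
 define m where "m = real_of_int n"
 have m: "m \<noteq> 0" using n by (simp add: m_def)
 define G where "G = m *R D - m^2 *R mat 1"
 define b where "b = (\<lambda>j. snd_block (matrix_power (gen n) j *v c))"
 have pw: "matrix_power (gen n) j *v c = block_vec 0 (b j)" if "j \<le> Suc J" for j
  using c[OF that] by (simp add: block_vec_eq_iff b_def)
 have b: "B *v b j = 0 \<and> b (Suc j) = G *v b j" if "j \<le> J" for j
 proof -
  have "block_vec 0 (b (Suc j)) = gen n *v block_vec 0 (b j)"
   using pw[of j] pw[of "Suc j"] that by (simp only: matrix_power_vector_Suc le_SucI Suc_le_mono)
  also have "... = block_vec (m *R (B *v b j)) (G *v b j)"
   by (simp add: gen_def block_mat_vector m_def G_def matrix_scaleR_left)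
  finally show ?thesis using m by (simp add: block_vec_eq_iff)
 qed
 have com: "matrix_power D (Suc i) *v x = matrix_power D i *v (D *v x)" for i x
  by (induction i) (simp_all only: matrix_power_vector_Suc, simp)
 have "B *v (matrix_power D i *v b j) = 0" if "i + j \<le> J" for i j using that
 proof (induction i arbitrary: j)
  case (Suc i)
  have "b (Suc j) = m *R (D *v b j) - m^2 *R b j"
   using b[of j] Suc.prems by (simp add: G_def matrix_vector_mult_diff_rdistrib matrix_scaleR_left)
  then have "D *v b j = (1 / m) *R b (Suc j) + m *R b j"
   using m by (simp add: scaleR_diff_right power2_eq_square)
  then have "B *v (matrix_power D (Suc i) *v b j) =
    (1 / m) *R (B *v (matrix_power D i *v b (Suc j))) + m *R (B *v (matrix_power D i *v b j))"
   unfolding com by (simp add: matrix_vector_right_distrib matrix_scaleR_right)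
  then show ?case using Suc.IH[of j] Suc.IH[of "Suc j"] Suc.prems by simp
 qed (use b in simp)
 then have "(\<Sum>j\<le>J. norm (B *v (matrix_power D j *v b 0))) = 0" by simp
 with kalman(2)[of "b 0"] have "\<kappa> * norm (b 0) \<le> 0" by simp
 then have "b 0 = 0" using kalman(1) by (simp add: mult_le_0_iff)
 with pw[of 0] show ?thesis by (simp add: block_vec_eq_iff)
qed

lemma fst_block_matrix: obtains P :: "complex^('p + 'q)^'p" where "\<And>x. P *v x = fst_block x"
proof (rule that[of "\<chi> i j. if j = Inl i then 1 else 0"])
 show "(\<chi> i j. if j = Inl i then 1 else 0) *v x = fst_block x" for x :: "complex^('p + 'q)"
  by (simp add: vec_eq_iff matrix_vector_mult_def fst_block_def if_distrib[of "\<lambda>a. a * _"] cong: if_cong)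
qed

text \<open>In the mode 0 the exponential of \<open>K\<close> is inverted. For
  \<open>n \<noteq> 0\<close> a state with zero output on \<open>[0, L]\<close> has zero samples and
  vanishes by \<open>kalman_gen\<close>; compactness of the sphere turns this into a bound. Its
  constant depends on \<open>n\<close>, so it serves for finitely many modes.\<close>

lemma mode_observability:
 assumes L: "0 < L"
 obtains M where "0 < M" "\<And>x. (hnorm n x)^2 \<le> M * integral {0..L} (\<lambda>s. nsq (fst_block (flow s n x)))"
proof (cases "n = 0")
 case True
 define k where "k = exp (L * norm K)"
 show ?thesis
 proof (rule that[of "k^2 / L"])
  show "0 < k^2 / L" using L by (simp add: k_def)
  fix x
  have le: "nsq (fst_block x) \<le> k^2 * nsq (fst_block (flow s n x))" if s: "s \<in> {0..L}" for s
  proof -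
   have "matrix_exp (- s *R K) *v fst_block (flow s n x) = fst_block x"
    unfolding True flow_zero_mode by (simp add: matrix_exp_add_vector[symmetric])
   then have "norm (fst_block x) \<le> exp (\<bar>s\<bar> * norm K) * norm (fst_block (flow s n x))"
    using norm_matrix_exp_scaleR_le[of "- s" K "fst_block (flow s n x)"] by simp
   also have "... \<le> k * norm (fst_block (flow s n x))"
    unfolding k_def using s by (intro mult_right_mono) (auto intro!: mult_right_mono)
   finally show ?thesis by (metis power_mult_distrib power_mono norm_ge_zero)
  qed
  have "L * nsq (fst_block x) = integral {0..L} (\<lambda>s. nsq (fst_block x))" using L by simp
  also have "... \<le> integral {0..L} (\<lambda>s. k^2 * nsq (fst_block (flow s n x)))"
   by (intro integral_le le) (auto intro!: integrable_continuous_real continuous_intros)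
  also have "... = k^2 * integral {0..L} (\<lambda>s. nsq (fst_block (flow s n x)))" by simp
  finally show "(hnorm n x)^2 \<le> k^2 / L * integral {0..L} (\<lambda>s. nsq (fst_block (flow s n x)))"
   using L True by (simp add: hnorm_def field_simps)
 qed
next
 case False
 define f where "f = (\<lambda>x. integral {0..L} (\<lambda>s. nsq (fst_block (flow s n x))))"
 obtain P :: "complex^('p + 'q)^'p" where P: "\<And>x. P *v x = fst_block x" using fst_block_matrix by blast
 obtain \<gamma> where g: "0 < \<gamma>" "\<And>c. \<gamma> * norm c \<le> (\<Sum>j\<le>Suc J. norm (P *v (matrix_power (gen n) j *v c)))"
 proof (rule positive_homogeneous_bound[of "\<lambda>c. \<Sum>j\<le>Suc J. norm (P *v (matrix_power (gen n) j *v c))"])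
  show "continuous_on UNIV (\<lambda>c. \<Sum>j\<le>Suc J. norm (P *v (matrix_power (gen n) j *v c)))"
   by (intro continuous_intros bounded_linear.continuous_on[OF bounded_linear_matrix_vector])
  show "(\<Sum>j\<le>Suc J. norm (P *v (matrix_power (gen n) j *v (r *R c)))) =
    \<bar>r\<bar> * (\<Sum>j\<le>Suc J. norm (P *v (matrix_power (gen n) j *v c)))" for r c
   by (simp only: matrix_scaleR_right norm_scaleR sum_distrib_left)
  fix c :: "complex^('p + 'q)" assume "c \<noteq> 0"
  then obtain j where "j \<le> Suc J" "fst_block (matrix_power (gen n) j *v c) \<noteq> 0"
   using kalman_gen[OF False] by blast
  then show "0 < (\<Sum>j\<le>Suc J. norm (P *v (matrix_power (gen n) j *v c)))"
   by (intro sum_pos2[of _ j]) (auto simp: P)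
 qed blast
 obtain \<epsilon> h0 M where s: "0 < \<epsilon>" "0 < h0" and so: "\<And>A C h c. norm (A - gen n) < \<epsilon> ==> norm (C - P) < \<epsilon> ==> 0 < h ==> h \<le> h0 ==>
   norm c \<le> M / h ^ Suc J * (\<Sum>k\<le>Suc J. norm (C *v (matrix_exp ((real k * h) *R A) *v c)))"
 proof (rule sampled_observability[OF g], goal_cases)
  case (1 e h M)
  then show ?case by (intro that[of e h M])
 qed
 have cf: "continuous_on U (\<lambda>s. nsq (fst_block (flow s n x)))" for U x by (intro continuous_intros)
 have f0: "0 \<le> f x" for x unfolding f_def by (intro integral_nonneg integrable_continuous_real cf) auto
 obtain \<eta> where e: "0 < \<eta>" "\<And>x. \<eta> * norm x \<le> sqrt (f x)"
 proof (rule positive_homogeneous_bound[of "\<lambda>x. sqrt (f x)"])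
  have "continuous_on (UNIV \<times> cbox 0 L) (\<lambda>(x, s). nsq (fst_block (flow s n x)))"
   unfolding split_beta flow_def
   by (intro continuous_intros continuous_on_matrix_vector)
  from integral_continuous_on_param[OF this]
  show "continuous_on UNIV (\<lambda>x. sqrt (f x))" unfolding f_def by (intro continuous_intros) (simp add: cbox_interval)
  show "sqrt (f (r *R x)) = \<bar>r\<bar> * sqrt (f x)" for r x
  proof -
   have "f (r *R x) = r^2 * f x"
    by (simp add: f_def linear_simps(5)[OF bounded_linear_flow] fst_block_scaleR power_mult_distrib)
   then show ?thesis by (simp add: real_sqrt_mult)
  qed
  fix x :: "complex^('p + 'q)" assume x: "x \<noteq> 0"
  have "f x \<noteq> 0"
  proof
   assume "f x = 0"
   then have z: "fst_block (flow s n x) = 0" if "s \<in> {0..L}" for s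
    using integral_eq_0_iff[of 0 L "\<lambda>s. nsq (fst_block (flow s n x))", OF cf L] that by (simp add: f_def)
   define h where "h = min h0 (L / (real J + 1))"
   have h: "0 < h" "h \<le> h0" "h \<le> L / (real J + 1)" using s L by (auto simp: h_def)
   have "fst_block (flow (real k * h) n x) = 0" if "k \<le> Suc J" for k
   proof (rule z)
    have "real k * h \<le> (real J + 1) * (L / (real J + 1))" using that h by (intro mult_mono) auto
    also have "... = L" by (simp add: field_simps)
    finally show "real k * h \<in> {0..L}" using h by simp
   qed
   then have "norm x \<le> 0" using so[of "gen n" P h x] s h by (simp add: P flow_def)
   with x show False by simp
  qed
  with f0[of x] show "0 < sqrt (f x)" by simp
 qed blast
 show ?thesis
 proof (rule that[of "1 / \<eta>^2"])
  show "0 < 1 / \<eta>^2" using e by simp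
  fix x
  have "(\<eta> * norm x)^2 \<le> (sqrt (f x))^2" using e by (intro power_mono) auto
  then show "(hnorm n x)^2 \<le> 1 / \<eta>^2 * integral {0..L} (\<lambda>s. nsq (fst_block (flow s n x)))"
   unfolding fun_cong[OF f_def, symmetric] using e(1) f0[of x] False by (simp add: hnorm_def power_mult_distrib field_simps)
 qed
qed

text \<open>The high modes are controlled at time \<open>T2\<close> and, by boundedness of the flow,
  afterwards. Subtracting them from the observation on \<open>[T2, T2 + L]\<close> leaves a
  polynomial in the low modes, which the spectral inequality separates into single modes.\<close>

lemma observability:
 assumes T0: "0 < T0" and hit: "\<And>k y. \<exists>t\<in>{0<..<T0}. y - \<mu> k * t \<in> \<Omega>" and T: "T0 < T"
 obtains M where "0 < M" "\<And>S v. finite S ==> (\<Sum>n\<in>S. (hnorm n (flow T n (v n)))^2) \<le> M * obs 0 T S v"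
proof -
 \<comment> \<open>The spare time is divided into thirds: one for the heat part, one for the filters
   and one for the low modes.\<close>
 define L where "L = (T - T0) / 3"
 define \<delta> where "\<delta> = min L 1"
 define T2 where "T2 = T0 + \<delta> + L"
 have L0: "0 < L" using T by (simp add: L_def)
 moreover have "0 < \<delta>" "\<delta> \<le> 1" "\<delta> \<le> L" using L0 by (auto simp: \<delta>_def)
 moreover have "T0 + 3 * L = T" by (simp add: L_def field_simps)
 ultimately have L: "0 < L" "0 < \<delta>" "\<delta> \<le> 1" "0 < T2" "T2 + L \<le> T" using T0 unfolding T2_def by simp_all
 have "obs_modulo (T0 + \<delta>) {}" using obs_modulo_empty[OF T0 hit L(2,3)] .
 from this[unfolded obs_modulo_def, THEN spec[of _ L], THEN mp, OF L(1), folded T2_def]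
 obtain M N :: real where M: "0 < M" and hi: "\<forall>S v. finite S \<longrightarrow> S \<inter> {} = {} \<longrightarrow>
   (\<Sum>n\<in>{n \<in> S. N \<le> absr n}. nsq (flow T2 n (v n))) \<le> M * obs 0 T2 S v"
  by (elim exE conjE) (rule that)
 have hi: "(\<Sum>n\<in>{n \<in> S. N \<le> absr n}. nsq (flow T2 n (v n))) \<le> M * obs 0 T2 S v" if "finite S" for S v
  using hi that by simp
 obtain Kb where Kb: "1 \<le> Kb" "\<And>n t v. t \<in> {0..T} ==> norm (flow t n v) \<le> Kb * norm v"
  using flow_bounded[of T] T T0 by (metis less_imp_le less_trans)
 define F where "F = {n :: int. absr n < N}"
 have F: "F \<subseteq> {- int (nat \<lceil>N\<rceil>)..int (nat \<lceil>N\<rceil>)}" by (auto simp: F_def) linarith+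
 then have finF: "finite F" using finite_subset by blast
 obtain C0 where C0: "0 < C0" "\<And>m S (c :: int => complex^'p). S \<subseteq> {- int m..int m} ==>
   (\<Sum>n\<in>S. nsq (c n)) \<le> exp (C0 * (real m + 1)) * energy X S c" using spectral_inequality by blast
 define Cs where "Cs = exp (C0 * (real (nat \<lceil>N\<rceil>) + 1))"
 have "\<exists>m>0. \<forall>x. (hnorm n x)^2 \<le> m * integral {0..L} (\<lambda>s. nsq (fst_block (flow s n x)))" for n
  using mode_observability[OF L(1), of n] by blast
 then obtain m where m: "\<And>n. 0 < m n" "\<And>n x. (hnorm n x)^2 \<le> m n * integral {0..L} (\<lambda>s. nsq (fst_block (flow s n x)))"
  by metis
 have "\<exists>k\<ge>1. \<forall>t x. 0 \<le> t \<longrightarrow> t \<le> T \<longrightarrow> hnorm n (flow t n x) \<le> k * hnorm n x" for n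
  using hnorm_flow_le[of T n] by metis
 then obtain k where k: "\<And>n. 1 \<le> k n" "\<And>n t x. 0 \<le> t ==> t \<le> T ==> hnorm n (flow t n x) \<le> k n * hnorm n x"
  by metis
 define m1 where "m1 = (\<Sum>n\<in>F. (k n)^2 * m n) + 1"
 have km: "0 \<le> (k n)^2 * m n" for n using m(1)[of n] by simp
 have m1: "0 < m1" unfolding m1_def using km by (intro add_nonneg_pos sum_nonneg) auto
 have m1n: "(k n)^2 * m n \<le> m1" if "n \<in> F" for n
  using member_le_sum[of n F "\<lambda>n. (k n)^2 * m n"] that finF km by (simp add: m1_def)
 define M' where "M' = m1 * Cs * (2 + 4 * L * pi * Kb^2 * M) + Kb^2 * M"
 have Cs: "0 < Cs" by (simp add: Cs_def)
 have M': "0 < M'"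
 proof -
  have "0 \<le> m1 * Cs * (2 + 4 * L * pi * Kb^2 * M)" using m1 Cs L M by auto
  moreover have "0 < Kb^2 * M" using Kb M by auto
  ultimately show ?thesis by (simp add: M'_def)
 qed
 have "(\<Sum>n\<in>S. (hnorm n (flow T n (v n)))^2) \<le> M' * obs 0 T S v" if S: "finite S" for S v
 proof -
  define H where "H = {n \<in> S. N \<le> absr n}"
  have split: "S = (S \<inter> F) \<union> H" "(S \<inter> F) \<inter> H = {}" by (auto simp: F_def H_def)
  have fin: "finite (S \<inter> F)" "finite H" using S by (auto simp: H_def)
  define Ob where "Ob = obs 0 T S v"
  have high: "(\<Sum>n\<in>H. nsq (flow T2 n (v n))) \<le> M * Ob"
   using order.trans[OF hi[OF S, folded H_def] mult_left_mono[OF obs_mono[of 0 0 T2 T S v]]] L M by (simp add: Ob_def)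
  have "(\<Sum>n\<in>H. (hnorm n (flow T n (v n)))^2) \<le> (\<Sum>n\<in>H. Kb^2 * nsq (flow T2 n (v n)))"
  proof (rule sum_mono)
   fix n
   have "hnorm n (flow T n (v n)) \<le> norm (flow T n (v n))" by (simp add: hnorm_def norm_fst_block_le)
   also have "... = norm (flow (T - T2) n (flow T2 n (v n)))" by (simp add: flow_add[symmetric])
   also have "... \<le> Kb * norm (flow T2 n (v n))" using L by (intro Kb) auto
   finally have "(hnorm n (flow T n (v n)))^2 \<le> (Kb * norm (flow T2 n (v n)))^2"
    by (intro power_mono hnorm_nonneg)
   then show "(hnorm n (flow T n (v n)))^2 \<le> Kb^2 * nsq (flow T2 n (v n))" by (simp add: power_mult_distrib)
  qed
  also have "... = Kb^2 * (\<Sum>n\<in>H. nsq (flow T2 n (v n)))" by (simp add: sum_distrib_left)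
  also have "... \<le> Kb^2 * (M * Ob)" using high by (intro mult_left_mono) auto
  finally have hh: "(\<Sum>n\<in>H. (hnorm n (flow T n (v n)))^2) \<le> Kb^2 * M * Ob" by (simp add: mult.assoc)

  have obs_high: "obs T2 (T2 + L) H v \<le> L * (2 * pi * (Kb^2 * (M * Ob)))"
  proof -
   have "obs T2 (T2 + L) H v \<le> integral {T2..T2 + L} (\<lambda>t. 2 * pi * (Kb^2 * (M * Ob)))"
    unfolding obs_def
   proof (rule integral_le[OF integrable_obs])
    fix t assume t: "t \<in> {T2..T2 + L}"
    have "energy X H (\<lambda>n. fst_block (flow t n (v n))) \<le> 2 * pi * (\<Sum>n\<in>H. nsq (fst_block (flow t n (v n))))"
     by (rule energy_le[OF fin(2)])
    also have "(\<Sum>n\<in>H. nsq (fst_block (flow t n (v n)))) \<le> (\<Sum>n\<in>H. Kb^2 * nsq (flow T2 n (v n)))"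
    proof (rule sum_mono)
     fix n
     have "norm (fst_block (flow t n (v n))) \<le> norm (flow t n (v n))" by (rule norm_fst_block_le)
     also have "... = norm (flow (t - T2) n (flow T2 n (v n)))" by (simp add: flow_add[symmetric])
     also have "... \<le> Kb * norm (flow T2 n (v n))" using L t by (intro Kb) auto
     finally have "nsq (fst_block (flow t n (v n))) \<le> (Kb * norm (flow T2 n (v n)))^2"
      by (intro power_mono norm_ge_zero)
     then show "nsq (fst_block (flow t n (v n))) \<le> Kb^2 * nsq (flow T2 n (v n))" by (simp add: power_mult_distrib)
    qed
    also have "... = Kb^2 * (\<Sum>n\<in>H. nsq (flow T2 n (v n)))" by (simp add: sum_distrib_left)
    also have "... \<le> Kb^2 * (M * Ob)" using high by (intro mult_left_mono) auto
    finally show "energy X H (\<lambda>n. fst_block (flow t n (v n))) \<le> 2 * pi * (Kb^2 * (M * Ob))" by simp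
   qed auto
   then show ?thesis using L by (simp add: mult_ac)
  qed
  \<comment> \<open>The low part is written as the data minus the high part, all three on the same
    set \<open>S\<close> of modes, so that \<open>obs_add_le\<close> applies.\<close>
  define w1 where "w1 = (\<lambda>n. if n \<in> F then v n else 0)"
  define w2 where "w2 = (\<lambda>n. if n \<in> F then 0 else v n)"
  have "obs T2 (T2 + L) (S \<inter> F) v = obs T2 (T2 + L) (S \<inter> F) w1" by (rule obs_cong) (auto simp: w1_def)
  also have "... = obs T2 (T2 + L) S w1" by (intro obs_mono_neutral S) (auto simp: w1_def)
  also have "... = obs T2 (T2 + L) S (\<lambda>n. v n + (-1) *R w2 n)" by (rule obs_cong) (auto simp: w1_def w2_def)
  also have "... \<le> 2 * obs T2 (T2 + L) S v + 2 * obs T2 (T2 + L) S (\<lambda>n. (-1) *R w2 n)" by (rule obs_add_le)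
  also have "obs T2 (T2 + L) S (\<lambda>n. (-1) *R w2 n) = obs T2 (T2 + L) S w2" unfolding obs_scaleR by simp
  also have "... = obs T2 (T2 + L) H w2"
   by (rule obs_mono_neutral[symmetric]) (use S in \<open>auto simp: w2_def F_def H_def\<close>)
  also have "... = obs T2 (T2 + L) H v" by (rule obs_cong) (auto simp: w2_def F_def H_def)
  finally have obs_low: "obs T2 (T2 + L) (S \<inter> F) v \<le> 2 * Ob + 2 * (L * (2 * pi * (Kb^2 * (M * Ob))))"
   using obs_high obs_mono[of 0 T2 "T2 + L" T S v] L unfolding Ob_def by linarith

  have "(\<Sum>n\<in>S \<inter> F. (hnorm n (flow T n (v n)))^2) \<le>
    (\<Sum>n\<in>S \<inter> F. m1 * integral {T2..T2 + L} (\<lambda>s. nsq (fst_block (flow s n (v n)))))"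
  proof (rule sum_mono)
   fix n assume n: "n \<in> S \<inter> F"
   define I where "I = integral {0..L} (\<lambda>s. nsq (fst_block (flow s n (flow T2 n (v n)))))"
   have I: "I = integral {T2..T2 + L} (\<lambda>s. nsq (fst_block (flow s n (v n))))"
    using integral_shift_real_ivl[of T2 T2 "T2 + L" "\<lambda>s. nsq (fst_block (flow s n (v n)))"]
    by (simp add: I_def flow_add[symmetric])
   have I0: "0 \<le> I" unfolding I_def by (intro integral_nonneg integrable_continuous_real continuous_intros) auto
   have "flow T n (v n) = flow (T - T2) n (flow T2 n (v n))" by (simp add: flow_add[symmetric])
   then have "hnorm n (flow T n (v n)) \<le> k n * hnorm n (flow T2 n (v n))" using k(2)[of "T - T2"] L by simp
   then have "(hnorm n (flow T n (v n)))^2 \<le> (k n * hnorm n (flow T2 n (v n)))^2"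
    by (intro power_mono hnorm_nonneg)
   also have "... \<le> (k n)^2 * (m n * I)"
    unfolding I_def power_mult_distrib by (intro mult_left_mono m) auto
   also have "... \<le> m1 * I" using mult_right_mono[OF m1n I0] n by (simp add: mult.assoc)
   finally show "(hnorm n (flow T n (v n)))^2 \<le> m1 * integral {T2..T2 + L} (\<lambda>s. nsq (fst_block (flow s n (v n))))"
    by (simp add: I)
  qed
  also have "... = m1 * integral {T2..T2 + L} (\<lambda>s. \<Sum>n\<in>S \<inter> F. nsq (fst_block (flow s n (v n))))"
   using fin by (subst Henstock_Kurzweil_Integration.integral_sum)
    (auto simp: sum_distrib_left intro!: integrable_continuous_real continuous_intros)
  also have "... \<le> m1 * (Cs * obs T2 (T2 + L) (S \<inter> F) v)"
  proof (rule mult_left_mono)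
   have "integral {T2..T2 + L} (\<lambda>s. \<Sum>n\<in>S \<inter> F. nsq (fst_block (flow s n (v n)))) \<le>
     integral {T2..T2 + L} (\<lambda>s. Cs * energy X (S \<inter> F) (\<lambda>n. fst_block (flow s n (v n))))"
   proof (rule integral_le)
    show "(\<Sum>n\<in>S \<inter> F. nsq (fst_block (flow s n (v n)))) \<le> Cs * energy X (S \<inter> F) (\<lambda>n. fst_block (flow s n (v n)))" for s
     unfolding Cs_def by (rule C0(2)) (use F in blast)
   qed (intro integrable_continuous_real continuous_intros)+
   then show "integral {T2..T2 + L} (\<lambda>s. \<Sum>n\<in>S \<inter> F. nsq (fst_block (flow s n (v n)))) \<le> Cs * obs T2 (T2 + L) (S \<inter> F) v"
    by (simp add: obs_def)
  qed (use m1 in simp)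
  also have "... \<le> m1 * (Cs * (2 * Ob + 2 * (L * (2 * pi * (Kb^2 * (M * Ob))))))"
   using obs_low m1 Cs by (intro mult_left_mono) auto
  also have "... = m1 * Cs * (2 + 4 * L * pi * Kb^2 * M) * Ob" by (simp add: algebra_simps)
  finally have ll: "(\<Sum>n\<in>S \<inter> F. (hnorm n (flow T n (v n)))^2) \<le> m1 * Cs * (2 + 4 * L * pi * Kb^2 * M) * Ob" .
  have "(\<Sum>n\<in>S. (hnorm n (flow T n (v n)))^2) = (\<Sum>n\<in>S \<inter> F. (hnorm n (flow T n (v n)))^2) + (\<Sum>n\<in>H. (hnorm n (flow T n (v n)))^2)"
   by (subst split(1), rule sum.union_disjoint[OF fin split(2)])
  also have "... \<le> M' * Ob" using add_mono[OF ll hh] by (simp add: M'_def distrib_right)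
  finally show ?thesis by (simp add: Ob_def)
 qed
 with M' show ?thesis by (rule that)
qed

end

section \<open>Square-integrable functions\<close>

text \<open>Square-integrable functions are not identified almost everywhere here; this is a squared
  seminorm on representatives.\<close>

definition l2sq :: "'a measure => ('a => 'b::real_normed_vector) => real"
 where "l2sq M f = (LINT x|M. nsq (f x))"

lemma L2_norm_l2sq: "L2_norm M f = sqrt (l2sq M f)" by (simp add: L2_norm_def l2sq_def)

lemma l2sq_nonneg: "0 \<le> l2sq M f" unfolding l2sq_def by (rule integral_nonneg_AE) simp

lemma square_integrable_add:
 fixes f g :: "'a => 'b::euclidean_space"
 assumes f: "square_integrable M f" and g: "square_integrable M g"
 shows "square_integrable M (\<lambda>x. f x + g x)" "l2sq M (\<lambda>x. f x + g x) \<le> 2 * l2sq M f + 2 * l2sq M g"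
proof -
 have int: "integrable M (\<lambda>x. 2 * nsq (f x) + 2 * nsq (g x))"
  using f g by (auto simp: square_integrable_def)
 have [measurable]: "f \<in> borel_measurable M" "g \<in> borel_measurable M" using f g by (auto simp: square_integrable_def)
 have i: "integrable M (\<lambda>x. nsq (f x + g x))"
  by (rule Bochner_Integration.integrable_bound[OF int]) (auto intro: order.trans[OF norm_add_sq_le])
 then show "square_integrable M (\<lambda>x. f x + g x)" by (simp add: square_integrable_def)
 have "l2sq M (\<lambda>x. f x + g x) \<le> (LINT x|M. 2 * nsq (f x) + 2 * nsq (g x))"
  unfolding l2sq_def by (intro integral_mono i int norm_add_sq_le)
 also have "... = 2 * l2sq M f + 2 * l2sq M g" using f g by (simp add: l2sq_def square_integrable_def)
 finally show "l2sq M (\<lambda>x. f x + g x) \<le> 2 * l2sq M f + 2 * l2sq M g" .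
qed

lemma square_integrable_scaleR:
 fixes f :: "'a => 'b::euclidean_space"
 assumes f: "square_integrable M f"
 shows "square_integrable M (\<lambda>x. r *R f x)" "l2sq M (\<lambda>x. r *R f x) = r^2 * l2sq M f"
 using f by (auto simp: square_integrable_def l2sq_def power_mult_distrib)

lemma square_integrable_diff:
 fixes f g :: "'a => 'b::euclidean_space"
 assumes f: "square_integrable M f" and g: "square_integrable M g"
 shows "square_integrable M (\<lambda>x. f x - g x)" "l2sq M (\<lambda>x. f x - g x) \<le> 2 * l2sq M f + 2 * l2sq M g"
 using square_integrable_add[OF f square_integrable_scaleR(1)[OF g, of "-1"]]
  square_integrable_scaleR(2)[OF g, of "-1"] by simp_all

lemma l2sq_commute: "l2sq M (\<lambda>x. f x - g x) = l2sq M (\<lambda>x. g x - f x)"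
 by (simp add: l2sq_def norm_minus_commute)

lemma integrable_inner:
 fixes f g :: "'a => 'b::euclidean_space"
 assumes f: "square_integrable M f" and g: "square_integrable M g"
 shows "integrable M (\<lambda>x. inner (f x) (g x))"
proof -
 have int: "integrable M (\<lambda>x. nsq (f x) + nsq (g x))" using f g by (auto simp: square_integrable_def)
 have [measurable]: "f \<in> borel_measurable M" "g \<in> borel_measurable M" using f g by (auto simp: square_integrable_def)
 show ?thesis
 proof (rule Bochner_Integration.integrable_bound[OF int])
  have "\<bar>inner a b\<bar> \<le> nsq a + nsq b" for a b :: 'b
  proof -
   have "\<bar>inner a b\<bar> \<le> norm a * norm b" by (rule Cauchy_Schwarz_ineq2)
   moreover have "0 \<le> norm a * norm b" by simp
   ultimately show ?thesis using zero_le_power2[of "norm a - norm b"] unfolding power2_diff by linarith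
  qed
  then show "AE x in M. norm (inner (f x) (g x)) \<le> norm (nsq (f x) + nsq (g x))" by simp
 qed simp
qed

lemma l2sq_add_scaleR:
 fixes f g :: "'a => 'b::euclidean_space"
 assumes f: "square_integrable M f" and g: "square_integrable M g"
 shows "l2sq M (\<lambda>x. f x + r *R g x) = l2sq M f + 2 * r * (LINT x|M. inner (f x) (g x)) + r^2 * l2sq M g"
proof -
 have "nsq (f x + r *R g x) = nsq (f x) + (2 * r * inner (f x) (g x) + r^2 * nsq (g x))" for x
  unfolding power2_norm_eq_inner by (simp add: inner_add inner_commute power2_eq_square)
 then show ?thesis using f g integrable_inner[OF f g] by (simp add: l2sq_def square_integrable_def)
qed

text \<open>A quadratic polynomial in \<open>r\<close> is nonnegative. If \<open>l2sq M g\<close> is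
  0, it is linear and its slope must vanish, which is why that case is separate.\<close>

lemma inner_l2sq_le:
 fixes f g :: "'a => 'b::euclidean_space"
 assumes f: "square_integrable M f" and g: "square_integrable M g"
 shows "(LINT x|M. inner (f x) (g x))^2 \<le> l2sq M f * l2sq M g"
proof -
 define a where "a = (LINT x|M. inner (f x) (g x))"
 define b where "b = l2sq M g"
 define c where "c = l2sq M f"
 have q: "0 \<le> c + 2 * r * a + r^2 * b" for r
  using l2sq_add_scaleR[OF f g, of r] l2sq_nonneg[of M "\<lambda>x. f x + r *R g x"] by (simp add: a_def b_def c_def)
 have "a^2 \<le> c * b"
 proof (cases "b = 0")
  case True
  have "a = 0"
  proof (rule ccontr)
   assume "a \<noteq> 0"
   then have "2 * (- (c + 1) / (2 * a)) * a = - (c + 1)" by (simp add: field_simps)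
   then show False using q[of "- (c + 1) / (2 * a)"] True by simp
  qed
  then show ?thesis using True by simp
 next
  case False
  then have b: "0 < b" using l2sq_nonneg[of M g] by (simp add: b_def)
  have "c + 2 * (- a / b) * a + (- a / b)^2 * b = c - a^2 / b"
   using b by (simp add: power2_eq_square field_simps)
  with q[of "- a / b"] have "a^2 / b \<le> c" by linarith
  then show ?thesis using b by (simp add: pos_divide_le_eq)
 qed
 then show ?thesis by (simp add: a_def b_def c_def)
qed

text \<open>A subsequence with rapidly decreasing increments converges almost everywhere; Fatou's
  lemma then gives norm convergence of the whole sequence to the pointwise limit.\<close>

lemma square_integrable_complete:
 fixes f :: "nat => 'a => 'b::euclidean_space"
 assumes f: "\<And>k. square_integrable M (f k)"
  and C: "\<And>e. 0 < e ==> \<exists>N. \<forall>m\<ge>N. \<forall>n\<ge>N. l2sq M (\<lambda>x. f m x - f n x) < e"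
 obtains g where "square_integrable M g" "(\<lambda>k. l2sq M (\<lambda>x. f k x - g x)) \<longlonglongrightarrow> 0"
proof -
 have [measurable]: "f k \<in> borel_measurable M" for k using f[of k] by (simp add: square_integrable_def)
 have nn: "(\<integral>\<^sup>+x. ennreal (nsq (f m x - f n x)) \<partial>M) = ennreal (l2sq M (\<lambda>x. f m x - f n x))" for m n
  unfolding l2sq_def using square_integrable_diff(1)[OF f f, of m n]
  by (intro nn_integral_eq_integral) (auto simp: square_integrable_def)
 have "\<exists>N. \<forall>m\<ge>N. \<forall>n\<ge>N. l2sq M (\<lambda>x. f m x - f n x) < (1 / 4) ^ k" for k :: nat by (rule C) simp
 then obtain N where N: "\<And>k m n. N k \<le> m ==> N k \<le> n ==> l2sq M (\<lambda>x. f m x - f n x) < (1 / 4) ^ k"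
  by metis
 \<comment> \<open>Partial sums make the choice monotone: both \<open>r k\<close> and
   \<open>r (Suc k)\<close> pass the threshold \<open>N k\<close>.\<close>
 define r where "r = (\<lambda>k. \<Sum>i\<le>k. Suc (N i))"
 have r: "N k \<le> r k" "N k \<le> r (Suc k)" "k \<le> r k" for k
 proof -
  show "N k \<le> r k" using member_le_sum[of k "{..k}" "\<lambda>i. Suc (N i)"] by (simp add: r_def)
  then show "N k \<le> r (Suc k)" by (simp add: r_def)
  show "k \<le> r k" by (induction k) (auto simp: r_def)
 qed
 \<comment> \<open>The integral of the squared increment is below \<open>(1 / 4) ^ k\<close>, so
   even with the weight \<open>2 ^ k\<close> the series converges. Almost everywhere its finiteness
   bounds \<open>d k x\<close> by a geometric sequence.\<close>
 define d where "d = (\<lambda>k x. norm (f (r (Suc k)) x - f (r k) x))"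
 have [measurable]: "d k \<in> borel_measurable M" for k unfolding d_def by measurable
 have "(\<integral>\<^sup>+x. (\<Sum>k. ennreal (2 ^ k * (d k x)^2)) \<partial>M) = (\<Sum>k. (\<integral>\<^sup>+x. ennreal (2 ^ k * (d k x)^2) \<partial>M))"
  by (rule nn_integral_suminf) measurable
 also have "... \<le> (\<Sum>k. ennreal ((1 / 2) ^ k))"
 proof (rule suminf_le)
  fix k :: nat
  have "ennreal (2 ^ k * (d k x)^2) = ennreal (2 ^ k) * ennreal (nsq (f (r (Suc k)) x - f (r k) x))" for x
   unfolding d_def by (rule ennreal_mult) auto
  then have "(\<integral>\<^sup>+x. ennreal (2 ^ k * (d k x)^2) \<partial>M) = ennreal (2 ^ k) * ennreal (l2sq M (\<lambda>x. f (r (Suc k)) x - f (r k) x))"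
   by (simp only: nn[symmetric]) (rule nn_integral_cmult, measurable)
  also have "... \<le> ennreal (2 ^ k) * ennreal ((1 / 4) ^ k)"
   using N[OF r(2,1), of k] by (intro mult_left_mono ennreal_leI) auto
  also have "... = ennreal (2 ^ k * (1 / 4) ^ k)" by (rule ennreal_mult[symmetric]) auto
  also have "2 ^ k * (1 / 4) ^ k = (1 / 2 :: real) ^ k" by (simp add: power_mult_distrib[symmetric])
  finally show "(\<integral>\<^sup>+x. ennreal (2 ^ k * (d k x)^2) \<partial>M) \<le> ennreal ((1 / 2) ^ k)" .
 qed auto
 also have "... = ennreal (\<Sum>k. (1 / 2) ^ k)" by (intro suminf_ennreal2) (auto intro: summable_geometric)
 also have "... < \<infinity>" by simp
 finally have fin: "(\<integral>\<^sup>+x. (\<Sum>k. ennreal (2 ^ k * (d k x)^2)) \<partial>M) \<noteq> \<infinity>" by simp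
 have "AE x in M. (\<Sum>k. ennreal (2 ^ k * (d k x)^2)) \<noteq> \<infinity>"
  by (rule nn_integral_PInf_AE[OF _ fin]) measurable
 define g where "g = (\<lambda>x. lim (\<lambda>k. f (r k) x))"
 have [measurable]: "g \<in> borel_measurable M" unfolding g_def by measurable
 have conv: "AE x in M. (\<lambda>k. f (r k) x) \<longlonglongrightarrow> g x"
  using \<open>AE x in M. (\<Sum>k. ennreal (2 ^ k * (d k x)^2)) \<noteq> \<infinity>\<close>
 proof (eventually_elim)
  fix x assume x: "(\<Sum>k. ennreal (2 ^ k * (d k x)^2)) \<noteq> \<infinity>"
  define s where "s = enn2real (\<Sum>k. ennreal (2 ^ k * (d k x)^2))"
  have s: "0 \<le> s" by (simp add: s_def)
  have dk: "d k x \<le> sqrt s * sqrt (1 / 2) ^ k" for k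
  proof -
   have "w k \<le> (\<Sum>k. w k)" for w :: "nat => ennreal" using sum_le_suminf[of w "{k}"] by simp
   then have "ennreal (2 ^ k * (d k x)^2) \<le> (\<Sum>k. ennreal (2 ^ k * (d k x)^2))" .
   also have "... = ennreal s" using x unfolding s_def by (intro ennreal_enn2real[symmetric]) (simp add: top.not_eq_extremum)
   finally have "2 ^ k * (d k x)^2 \<le> s" by (simp only: ennreal_le_iff[OF s])
   then have "(d k x)^2 \<le> s * (1 / 2) ^ k" by (simp add: field_simps power_one_over)
   then have "sqrt ((d k x)^2) \<le> sqrt (s * (1 / 2) ^ k)" by (rule real_sqrt_le_mono)
   then show ?thesis by (simp add: d_def real_sqrt_mult real_sqrt_power)
  qed
  have "summable (\<lambda>k. sqrt s * sqrt (1 / 2) ^ k)" by (intro summable_mult summable_geometric) simp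
  then have "summable (\<lambda>k. norm (f (r (Suc k)) x - f (r k) x))"
   by (rule summable_comparison_test') (use dk in \<open>simp add: d_def\<close>)
  then have "summable (\<lambda>k. f (r (Suc k)) x - f (r k) x)" by (rule summable_norm_cancel)
  then obtain l where "(\<lambda>n. \<Sum>k<n. f (r (Suc k)) x - f (r k) x) \<longlonglongrightarrow> l" using summable_LIMSEQ by blast
  then have "(\<lambda>n. (f (r n) x - f (r 0) x) + f (r 0) x) \<longlonglongrightarrow> l + f (r 0) x"
   by (intro tendsto_add) (simp_all add: sum_lessThan_telescope[of "\<lambda>k. f (r k) x"])
  then have "convergent (\<lambda>n. f (r n) x)" by (auto simp: convergent_def)
  then show "(\<lambda>k. f (r k) x) \<longlonglongrightarrow> g x" unfolding g_def by (simp add: convergent_LIMSEQ_iff)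
 qed
 have bound: "(\<integral>\<^sup>+x. ennreal (nsq (f n x - g x)) \<partial>M) \<le> ennreal e"
  if "\<And>m. Na \<le> m ==> l2sq M (\<lambda>x. f n x - f m x) < e" for n Na e
 proof -
  have "(\<integral>\<^sup>+x. ennreal (nsq (f n x - g x)) \<partial>M) = (\<integral>\<^sup>+x. liminf (\<lambda>k. ennreal (nsq (f n x - f (r k) x))) \<partial>M)"
  proof (rule nn_integral_cong_AE)
   show "AE x in M. ennreal (nsq (f n x - g x)) = liminf (\<lambda>k. ennreal (nsq (f n x - f (r k) x)))"
    using conv
   proof (eventually_elim)
    fix x assume "(\<lambda>k. f (r k) x) \<longlonglongrightarrow> g x"
    then have "(\<lambda>k. ennreal (nsq (f n x - f (r k) x))) \<longlonglongrightarrow> ennreal (nsq (f n x - g x))"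
     by (intro tendsto_intros)
    then show "ennreal (nsq (f n x - g x)) = liminf (\<lambda>k. ennreal (nsq (f n x - f (r k) x)))"
     by (intro lim_imp_Liminf[symmetric]) auto
   qed
  qed
  also have "... \<le> liminf (\<lambda>k. \<integral>\<^sup>+x. ennreal (nsq (f n x - f (r k) x)) \<partial>M)"
   by (rule nn_integral_liminf) measurable
  also have "... = liminf (\<lambda>k. ennreal (l2sq M (\<lambda>x. f n x - f (r k) x)))" by (simp only: nn)
  also have "... \<le> liminf (\<lambda>k. ennreal e)"
   using r(3) that by (intro Liminf_mono eventually_sequentiallyI[of Na] ennreal_leI) (meson le_trans less_imp_le)
  finally show ?thesis by (simp add: Liminf_const)
 qed
 have sg: "square_integrable M (\<lambda>x. f n x - g x)" "l2sq M (\<lambda>x. f n x - g x) \<le> e"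
  if "\<And>m. Na \<le> m ==> l2sq M (\<lambda>x. f n x - f m x) < e" for n Na e
 proof -
  have e: "0 \<le> e" using that[of Na] l2sq_nonneg[of M "\<lambda>x. f n x - f Na x"] by simp
  have b: "(\<integral>\<^sup>+x. ennreal (nsq (f n x - g x)) \<partial>M) \<le> ennreal e" using that by (rule bound)
  have "integrable M (\<lambda>x. nsq (f n x - g x))"
   using b by (intro integrableI_nonneg) (auto simp: order_le_less_trans ennreal_less_top intro: le_less_trans)
  then show "square_integrable M (\<lambda>x. f n x - g x)" by (simp add: square_integrable_def)
  show "l2sq M (\<lambda>x. f n x - g x) \<le> e"
   unfolding l2sq_def using b e by (subst integral_eq_nn_integral) (auto simp: enn2real_leI)
 qed
 show ?thesis
 proof (rule that)
  have "square_integrable M (\<lambda>x. f (N 0) x - g x)" by (rule sg(1)[of "N 0" _ 1]) (use N[of 0 "N 0"] in simp)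
  from square_integrable_diff(1)[OF f[of "N 0"] this] show "square_integrable M g" by simp
  show "(\<lambda>k. l2sq M (\<lambda>x. f k x - g x)) \<longlonglongrightarrow> 0"
  proof (rule LIMSEQ_I)
   fix e :: real assume e: "0 < e"
   then obtain Na where "\<forall>m\<ge>Na. \<forall>n\<ge>Na. l2sq M (\<lambda>x. f m x - f n x) < e / 2" using C[of "e / 2"] by auto
   then have le: "l2sq M (\<lambda>x. f n x - g x) \<le> e / 2" if "Na \<le> n" for n using that by (intro sg(2)[of Na]) auto
   have "norm (l2sq M (\<lambda>x. f n x - g x) - 0) < e" if "Na \<le> n" for n
    using le[OF that] e by (simp add: l2sq_nonneg)
   then show "\<exists>no. \<forall>n\<ge>no. norm (l2sq M (\<lambda>x. f n x - g x) - 0) < e" by blast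
  qed
 qed
qed

lemma inner_l2_tendsto:
 fixes f :: "nat => 'a => 'b::euclidean_space"
 assumes f: "\<And>k. square_integrable M (f k)" and g: "square_integrable M g" and h: "square_integrable M h"
  and l: "(\<lambda>k. l2sq M (\<lambda>x. f k x - g x)) \<longlonglongrightarrow> 0"
 shows "(\<lambda>k. LINT x|M. inner (f k x) (h x)) \<longlonglongrightarrow> (LINT x|M. inner (g x) (h x))"
proof -
 have "(\<lambda>k. (LINT x|M. inner (f k x - g x) (h x))^2) \<longlonglongrightarrow> 0"
 proof (rule tendsto_sandwich[OF _ _ tendsto_const])
  show "\<forall>\<^sub>F k in sequentially. (LINT x|M. inner (f k x - g x) (h x))^2 \<le> l2sq M (\<lambda>x. f k x - g x) * l2sq M h"
   by (intro always_eventually allI inner_l2sq_le square_integrable_diff f g h)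
  show "(\<lambda>k. l2sq M (\<lambda>x. f k x - g x) * l2sq M h) \<longlonglongrightarrow> 0" using tendsto_mult_right[OF l] by simp
 qed simp
 then have "(\<lambda>k. LINT x|M. inner (f k x - g x) (h x)) \<longlonglongrightarrow> 0"
  using tendsto_real_sqrt[of "\<lambda>k. (LINT x|M. inner (f k x - g x) (h x))^2" 0] by (simp add: tendsto_rabs_zero_iff)
 moreover have "(LINT x|M. inner (f k x - g x) (h x)) = (LINT x|M. inner (f k x) (h x)) - (LINT x|M. inner (g x) (h x))" for k
  by (simp add: inner_diff_left integrable_inner f g h)
 ultimately show ?thesis by (simp add: LIM_zero_iff)
qed

text \<open>The representing function is the limit of a minimizing sequence of
 \<open>l2sq M (\<phi> i) / 2 - \<Lambda> i\<close>.\<close>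

lemma riesz_representation:
 fixes \<phi> :: "'i => 'a => 'b::euclidean_space" and \<Lambda> :: "'i => real"
 assumes ne: "V \<noteq> {}" and si: "\<And>i. i \<in> V ==> square_integrable M (\<phi> i)"
  and lin: "\<And>i j r s. i \<in> V ==> j \<in> V ==> \<exists>k\<in>V. \<phi> k = (\<lambda>x. r *R \<phi> i x + s *R \<phi> j x) \<and> \<Lambda> k = r * \<Lambda> i + s * \<Lambda> j"
  and bd: "\<And>i. i \<in> V ==> (\<Lambda> i)^2 \<le> C * l2sq M (\<phi> i)"
 obtains u where "square_integrable M u" "\<And>i. i \<in> V ==> (LINT x|M. inner (u x) (\<phi> i x)) = \<Lambda> i"
proof -
 define F where "F = (\<lambda>i. l2sq M (\<phi> i) / 2 - \<Lambda> i)"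
 have lower: "- \<bar>C\<bar> / 2 \<le> F i" if i: "i \<in> V" for i
 proof (rule ccontr)
  define a where "a = l2sq M (\<phi> i)"
  have a: "0 \<le> a" by (simp add: a_def l2sq_nonneg)
  assume "\<not> - \<bar>C\<bar> / 2 \<le> F i"
  then have l: "(a + \<bar>C\<bar>) / 2 < \<Lambda> i" by (simp add: F_def a_def field_simps)
  then have "((a + \<bar>C\<bar>) / 2)^2 < (\<Lambda> i)^2" using a by (intro power_strict_mono) auto
  also have "... \<le> C * a" using bd[OF i] by (simp add: a_def)
  also have "... \<le> \<bar>C\<bar> * a" using a by (intro mult_right_mono) auto
  finally have "(a + \<bar>C\<bar>)^2 < 4 * (\<bar>C\<bar> * a)" by (simp add: power_divide)
  then show False using zero_le_power2[of "a - \<bar>C\<bar>"] by (simp add: power2_sum power2_diff)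
 qed
 define m where "m = Inf (F ` V)"
 have bb: "bdd_below (F ` V)" using lower by (auto simp: bdd_below_def)
 have m: "m \<le> F i" if "i \<in> V" for i unfolding m_def using that bb by (intro cInf_lower) auto
 have "\<exists>i\<in>V. F i < m + 1 / real (Suc k)" for k
  using cInf_lessD[of "F ` V" "m + 1 / real (Suc k)"] ne by (auto simp: m_def)
 then obtain s where s: "\<And>k. s k \<in> V" "\<And>k. F (s k) < m + 1 / real (Suc k)" by metis
 have expand: "l2sq M (\<lambda>x. r *R \<phi> i x + t *R \<phi> j x) =
   r^2 * l2sq M (\<phi> i) + 2 * r * t * (LINT x|M. inner (\<phi> i x) (\<phi> j x)) + t^2 * l2sq M (\<phi> j)"
  if "i \<in> V" "j \<in> V" for i j r t
  using l2sq_add_scaleR[OF square_integrable_scaleR(1)[OF si[OF that(1)], of r] si[OF that(2)], of t]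
  by (simp add: square_integrable_scaleR(2)[OF si[OF that(1)]])
 \<comment> \<open>Parallelogram identity: the value at the midpoint is at least \<open>m\<close>,
   so two almost minimizing elements are close to each other.\<close>
 have par: "l2sq M (\<lambda>x. \<phi> i x - \<phi> j x) \<le> 4 * (F i - m) + 4 * (F j - m)" if ij: "i \<in> V" "j \<in> V" for i j
 proof -
  obtain k where k: "k \<in> V" "\<phi> k = (\<lambda>x. (1/2) *R \<phi> i x + (1/2) *R \<phi> j x)" "\<Lambda> k = (1/2) * \<Lambda> i + (1/2) * \<Lambda> j"
   using lin[OF ij] by blast
  have "m \<le> F k" by (rule m[OF k(1)])
  moreover have "F k = (l2sq M (\<phi> i) + 2 * (LINT x|M. inner (\<phi> i x) (\<phi> j x)) + l2sq M (\<phi> j)) / 8 - (\<Lambda> i + \<Lambda> j) / 2"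
   unfolding F_def k(2,3) expand[OF ij] by (simp add: power2_eq_square field_simps)
  moreover have "l2sq M (\<lambda>x. \<phi> i x - \<phi> j x) = l2sq M (\<phi> i) - 2 * (LINT x|M. inner (\<phi> i x) (\<phi> j x)) + l2sq M (\<phi> j)"
   using expand[OF ij, of 1 "-1"] by simp
  ultimately show ?thesis unfolding F_def by argo
 qed
 have "\<exists>N. \<forall>k\<ge>N. \<forall>l\<ge>N. l2sq M (\<lambda>x. \<phi> (s k) x - \<phi> (s l) x) < e" if e: "0 < e" for e
 proof -
  obtain N where N: "1 / real (Suc N) < e / 8" using nat_approx_posE[of "e / 8"] e by auto
  have Fs: "F (s k) - m < e / 8" if "N \<le> k" for k
  proof -
   have "1 / real (Suc k) \<le> 1 / real (Suc N)" using that by (simp add: frac_le)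
   then show ?thesis using s(2)[of k] N by linarith
  qed
  have "l2sq M (\<lambda>x. \<phi> (s k) x - \<phi> (s l) x) < e" if "N \<le> k" "N \<le> l" for k l
   using par[OF s(1) s(1), of k l] Fs[OF that(1)] Fs[OF that(2)] by argo
  then show ?thesis by blast
 qed
 then obtain u where u: "square_integrable M u" "(\<lambda>k. l2sq M (\<lambda>x. \<phi> (s k) x - u x)) \<longlonglongrightarrow> 0"
  using square_integrable_complete[of M "\<lambda>k. \<phi> (s k)", OF si[OF s(1)]] by blast
 show ?thesis
 proof (rule that[OF u(1)])
  fix j assume j: "j \<in> V"
  define a where "a = (LINT x|M. inner (u x) (\<phi> j x)) - \<Lambda> j"
  define b where "b = l2sq M (\<phi> j)"
  have b: "0 \<le> b" by (simp add: b_def l2sq_nonneg)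
  have lim: "(\<lambda>k. LINT x|M. inner (\<phi> (s k) x) (\<phi> j x)) \<longlonglongrightarrow> (LINT x|M. inner (u x) (\<phi> j x))"
   by (intro inner_l2_tendsto si s u j)
  \<comment> \<open>Moving the minimizing sequence in the direction \<open>\<phi> j\<close> yields
    in the limit a quadratic in \<open>r\<close> that is nonnegative and zero at 0; its linear
    coefficient \<open>a\<close> has to vanish.\<close>
  have q: "0 \<le> r * a + r^2 / 2 * b" for r
  proof -
   have "- (1 / real (Suc k)) \<le> r * ((LINT x|M. inner (\<phi> (s k) x) (\<phi> j x)) - \<Lambda> j) + r^2 / 2 * b" for k
   proof -
    obtain l where l: "l \<in> V" "\<phi> l = (\<lambda>x. 1 *R \<phi> (s k) x + r *R \<phi> j x)" "\<Lambda> l = 1 * \<Lambda> (s k) + r * \<Lambda> j"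
     using lin[OF s(1) j] by blast
    have "m \<le> F l" by (rule m[OF l(1)])
    also have "F l = F (s k) + (r * ((LINT x|M. inner (\<phi> (s k) x) (\<phi> j x)) - \<Lambda> j) + r^2 / 2 * b)"
     unfolding F_def l(2,3) expand[OF s(1) j] b_def by (simp add: field_simps)
    finally show ?thesis using s(2)[of k] by linarith
   qed
   moreover have "(\<lambda>k. r * ((LINT x|M. inner (\<phi> (s k) x) (\<phi> j x)) - \<Lambda> j) + r^2 / 2 * b) \<longlonglongrightarrow> r * a + r^2 / 2 * b"
    unfolding a_def by (intro tendsto_intros lim)
   moreover have "(\<lambda>k. - (1 / real (Suc k))) \<longlonglongrightarrow> - 0"
    by (intro tendsto_minus) (rule LIMSEQ_inverse_real_of_nat[unfolded inverse_eq_divide])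
   ultimately show ?thesis using LIMSEQ_le[of "\<lambda>k. - (1 / real (Suc k))" "- 0"] by auto
  qed
  have "a = 0"
  proof (rule ccontr)
   assume a: "a \<noteq> 0"
   define c where "c = 1 / (b + 1)"
   have c: "0 < c" "c * b < 1" using b by (auto simp: c_def)
   have "0 \<le> - (a * c) * a + (- (a * c))^2 / 2 * b" by (rule q)
   also have "... = (a^2 * c) * (c * b / 2 - 1)" by (simp add: power2_eq_square algebra_simps)
   finally have "0 \<le> (a^2 * c) * (c * b / 2 - 1)" .
   moreover have "(a^2 * c) * (c * b / 2 - 1) < 0" using a c by (intro mult_pos_neg) auto
   ultimately show False by simp
  qed
  then show "(LINT x|M. inner (u x) (\<phi> j x)) = \<Lambda> j" by (simp add: a_def)
 qed
qed

section \<open>Fourier series on the torus\<close>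

lemma torus_exp_of_real [simp]: "torus_exp n (torus_of_real x) = cis (of_int n * x)"
 by (rule torus_exp.abs_eq)

lemma torus_of_real_surj: obtains y where "x = torus_of_real y"
 using Quotient_abs_rep[OF Quotient_torus, of x] by metis

lemma continuous_torus_exp: "continuous_on UNIV (torus_exp n)"
proof -
 have "open ((\<lambda>x. torus_exp n (torus_of_real x)) -` U)" if "open U" for U
  using that by (intro open_vimage) (auto intro!: continuous_intros)
 then show ?thesis by (simp add: continuous_on_open_vimage open_torus_def vimage_def)
qed

lemma measurable_torus_exp [measurable]: "torus_exp n \<in> borel_measurable borel"
 by (rule borel_measurable_continuous_onI[OF continuous_torus_exp])

lemma norm_torus_exp [simp]: "norm (torus_exp n x) = 1" by (rule torus_of_real_surj[of x]) simp

lemma torus_exp_minus: "torus_exp (- n) x = cnj (torus_exp n x)"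
 by (rule torus_of_real_surj[of x]) (simp add: cis_cnj)

lemma sets_torus_measure [simp, measurable_cong]: "sets torus_measure = sets borel"
 by (simp add: torus_measure_def)

lemma space_torus_measure [simp]: "space torus_measure = UNIV" by (simp add: torus_measure_def)

lemma finite_measure_torus: "finite_measure torus_measure"
 by (rule finite_measureI) (simp add: emeasure_torus_measure_UNIV)

lemma integral_torus:
 fixes f :: "torus => 'b::{banach, second_countable_topology}"
 assumes f: "f \<in> borel_measurable borel"
 shows "(LINT x|torus_measure. f x) = (LINT x:{0..<2 * pi}|lborel. f (torus_of_real x))"
 unfolding torus_measure_def
 by (simp add: integral_distr[OF measurable_torus_of_real f] integral_restrict_space set_lebesgue_integral_def)

definition torus_poly :: "int set => (int => complex^'k) => torus => complex^'k"
 where "torus_poly S c x = (\<Sum>n\<in>S. torus_exp n x *s c n)"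

lemma torus_poly_of_real [simp]: "torus_poly S c (torus_of_real x) = tpoly S c x"
 by (simp add: torus_poly_def tpoly_def)

lemma measurable_smult [measurable]:
 "f \<in> borel_measurable M ==> g \<in> borel_measurable M ==> (\<lambda>x. f x *s (g x :: complex^'k)) \<in> borel_measurable M"
 by (rule borel_measurable_continuous_Pair[where H = "\<lambda>x y. x *s y"]) (auto intro!: continuous_intros)

lemma measurable_torus_poly [measurable]: "torus_poly S c \<in> borel_measurable borel"
 unfolding torus_poly_def by measurable

lemma norm_torus_poly_le: "norm (torus_poly S c x) \<le> (\<Sum>n\<in>S. norm (c n))"
 unfolding torus_poly_def by (rule order.trans[OF norm_sum]) (simp add: norm_vector_smult)

lemma (in finite_measure) square_integrable_bounded:
 fixes f :: "'a => 'b::euclidean_space"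
 assumes [measurable]: "f \<in> borel_measurable M" and b: "\<And>x. x \<in> space M ==> norm (f x) \<le> B"
 shows "square_integrable M f" unfolding square_integrable_def
proof
 show "integrable M (\<lambda>x. nsq (f x))"
  by (rule integrable_const_bound[where B = "B^2"]) (auto intro!: power_mono b)
qed fact

lemma square_integrable_torus_poly: "square_integrable torus_measure (torus_poly S c)"
 by (rule finite_measure.square_integrable_bounded[OF finite_measure_torus _ norm_torus_poly_le]) measurable

lemma inner_torus_poly:
 fixes c d :: "int => complex^'k"
 assumes "finite S" "finite S'"
 shows "(LINT x|torus_measure. inner (torus_poly S c x) (torus_poly S' d x)) = 2 * pi * (\<Sum>n\<in>S \<inter> S'. inner (c n) (d n))"
proof -
 interpret obs_set "{0..<2 * pi}" by (rule obs_set_full)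
 have "(LINT x|torus_measure. inner (torus_poly S c x) (torus_poly S' d x)) =
   (\<Sum>n\<in>S. \<Sum>m\<in>S'. Re ((LINT x:{0..<2*pi}|lborel. cis (of_int (m - n) * x)) * cinner (c n) (d m)))"
  by (subst integral_torus) (simp_all add: integral_inner_tpoly)
 also have "... = (\<Sum>n\<in>S. \<Sum>m\<in>S'. if m = n then 2 * pi * inner (c n) (d n) else 0)"
  unfolding integral_cis_period by (intro sum.cong refl) (auto simp: Re_cinner[symmetric])
 also have "... = (\<Sum>n\<in>S. if n \<in> S' then 2 * pi * inner (c n) (d n) else 0)" using assms by simp
 also have "... = 2 * pi * (\<Sum>n\<in>S \<inter> S'. inner (c n) (d n))"
  using assms by (simp add: sum.inter_restrict sum_distrib_left if_distrib[of "\<lambda>a. 2 * pi * a"] cong: if_cong)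
 finally show ?thesis .
qed

lemma l2sq_torus_poly: "finite S ==> l2sq torus_measure (torus_poly S c) = 2 * pi * (\<Sum>n\<in>S. nsq (c n))"
 using inner_torus_poly[of S S c c] by (simp add: l2sq_def power2_norm_eq_inner)

lemma inner_cnj_smult: "inner (cnj z *s u) w = inner u (z *s (w :: complex^'k))"
 by (simp add: Re_cinner[symmetric] cinner_def sum_distrib_left algebra_simps del: Re_sum)

lemma (in finite_measure) square_integrable_integrable:
 fixes f :: "'a => 'b::euclidean_space"
 assumes f: "square_integrable M f"
 shows "integrable M f"
proof (rule Bochner_Integration.integrable_bound)
 show "integrable M (\<lambda>x. 1 + nsq (f x))" using f by (auto simp: square_integrable_def)
 have "a \<le> 1 + a^2" for a :: real using zero_le_power2[of "a - 1 / 2"] by (simp add: power2_diff power_one_over)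
 then show "AE x in M. norm (f x) \<le> norm (1 + nsq (f x))" by simp
qed (use f in \<open>simp add: square_integrable_def\<close>)

lemma inner_fourier_coeff:
 fixes f :: "torus => complex^'k"
 assumes f: "square_integrable torus_measure f"
 shows "inner (fourier_coeff f n) w = (LINT x|torus_measure. inner (f x) (torus_exp n x *s w)) / (2 * pi)"
proof -
 have [measurable]: "f \<in> borel_measurable borel"
  using f by (simp add: square_integrable_def cong: measurable_cong_sets)
 have "integrable torus_measure (\<lambda>x. torus_exp (- n) x *s f x)"
  using finite_measure.square_integrable_integrable[OF finite_measure_torus f]
  by (rule Bochner_Integration.integrable_bound) (measurable, simp add: norm_vector_smult)
 then have "inner (LINT x|torus_measure. torus_exp (- n) x *s f x) w =
   (LINT x|torus_measure. inner (torus_exp (- n) x *s f x) w)" by (rule integral_inner_left[symmetric])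
 then show ?thesis
  unfolding fourier_coeff_def inner_scaleR_left by (simp only: torus_exp_minus inner_cnj_smult divide_inverse_commute)
qed

lemma inner_torus_poly_fourier_coeff:
 fixes f :: "torus => complex^'k"
 assumes f: "square_integrable torus_measure f"
 shows "(LINT x|torus_measure. inner (f x) (torus_poly S c x)) = 2 * pi * (\<Sum>n\<in>S. inner (fourier_coeff f n) (c n))"
proof -
 have "square_integrable torus_measure (\<lambda>x. torus_exp n x *s w)" for n and w :: "complex^'k"
  using square_integrable_torus_poly[of "{n}" "\<lambda>_. w"] by (simp add: torus_poly_def[abs_def])
 then have "(LINT x|torus_measure. inner (f x) (torus_poly S c x)) = (\<Sum>n\<in>S. LINT x|torus_measure. inner (f x) (torus_exp n x *s c n))"
  unfolding torus_poly_def inner_sum_right by (intro Bochner_Integration.integral_sum integrable_inner f)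
 then show ?thesis by (simp add: inner_fourier_coeff[OF f] sum_divide_distrib[symmetric])
qed

lemma bessel_inequality:
 fixes f :: "torus => complex^'k"
 assumes f: "square_integrable torus_measure f" and S: "finite S"
 shows "2 * pi * (\<Sum>n\<in>S. nsq (fourier_coeff f n)) \<le> l2sq torus_measure f"
proof -
 define p where "p = torus_poly S (fourier_coeff f)"
 have "0 \<le> l2sq torus_measure (\<lambda>x. f x + (- 1) *R p x)" by (rule l2sq_nonneg)
 also have "... = l2sq torus_measure f - 2 * (LINT x|torus_measure. inner (f x) (p x)) + l2sq torus_measure p"
  by (subst l2sq_add_scaleR[OF f]) (simp_all add: p_def square_integrable_torus_poly)
 also have "... = l2sq torus_measure f - 2 * pi * (\<Sum>n\<in>S. nsq (fourier_coeff f n))"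
  by (simp add: p_def inner_torus_poly_fourier_coeff[OF f] l2sq_torus_poly[OF S] power2_norm_eq_inner)
 finally show ?thesis by simp
qed

lemma torus_poly_diff_subset:
 assumes "finite S'" "S \<subseteq> S'"
 shows "(\<lambda>x. torus_poly S' c x - torus_poly S c x) = torus_poly (S' - S) c"
 using assms by (intro ext) (simp add: torus_poly_def sum_diff)

text \<open>By orthogonality the symmetric partial sums are Cauchy. The last clause fixes a
  representative: if all coefficients are zero, \<open>f\<close> is the zero function itself and not
  only zero almost everywhere.\<close>

lemma riesz_fischer:
 fixes c :: "int => complex^'k"
 assumes b: "\<And>S. finite S ==> (\<Sum>n\<in>S. nsq (c n)) \<le> B"
 obtains f where "square_integrable torus_measure f"
  "(\<lambda>k. l2sq torus_measure (\<lambda>x. torus_poly {- int k..int k} c x - f x)) \<longlonglongrightarrow> 0"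
  "\<And>n. fourier_coeff f n = c n" "(\<And>n. c n = 0) ==> f = (\<lambda>x. 0)"
proof (cases "\<forall>n. c n = 0")
 case True
 have "fourier_coeff (\<lambda>x. 0) n = c n" for n using True by (simp add: fourier_coeff_def)
 moreover have "torus_poly S c x = 0" for S x using True by (simp add: torus_poly_def)
 ultimately show ?thesis by (intro that[of "\<lambda>x. 0"]) (auto simp: square_integrable_def l2sq_def)
next
 case False
 define I where "I = (\<lambda>k :: nat. {- int k..int k})"
 define s where "s = (\<lambda>k. \<Sum>n\<in>I k. nsq (c n))"
 have fin: "finite (I k)" for k by (simp add: I_def)
 have mono: "I k \<subseteq> I l" if "k \<le> l" for k l using that by (auto simp: I_def)
 have diff: "l2sq torus_measure (\<lambda>x. torus_poly (I l) c x - torus_poly (I k) c x) = 2 * pi * (s l - s k)" if "k \<le> l" for k l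
  unfolding torus_poly_diff_subset[OF fin mono[OF that]] s_def
  using fin mono[OF that] by (simp add: l2sq_torus_poly sum_diff)
 have "incseq s" unfolding s_def incseq_def using fin mono by (intro allI impI sum_mono2) auto
 moreover have "Bseq s" by (rule BseqI'[of _ B]) (use b[OF fin] in \<open>auto simp: s_def sum_nonneg\<close>)
 ultimately have "Cauchy s" by (metis Bseq_monoseq_convergent incseq_def monoseq_def convergent_Cauchy)
 have C: "\<exists>N. \<forall>m\<ge>N. \<forall>n\<ge>N. l2sq torus_measure (\<lambda>x. torus_poly (I m) c x - torus_poly (I n) c x) < e" if e: "0 < e" for e
 proof -
  have "0 < e / (2 * pi)" using e by simp
  then obtain N where N: "\<And>m n. N \<le> m ==> N \<le> n ==> dist (s m) (s n) < e / (2 * pi)"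
   using \<open>Cauchy s\<close> unfolding Cauchy_def by blast
  have "l2sq torus_measure (\<lambda>x. torus_poly (I m) c x - torus_poly (I n) c x) < e" if mn: "N \<le> m" "N \<le> n" for m n
  proof -
   have "l2sq torus_measure (\<lambda>x. torus_poly (I m) c x - torus_poly (I n) c x) \<le> 2 * pi * dist (s m) (s n)"
   proof (cases "n \<le> m")
    case True
    then show ?thesis by (simp add: diff dist_real_def)
   next
    case False
    then show ?thesis unfolding l2sq_commute[of _ "torus_poly (I m) c"] by (simp add: diff dist_real_def)
   qed
   also have "... < e" using N[OF mn] by (simp add: field_simps)
   finally show ?thesis .
  qed
  then show ?thesis by blast
 qed
 obtain f where f: "square_integrable torus_measure f"
   "(\<lambda>k. l2sq torus_measure (\<lambda>x. torus_poly (I k) c x - f x)) \<longlonglongrightarrow> 0"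
  using square_integrable_complete[of torus_measure "\<lambda>k. torus_poly (I k) c", OF square_integrable_torus_poly C] by blast
 have "fourier_coeff f n = c n" for n
 proof -
  have "inner (fourier_coeff f n) w = inner (c n) w" for w
  proof -
   have e: "torus_poly {n} (\<lambda>_. w) x = torus_exp n x *s w" for x by (simp add: torus_poly_def)
   have "(\<lambda>k. LINT x|torus_measure. inner (torus_poly (I k) c x) (torus_poly {n} (\<lambda>_. w) x)) \<longlonglongrightarrow>
     (LINT x|torus_measure. inner (f x) (torus_poly {n} (\<lambda>_. w) x))"
    by (intro inner_l2_tendsto square_integrable_torus_poly f)
   moreover have "\<forall>\<^sub>F k in sequentially. (LINT x|torus_measure. inner (torus_poly (I k) c x) (torus_poly {n} (\<lambda>_. w) x)) = 2 * pi * inner (c n) w"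
   proof (rule eventually_sequentiallyI[of "nat \<bar>n\<bar>"])
    fix k assume "nat \<bar>n\<bar> \<le> k"
    then have "I k \<inter> {n} = {n}" by (auto simp: I_def)
    then show "(LINT x|torus_measure. inner (torus_poly (I k) c x) (torus_poly {n} (\<lambda>_. w) x)) = 2 * pi * inner (c n) w"
     using fin by (simp add: inner_torus_poly)
   qed
   ultimately have "(LINT x|torus_measure. inner (f x) (torus_poly {n} (\<lambda>_. w) x)) = 2 * pi * inner (c n) w"
    by (rule LIMSEQ_unique[OF _ tendsto_eventually])
   then show ?thesis by (simp add: inner_fourier_coeff[OF f(1)] e)
  qed
  then show ?thesis using vector_eq_rdot[of "fourier_coeff f n" "c n"] by blast
 qed
 then show ?thesis
 proof (rule that[OF f[unfolded I_def]])
  show "f = (\<lambda>x. 0)" if "\<And>n. c n = 0" using False that by blast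
 qed
qed

text \<open>The dominating constants \<open>b\<close> have small tails, uniformly in
  \<open>t\<close>, and finitely many modes are continuous one by one; together this gives
  continuity in norm.\<close>

lemma l2_continuous_family:
 fixes F :: "int => real => complex^'k"
 assumes b: "\<And>S. finite S ==> sum b S \<le> B" and F: "\<And>n t. t \<in> I ==> nsq (F n t) \<le> b n"
  and c: "\<And>n. continuous_on I (F n)"
 obtains f where "\<And>t. t \<in> I ==> square_integrable torus_measure (f t)"
  "\<And>t n. t \<in> I ==> fourier_coeff (f t) n = F n t"
  "\<And>t. t \<in> I ==> ((\<lambda>s. L2_norm torus_measure (\<lambda>x. f s x - f t x)) \<longlongrightarrow> 0) (at t within I)"
  "\<And>t. t \<in> I ==> (\<And>n. F n t = 0) ==> f t = (\<lambda>x. 0)"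
proof -
 define P where "P = (\<lambda>k t. torus_poly {- int k..int k} (\<lambda>n. F n t))"
 define Q where "Q = (\<lambda>t f. square_integrable torus_measure f \<and> (\<lambda>k. l2sq torus_measure (\<lambda>x. P k t x - f x)) \<longlonglongrightarrow> 0 \<and>
   (\<forall>n. fourier_coeff f n = F n t) \<and> ((\<forall>n. F n t = 0) \<longrightarrow> f = (\<lambda>x. 0)))"
 have "\<exists>f. Q t f" if t: "t \<in> I" for t unfolding Q_def
 proof (rule riesz_fischer[of "\<lambda>n. F n t" B])
  show "(\<Sum>n\<in>S. nsq (F n t)) \<le> B" if "finite S" for S
   using sum_mono[of S "\<lambda>n. nsq (F n t)" b, OF F[OF t]] b[OF that] by simp
 qed (auto simp: P_def)
 then obtain f where "\<And>t. t \<in> I ==> Q t (f t)" using bchoice[of I Q] by blast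
 then have f: "\<And>t. t \<in> I ==> square_integrable torus_measure (f t)"
   "\<And>t. t \<in> I ==> (\<lambda>k. l2sq torus_measure (\<lambda>x. P k t x - f t x)) \<longlonglongrightarrow> 0"
   "\<And>t n. t \<in> I ==> fourier_coeff (f t) n = F n t"
   "\<And>t. t \<in> I ==> (\<And>n. F n t = 0) ==> f t = (\<lambda>x. 0)"
  by (simp_all add: Q_def)
 have siP: "square_integrable torus_measure (P k t)" for k t unfolding P_def by (rule square_integrable_torus_poly)
 have P_diff: "l2sq torus_measure (\<lambda>x. P k s x - P k t x) = 2 * pi * (\<Sum>n\<in>{- int k..int k}. nsq (F n s - F n t))" for k s t
  unfolding P_def l2sq_torus_poly[OF finite_atLeastAtMost_int, symmetric]
  by (simp add: torus_poly_def[abs_def] vec.scale_right_diff_distrib sum_subtractf)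
 \<comment> \<open>A finite set whose sum is within \<open>e\<close> of the supremum of all finite
   sums leaves at most \<open>e\<close> outside.\<close>
 have tail: "\<exists>S0. finite S0 \<and> (\<forall>S. finite S \<longrightarrow> sum b (S - S0) \<le> e)" if e: "0 < e" for e
 proof -
  define Z where "Z = sum b ` Collect finite"
  have bdd: "bdd_above Z" using b by (auto simp: Z_def bdd_above_def)
  have "Z \<noteq> {}" by (auto simp: Z_def)
  then obtain S0 where S0: "finite S0" "Sup Z - e < sum b S0"
   using less_cSupD[of Z "Sup Z - e"] e by (auto simp: Z_def)
  have "sum b (S - S0) \<le> e" if S: "finite S" for S
  proof -
   have "sum b (S - S0) + sum b S0 = sum b (S \<union> S0)"
    using S S0 by (subst sum.union_disjoint[symmetric]) (auto simp: Un_Diff_cancel2)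
   also have "... \<le> Sup Z" using S S0 by (intro cSup_upper bdd) (auto simp: Z_def)
   finally show ?thesis using S0 by simp
  qed
  then show ?thesis using S0 by blast
 qed
 \<comment> \<open>The limits are compared through their partial sums, whose mutual distance
   Parseval's identity computes exactly.\<close>
 have key: "l2sq torus_measure (\<lambda>x. f s x - f t x) \<le> 8 * pi * ((\<Sum>n\<in>S0. nsq (F n s - F n t)) + 4 * e)"
  if st: "s \<in> I" "t \<in> I" and S0: "finite S0" "\<And>S. finite S ==> sum b (S - S0) \<le> e" for s t S0 e
 proof -
  define R where "R = 2 * pi * ((\<Sum>n\<in>S0. nsq (F n s - F n t)) + 4 * e)"
  have PR: "l2sq torus_measure (\<lambda>x. P k s x - P k t x) \<le> R" for k
  proof -
   let ?S = "{- int k..int k}"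
   have "(\<Sum>n\<in>?S. nsq (F n s - F n t)) \<le> (\<Sum>n\<in>S0 \<union> (?S - S0). nsq (F n s - F n t))"
    using S0 by (intro sum_mono2) auto
   also have "... = (\<Sum>n\<in>S0. nsq (F n s - F n t)) + (\<Sum>n\<in>?S - S0. nsq (F n s - F n t))"
    using S0 by (intro sum.union_disjoint) auto
   also have "(\<Sum>n\<in>?S - S0. nsq (F n s - F n t)) \<le> (\<Sum>n\<in>?S - S0. 4 * b n)"
   proof (rule sum_mono)
    show "nsq (F n s - F n t) \<le> 4 * b n" for n
     using norm_diff_sq_le[of "F n s" "F n t"] F[OF st(1), of n] F[OF st(2), of n] by simp
   qed
   also have "... = 4 * sum b (?S - S0)" by (simp add: sum_distrib_left)
   also have "... \<le> 4 * e" using S0(2)[of ?S] by simp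
   finally show ?thesis unfolding P_diff R_def by simp
  qed
  have "l2sq torus_measure (\<lambda>x. f s x - f t x) \<le>
    2 * l2sq torus_measure (\<lambda>x. P k s x - f s x) + 2 * (2 * R + 2 * l2sq torus_measure (\<lambda>x. P k t x - f t x))" for k
  proof -
   have 1: "square_integrable torus_measure (\<lambda>x. P k s x - f s x)" "square_integrable torus_measure (\<lambda>x. P k t x - f t x)"
     "square_integrable torus_measure (\<lambda>x. P k s x - P k t x)"
    using st by (auto intro!: square_integrable_diff(1) siP f)
   have 2: "square_integrable torus_measure (\<lambda>x. (P k s x - P k t x) + (P k t x - f t x))"
    by (intro square_integrable_add(1) 1)
   have "l2sq torus_measure (\<lambda>x. ((P k s x - P k t x) + (P k t x - f t x)) - (P k s x - f s x)) \<le>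
     2 * l2sq torus_measure (\<lambda>x. (P k s x - P k t x) + (P k t x - f t x)) + 2 * l2sq torus_measure (\<lambda>x. P k s x - f s x)"
    by (intro square_integrable_diff(2) 1 2)
   moreover have "l2sq torus_measure (\<lambda>x. (P k s x - P k t x) + (P k t x - f t x)) \<le>
     2 * l2sq torus_measure (\<lambda>x. P k s x - P k t x) + 2 * l2sq torus_measure (\<lambda>x. P k t x - f t x)"
    by (intro square_integrable_add(2) 1)
   ultimately show ?thesis using PR[of k] by simp
  qed
  moreover have "(\<lambda>k. 2 * l2sq torus_measure (\<lambda>x. P k s x - f s x) + 2 * (2 * R + 2 * l2sq torus_measure (\<lambda>x. P k t x - f t x)))
    \<longlonglongrightarrow> 2 * 0 + 2 * (2 * R + 2 * 0)" by (intro tendsto_intros f st)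
  ultimately have "l2sq torus_measure (\<lambda>x. f s x - f t x) \<le> 2 * 0 + 2 * (2 * R + 2 * 0)"
   by (intro LIMSEQ_le_const) auto
  then show ?thesis by (simp add: R_def)
 qed
 have "((\<lambda>s. l2sq torus_measure (\<lambda>x. f s x - f t x)) \<longlongrightarrow> 0) (at t within I)" if t: "t \<in> I" for t
 proof (rule tendstoI)
  fix e :: real assume e: "0 < e"
  define d where "d = e / (8 * pi * 8)"
  have d: "0 < d" using e by (simp add: d_def)
  obtain S0 where S0: "finite S0" "\<And>S. finite S ==> sum b (S - S0) \<le> d" using tail[OF d] by blast
  have "((\<lambda>s. 8 * pi * ((\<Sum>n\<in>S0. nsq (F n s - F n t)) + 4 * d)) \<longlongrightarrow> 8 * pi * ((\<Sum>n\<in>S0. nsq (F n t - F n t)) + 4 * d)) (at t within I)"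
   using c t by (intro tendsto_intros) (auto simp: continuous_on_def)
  moreover have "8 * pi * ((\<Sum>n\<in>S0. nsq (F n t - F n t)) + 4 * d) < e" using e by (simp add: d_def)
  ultimately have "\<forall>\<^sub>F s in at t within I. 8 * pi * ((\<Sum>n\<in>S0. nsq (F n s - F n t)) + 4 * d) < e"
   by (rule order_tendstoD(2))
  moreover have "\<forall>\<^sub>F s in at t within I. s \<in> I" by (simp add: eventually_at_filter)
  ultimately show "\<forall>\<^sub>F s in at t within I. dist (l2sq torus_measure (\<lambda>x. f s x - f t x)) 0 < e"
  proof eventually_elim
   case (elim s)
   then show ?case using key[OF elim(2) t S0] by (simp add: l2sq_nonneg)
  qed
 qed
 then have "((\<lambda>s. L2_norm torus_measure (\<lambda>x. f s x - f t x)) \<longlongrightarrow> 0) (at t within I)" if "t \<in> I" for t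
  unfolding L2_norm_l2sq using tendsto_real_sqrt[of _ 0] that by fastforce
 with f(1,3) show ?thesis using f(4) by (rule that)
qed

section \<open>Mild solutions\<close>

lemma square_integrable_set_integrable:
 fixes h :: "real => 'b::euclidean_space"
 assumes h: "square_integrable lborel h"
 shows "set_integrable lborel {a..b} h" unfolding set_integrable_def
proof (rule Bochner_Integration.integrable_bound)
 have [measurable]: "h \<in> borel_measurable borel" using h by (simp add: square_integrable_def)
 show "integrable lborel (\<lambda>x. indicator {a..b} x + nsq (h x))"
  using h by (intro Bochner_Integration.integrable_add integrable_real_indicator) (auto simp: square_integrable_def emeasure_lborel_Icc_eq)
 show "(\<lambda>x. indicator {a..b} x *R h x) \<in> borel_measurable lborel" by measurable
 have "c \<le> 1 + c^2" for c :: real using zero_le_power2[of "c - 1 / 2"] by (simp add: power2_diff power_one_over)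
 then show "AE x in lborel. norm (indicator {a..b} x *R h x) \<le> norm (indicator {a..b} x + nsq (h x))"
  by (auto simp: indicator_def)
qed

lemma set_integral_norm_square_le:
 fixes h :: "real => 'b::euclidean_space"
 assumes h: "square_integrable lborel h" and T: "0 \<le> T"
 shows "(LINT x:{0..T}|lborel. norm (h x))^2 \<le> T * l2sq lborel h"
proof -
 have 1: "square_integrable lborel (indicator {0..T} :: real => real)"
  by (simp add: square_integrable_def power2_eq_square indicator_inter_arith[symmetric] integrable_indicator_iff emeasure_lborel_Icc_eq)
 have 2: "square_integrable lborel (\<lambda>x. norm (h x))" using h by (auto simp: square_integrable_def)
 have "l2sq lborel (indicator {0..T} :: real => real) = T"
  using T by (simp add: l2sq_def power2_eq_square indicator_inter_arith[symmetric])
 moreover have "l2sq lborel (\<lambda>x. norm (h x)) = l2sq lborel h" by (simp add: l2sq_def)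
 ultimately show ?thesis using inner_l2sq_le[OF 1 2] by (simp add: set_lebesgue_integral_def)
qed

lemma set_integrable_matrix_vector:
 fixes h :: "real => complex^'n" and M :: "real => complex^'n^'m"
 assumes h: "set_integrable lborel {a..b} h" and M: "continuous_on UNIV M"
 shows "set_integrable lborel {a..b} (\<lambda>x. M x *v h x)"
proof -
 have "bounded (M ` {a..b})"
  by (intro compact_imp_bounded compact_continuous_image continuous_on_subset[OF M]) auto
 then obtain B where B: "\<And>x. x \<in> {a..b} ==> norm (M x) \<le> B" unfolding bounded_iff by blast
 show ?thesis unfolding set_integrable_def
 proof (rule Bochner_Integration.integrable_bound)
  show "integrable lborel (\<lambda>x. B *R (norm (indicator {a..b} x *R h x)))"
   using h by (intro integrable_scaleR_right integrable_norm) (simp add: set_integrable_def)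
  have [measurable]: "(\<lambda>x. indicator {a..b} x *R h x) \<in> borel_measurable borel"
   using h by (auto simp: set_integrable_def)
  have [measurable]: "M \<in> borel_measurable borel" by (rule borel_measurable_continuous_onI[OF M])
  have "(\<lambda>x. M x *v (indicator {a..b} x *R h x)) \<in> borel_measurable borel"
   by (rule borel_measurable_continuous_Pair[where H = "\<lambda>x y. x *v y"])
    (auto intro!: continuous_on_matrix_vector continuous_intros)
  then show "(\<lambda>x. indicator {a..b} x *R (M x *v h x)) \<in> borel_measurable lborel"
   by (simp add: matrix_scaleR_right)
  have "norm (M x *v h x) \<le> B * norm (h x)" if "x \<in> {a..b}" for x
   using norm_matrix_vector_le[of "M x" "h x"] B[OF that] by (meson mult_right_mono norm_ge_zero order_trans)
  then show "AE x in lborel. norm (indicator {a..b} x *R (M x *v h x)) \<le> norm (B *R norm (indicator {a..b} x *R h x))"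
   by (auto simp: indicator_def intro: order.trans[OF _ abs_ge_self])
 qed
qed

lemma set_integral_bounded_linear:
 fixes h :: "real => 'b::euclidean_space"
 assumes f: "bounded_linear f" and h: "set_integrable lborel S h"
 shows "(LINT t:S|lborel. f (h t)) = f (LINT t:S|lborel. h t)"
 using integral_bounded_linear[OF f h[unfolded set_integrable_def]]
 by (simp add: set_lebesgue_integral_def linear_simps(5)[OF f])

text \<open>Taking the factor \<open>exp (- t L)\<close> out of the convolution leaves an indefinite
  integral, which is continuous in its upper limit.\<close>

lemma duhamel_continuous:
 fixes h :: "real => complex^'n"
 assumes h: "square_integrable lborel h"
 shows "continuous_on {0..T} (\<lambda>t. matrix_exp (- t *R L) *v c + (LINT \<tau>:{0..t}|lborel. matrix_exp (- (t - \<tau>) *R L) *v h \<tau>))"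
proof -
 have int: "set_integrable lborel {0..t} (\<lambda>\<tau>. matrix_exp (\<tau> *R L) *v h \<tau>)" for t
  by (intro set_integrable_matrix_vector square_integrable_set_integrable h continuous_intros)
 have "(LINT \<tau>:{0..t}|lborel. matrix_exp (- (t - \<tau>) *R L) *v h \<tau>) =
   matrix_exp (- t *R L) *v integral {0..t} (\<lambda>\<tau>. matrix_exp (\<tau> *R L) *v h \<tau>)" for t
 proof -
  have e: "matrix_exp (- (t - \<tau>) *R L) *v h \<tau> = matrix_exp (- t *R L) *v (matrix_exp (\<tau> *R L) *v h \<tau>)" for \<tau>
   using matrix_exp_add_vector[of "- t" \<tau> L "h \<tau>"] by simp
  have "(LINT \<tau>:{0..t}|lborel. matrix_exp (- (t - \<tau>) *R L) *v h \<tau>) =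
    matrix_exp (- t *R L) *v (LINT \<tau>:{0..t}|lborel. matrix_exp (\<tau> *R L) *v h \<tau>)"
   unfolding e by (rule set_integral_bounded_linear[OF bounded_linear_matrix_vector int])
  also have "(LINT \<tau>:{0..t}|lborel. matrix_exp (\<tau> *R L) *v h \<tau>) = integral {0..t} (\<lambda>\<tau>. matrix_exp (\<tau> *R L) *v h \<tau>)"
   by (rule set_borel_integral_eq_integral(2)[OF int])
  finally show ?thesis .
 qed
 moreover have "continuous_on {0..T} (\<lambda>t. integral {0..t} (\<lambda>\<tau>. matrix_exp (\<tau> *R L) *v h \<tau>))"
  by (rule indefinite_integral_continuous_1[OF set_borel_integral_eq_integral(1)[OF int]])
 ultimately show ?thesis
  by (simp only:) (intro continuous_intros continuous_on_matrix_vector)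
qed

lemma duhamel_bound:
 fixes h :: "real => complex^'n"
 assumes h: "square_integrable lborel h" and t: "t \<in> {0..T}" and k: "0 \<le> k"
  and b: "\<And>t x. t \<in> {0..T} ==> norm (matrix_exp (- t *R L) *v x) \<le> k * norm (x :: complex^'n)"
 shows "nsq (matrix_exp (- t *R L) *v c + (LINT \<tau>:{0..t}|lborel. matrix_exp (- (t - \<tau>) *R L) *v h \<tau>))
   \<le> 2 * k^2 * nsq c + 2 * k^2 * T * l2sq lborel h"
proof -
 have int: "set_integrable lborel {0..t} (\<lambda>\<tau>. matrix_exp (- (t - \<tau>) *R L) *v h \<tau>)"
  by (intro set_integrable_matrix_vector square_integrable_set_integrable h continuous_intros)
 have intn: "set_integrable lborel {0..t} (\<lambda>\<tau>. norm (h \<tau>))"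
  by (intro set_integrable_norm square_integrable_set_integrable h)
 have "norm (LINT \<tau>:{0..t}|lborel. matrix_exp (- (t - \<tau>) *R L) *v h \<tau>) \<le>
   (LINT \<tau>:{0..t}|lborel. norm (matrix_exp (- (t - \<tau>) *R L) *v h \<tau>))"
  by (rule set_integral_norm_bound[OF int])
 also have "... \<le> (LINT \<tau>:{0..t}|lborel. k * norm (h \<tau>))"
 proof (intro set_integral_mono set_integrable_norm int)
  show "set_integrable lborel {0..t} (\<lambda>\<tau>. k * norm (h \<tau>))" using intn by (rule set_integrable_mult_right)
  fix \<tau> assume "\<tau> \<in> {0..t}"
  with t show "norm (matrix_exp (- (t - \<tau>) *R L) *v h \<tau>) \<le> k * norm (h \<tau>)" by (intro b) auto
 qed
 also have "... = k * (LINT \<tau>:{0..t}|lborel. norm (h \<tau>))" by simp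
 finally have "nsq (LINT \<tau>:{0..t}|lborel. matrix_exp (- (t - \<tau>) *R L) *v h \<tau>) \<le> (k * (LINT \<tau>:{0..t}|lborel. norm (h \<tau>)))^2"
  by (rule power_mono) simp
 also have "... \<le> k^2 * (T * l2sq lborel h)"
 proof -
  have "(LINT \<tau>:{0..t}|lborel. norm (h \<tau>))^2 \<le> t * l2sq lborel h" using t by (intro set_integral_norm_square_le h) auto
  also have "... \<le> T * l2sq lborel h" using t by (intro mult_right_mono l2sq_nonneg) auto
  finally show ?thesis by (simp add: power_mult_distrib mult_left_mono)
 qed
 finally have 1: "nsq (LINT \<tau>:{0..t}|lborel. matrix_exp (- (t - \<tau>) *R L) *v h \<tau>) \<le> k^2 * (T * l2sq lborel h)" .
 have "nsq (matrix_exp (- t *R L) *v c) \<le> (k * norm c)^2" by (intro power_mono b t) auto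
 with 1 norm_add_sq_le[of "matrix_exp (- t *R L) *v c" "LINT \<tau>:{0..t}|lborel. matrix_exp (- (t - \<tau>) *R L) *v h \<tau>"]
 show ?thesis by (simp add: power_mult_distrib)
qed

text \<open>Each mode is given by its Duhamel formula. The bound \<open>k\<close>, uniform in the
  modes, together with Bessel's inequality for \<open>f0\<close> and the bound \<open>B\<close> on
  the forcing, provides the dominating constants for \<open>l2_continuous_family\<close>.\<close>

lemma mild_solution_exists:
 fixes L :: "int => complex^'d^'d" and f0 :: "torus => complex^'d" and h :: "int => real => complex^'d"
 assumes T: "0 \<le> T" and f0: "square_integrable torus_measure f0" and k: "0 \<le> k"
  and b: "\<And>n t x. t \<in> {0..T} ==> norm (matrix_exp (- t *R L n) *v x) \<le> k * norm (x :: complex^'d)"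
  and h: "\<And>n. square_integrable lborel (h n)" and B: "\<And>S. finite S ==> (\<Sum>n\<in>S. l2sq lborel (h n)) \<le> B"
 obtains f where "\<And>t. t \<in> {0..T} ==> square_integrable torus_measure (f t)"
  "\<And>t n. t \<in> {0..T} ==> fourier_coeff (f t) n = matrix_exp (- t *R L n) *v fourier_coeff f0 n +
    (LINT \<tau>:{0..t}|lborel. matrix_exp (- (t - \<tau>) *R L n) *v h n \<tau>)"
  "\<And>t. t \<in> {0..T} ==> ((\<lambda>s. L2_norm torus_measure (\<lambda>x. f s x - f t x)) \<longlongrightarrow> 0) (at t within {0..T})"
  "\<And>t. t \<in> {0..T} ==> (\<And>n. fourier_coeff (f t) n = 0) ==> f t = (\<lambda>x. 0)"
proof -
 define F where "F = (\<lambda>n t. matrix_exp (- t *R L n) *v fourier_coeff f0 n +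
    (LINT \<tau>:{0..t}|lborel. matrix_exp (- (t - \<tau>) *R L n) *v h n \<tau>))"
 define \<beta> where "\<beta> = (\<lambda>n. 2 * k^2 * nsq (fourier_coeff f0 n) + 2 * k^2 * T * l2sq lborel (h n))"
 have sum: "sum \<beta> S \<le> 2 * k^2 * (l2sq torus_measure f0 / (2 * pi)) + 2 * k^2 * T * B" if "finite S" for S
 proof -
  have "(\<Sum>n\<in>S. nsq (fourier_coeff f0 n)) \<le> l2sq torus_measure f0 / (2 * pi)"
   using bessel_inequality[OF f0 that] by (simp add: field_simps)
  then have "2 * k^2 * (\<Sum>n\<in>S. nsq (fourier_coeff f0 n)) \<le> 2 * k^2 * (l2sq torus_measure f0 / (2 * pi))"
   by (intro mult_left_mono) auto
  moreover have "2 * k^2 * T * (\<Sum>n\<in>S. l2sq lborel (h n)) \<le> 2 * k^2 * T * B"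
   using T B[OF that] by (intro mult_left_mono) auto
  ultimately show ?thesis by (simp add: \<beta>_def sum.distrib sum_distrib_left[symmetric])
 qed
 have cont: "continuous_on {0..T} (F n)" for n unfolding F_def by (rule duhamel_continuous[OF h])
 have bound: "nsq (F n t) \<le> \<beta> n" if "t \<in> {0..T}" for n t
  unfolding F_def \<beta>_def by (rule duhamel_bound[OF h that k b])
 show ?thesis
 proof (rule l2_continuous_family[of \<beta> _ "{0..T}" F, OF sum bound cont])
  fix f assume f: "\<And>t. t \<in> {0..T} ==> square_integrable torus_measure (f t)"
   "\<And>t n. t \<in> {0..T} ==> fourier_coeff (f t) n = F n t"
   "\<And>t. t \<in> {0..T} ==> ((\<lambda>s. L2_norm torus_measure (\<lambda>x. f s x - f t x)) \<longlongrightarrow> 0) (at t within {0..T})"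
   "\<And>t. t \<in> {0..T} ==> (\<And>n. F n t = 0) ==> f t = (\<lambda>x. 0)"
  have "f t = (\<lambda>x. 0)" if "t \<in> {0..T}" "\<And>n. fourier_coeff (f t) n = 0" for t
   using f(4)[OF that(1)] f(2)[OF that(1)] that(2) by simp
  with f(1) f(2)[unfolded F_def] f(3) show thesis by (rule that)
 qed
qed

section \<open>Fourier coefficients of functions of time and space\<close>

lemma pair_sigma_finite_torus: "pair_sigma_finite lborel torus_measure"
proof -
 interpret finite_measure torus_measure by (rule finite_measure_torus)
 show ?thesis by unfold_locales
qed

text \<open>Fubini's theorem. Only almost every section of \<open>U\<close> is square integrable,
  which is why later identities in \<open>t\<close> hold almost everywhere.\<close>

lemma square_integrable_sections:
 fixes U :: "real \<times> torus => 'b::euclidean_space"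
 assumes U: "square_integrable (lborel \<Otimes>\<^sub>M torus_measure) U"
 shows "AE t in lborel. square_integrable torus_measure (\<lambda>x. U (t, x))"
  "integrable lborel (\<lambda>t. l2sq torus_measure (\<lambda>x. U (t, x)))"
  "(LINT t|lborel. l2sq torus_measure (\<lambda>x. U (t, x))) = l2sq (lborel \<Otimes>\<^sub>M torus_measure) U"
proof -
 interpret pair_sigma_finite lborel torus_measure by (rule pair_sigma_finite_torus)
 have [measurable]: "U \<in> borel_measurable (lborel \<Otimes>\<^sub>M torus_measure)" and
  int: "integrable (lborel \<Otimes>\<^sub>M torus_measure) (\<lambda>p. nsq (U p))"
  using U by (auto simp: square_integrable_def)
 show "AE t in lborel. square_integrable torus_measure (\<lambda>x. U (t, x))"
  using AE_integrable_fst'[OF int] by eventually_elim (auto simp: square_integrable_def)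
 show "integrable lborel (\<lambda>t. l2sq torus_measure (\<lambda>x. U (t, x)))"
  unfolding l2sq_def using integrable_fst'[OF int] by simp
 show "(LINT t|lborel. l2sq torus_measure (\<lambda>x. U (t, x))) = l2sq (lborel \<Otimes>\<^sub>M torus_measure) U"
  unfolding l2sq_def using integral_fst'[OF int] by simp
qed

text \<open>Bessel's inequality in \<open>x\<close> holds for almost every \<open>t\<close> and is
  integrated in \<open>t\<close>.\<close>

lemma fourier_coeff_sections:
 fixes U :: "real \<times> torus => complex^'p"
 assumes U: "square_integrable (lborel \<Otimes>\<^sub>M torus_measure) U"
 shows "square_integrable lborel (\<lambda>t. fourier_coeff (\<lambda>x. U (t, x)) n)"
  "finite S ==> (\<Sum>n\<in>S. l2sq lborel (\<lambda>t. fourier_coeff (\<lambda>x. U (t, x)) n)) \<le> l2sq (lborel \<Otimes>\<^sub>M torus_measure) U / (2 * pi)"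
proof -
 interpret pair_sigma_finite lborel torus_measure by (rule pair_sigma_finite_torus)
 have [measurable]: "U \<in> borel_measurable (lborel \<Otimes>\<^sub>M torus_measure)" using U by (auto simp: square_integrable_def)
 define e where "e = (\<lambda>t. l2sq torus_measure (\<lambda>x. U (t, x)) / (2 * pi))"
 have e: "integrable lborel e" "(LINT t|lborel. e t) = l2sq (lborel \<Otimes>\<^sub>M torus_measure) U / (2 * pi)"
  using square_integrable_sections(2,3)[OF U] by (simp_all add: e_def)
 have meas: "(\<lambda>t. fourier_coeff (\<lambda>x. U (t, x)) n) \<in> borel_measurable lborel" for n
  unfolding fourier_coeff_def by measurable
 have le: "AE t in lborel. (\<Sum>n\<in>S. nsq (fourier_coeff (\<lambda>x. U (t, x)) n)) \<le> e t" if "finite S" for S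
  using square_integrable_sections(1)[OF U]
 proof eventually_elim
  case (elim t)
  show ?case using bessel_inequality[OF elim that] by (simp add: e_def field_simps)
 qed
 have int: "integrable lborel (\<lambda>t. nsq (fourier_coeff (\<lambda>x. U (t, x)) n))" for n
 proof (rule Bochner_Integration.integrable_bound[OF e(1)])
  show "AE t in lborel. norm (nsq (fourier_coeff (\<lambda>x. U (t, x)) n)) \<le> norm (e t)"
   using le[of "{n}"] by (auto elim!: eventually_mono)
 qed (use meas in measurable)
 then show "square_integrable lborel (\<lambda>t. fourier_coeff (\<lambda>x. U (t, x)) n)" using meas by (simp add: square_integrable_def)
 assume S: "finite S"
 have "(\<Sum>n\<in>S. l2sq lborel (\<lambda>t. fourier_coeff (\<lambda>x. U (t, x)) n)) = (LINT t|lborel. (\<Sum>n\<in>S. nsq (fourier_coeff (\<lambda>x. U (t, x)) n)))"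
  unfolding l2sq_def by (intro Bochner_Integration.integral_sum[symmetric] int)
 also have "... \<le> (LINT t|lborel. e t)"
  by (intro integral_mono_AE Bochner_Integration.integrable_sum int e le S)
 finally show "(\<Sum>n\<in>S. l2sq lborel (\<lambda>t. fourier_coeff (\<lambda>x. U (t, x)) n)) \<le> l2sq (lborel \<Otimes>\<^sub>M torus_measure) U / (2 * pi)"
  by (simp add: e)
qed

section \<open>Control by duality\<close>

lemma integral_reverse: "integral {0..T} (\<lambda>t. g (T - t)) = integral {0..T} (g :: real => real)"
 using Henstock_Kurzweil_Integration.integral_reflect_real[of 0 "- T" "\<lambda>y. g (T + y)"] integral_shift_real_ivl[of 0 T T g] by (simp add: add.commute)

lemma set_integral_torus_poly:
 assumes "open \<omega>"
 shows "(LINT x|torus_measure. indicator \<omega> x * nsq (torus_poly S c x)) =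
  energy ((torus_of_real -` \<omega>) \<inter> {0..<2 * pi}) S c"
proof -
 have "(\<lambda>x. indicator \<omega> x * nsq (torus_poly S c x)) \<in> borel_measurable borel"
  by (intro borel_measurable_times borel_measurable_indicator borel_measurable_power
    measurable_compose[OF measurable_torus_poly borel_measurable_norm] borel_open assms)
 from integral_torus[OF this]
 have "(LINT x|torus_measure. indicator \<omega> x * nsq (torus_poly S c x)) =
   (LINT x:{0..<2 * pi}|lborel. indicator \<omega> (torus_of_real x) * nsq (tpoly S c x))" by simp
 also have "... = energy ((torus_of_real -` \<omega>) \<inter> {0..<2 * pi}) S c"
  unfolding energy_def set_lebesgue_integral_def
  by (rule Bochner_Integration.integral_cong) (auto simp: indicator_def)
 finally show ?thesis .
qed

lemma torus_poly_add: "torus_poly S (\<lambda>n. c n + d n) x = torus_poly S c x + torus_poly S d x"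
 by (simp add: torus_poly_def sum.distrib vec.scale_right_distrib)

lemma torus_poly_scaleR: "torus_poly S (\<lambda>n. r *R c n) x = r *R torus_poly S c x"
 by (simp add: torus_poly_def scaleR_sum_right scaleR_eq_smult vec.scale_scale mult.commute vec.scale_sum_right)

context observed_system
begin

definition supp :: "(int => complex^('p + 'q)) => int set"
 where "supp v = {n. v n \<noteq> 0}"

text \<open>First block of the adjoint solution that has the data \<open>v\<close> at the final time
  \<open>T\<close> and runs backwards. For finitely supported \<open>v\<close> it is a trigonometric
  polynomial at each time.\<close>

definition dual_state :: "real => (int => complex^('p + 'q)) => real \<times> torus => complex^'p"
 where "dual_state T v = (\<lambda>(t, x). torus_poly (supp v) (\<lambda>n. fst_block (flow (T - t) n (v n))) x)"

lemma flow_0 [simp]: "flow t n 0 = 0" by (simp add: flow_def)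

lemma dual_state_superset:
 assumes "finite S" "supp v \<subseteq> S"
 shows "dual_state T v (t, x) = torus_poly S (\<lambda>n. fst_block (flow (T - t) n (v n))) x"
 unfolding dual_state_def torus_poly_def prod.case
 using assms by (intro sum.mono_neutral_left) (auto simp: supp_def)

lemma dual_state_linear:
 assumes "finite (supp v)" "finite (supp w)"
 shows "dual_state T (\<lambda>n. r *R v n + s *R w n) = (\<lambda>p. r *R dual_state T v p + s *R dual_state T w p)"
proof
 fix p :: "real \<times> torus"
 obtain t x where p: "p = (t, x)" by (cases p)
 define S where "S = supp v \<union> supp w"
 have S: "finite S" "supp v \<subseteq> S" "supp w \<subseteq> S" "supp (\<lambda>n. r *R v n + s *R w n) \<subseteq> S"
  using assms by (auto simp: S_def supp_def)
 have lin: "fst_block (flow (T - t) n (r *R v n + s *R w n)) = r *R fst_block (flow (T - t) n (v n)) + s *R fst_block (flow (T - t) n (w n))" for n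
  by (simp add: linear_simps[OF bounded_linear_flow] fst_block_add fst_block_scaleR)
 show "dual_state T (\<lambda>n. r *R v n + s *R w n) p = r *R dual_state T v p + s *R dual_state T w p"
  unfolding p dual_state_superset[OF S(1,2)] dual_state_superset[OF S(1,3)] dual_state_superset[OF S(1,4)] lin
  by (simp only: torus_poly_add torus_poly_scaleR)
qed

lemma measurable_dual_state: "dual_state T v \<in> borel_measurable (lborel \<Otimes>\<^sub>M torus_measure)"
proof -
 have [measurable]: "(\<lambda>t. fst_block (flow (T - t) n (v n))) \<in> borel_measurable borel" for n
  by (intro borel_measurable_continuous_onI continuous_intros)
 show ?thesis unfolding dual_state_def torus_poly_def by measurable
qed

lemma dual_state_bound:
 obtains b where "\<And>t x. t \<in> {0..T} ==> norm (dual_state T v (t, x)) \<le> b"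
proof -
 have "bounded ((\<lambda>t. \<Sum>n\<in>supp v. norm (fst_block (flow (T - t) n (v n)))) ` {0..T})"
  by (intro compact_imp_bounded compact_continuous_image continuous_intros) auto
 then obtain b where b: "\<And>t. t \<in> {0..T} ==> norm (\<Sum>n\<in>supp v. norm (fst_block (flow (T - t) n (v n)))) \<le> b"
  unfolding bounded_iff by blast
 show ?thesis
 proof (rule that)
  fix t x assume t: "t \<in> {0..T}"
  have "norm (dual_state T v (t, x)) \<le> (\<Sum>n\<in>supp v. norm (fst_block (flow (T - t) n (v n))))"
   unfolding dual_state_def prod.case by (rule norm_torus_poly_le)
  also have "... \<le> b" using b[OF t] by simp
  finally show "norm (dual_state T v (t, x)) \<le> b" .
 qed
qed

text \<open>Riesz' theorem in the square-integrable functions on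
  \<open>{0<..<T} \<times> \<omega>\<close>, for the functional \<open>\<Lambda>\<close> that the
  control must represent in order to cancel the free evolution at time \<open>T\<close>.
  Observability bounds \<open>\<Lambda>\<close> by the norm of the dual state; testing with data on
  a single mode gives the moment identities.\<close>

lemma control_exists:
 assumes \<omega>: "open \<omega>" "\<Omega> = torus_of_real -` \<omega>" and T: "0 < T" and M: "0 < M"
  and obs: "\<And>S v. finite S ==> (\<Sum>n\<in>S. (hnorm n (flow T n (v n)))^2) \<le> M * obs 0 T S v"
  and c: "\<And>S. finite S ==> (\<Sum>n\<in>S. nsq (c n)) \<le> b0" "snd_block (c 0) = 0"
 obtains U :: "real \<times> torus => complex^'p" where "square_integrable (lborel \<Otimes>\<^sub>M torus_measure) U"
  "\<And>p. p \<notin> {0<..<T} \<times> \<omega> ==> U p = 0"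
  "\<And>n w. (LINT t:{0..T}|lborel. inner (fourier_coeff (\<lambda>x. U (t, x)) n) (fst_block (flow (T - t) n w))) = - inner (c n) (flow T n w)"
proof -
 interpret pair_sigma_finite lborel torus_measure by (rule pair_sigma_finite_torus)
 define P :: "(real \<times> torus) measure" where "P = lborel \<Otimes>\<^sub>M torus_measure"
 define R where "R = {0<..<T} \<times> \<omega>"
 define N where "N = restrict_space P R"
 have [measurable]: "\<omega> \<in> sets borel" using \<omega> by simp
 have R: "R \<in> sets P" "R \<inter> space P \<in> sets P" unfolding R_def P_def by measurable
 have emR: "emeasure P R < \<infinity>"
 proof -
  have "emeasure P R = emeasure lborel {0<..<T} * emeasure torus_measure \<omega>"
   unfolding P_def R_def by (rule M2.emeasure_pair_measure_Times) simp_all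
  also have "... < \<infinity>" using T finite_measure.emeasure_finite[OF finite_measure_torus, of \<omega>]
   by (simp add: top.not_eq_extremum[symmetric] ennreal_mult_eq_top_iff)
  finally show ?thesis .
 qed
 have finN: "finite_measure N" unfolding N_def using emR R
  by (intro finite_measureI) (simp add: space_restrict_space emeasure_restrict_space less_top[symmetric] inf_absorb1 sets.sets_into_space)
 have int_N: "(LINT p|N. f p) = (LINT p|P. indicator R p *R f p)" for f :: "real \<times> torus => real"
  unfolding N_def by (rule integral_restrict_space[OF R(2)])
 have integrable_N: "integrable N f \<longleftrightarrow> integrable P (\<lambda>p. indicator R p *R f p)" for f :: "real \<times> torus => real"
  unfolding N_def by (rule integrable_restrict_space[OF R(2)])
 have space_N: "space N = R" using R sets.sets_into_space[OF R(1)] by (auto simp: N_def space_restrict_space)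
 have si: "square_integrable N (dual_state T v)" for v
 proof -
  obtain b where b: "\<And>t x. t \<in> {0..T} ==> norm (dual_state T v (t, x)) \<le> b" using dual_state_bound by blast
  show ?thesis
  proof (rule finite_measure.square_integrable_bounded[OF finN])
   show "dual_state T v \<in> borel_measurable N"
    unfolding N_def P_def by (rule measurable_restrict_space1[OF measurable_dual_state])
   show "norm (dual_state T v p) \<le> b" if "p \<in> space N" for p
    using that b by (cases p) (auto simp: space_N R_def)
  qed
 qed
 have l2: "l2sq N (dual_state T v) = obs 0 T (supp v) v" for v
 proof -
  define g where "g = (\<lambda>t. energy X (supp v) (\<lambda>n. fst_block (flow t n (v n))))"
  have cg: "continuous_on U (\<lambda>t. g (T - t))" for U unfolding g_def by (intro continuous_intros)
  have "integrable N (\<lambda>p. nsq (dual_state T v p))" using si by (simp add: square_integrable_def)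
  then have int: "integrable P (\<lambda>p. indicator R p *R nsq (dual_state T v p))" by (simp only: integrable_N)
  have "l2sq N (dual_state T v) = (LINT p|P. indicator R p *R nsq (dual_state T v p))"
   unfolding l2sq_def int_N ..
  also have "... = (LINT t|lborel. LINT x|torus_measure. indicator R (t, x) *R nsq (dual_state T v (t, x)))"
   by (rule integral_fst'[OF int[unfolded P_def], folded P_def, symmetric])
  also have "... = (LINT t|lborel. indicator {0<..<T} t * g (T - t))"
  proof (rule Bochner_Integration.integral_cong[OF refl])
   fix t
   have "(LINT x|torus_measure. indicator R (t, x) *R nsq (dual_state T v (t, x))) =
     (LINT x|torus_measure. indicator {0<..<T} t * (indicator \<omega> x * nsq (torus_poly (supp v) (\<lambda>n. fst_block (flow (T - t) n (v n))) x)))"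
    by (rule Bochner_Integration.integral_cong) (auto simp: R_def dual_state_def indicator_def)
   also have "... = indicator {0<..<T} t * g (T - t)"
    by (simp add: set_integral_torus_poly[OF \<omega>(1)] g_def \<omega>(2))
   finally show "(LINT x|torus_measure. indicator R (t, x) *R nsq (dual_state T v (t, x))) = indicator {0<..<T} t * g (T - t)" .
  qed
  also have "... = (LINT t:{0<..<T}|lborel. g (T - t))" by (simp add: set_lebesgue_integral_def)
  also have "... = integral {0<..<T} (\<lambda>t. g (T - t))"
   by (rule set_borel_integral_eq_integral(2), rule set_integrable_subset[OF borel_integrable_atLeastAtMost'[OF cg, of 0 T]]) auto
  also have "... = integral {0..T} (\<lambda>t. g (T - t))" by (rule integral_open_interval_real[symmetric])
  also have "... = integral {0..T} g" by (rule integral_reverse)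
  also have "... = obs 0 T (supp v) v" by (simp add: obs_def g_def)
  finally show ?thesis .
 qed
 define V where "V = {v :: int => complex^('p + 'q). finite (supp v)}"
 \<comment> \<open>The factor \<open>2 * pi\<close> is the one of Parseval's identity; the sign
   makes the control compensate the free evolution.\<close>
 define \<Lambda> where "\<Lambda> = (\<lambda>v. - 2 * pi * (\<Sum>n\<in>supp v. inner (c n) (flow T n (v n))))"
 have \<Lambda>_superset: "\<Lambda> v = - 2 * pi * (\<Sum>n\<in>S. inner (c n) (flow T n (v n)))" if "finite S" "supp v \<subseteq> S" for S v
  unfolding \<Lambda>_def using that by (intro arg_cong2[where f = "(*)"] refl sum.mono_neutral_left) (auto simp: supp_def)
 have lin: "\<exists>k\<in>V. dual_state T k = (\<lambda>p. r *R dual_state T v p + s *R dual_state T w p) \<and> \<Lambda> k = r * \<Lambda> v + s * \<Lambda> w"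
  if vw: "v \<in> V" "w \<in> V" for v w r s
 proof (intro bexI conjI)
  let ?k = "\<lambda>n. r *R v n + s *R w n"
  have S: "finite (supp v \<union> supp w)" "supp v \<subseteq> supp v \<union> supp w" "supp w \<subseteq> supp v \<union> supp w" "supp ?k \<subseteq> supp v \<union> supp w"
   using vw by (auto simp: V_def supp_def)
  show "?k \<in> V" using S(1,4) finite_subset by (auto simp: V_def)
  show "dual_state T ?k = (\<lambda>p. r *R dual_state T v p + s *R dual_state T w p)"
   using vw by (intro dual_state_linear) (auto simp: V_def)
  show "\<Lambda> ?k = r * \<Lambda> v + s * \<Lambda> w"
   unfolding \<Lambda>_superset[OF S(1,2)] \<Lambda>_superset[OF S(1,3)] \<Lambda>_superset[OF S(1,4)]
   by (simp add: linear_simps[OF bounded_linear_flow] inner_add_right sum.distrib sum_distrib_left algebra_simps)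
 qed
 have B0: "0 \<le> b0" using c(1)[of "{}"] by simp
 have bd: "(\<Lambda> v)^2 \<le> 4 * pi^2 * b0 * M * l2sq N (dual_state T v)" if v: "v \<in> V" for v
 proof -
  have fin: "finite (supp v)" using v by (simp add: V_def)
  \<comment> \<open>In the mode 0 the coefficient \<open>c\<close> has only a first block, so
    \<open>hnorm\<close> is enough to control the pairing.\<close>
  have le: "\<bar>inner (c n) y\<bar> \<le> norm (c n) * hnorm n y" for n y
  proof (cases "n = 0")
   case True
   have "\<bar>inner (c 0) y\<bar> = \<bar>inner (fst_block (c 0)) (fst_block y)\<bar>" using c(2) by (simp add: inner_block_vec)
   also have "... \<le> norm (fst_block (c 0)) * norm (fst_block y)" by (rule Cauchy_Schwarz_ineq2)
   also have "... \<le> norm (c 0) * norm (fst_block y)" by (intro mult_right_mono norm_fst_block_le) simp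
   finally show ?thesis using True by (simp add: hnorm_def)
  next
   case False
   then show ?thesis by (simp add: hnorm_def Cauchy_Schwarz_ineq2)
  qed
  have "(\<Sum>n\<in>supp v. inner (c n) (flow T n (v n)))^2 \<le> (\<Sum>n\<in>supp v. norm (c n) * hnorm n (flow T n (v n)))^2"
   by (intro abs_le_square_iff[THEN iffD1] order.trans[OF sum_abs] order.trans[OF sum_mono[OF le] abs_ge_self])
  also have "... \<le> (\<Sum>n\<in>supp v. nsq (c n)) * (\<Sum>n\<in>supp v. (hnorm n (flow T n (v n)))^2)"
   by (rule Cauchy_Schwarz_ineq_sum)
  also have "... \<le> b0 * (M * obs 0 T (supp v) v)"
   using c(1)[OF fin] obs[OF fin, of v] B0 by (intro mult_mono) (auto intro: sum_nonneg)
  finally show ?thesis by (simp add: \<Lambda>_def l2 power_mult_distrib mult.assoc)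
 qed
 have neV: "V \<noteq> {}"
 proof -
  have "(\<lambda>_. 0) \<in> V" by (simp add: V_def supp_def)
  then show ?thesis by blast
 qed
 obtain u where u: "square_integrable N u" "\<And>v. v \<in> V ==> (LINT p|N. inner (u p) (dual_state T v p)) = \<Lambda> v"
  using riesz_representation[of V N "dual_state T" \<Lambda>, OF neV si lin bd] by blast
 \<comment> \<open>Extension by zero, so that Fourier coefficients on the whole torus can be
   taken.\<close>
 define U where "U = (\<lambda>p. indicator R p *R u p)"
 have U0: "U p = 0" if "p \<notin> R" for p using that by (simp add: U_def)
 have siU: "square_integrable P U" unfolding square_integrable_def
 proof
  have "u \<in> borel_measurable N" using u by (simp add: square_integrable_def)
  then show "U \<in> borel_measurable P"
   unfolding U_def N_def by (simp only: borel_measurable_restrict_space_iff[OF R(2)])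
  have "integrable N (\<lambda>p. nsq (u p))" using u by (simp add: square_integrable_def)
  then have "integrable P (\<lambda>p. indicator R p *R nsq (u p))" by (simp only: integrable_N)
  moreover have "(\<lambda>p. indicator R p *R nsq (u p)) = (\<lambda>p. nsq (U p))"
   by (auto simp: U_def indicator_def)
  ultimately show "integrable P (\<lambda>p. nsq (U p))" by simp
 qed
 have id: "(LINT t:{0..T}|lborel. inner (fourier_coeff (\<lambda>x. U (t, x)) n) (fst_block (flow (T - t) n w))) = - inner (c n) (flow T n w)" for n w
 proof -
  define v where "v = (\<lambda>m. if m = n then w else 0)"
  have v: "supp v \<subseteq> {n}" "v n = w" by (auto simp: v_def supp_def)
  have vV: "v \<in> V" using v finite_subset by (auto simp: V_def)
  define a where "a = (\<lambda>t. fst_block (flow (T - t) n w))"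
  have ds: "dual_state T v (t, x) = torus_poly {n} (\<lambda>_. a t) x" for t x
   using dual_state_superset[OF _ v(1), of T t x] by (simp add: torus_poly_def a_def v(2))
  have "integrable N (\<lambda>p. inner (u p) (dual_state T v p))" by (intro integrable_inner u si)
  then have int: "integrable P (\<lambda>p. indicator R p *R inner (u p) (dual_state T v p))" by (simp only: integrable_N)
  have "\<Lambda> v = (LINT p|P. indicator R p *R inner (u p) (dual_state T v p))"
   using u(2)[OF vV] by (simp only: int_N)
  also have "... = (LINT t|lborel. LINT x|torus_measure. indicator R (t, x) *R inner (u (t, x)) (dual_state T v (t, x)))"
   by (rule integral_fst'[OF int[unfolded P_def], folded P_def, symmetric])
  also have "... = (LINT t|lborel. LINT x|torus_measure. inner (U (t, x)) (torus_poly {n} (\<lambda>_. a t) x))"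
   by (simp add: U_def ds)
  also have "... = (LINT t|lborel. 2 * pi * (indicator {0..T} t *R inner (fourier_coeff (\<lambda>x. U (t, x)) n) (a t)))"
  proof (rule integral_cong_AE)
   have [measurable]: "U \<in> borel_measurable (lborel \<Otimes>\<^sub>M torus_measure)" using siU by (simp add: square_integrable_def P_def)
   have [measurable]: "a \<in> borel_measurable borel"
    unfolding a_def by (intro borel_measurable_continuous_onI continuous_intros)
   show "(\<lambda>t. LINT x|torus_measure. inner (U (t, x)) (torus_poly {n} (\<lambda>_. a t) x)) \<in> borel_measurable lborel"
    unfolding torus_poly_def by measurable
   have [measurable]: "(\<lambda>t. fourier_coeff (\<lambda>x. U (t, x)) n) \<in> borel_measurable borel"
    using fourier_coeff_sections(1)[OF siU[unfolded P_def], of n] by (simp add: square_integrable_def)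
   show "(\<lambda>t. 2 * pi * (indicator {0..T} t *R inner (fourier_coeff (\<lambda>x. U (t, x)) n) (a t))) \<in> borel_measurable lborel"
    by measurable
   show "AE t in lborel. (LINT x|torus_measure. inner (U (t, x)) (torus_poly {n} (\<lambda>_. a t) x)) =
     2 * pi * (indicator {0..T} t *R inner (fourier_coeff (\<lambda>x. U (t, x)) n) (a t))"
    using square_integrable_sections(1)[OF siU[unfolded P_def]]
   proof eventually_elim
    case (elim t)
    have "fourier_coeff (\<lambda>x. U (t, x)) n = 0" if "t \<notin> {0..T}"
     using that U0[of "(t, _)"] by (auto simp: fourier_coeff_def R_def)
    then show ?case by (cases "t \<in> {0..T}") (simp_all add: inner_torus_poly_fourier_coeff[OF elim])
   qed
  qed
  also have "... = 2 * pi * (LINT t:{0..T}|lborel. inner (fourier_coeff (\<lambda>x. U (t, x)) n) (a t))"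
   by (simp add: set_lebesgue_integral_def)
  finally have "\<Lambda> v = 2 * pi * (LINT t:{0..T}|lborel. inner (fourier_coeff (\<lambda>x. U (t, x)) n) (a t))" .
  moreover have "\<Lambda> v = 2 * pi * (- inner (c n) (flow T n w))"
   using \<Lambda>_superset[OF _ v(1)] by (simp add: v(2))
  ultimately have "2 * pi * (LINT t:{0..T}|lborel. inner (fourier_coeff (\<lambda>x. U (t, x)) n) (a t)) = 2 * pi * (- inner (c n) (flow T n w))"
   by (simp only:)
  then have "(LINT t:{0..T}|lborel. inner (fourier_coeff (\<lambda>x. U (t, x)) n) (a t)) = - inner (c n) (flow T n w)"
   by (subst (asm) mult_left_cancel) auto
  then show ?thesis by (simp add: a_def)
 qed
 show ?thesis by (rule that[OF siU[unfolded P_def] U0[unfolded R_def] id])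
qed

end

text \<open>The form in which the modes of the system, whose matrices are \<open>- adjm G\<close>,
  are paired with the adjoint flow.\<close>

lemma inner_matrix_exp_neg_adjm:
 "inner (matrix_exp (- t *R (- adjm G)) *v x) y = inner x (matrix_exp (t *R G) *v y)"
proof -
 have "- t *R (- adjm G) = adjm (t *R G)" by (simp add: adjm_scaleR)
 then show ?thesis by (simp only: inner_matrix_exp_adjm adjm_adjm)
qed

lemma square_integrable_block:
 fixes f :: "'a => complex^'p" and g :: "'a => complex^'q"
 assumes "square_integrable M f" "square_integrable M g"
 shows "square_integrable M (\<lambda>x. block_vec (f x) (g x))"
proof -
 have [measurable]: "f \<in> borel_measurable M" "g \<in> borel_measurable M" using assms by (auto simp: square_integrable_def)
 have "continuous_on UNIV (\<lambda>p :: (complex^'p) \<times> (complex^'q). block_vec (fst p) (snd p))"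
  by (intro linear_continuous_on bounded_linear_block_vec bounded_linear_fst bounded_linear_snd)
 then have "(\<lambda>x. block_vec (f x) (g x)) \<in> borel_measurable M"
  using assms by (intro borel_measurable_continuous_Pair[where H = block_vec]) (auto simp: square_integrable_def)
 then show ?thesis using assms by (simp add: square_integrable_def norm_block_sq)
qed

lemma fourier_coeff_block:
 fixes f :: "torus => complex^'p" and g :: "torus => complex^'q"
 assumes "square_integrable torus_measure f" "square_integrable torus_measure g"
 shows "fourier_coeff (\<lambda>x. block_vec (f x) (g x)) n = block_vec (fourier_coeff f n) (fourier_coeff g n)"
proof -
 have i: "integrable torus_measure (\<lambda>x. torus_exp (- n) x *s h x)" if "square_integrable torus_measure h" for h :: "torus => complex^'k"
 proof -
  have [measurable]: "h \<in> borel_measurable borel"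
   using that by (simp add: square_integrable_def cong: measurable_cong_sets)
  show ?thesis using finite_measure.square_integrable_integrable[OF finite_measure_torus that]
   by (rule Bochner_Integration.integrable_bound) (measurable, simp add: norm_vector_smult)
 qed
 note i0 = i[OF square_integrable_block[OF assms]]
 have "(LINT x|torus_measure. torus_exp (- n) x *s block_vec (f x) (g x)) =
   block_vec (LINT x|torus_measure. torus_exp (- n) x *s f x) (LINT x|torus_measure. torus_exp (- n) x *s g x)"
  using integral_bounded_linear[OF bounded_linear_fst_block i0] integral_bounded_linear[OF bounded_linear_snd_block i0]
  by (simp add: block_vec_eq_iff block_vec_smult)
 then show ?thesis by (simp add: fourier_coeff_def block_vec_scaleR)
qed

context observed_system
begin

text \<open>The final state is tested mode by mode against vectors \<open>w\<close>: the free
  evolution contributes \<open>inner (c n) (flow T n w)\<close>, and the moment identity of the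
  control contributes its negative.\<close>

lemma null_controllable:
 assumes \<omega>: "open \<omega>" "\<Omega> = torus_of_real -` \<omega>"
  and T0: "0 < T0" and hit: "\<And>k y. \<exists>t\<in>{0<..<T0}. y - \<mu> k * t \<in> \<Omega>" and T: "T0 < T"
  and f: "square_integrable torus_measure f01" "square_integrable torus_measure f02"
  and mean: "(LINT x|torus_measure. f02 x) = 0"
 obtains U :: "real \<times> torus => complex^'p" and f :: "real => torus => complex^('p + 'q)" where
  "square_integrable (restrict_space (lborel \<Otimes>\<^sub>M torus_measure) ({0<..<T} \<times> \<omega>)) U"
  "\<And>t. t \<in> {0..T} ==> square_integrable torus_measure (f t)"
  "\<And>t. t \<in> {0..T} ==> ((\<lambda>s. L2_norm torus_measure (\<lambda>x. f s x - f t x)) \<longlongrightarrow> 0) (at t within {0..T})"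
  "\<And>t n. t \<in> {0..T} ==> fourier_coeff (f t) n =
    matrix_exp (- t *R (- adjm (gen n))) *v fourier_coeff (\<lambda>x. block_vec (f01 x) (f02 x)) n +
    (LINT \<tau>:{0..t}|lborel. matrix_exp (- (t - \<tau>) *R (- adjm (gen n))) *v
     fourier_coeff (\<lambda>x. block_vec (indicator \<omega> x *R U (\<tau>, x)) 0) n)"
  "f T = (\<lambda>x. 0)"
proof -
 define f0 where "f0 = (\<lambda>x. block_vec (f01 x) (f02 x))"
 define c where "c = fourier_coeff f0"
 have T': "0 < T" "0 \<le> T" using T0 T by auto
 have sif: "square_integrable torus_measure f0" unfolding f0_def by (intro square_integrable_block f)
 have "fourier_coeff f02 0 = 0"
 proof -
  have "torus_exp (- 0) x *s f02 x = f02 x" for x by (rule torus_of_real_surj[of x]) simp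
  then show ?thesis using mean by (simp add: fourier_coeff_def)
 qed
 then have c0: "snd_block (c 0) = 0" by (simp add: c_def f0_def fourier_coeff_block[OF f])
 have cB: "(\<Sum>n\<in>S. nsq (c n)) \<le> l2sq torus_measure f0 / (2 * pi)" if "finite S" for S
  using bessel_inequality[OF sif that] by (simp add: c_def field_simps)
 obtain M where M: "0 < M" "\<And>S v. finite S ==> (\<Sum>n\<in>S. (hnorm n (flow T n (v n)))^2) \<le> M * obs 0 T S v"
  using observability[OF T0 hit T] by blast
 obtain U :: "real \<times> torus => complex^'p" where U: "square_integrable (lborel \<Otimes>\<^sub>M torus_measure) U"
  "\<And>p. p \<notin> {0<..<T} \<times> \<omega> ==> U p = 0"
  "\<And>n w. (LINT t:{0..T}|lborel. inner (fourier_coeff (\<lambda>x. U (t, x)) n) (fst_block (flow (T - t) n w))) = - inner (c n) (flow T n w)"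
 proof (rule control_exists[OF \<omega> T'(1) M cB c0])
  fix U :: "real \<times> torus => complex^'p"
  assume "square_integrable (lborel \<Otimes>\<^sub>M torus_measure) U" "\<And>p. p \<notin> {0<..<T} \<times> \<omega> ==> U p = 0"
   "\<And>n w. (LINT t:{0..T}|lborel. inner (fourier_coeff (\<lambda>x. U (t, x)) n) (fst_block (flow (T - t) n w))) = - inner (c n) (flow T n w)"
  then show thesis by (rule that)
 qed
 define h where "h = (\<lambda>n t. fourier_coeff (\<lambda>x. block_vec (U (t, x)) (0 :: complex^'q)) n)"
 have siG: "square_integrable (lborel \<Otimes>\<^sub>M torus_measure) (\<lambda>p. block_vec (U p) (0 :: complex^'q))"
  by (intro square_integrable_block U) (simp add: square_integrable_def)
 have h: "square_integrable lborel (h n)" for n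
  unfolding h_def using fourier_coeff_sections(1)[OF siG] by simp
 have hB: "(\<Sum>n\<in>S. l2sq lborel (h n)) \<le> l2sq (lborel \<Otimes>\<^sub>M torus_measure) (\<lambda>p. block_vec (U p) (0 :: complex^'q)) / (2 * pi)" if "finite S" for S
  unfolding h_def using fourier_coeff_sections(2)[OF siG that] by simp
 obtain Kb where Kb: "1 \<le> Kb" "\<And>n t v. t \<in> {0..T} ==> norm (flow t n v) \<le> Kb * norm v"
  using flow_bounded[OF T'(2)] by blast
 have adj: "inner (matrix_exp (- t *R (- adjm (gen n))) *v x) y = inner x (flow t n y)" for t n x y
  unfolding flow_def by (rule inner_matrix_exp_neg_adjm)
 \<comment> \<open>The exponentials of the system are the adjoints of \<open>flow\<close> and
   inherit its bound, which is uniform in \<open>n\<close>.\<close>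
 have bound: "norm (matrix_exp (- t *R (- adjm (gen n))) *v x) \<le> Kb * norm x" if t: "t \<in> {0..T}" for n t x
 proof -
  define y where "y = matrix_exp (- t *R (- adjm (gen n))) *v x"
  have "nsq y = inner x (flow t n y)" unfolding power2_norm_eq_inner using adj[of t n x y] by (simp only: y_def)
  also have "... \<le> norm x * norm (flow t n y)" by (rule norm_cauchy_schwarz)
  also have "... \<le> norm x * (Kb * norm y)" by (intro mult_left_mono Kb t) simp
  finally have "norm y * norm y \<le> (Kb * norm x) * norm y" by (simp add: power2_eq_square mult_ac)
  then have "norm y \<le> Kb * norm x" using Kb(1) by (cases "y = 0") auto
  then show ?thesis by (simp only: y_def)
 qed
 have Kb0: "0 \<le> Kb" using Kb(1) by simp
 obtain F where F: "\<And>t. t \<in> {0..T} ==> square_integrable torus_measure (F t)"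
  "\<And>t n. t \<in> {0..T} ==> fourier_coeff (F t) n = matrix_exp (- t *R (- adjm (gen n))) *v c n +
    (LINT \<tau>:{0..t}|lborel. matrix_exp (- (t - \<tau>) *R (- adjm (gen n))) *v h n \<tau>)"
  "\<And>t. t \<in> {0..T} ==> ((\<lambda>s. L2_norm torus_measure (\<lambda>x. F s x - F t x)) \<longlongrightarrow> 0) (at t within {0..T})"
  "\<And>t. t \<in> {0..T} ==> (\<And>n. fourier_coeff (F t) n = 0) ==> F t = (\<lambda>x. 0)"
 proof (rule mild_solution_exists[where L = "\<lambda>n. - adjm (gen n)", OF T'(2) sif Kb0 bound h hB, folded c_def])
  fix F :: "real => torus => complex^('p + 'q)"
  assume "\<And>t. t \<in> {0..T} ==> square_integrable torus_measure (F t)"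
  "\<And>t n. t \<in> {0..T} ==> fourier_coeff (F t) n = matrix_exp (- t *R (- adjm (gen n))) *v c n +
    (LINT \<tau>:{0..t}|lborel. matrix_exp (- (t - \<tau>) *R (- adjm (gen n))) *v h n \<tau>)"
  "\<And>t. t \<in> {0..T} ==> ((\<lambda>s. L2_norm torus_measure (\<lambda>x. F s x - F t x)) \<longlongrightarrow> 0) (at t within {0..T})"
  "\<And>t. t \<in> {0..T} ==> (\<And>n. fourier_coeff (F t) n = 0) ==> F t = (\<lambda>x. 0)"
  then show thesis by (rule that)
 qed
 \<comment> \<open>Coefficients split into blocks for square-integrable sections, hence for almost
   every \<open>t\<close>; this is enough under the time integral.\<close>
 have hU: "AE t in lborel. h n t = block_vec (fourier_coeff (\<lambda>x. U (t, x)) n) 0" for n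
  using square_integrable_sections(1)[OF U(1)]
 proof eventually_elim
  case (elim t)
  have "square_integrable torus_measure (\<lambda>x. 0 :: complex^'q)" by (simp add: square_integrable_def)
  from fourier_coeff_block[OF elim this] show ?case by (simp add: h_def fourier_coeff_def)
 qed
 have "fourier_coeff (F T) n = 0" for n
 proof -
  define E where "E = (\<lambda>\<tau>. matrix_exp (- (T - \<tau>) *R (- adjm (gen n))) *v h n \<tau>)"
  have intE: "set_integrable lborel {0..T} E"
   unfolding E_def by (intro set_integrable_matrix_vector square_integrable_set_integrable h continuous_intros)
  have "inner (fourier_coeff (F T) n) w = 0" for w
  proof -
   have [measurable]: "(\<lambda>t. fourier_coeff (\<lambda>x. U (t, x)) n) \<in> borel_measurable borel"
    using fourier_coeff_sections(1)[OF U(1), of n] by (simp add: square_integrable_def)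
   have [measurable]: "(\<lambda>t. fst_block (flow (T - t) n w)) \<in> borel_measurable borel"
    by (intro borel_measurable_continuous_onI continuous_intros)
   have "inner (LINT \<tau>:{0..T}|lborel. E \<tau>) w = (LINT \<tau>:{0..T}|lborel. inner (E \<tau>) w)"
    by (rule set_integral_bounded_linear[OF bounded_linear_inner_left intE, symmetric])
   also have "... = (LINT \<tau>:{0..T}|lborel. inner (fourier_coeff (\<lambda>x. U (\<tau>, x)) n) (fst_block (flow (T - \<tau>) n w)))"
    unfolding set_lebesgue_integral_def
   proof (rule integral_cong_AE)
    have "integrable lborel (\<lambda>\<tau>. inner (indicator {0..T} \<tau> *R E \<tau>) w)"
     using intE by (intro integrable_inner_left) (simp add: set_integrable_def)
    then show "(\<lambda>\<tau>. indicator {0..T} \<tau> *R inner (E \<tau>) w) \<in> borel_measurable lborel"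
     by (simp add: borel_measurable_integrable)
    show "(\<lambda>\<tau>. indicator {0..T} \<tau> *R inner (fourier_coeff (\<lambda>x. U (\<tau>, x)) n) (fst_block (flow (T - \<tau>) n w))) \<in> borel_measurable lborel"
     by measurable
    show "AE \<tau> in lborel. indicator {0..T} \<tau> *R inner (E \<tau>) w =
      indicator {0..T} \<tau> *R inner (fourier_coeff (\<lambda>x. U (\<tau>, x)) n) (fst_block (flow (T - \<tau>) n w))"
     using hU[of n]
    proof eventually_elim
     case (elim \<tau>)
     show ?case unfolding E_def adj elim by (simp add: inner_block_vec)
    qed
   qed
   also have "... = - inner (c n) (flow T n w)" by (rule U(3))
   finally show ?thesis using T' by (simp add: F(2) inner_add_left adj E_def del: minus_diff_eq scaleR_minus_left scaleR_minus_right)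
  qed
  then show ?thesis using inner_eq_zero_iff by blast
 qed
 then have FT: "F T = (\<lambda>x. 0)" using T' by (intro F(4)) auto
 have ind: "indicator \<omega> x *R U (t, x) = U (t, x)" for t x
  using U(2)[of "(t, x)"] by (auto simp: indicator_def)
 have siU: "square_integrable (restrict_space (lborel \<Otimes>\<^sub>M torus_measure) ({0<..<T} \<times> \<omega>)) U"
  unfolding square_integrable_def
 proof
  have [measurable]: "\<omega> \<in> sets borel" using \<omega> by simp
  have R: "{0<..<T} \<times> \<omega> \<inter> space (lborel \<Otimes>\<^sub>M torus_measure) \<in> sets (lborel \<Otimes>\<^sub>M torus_measure)" by measurable
  show "U \<in> borel_measurable (restrict_space (lborel \<Otimes>\<^sub>M torus_measure) ({0<..<T} \<times> \<omega>))"
   using U(1) by (intro measurable_restrict_space1) (simp add: square_integrable_def)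
  have ind2: "indicator ({0<..<T} \<times> \<omega>) p *R nsq (U p) = nsq (U p)" for p
   by (cases "p \<in> {0<..<T} \<times> \<omega>") (simp_all add: U(2))
  show "integrable (restrict_space (lborel \<Otimes>\<^sub>M torus_measure) ({0<..<T} \<times> \<omega>)) (\<lambda>p. nsq (U p))"
   unfolding integrable_restrict_space[OF R] ind2 using U(1) by (simp add: square_integrable_def)
 qed
 show ?thesis by (rule that[OF siU F(1) F(3) _ FT]) (simp_all only: F(2) c_def f0_def h_def ind)
qed

end

section \<open>The geometric condition\<close>

lemma torus_of_real_periodic: "torus_of_real (x + 2 * pi) = torus_of_real x"
 unfolding torus.abs_eq_iff by (rule exI[of _ 1]) simp

text \<open>A connected arc outside \<open>\<omega>\<close> lies in a single component of the
  complement. Measured on the period that starts at \<open>a\<close>, the arc is an interval of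
  length \<open>b - a\<close>, which fits into one period.\<close>

lemma gap_length_ge:
 assumes \<omega>: "open \<omega>" and ab: "a < b" "b - a \<le> 2 * pi" and J: "torus_of_real ` {a<..<b} \<inter> \<omega> = {}"
 shows "ennreal (b - a) \<le> gap_length \<omega>"
proof -
 have "connected (torus_of_real ` {a<..<b})"
  by (intro connected_continuous_image continuous_on_subset[OF continuous_torus_of_real]) auto
 moreover have "torus_of_real ` {a<..<b} \<subseteq> - \<omega>" using J by blast
 moreover have "torus_of_real ((a + b) / 2) \<in> torus_of_real ` {a<..<b}" using ab by auto
 ultimately obtain C where C: "C \<in> components (- \<omega>)" "torus_of_real ` {a<..<b} \<subseteq> C"
  using exists_component_superset[of "torus_of_real ` {a<..<b}" "- \<omega>"] by blast
 have "closed C" using \<omega> by (intro closed_components[OF _ C(1)]) (simp add: closed_def)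
 then have [measurable]: "C \<in> sets borel" by simp
 define Y where "Y = torus_of_real -` C"
 have [measurable]: "Y \<in> sets borel"
  using measurable_sets[OF borel_measurable_continuous_onI[OF continuous_torus_of_real] \<open>C \<in> sets borel\<close>] by (simp add: Y_def)
 define F where "F = (\<lambda>x. indicator Y x :: real)"
 have [measurable]: "F \<in> borel_measurable borel" unfolding F_def by measurable
 have fin: "emeasure lborel (S \<inter> {0..<2 * pi}) < \<infinity>" if "S \<in> sets borel" for S
  using emeasure_mono[of "S \<inter> {0..<2 * pi}" "{0..<2 * pi}" lborel] by (simp add: le_less_trans[OF _ ennreal_less_top])
 have "b - a = (LINT x|lborel. indicator {0<..<b - a} x)" using ab by simp
 also have "... \<le> (LINT x:{0..<2 * pi}|lborel. F (x + a))" unfolding set_lebesgue_integral_def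
 proof (rule integral_mono)
  show "integrable lborel (indicator {0<..<b - a} :: real => real)" using ab by (intro integrable_real_indicator) auto
  have "(\<lambda>x. x + a) -` Y \<in> sets borel" using measurable_sets[of "\<lambda>x. x + a" borel borel Y] by simp
  from fin[OF this] have "integrable lborel (indicator ((\<lambda>x. x + a) -` Y \<inter> {0..<2 * pi}) :: real => real)"
   using \<open>(\<lambda>x. x + a) -` Y \<in> sets borel\<close> by (intro integrable_real_indicator) auto
  moreover have "(indicator ((\<lambda>x. x + a) -` Y \<inter> {0..<2 * pi}) :: real => real) = (\<lambda>x. indicator {0..<2 * pi} x *R F (x + a))"
   by (auto simp: F_def indicator_def)
  ultimately show "integrable lborel (\<lambda>x. indicator {0..<2 * pi} x *R F (x + a))" by simp
  have "torus_of_real (x + a) \<in> C" if "x \<in> {0<..<b - a}" for x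
   using that by (intro subsetD[OF C(2)] imageI) auto
  then show "indicator {0<..<b - a} x \<le> indicator {0..<2 * pi} x *R F (x + a)" for x
   using ab by (auto simp: F_def Y_def indicator_def)
 qed
 also have "... = (LINT x:{0..<2 * pi}|lborel. F x)"
  by (rule periodic_integral_shift[where B = 1, OF \<open>F \<in> borel_measurable borel\<close>]) (auto simp: F_def Y_def torus_of_real_periodic indicator_def)
 also have "... = (LINT x|lborel. indicator (Y \<inter> {0..<2 * pi}) x)"
  unfolding set_lebesgue_integral_def by (rule Bochner_Integration.integral_cong) (auto simp: F_def indicator_def)
 also have "... = measure lborel (Y \<inter> {0..<2 * pi})" by simp
 finally have "ennreal (b - a) \<le> ennreal (measure lborel (Y \<inter> {0..<2 * pi}))" by (rule ennreal_leI)
 also have "... = emeasure lborel (Y \<inter> {0..<2 * pi})"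
  using fin[of Y] by (intro emeasure_eq_ennreal_measure[symmetric]) auto
 also have "... = emeasure torus_measure C" unfolding torus_measure_def
  by (subst emeasure_distr[OF measurable_torus_of_real])
   (simp_all add: emeasure_restrict_space space_restrict_space Y_def)
 also have "... \<le> gap_length \<omega>" unfolding gap_length_def by (rule SUP_upper[OF C(1)])
 finally show ?thesis .
qed

lemma gap_length_le: "gap_length \<omega> \<le> ennreal (2 * pi)" unfolding gap_length_def
proof (rule SUP_least)
 fix I
 show "emeasure torus_measure I \<le> ennreal (2 * pi)"
  using emeasure_space[of torus_measure I] by (simp add: emeasure_torus_measure_UNIV)
qed

text \<open>A characteristic that misses \<open>\<omega>\<close> during \<open>{0<..<T0}\<close>
  sweeps an arc of length \<open>\<bar>\<mu>\<bar> * T0\<close> outside \<open>\<omega>\<close>. Up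
  to one full turn this exceeds the gap length; beyond one turn the arc covers the whole torus and
  meets \<open>\<omega>\<close> after all.\<close>

lemma characteristic_hits:
 assumes \<omega>: "open \<omega>" "\<omega> \<noteq> {}" and m: "0 < m" "m \<le> \<bar>\<mu>\<bar>" and T0: "0 < T0" "gap_length \<omega> < ennreal (m * T0)"
 shows "\<exists>t\<in>{0<..<T0}. y - \<mu> * t \<in> torus_of_real -` \<omega>"
proof (rule ccontr)
 assume neg: "\<not> (\<exists>t\<in>{0<..<T0}. y - \<mu> * t \<in> torus_of_real -` \<omega>)"
 have \<mu>: "\<mu> \<noteq> 0" using m by auto
 define l where "l = \<bar>\<mu>\<bar> * T0"
 \<comment> \<open>Left end of the swept interval; it depends on the direction of travel.\<close>
 define a where "a = (if 0 < \<mu> then y - l else y)"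
 have l: "0 < l" "m * T0 \<le> l" using m T0 \<mu> by (auto simp: l_def)
 have J: "torus_of_real z \<notin> \<omega>" if z: "a < z" "z < a + l" for z
 proof -
  define t where "t = (y - z) / \<mu>"
  have "0 < t \<and> t < T0"
  proof (cases "0 < \<mu>")
   case True
   then show ?thesis using z by (auto simp: t_def a_def l_def field_simps)
  next
   case False
   then have "\<mu> < 0" using \<mu> by simp
   then show ?thesis using z by (auto simp: t_def a_def l_def field_simps)
  qed
  moreover have "y - \<mu> * t = z" using \<mu> by (simp add: t_def)
  ultimately show ?thesis using neg by auto
 qed
 show False
 proof (cases "l \<le> 2 * pi")
  case True
  have "ennreal (m * T0) \<le> ennreal (a + l - a)" using l by (intro ennreal_leI) simp
  also have "... \<le> gap_length \<omega>" using l True J by (intro gap_length_ge \<omega>) auto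
  finally show False using T0 by simp
 next
  case False
  obtain x where "x \<in> \<omega>" using \<omega> by blast
  obtain p where p: "torus_of_real p \<in> \<omega>" using torus_of_real_surj[of x] \<open>x \<in> \<omega>\<close> by metis
  define k where "k = \<lfloor>(a - p) / (2 * pi)\<rfloor> + 1"
  have "(a - p) / (2 * pi) < of_int k" "of_int k \<le> (a - p) / (2 * pi) + 1" unfolding k_def by linarith+
  then have "a < p + 2 * pi * of_int k" "p + 2 * pi * of_int k \<le> a + 2 * pi" by (simp_all add: field_simps)
  then have "torus_of_real (p + 2 * pi * of_int k) \<notin> \<omega>" using False by (intro J) auto
  moreover have "torus_of_real (p + 2 * pi * of_int k) = torus_of_real p"
   by (rule periodic_int[of torus_of_real]) (rule torus_of_real_periodic)
  ultimately show False using p by simp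
 qed
qed

section \<open>The Kalman condition\<close>

lemma matrix_power_vector_Suc_right: "matrix_power M (Suc k) *v x = matrix_power M k *v (M *v x)"
 by (induction k) (simp_all only: matrix_power_vector_Suc, simp)

text \<open>Bilinear, without conjugation: \<open>transpose\<close> is its adjoint, and the
  annihilator of a vector is a complex subspace.\<close>

definition bil :: "complex^'n => complex^'n => complex"
 where "bil x y = (\<Sum>k\<in>UNIV. x $ k * y $ k)"

lemma bil_matrix: "bil (M *v x) y = bil x (transpose M *v y)"
 unfolding bil_def matrix_vector_mult_def transpose_def
 by (simp add: sum_distrib_left sum_distrib_right mult_ac) (rule sum.swap)

lemma bil_matrix_power: "bil (matrix_power M j *v x) y = bil x (matrix_power (transpose M) j *v y)"
proof (induction j arbitrary: y)
 case (Suc j)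
 have "bil (matrix_power M (Suc j) *v x) y = bil (matrix_power M j *v x) (transpose M *v y)"
  unfolding matrix_power_vector_Suc by (rule bil_matrix)
 also have "... = bil x (matrix_power (transpose M) j *v (transpose M *v y))" by (rule Suc)
 finally show ?case unfolding matrix_power_vector_Suc_right .
qed simp

lemma bil_axis: "bil (axis k 1) y = y $ k"
proof -
 have "axis k 1 $ i * y $ i = (if i = k then y $ i else 0)" for i by (simp add: axis_def)
 then show ?thesis by (simp add: bil_def)
qed

lemma bil_zero_iff: "(\<forall>x. bil x y = 0) \<longleftrightarrow> y = 0"
proof
 assume "\<forall>x. bil x y = 0"
 then have "y $ k = 0" for k using bil_axis[of k y] by simp
 then show "y = 0" by (simp add: vec_eq_iff)
qed (simp add: bil_def)

lemma bil_add_left: "bil (x + x') y = bil x y + bil x' y"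
 and bil_smult_left: "bil (c *s x) y = c * bil x y"
 by (simp_all add: bil_def distrib_right sum.distrib sum_distrib_left mult.assoc)

text \<open>The annihilator of \<open>c\<close> is a complex subspace that contains all generators
  of the Kalman span, hence everything.\<close>

lemma kalman_annihilator:
 fixes A :: "real^'q^'q" and B :: "real^'p^'q"
 assumes k: "kalman_rank_condition A B"
  and c: "\<And>j. j \<le> CARD('q) - 1 ==> transpose (cmat B) *v (matrix_power (transpose (cmat A)) j *v c) = 0"
 shows "c = 0"
proof -
 define S where "S = {matrix_power (cmat A) j *v (cmat B *v X) | j X. j \<le> CARD('q) - 1}"
 have "vec.subspace {x. bil x c = 0}"
  by (rule vec.subspaceI) (auto simp: bil_add_left bil_smult_left, simp add: bil_def)
 moreover have "S \<subseteq> {x. bil x c = 0}"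
 proof
  fix x assume "x \<in> S"
  then obtain j X where j: "j \<le> CARD('q) - 1" "x = matrix_power (cmat A) j *v (cmat B *v X)" by (auto simp: S_def)
  have "bil x c = bil X (transpose (cmat B) *v (matrix_power (transpose (cmat A)) j *v c))"
   by (simp only: j(2) bil_matrix_power bil_matrix[of "cmat B"])
  then show "x \<in> {x. bil x c = 0}" using c[OF j(1)] by (simp add: bil_def)
 qed
 ultimately have "vec.span S \<subseteq> {x. bil x c = 0}" by (rule vec.span_minimal[rotated])
 then have "bil x c = 0" for x using k by (auto simp: kalman_rank_condition_def S_def)
 then show ?thesis using bil_zero_iff by blast
qed

text \<open>A dimension count in place of Cayley-Hamilton: the subspaces \<open>V m\<close>
  decrease, the chain is constant from the first place where two consecutive ones agree, and it can
  decrease strictly at most \<open>CARD('q)\<close> times.\<close>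

lemma kalman_stabilize:
 fixes A :: "complex^'q^'q" and B :: "complex^'q^'p"
 assumes c: "\<And>j. j < CARD('q) ==> B *v (matrix_power A j *v c) = 0"
 shows "B *v (matrix_power A j *v c) = 0"
proof -
 define V where "V = (\<lambda>m. {x. \<forall>j<m. B *v (matrix_power A j *v x) = 0})"
 have sub: "vec.subspace (V m)" for m
  by (rule vec.subspaceI) (auto simp: V_def matrix_vector_right_distrib matrix_vector_smult)
 have dec: "V (Suc m) \<subseteq> V m" for m by (auto simp: V_def)
 have inv: "A *v x \<in> V m" if "x \<in> V (Suc m)" for x m
  using that by (auto simp: V_def matrix_power_vector_Suc_right[symmetric] simp del: matrix_power.simps)
 have stab: "c \<in> V j" if m: "V m = V (Suc m)" "c \<in> V m" for m j and c
 proof -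
  have "B *v (matrix_power A j *v x) = 0" if "x \<in> V m" for x j using that
  proof (induction j arbitrary: x)
   case 0
   then have "x \<in> V (Suc m)" using m by simp
   then have "\<forall>j<Suc m. B *v (matrix_power A j *v x) = 0" by (simp add: V_def)
   from this[rule_format, of 0] show ?case by simp
  next
   case (Suc j)
   then have "A *v x \<in> V m" using inv[of x m] m by simp
   then show ?case unfolding matrix_power_vector_Suc_right by (rule Suc.IH)
  qed
  then show ?thesis using m by (auto simp: V_def)
 qed
 have dim: "(\<exists>m<k. V m = V (Suc m)) \<or> vec.dim (V k) + k \<le> CARD('q)" for k
 proof (induction k)
  case 0
  have "vec.dim (V 0) \<le> CARD('q)" using vec.dim_subset[OF subset_UNIV, of "V 0"] unfolding vec_dim_card .
  then show ?case by simp
 next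
  case (Suc k)
  show ?case
  proof (cases "\<exists>m<Suc k. V m = V (Suc m)")
   case False
   then have d: "vec.dim (V k) + k \<le> CARD('q)" and ne: "V k \<noteq> V (Suc k)" using Suc by (auto simp: less_Suc_eq)
   have "vec.dim (V (Suc k)) < vec.dim (V k)"
    using vec.subspace_dim_equal[OF sub sub dec] ne vec.dim_subset[OF dec] by (metis not_le)
   then show ?thesis using d by simp
  qed blast
 qed
 have cV: "c \<in> V CARD('q)" using c by (simp add: V_def)
 consider m where "m < CARD('q)" "V m = V (Suc m)" | "vec.dim (V CARD('q)) = 0" using dim[of "CARD('q)"] by auto
 then show ?thesis
 proof cases
  case 1
  then have "c \<in> V m" using cV by (auto simp: V_def)
  from stab[OF 1(2) this, of "Suc j"] show ?thesis by (simp add: V_def)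
 next
  case 2
  then have "c = 0" using cV by auto
  then show ?thesis by simp
 qed
qed

text \<open>A proper complex subspace is also a proper real one, so a nonzero vector is orthogonal
  to it for \<open>inner\<close>; its conjugate is the annihilator sought. Orthogonality to
  \<open>y\<close> and to \<open>- \<i>\<close> times \<open>y\<close> gives the real and the
  imaginary part of \<open>bil y c = 0\<close>. All powers are then reached by
  \<open>kalman_stabilize\<close>.\<close>

lemma kalman_fails:
 fixes A :: "real^'q^'q" and B :: "real^'p^'q"
 assumes "\<not> kalman_rank_condition A B"
 obtains c where "c \<noteq> 0" "\<And>j. transpose (cmat B) *v (matrix_power (transpose (cmat A)) j *v c) = 0"
proof -
 define S where "S = {matrix_power (cmat A) j *v (cmat B *v X) | j X. j \<le> CARD('q) - 1}"
 define W where "W = vec.span S"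
 have W: "W \<noteq> UNIV" using assms by (auto simp: W_def S_def kalman_rank_condition_def)
 have sm: "z *s y \<in> W" if "y \<in> W" for y z using that unfolding W_def by (rule vec.span_scale)
 have "subspace W" unfolding subspace_def
 proof (intro conjI ballI allI)
  show "0 \<in> W" unfolding W_def by (rule vec.span_zero)
  show "x + y \<in> W" if "x \<in> W" "y \<in> W" for x y using that unfolding W_def by (rule vec.span_add)
  show "r *R x \<in> W" if "x \<in> W" for r x unfolding scaleR_eq_smult using that by (rule sm)
 qed
 then have sW: "span W = W" by (simp add: span_eq_iff)
 then have "dim W \<noteq> DIM(complex^'q)" using W by (metis dim_eq_full)
 then have "dim W < DIM(complex^'q)" using dim_subset_UNIV[of W] by simp
 then obtain x where x: "x \<noteq> 0" "\<And>y. y \<in> span W ==> orthogonal x y"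
  by (rule orthogonal_to_subspace_exists) blast
 define c where "c = (\<chi> k. cnj (x $ k))"
 have re: "Re (bil y c) = inner x y" for y
  by (simp add: bil_def c_def inner_vec_def inner_complex_def mult.commute)
 have bil0: "bil y c = 0" if y: "y \<in> W" for y
 proof -
  have "Re (bil y c) = 0" using x(2) y by (simp add: re sW orthogonal_def)
  moreover have "Re (bil ((- \<i>) *s y) c) = 0" using x(2) sm[OF y, of "- \<i>"] by (simp only: re sW orthogonal_def)
  ultimately show ?thesis unfolding bil_smult_left by (simp add: complex_eq_iff)
 qed
 have low: "transpose (cmat B) *v (matrix_power (transpose (cmat A)) j *v c) = 0" if j: "j < CARD('q)" for j
 proof -
  have "bil X (transpose (cmat B) *v (matrix_power (transpose (cmat A)) j *v c)) = 0" for X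
  proof -
   have "matrix_power (cmat A) j *v (cmat B *v X) \<in> W"
    unfolding W_def S_def using j by (intro vec.span_base) auto
   from bil0[OF this] show ?thesis by (simp only: bil_matrix_power bil_matrix[of "cmat B"])
  qed
  then show ?thesis using bil_zero_iff by blast
 qed
 show ?thesis
 proof (rule that)
  show "c \<noteq> 0" using x(1) by (auto simp: c_def vec_eq_iff)
  show "transpose (cmat B) *v (matrix_power (transpose (cmat A)) j *v c) = 0" for j
   by (rule kalman_stabilize[OF low])
 qed
qed

text \<open>Complex multiples of matrices, in the entrywise form in which they occur in
  \<open>mode_matrix\<close>.\<close>

definition cscale :: "complex => complex^'n^'m => complex^'n^'m"
 where "cscale z M = map_matrix ((*) z) M"

lemma cscale_vector: "cscale z M *v x = z *s (M *v x)"
 by (simp add: cscale_def map_matrix_def matrix_vector_mult_def vec_eq_iff sum_distrib_left mult.assoc)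

lemma cscale_power_vector: "matrix_power (cscale z M) j *v x = z ^ j *s (matrix_power M j *v x)"
 by (induction j) (simp_all only: matrix_power_vector_Suc cscale_vector, simp_all add: matrix_vector_smult vec.scale_scale mult.commute)

text \<open>The factors \<open>\<i>\<close> have modulus one and disappear in the norms;
  \<open>kalman_annihilator\<close> gives positivity, and compactness of the sphere the
  constant.\<close>

lemma kalman_lower_bound:
 fixes A :: "real^'q^'q" and B :: "real^'p^'q"
 assumes k: "kalman_rank_condition A B"
 obtains \<kappa> where "0 < \<kappa>" "\<And>c. \<kappa> * norm c \<le> (\<Sum>j\<le>CARD('q) - 1. norm (cscale \<i> (transpose (cmat B)) *v (matrix_power (cscale \<i> (transpose (cmat A))) j *v c)))"
proof -
 define f where "f = (\<lambda>c. \<Sum>j\<le>CARD('q) - 1. norm (cscale \<i> (transpose (cmat B)) *v (matrix_power (cscale \<i> (transpose (cmat A))) j *v c)))"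
 have fe: "f c = (\<Sum>j\<le>CARD('q) - 1. norm (transpose (cmat B) *v (matrix_power (transpose (cmat A)) j *v c)))" for c
  by (simp add: f_def cscale_vector cscale_power_vector matrix_vector_smult norm_vector_smult norm_power norm_mult)
 obtain \<kappa> where \<kappa>: "0 < \<kappa>" "\<And>c. \<kappa> * norm c \<le> f c"
 proof (rule positive_homogeneous_bound[of f])
  show "continuous_on UNIV f" unfolding f_def
   by (intro continuous_intros bounded_linear.continuous_on[OF bounded_linear_matrix_vector])
  show "f (r *R c) = \<bar>r\<bar> * f c" for r c
   unfolding f_def by (simp only: matrix_scaleR_right norm_scaleR sum_distrib_left)
  show "0 < f c" if c: "c \<noteq> 0" for c
  proof -
   have "\<exists>j\<le>CARD('q) - 1. transpose (cmat B) *v (matrix_power (transpose (cmat A)) j *v c) \<noteq> 0"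
   proof (rule ccontr)
    assume n: "\<not> (\<exists>j\<le>CARD('q) - 1. transpose (cmat B) *v (matrix_power (transpose (cmat A)) j *v c) \<noteq> 0)"
    have "c = 0" by (rule kalman_annihilator[OF k]) (use n in simp)
    with c show False ..
   qed
   then obtain j where "j \<le> CARD('q) - 1" "transpose (cmat B) *v (matrix_power (transpose (cmat A)) j *v c) \<noteq> 0"
    by blast
   then show ?thesis unfolding fe by (intro sum_pos2[of _ j]) auto
  qed
 qed blast
 show ?thesis by (rule that[OF \<kappa>(1) \<kappa>(2)[unfolded f_def]])
qed

section \<open>Diagonalization\<close>

lemma diagonalizable_spectrum:
 fixes M :: "complex^'n^'n"
 assumes "diagonalizable M"
 obtains P P' :: "complex^'n^'n" and d where "P ** P' = mat 1" "P' ** P = mat 1" "M = P ** diagm d ** P'"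
  "spectrum M = range d"
proof -
 obtain P D :: "complex^'n^'n" where P: "invertible P" "\<And>i j. i \<noteq> j ==> D $ i $ j = 0" "M = P ** D ** matrix_inv P"
  using assms unfolding diagonalizable_def by blast
 define d where "d = (\<lambda>k. D $ k $ k)"
 define P' where "P' = matrix_inv P"
 have D: "D = diagm d" using P(2) by (simp add: vec_eq_iff diagm_def d_def)
 have "P ** P' = mat 1 \<and> P' ** P = mat 1"
  using P(1) unfolding invertible_def P'_def matrix_inv_def by (rule someI_ex)
 then have PP: "P ** P' = mat 1" "P' ** P = mat 1" by auto
 have M: "M = P ** diagm d ** P'" using P(3) by (simp add: D P'_def)
 have "spectrum M = range d"
 proof (intro equalityI subsetI)
  fix z assume "z \<in> spectrum M"
  then obtain v where v: "v \<noteq> 0" "M *v v = z *s v" by (auto simp: spectrum_def)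
  define w where "w = P' *v v"
  have vw: "v = P *v w" by (simp add: w_def matrix_vector_mul_assoc PP)
  then have "w \<noteq> 0" using v(1) by auto
  then obtain k where k: "w $ k \<noteq> 0" by (auto simp: vec_eq_iff)
  have "diagm d *v w = P' *v (M *v v)"
   unfolding M w_def by (simp add: matrix_vector_mul_assoc matrix_mul_assoc PP)
  also have "... = z *s w" by (simp add: v(2) matrix_vector_smult w_def)
  finally have "d k * w $ k = z * w $ k" using diagm_vector[of d w k] by (metis vector_smult_component)
  then show "z \<in> range d" using k by auto
 next
  fix z assume "z \<in> range d"
  then obtain k where k: "z = d k" by blast
  define e where "e = (axis k 1 :: complex^'n)"
  have e: "diagm d *v e = z *s e" by (simp add: vec_eq_iff diagm_vector e_def axis_def k)
  have "M *v (P *v e) = P *v (diagm d *v ((P' ** P) *v e))"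
   unfolding M by (simp add: matrix_vector_mul_assoc matrix_mul_assoc)
  then have "M *v (P *v e) = z *s (P *v e)" by (simp add: PP e matrix_vector_smult)
  moreover have "P *v e \<noteq> 0"
  proof
   assume "P *v e = 0"
   then have "(P' ** P) *v e = 0" by (simp add: matrix_vector_mul_assoc[symmetric])
   then show False by (simp add: PP e_def axis_eq_0_iff)
  qed
  ultimately show "z \<in> spectrum M" by (auto simp: spectrum_def)
 qed
 then show ?thesis using that[OF PP M] by blast
qed

text \<open>Transposition keeps the diagonal matrix and exchanges the two diagonalizing factors; the
  velocities \<open>\<mu> k\<close> are the eigenvalues of \<open>M\<close>, real by
  hypothesis.\<close>

lemma transport_diagonalization:
 fixes M :: "real^'n^'n"
 assumes "diagonalizable (cmat M)" "spectrum (cmat M) \<subseteq> \<real>"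
 obtains Q Q' :: "complex^'n^'n" and \<mu> :: "'n => real" where "Q ** Q' = mat 1" "Q' ** Q = mat 1"
  "cscale \<i> (transpose (cmat M)) = Q ** diagm (\<lambda>k. \<i> * of_real (\<mu> k)) ** Q'" "\<And>k. mu_star M \<le> \<bar>\<mu> k\<bar>"
proof -
 obtain P P' :: "complex^'n^'n" and d where P: "P ** P' = mat 1" "P' ** P = mat 1" "cmat M = P ** diagm d ** P'"
   "spectrum (cmat M) = range d" by (rule diagonalizable_spectrum[OF assms(1)])
 define \<mu> where "\<mu> = (\<lambda>k. Re (d k))"
 have d: "d k = of_real (\<mu> k)" for k
 proof -
  have "d k \<in> \<real>" using assms(2) P(4) by auto
  then show ?thesis by (simp add: \<mu>_def)
 qed
 have tdiag: "transpose (diagm d) = diagm d" by (simp add: transpose_def diagm_def vec_eq_iff)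
 show ?thesis
 proof (rule that[of "transpose P'" "transpose P" \<mu>])
  show "transpose P' ** transpose P = mat 1" "transpose P ** transpose P' = mat 1"
   by (simp_all add: matrix_transpose_mul[symmetric] P transpose_mat)
  have sc: "cscale z (X ** Y ** Z) = X ** cscale z Y ** Z" for z and X Y Z :: "complex^'n^'n"
   by (simp add: matrix_eq cscale_vector matrix_vector_mul_assoc[symmetric] matrix_vector_smult)
  have "cscale \<i> (transpose (cmat M)) = cscale \<i> (transpose P' ** diagm d ** transpose P)"
   unfolding P(3) matrix_transpose_mul tdiag matrix_mul_assoc ..
  also have "... = transpose P' ** cscale \<i> (diagm d) ** transpose P" by (rule sc)
  also have "cscale \<i> (diagm d) = diagm (\<lambda>k. \<i> * of_real (\<mu> k))"
   by (simp add: cscale_def map_matrix_def diagm_def vec_eq_iff d)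
  finally show "cscale \<i> (transpose (cmat M)) = transpose P' ** diagm (\<lambda>k. \<i> * of_real (\<mu> k)) ** transpose P" .
  fix k
  have "mu_star M \<le> cmod (d k)" unfolding mu_star_def P(4) by (intro Min_le) auto
  then show "mu_star M \<le> \<bar>\<mu> k\<bar>" by (simp add: d)
 qed
qed

section \<open>Necessity of the Kalman condition\<close>

abbreviation "system_mode A' A12 A21 A22 K11 K12 \<equiv>
 mode_matrix (block_mat 0 0 0 (mat 1)) (block_mat A' A12 A21 A22) (block_mat K11 K12 0 0)"

abbreviation "system_solution A' A12 A21 A22 K11 K12 \<equiv>
 mild_solution (block_mat 0 0 0 (mat 1)) (block_mat A' A12 A21 A22) (block_mat K11 K12 0 0)"

abbreviation "adjoint_gen A' A12 A21 A22 K11 K12 \<equiv>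
 coupled_modes.gen (cscale \<i> (transpose (cmat A'))) (- transpose (cmat K11)) (cscale \<i> (transpose (cmat A21)))
  (cscale \<i> (transpose (cmat A12))) (- transpose (cmat K12)) (cscale \<i> (transpose (cmat A22)))"

text \<open>Links the system to the abstract modes. The coefficients contain
  \<open>transpose\<close> in place of \<open>adjm\<close> because the given matrices are real; the
  conjugation acts only on the factor \<open>\<i>\<close>.\<close>

lemma mode_matrix_adjoint:
 fixes A' K11 :: "real^'p^'p" and A12 K12 :: "real^'q^'p" and A21 :: "real^'p^'q" and A22 :: "real^'q^'q"
 shows "system_mode A' A12 A21 A22 K11 K12 n =
  - adjm (adjoint_gen A' A12 A21 A22 K11 K12 n)"
proof -
 have "system_mode A' A12 A21 A22 K11 K12 n $ i $ j =
  (- adjm (adjoint_gen A' A12 A21 A22 K11 K12 n)) $ i $ j" for i j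
  by (cases i; cases j)
   (simp_all add: mode_matrix_def coupled_modes.gen_def block_mat_def adjm_def cscale_def map_matrix_def transpose_def
    mat_def scaleR_conv_of_real[where 'a = complex])
 then show ?thesis by (simp add: vec_eq_iff)
qed

lemma fourier_coeff_torus_poly:
 assumes "finite S"
 shows "fourier_coeff (torus_poly S c) n = (if n \<in> S then c n else 0)"
proof -
 have "inner (fourier_coeff (torus_poly S c) n) w = inner (if n \<in> S then c n else 0) w" for w
 proof -
  have e: "torus_poly {n} (\<lambda>_. w) x = torus_exp n x *s w" for x by (simp add: torus_poly_def)
  have "S \<inter> {n} = (if n \<in> S then {n} else {})" by auto
  then show ?thesis
   using inner_torus_poly[OF assms, of "{n}" c "\<lambda>_. w"] by (simp add: inner_fourier_coeff[OF square_integrable_torus_poly] e)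
 qed
 then show ?thesis using vector_eq_rdot[of "fourier_coeff (torus_poly S c) n"] by blast
qed

text \<open>The function \<open>a\<close> is arbitrary: without integrability the Fourier integral
  has the default value 0 and the claim persists.\<close>

lemma snd_block_fourier_coeff: "snd_block (fourier_coeff (\<lambda>x. block_vec (a x :: complex^'p) (0 :: complex^'q)) n) = 0"
proof -
 define F where "F = (\<lambda>x. torus_exp (- n) x *s block_vec (a x) (0 :: complex^'q))"
 have "snd_block (LINT x|torus_measure. F x) = 0"
 proof (cases "integrable torus_measure F")
  case True
  from integral_bounded_linear[OF bounded_linear_snd_block this] show ?thesis
   by (simp add: F_def snd_block_smult)
 qed (simp add: not_integrable_integral_eq)
 then show ?thesis by (simp add: fourier_coeff_def F_def snd_block_scaleR)
qed

text \<open>\<open>Z\<close> is invariant under \<open>D\<close> and killed by the coupling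
  \<open>B\<close>, so the adjoint solution \<open>y\<close> started from
  \<open>block_vec 0 c\<close> keeps a zero first block, and the control never acts on its pairing
  with the state. The pairing of the final state with \<open>block_vec 0 c\<close> thus equals that
  of the initial datum with \<open>y T\<close>. Taking \<open>w\<close> as the second block of
  \<open>y T\<close> makes it \<open>inner w w\<close>, which is not zero. The datum lives on the
  mode 1 and so has zero mean.\<close>

lemma unreachable_target:
 fixes A' K11 :: "real^'p^'p" and A12 K12 :: "real^'q^'p" and A21 :: "real^'p^'q" and A22 :: "real^'q^'q" and T :: real
 assumes c: "c \<noteq> 0" "\<And>j. transpose (cmat A21) *v (matrix_power (transpose (cmat A22)) j *v c) = 0" and T: "0 \<le> T"
 obtains w :: "complex^'q" where
  "\<And>g f. system_solution A' A12 A21 A22 K11 K12 T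
    (\<lambda>x. block_vec 0 (torus_poly {1} (\<lambda>_. w) x)) (\<lambda>t x. block_vec (g t x) 0) f ==>
   \<not> (AE x in torus_measure. f T x = 0)"
proof -
 define D where "D = cscale \<i> (transpose (cmat A22))"
 define G where "G = coupled_modes.gen (cscale \<i> (transpose (cmat A'))) (- transpose (cmat K11)) (cscale \<i> (transpose (cmat A21)))
    (cscale \<i> (transpose (cmat A12))) (- transpose (cmat K12)) D 1"
 define L where "L = system_mode A' A12 A21 A22 K11 K12 1"
 have L: "L = - adjm G" unfolding L_def G_def D_def by (rule mode_matrix_adjoint)
 define y where "y = (\<lambda>t. matrix_exp (t *R G) *v block_vec 0 c)"
 define Z where "Z = {x. \<forall>j. transpose (cmat A21) *v (matrix_power (transpose (cmat A22)) j *v x) = 0}"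
 have G_Z: "G *v block_vec 0 x = block_vec 0 (D *v x - x)" and Z_step: "D *v x - x \<in> Z" if "x \<in> Z" for x
 proof -
  have z: "transpose (cmat A21) *v (matrix_power (transpose (cmat A22)) j *v x) = 0" for j using that by (auto simp: Z_def)
  show "G *v block_vec 0 x = block_vec 0 (D *v x - x)"
   using z[of 0] by (simp add: G_def coupled_modes.gen_def block_mat_vector cscale_vector matrix_vector_mult_diff_rdistrib)
  have "transpose (cmat A21) *v (matrix_power (transpose (cmat A22)) j *v (D *v x)) = 0" for j
   using z[of "Suc j"] unfolding D_def cscale_vector matrix_vector_smult matrix_power_vector_Suc_right by simp
  then show "D *v x - x \<in> Z" using z unfolding Z_def mem_Collect_eq matrix_vector_mult_diff_distrib by simp
 qed
 have pw: "\<exists>x\<in>Z. matrix_power G j *v block_vec 0 c = block_vec 0 x" for j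
 proof (induction j)
  case 0
  have "c \<in> Z" using c(2) by (simp add: Z_def)
  then show ?case by auto
 next
  case (Suc j)
  then show ?case unfolding matrix_power_vector_Suc using G_Z Z_step by metis
 qed
 have fst_y: "fst_block (y t) = 0" for t
 proof -
  have p: "fst_block (matrix_power (t *R G) k *v block_vec 0 c /\<^sub>R fact k) = 0" for k
  proof -
   have "matrix_power (t *R G) k *v z = t ^ k *R (matrix_power G k *v z)" for z
    by (induction k) (simp_all only: matrix_power_vector_Suc matrix_scaleR_left matrix_scaleR_right, simp_all)
   then show ?thesis using pw[of k] by (auto simp: fst_block_scaleR)
  qed
  from bounded_linear.sums[OF bounded_linear_fst_block sums_matrix_exp_vector[of "t *R G" "block_vec 0 c"]]
  have "(\<lambda>k. 0 :: complex^'p) sums fst_block (y t)" by (simp only: p y_def)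
  then show ?thesis using sums_unique2 sums_zero by blast
 qed
 define w where "w = snd_block (y T)"
 have yT: "y T = block_vec 0 w" using fst_y[of T] by (simp add: block_vec_eq_iff w_def)
 have w: "w \<noteq> 0"
 proof
  assume "w = 0"
  then have "matrix_exp (- T *R G) *v y T = 0" using yT by simp
  moreover have "matrix_exp (- T *R G) *v y T = block_vec 0 c"
   using matrix_exp_add_vector[of "- T" T G "block_vec 0 c"] by (simp add: y_def)
  ultimately have "block_vec 0 c = (0 :: complex^('p + 'q))" by simp
  with c(1) show False by (simp add: block_vec_eq_iff)
 qed
 show ?thesis
 proof (rule that[of w], rule notI)
  fix g :: "real => torus => complex^'p" and f
  assume ms: "system_solution A' A12 A21 A22 K11 K12 T
    (\<lambda>x. block_vec 0 (torus_poly {1} (\<lambda>_. w) x)) (\<lambda>t x. block_vec (g t x) 0) f"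
   and ae: "AE x in torus_measure. f T x = 0"
  define h where "h = (\<lambda>\<tau>. fourier_coeff (\<lambda>x. block_vec (g \<tau> x) (0 :: complex^'q)) 1)"
  have eq: "fourier_coeff (f T) 1 = matrix_exp (- T *R L) *v fourier_coeff (\<lambda>x. block_vec 0 (torus_poly {1} (\<lambda>_. w) x)) 1 +
    (LINT \<tau>:{0..T}|lborel. matrix_exp (- (T - \<tau>) *R L) *v h \<tau>)"
   using ms T unfolding mild_solution_def L_def h_def by simp
  have a1: "fourier_coeff (f T) 1 = 0"
  proof -
   have "AE x in torus_measure. torus_exp (- 1) x *s f T x = 0" using ae by eventually_elim simp
   then have "(LINT x|torus_measure. torus_exp (- 1) x *s f T x) = 0" by (rule integral_eq_zero_AE)
   then show ?thesis by (simp add: fourier_coeff_def)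
  qed
  have a2: "fourier_coeff (\<lambda>x. block_vec 0 (torus_poly {1} (\<lambda>_. w) x)) 1 = block_vec (0 :: complex^'p) w"
  proof -
   have "square_integrable torus_measure (\<lambda>x. 0 :: complex^'p)" by (simp add: square_integrable_def)
   from fourier_coeff_block[OF this square_integrable_torus_poly, of "{1}" "\<lambda>_. w" 1] show ?thesis
    by (simp add: fourier_coeff_torus_poly) (simp add: fourier_coeff_def)
  qed
  have a3: "inner (matrix_exp (- T *R L) *v block_vec 0 w) (block_vec 0 c) = inner w w"
   unfolding L inner_matrix_exp_neg_adjm y_def[symmetric] by (simp add: yT[unfolded y_def] inner_block_vec)
  have a4: "inner (LINT \<tau>:{0..T}|lborel. matrix_exp (- (T - \<tau>) *R L) *v h \<tau>) (block_vec 0 c) = 0"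
  proof -
   have z: "inner (matrix_exp (- (T - \<tau>) *R L) *v h \<tau>) (block_vec 0 c) = 0" for \<tau>
   proof -
    have "inner (matrix_exp (- (T - \<tau>) *R L) *v h \<tau>) (block_vec 0 c) = inner (h \<tau>) (y (T - \<tau>))"
     unfolding L inner_matrix_exp_neg_adjm y_def ..
    also have "... = 0" by (simp add: inner_block_vec fst_y h_def snd_block_fourier_coeff)
    finally show ?thesis .
   qed
   show ?thesis
   \<comment> \<open>For a non-integrable integrand the integral has the default value 0, which
     agrees with the claim.\<close>
   proof (cases "set_integrable lborel {0..T} (\<lambda>\<tau>. matrix_exp (- (T - \<tau>) *R L) *v h \<tau>)")
    case True
    from set_integral_bounded_linear[OF bounded_linear_inner_left this, of "block_vec 0 c"] show ?thesis
     unfolding z by (simp add: set_lebesgue_integral_def)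
   next
    case False
    then show ?thesis
     unfolding set_integrable_def set_lebesgue_integral_def by (subst not_integrable_integral_eq) simp_all
   qed
  qed
  have "inner (fourier_coeff (f T) 1) (block_vec 0 c) = inner w w"
   unfolding eq a2 inner_add_left a3 a4 by (rule add_0_right)
  with a1 w show False by simp
 qed
qed

text \<open>The midpoint between \<open>T_star\<close> and \<open>T\<close>, computed in real
  numbers, leaves spare time on the right and turns the condition on the gap into a strict
  inequality.\<close>

lemma time_below:
 assumes T: "ennreal T > T_star A' \<omega>" and mu: "0 < mu_star A'"
 obtains T0 where "0 < T0" "T0 < T" "gap_length \<omega> < ennreal (mu_star A' * T0)"
proof -
 define g where "g = enn2real (gap_length \<omega>)"
 have g: "gap_length \<omega> = ennreal g" "0 \<le> g"
  using gap_length_le[of \<omega>] unfolding g_def by (auto simp: top_unique intro!: ennreal_enn2real[symmetric] le_less_trans[OF _ ennreal_less_top])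
 have "T_star A' \<omega> = ennreal (g / mu_star A')" using mu g by (simp add: T_star_def divide_ennreal)
 with T have lt: "g / mu_star A' < T" using mu g by (simp add: ennreal_less_iff)
 define q where "q = g / mu_star A'"
 define T0 where "T0 = (q + T) / 2"
 have "0 \<le> q" "g = mu_star A' * q" using g mu by (auto simp: q_def)
 moreover have "q < T" using lt by (simp add: q_def)
 ultimately have "0 < T0" "T0 < T" "g < mu_star A' * T0" using mu by (auto simp: T0_def)
 then show ?thesis using g by (intro that[of T0]) (auto simp: ennreal_less_iff)
qed
theorem theorem3:
  fixes A' K11 :: "real^'p^'p"
    and A12 K12 :: "real^'q^'p"
    and A21 :: "real^'p^'q"
    and A22 :: "real^'q^'q"
    and \<omega> :: "torus set"
  assumes diag: "diagonalizable (cmat A')"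
    and real_spectrum: "spectrum (cmat A') \<subseteq> \<real>"
    and \<omega>: "open \<omega>" "\<omega> \<noteq> {}"
    and mu_pos: "mu_star A' > 0"
  shows "(\<forall>T f01 f02.
            ennreal T > T_star A' \<omega> \<and>
            square_integrable torus_measure (f01 :: torus \<Rightarrow> complex^'p) \<and>
            square_integrable torus_measure (f02 :: torus \<Rightarrow> complex^'q) \<and>
            (LINT x|torus_measure. f02 x) = 0 \<longrightarrow>
            (\<exists>(u1 :: real \<times> torus \<Rightarrow> complex^'p) f.
               square_integrable
                 (restrict_space (lborel \<Otimes>\<^sub>M torus_measure) ({0<..<T} \<times> \<omega>)) u1 \<and>
               mild_solution (block_mat 0 0 0 (mat 1)) (block_mat A' A12 A21 A22)
                 (block_mat K11 K12 0 0) T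
                 (\<lambda>x. block_vec (f01 x) (f02 x))
                 (\<lambda>t x. block_vec (indicator \<omega> x *\<^sub>R u1 (t, x)) 0) f \<and>
               (AE x in torus_measure. f T x = 0)))
         \<longleftrightarrow> kalman_rank_condition A22 A21"
proof (rule iffI, goal_cases)
 case controllable: 1
 show ?case
 proof (rule ccontr)
  assume "\<not> kalman_rank_condition A22 A21"
  then obtain c where c: "c \<noteq> 0" "\<And>j. transpose (cmat A21) *v (matrix_power (transpose (cmat A22)) j *v c) = 0"
   by (rule kalman_fails) blast
  \<comment> \<open>Any time above \<open>T_star\<close> serves, since the obstruction is present
    for all \<open>T\<close>; this one works because a gap is never longer than
    \<open>2 * pi\<close>.\<close>
  define T where "T = 2 * pi / mu_star A' + 1"
  have T0: "0 \<le> T" using mu_pos by (simp add: T_def)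
  have "T_star A' \<omega> \<le> ennreal (2 * pi) / ennreal (mu_star A')"
   using mu_pos by (simp add: T_star_def divide_right_mono_ennreal gap_length_le)
  also have "... = ennreal (2 * pi / mu_star A')" using mu_pos by (simp add: divide_ennreal)
  also have "... < ennreal T" using mu_pos by (simp add: T_def ennreal_less_iff)
  finally have T: "ennreal T > T_star A' \<omega>" .
  obtain w :: "complex^'q" where w: "\<And>g f. system_solution A' A12 A21 A22 K11 K12 T
    (\<lambda>x. block_vec 0 (torus_poly {1} (\<lambda>_. w) x)) (\<lambda>t x. block_vec (g t x) 0) f ==>
   \<not> (AE x in torus_measure. f T x = 0)" by (rule unreachable_target[OF c T0, of A' A12 K11 K12]) blast
  have "square_integrable torus_measure (\<lambda>x. 0 :: complex^'p)" by (simp add: square_integrable_def)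
  moreover have "(LINT x|torus_measure. torus_poly {1} (\<lambda>_. w) x) = 0"
  proof -
   have "torus_exp (- 0) x *s torus_poly {1} (\<lambda>_. w) x = torus_poly {1} (\<lambda>_. w) x" for x
    by (rule torus_of_real_surj[of x]) simp
   moreover have "fourier_coeff (torus_poly {1} (\<lambda>_. w)) 0 = 0" by (simp add: fourier_coeff_torus_poly)
   ultimately show ?thesis by (simp add: fourier_coeff_def)
  qed
  ultimately obtain u1 :: "real \<times> torus => complex^'p" and f where
   "system_solution A' A12 A21 A22 K11 K12 T
    (\<lambda>x. block_vec 0 (torus_poly {1} (\<lambda>_. w) x)) (\<lambda>t x. block_vec (indicator \<omega> x *R u1 (t, x)) 0) f"
   "AE x in torus_measure. f T x = 0"
   using controllable T square_integrable_torus_poly[of "{1}" "\<lambda>_. w"] by blast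
  with w[of "\<lambda>t x. indicator \<omega> x *R u1 (t, x)" f] show False by blast
 qed
next
 case k: 2
 define A where "A = cscale \<i> (transpose (cmat A'))"
 define K where "K = - transpose (cmat K11)"
 define B where "B = cscale \<i> (transpose (cmat A21))"
 define C where "C = cscale \<i> (transpose (cmat A12))"
 define E where "E = - transpose (cmat K12)"
 define D where "D = cscale \<i> (transpose (cmat A22))"
 obtain Q Q' :: "complex^'p^'p" and \<mu> :: "'p => real" where diagQ: "Q ** Q' = mat 1" "Q' ** Q = mat 1"
  "A = Q ** diagm (\<lambda>k. \<i> * of_real (\<mu> k)) ** Q'" "\<And>k. mu_star A' \<le> \<bar>\<mu> k\<bar>"
  unfolding A_def using transport_diagonalization[OF diag real_spectrum] by blast
 \<comment> \<open>By transposition the Kalman condition on \<open>A22\<close> and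
   \<open>A21\<close> becomes a lower bound for the pair \<open>D\<close>, \<open>B\<close>, in
   which \<open>B\<close> observes the adjoint heat component.\<close>
 obtain \<kappa> where \<kappa>: "0 < \<kappa>" "\<And>c. \<kappa> * norm c \<le> (\<Sum>j\<le>CARD('q) - 1. norm (B *v (matrix_power D j *v c)))"
  unfolding B_def D_def using kalman_lower_bound[OF k] by blast
 define \<Omega> where "\<Omega> = torus_of_real -` \<omega>"
 interpret observed_system \<Omega> A K B C E D \<mu> Q Q' \<kappa> "CARD('q) - 1"
 proof
  show "open \<Omega>" using \<omega>(1) by (simp add: \<Omega>_def open_torus_def)
  show "(x + 2 * pi \<in> \<Omega>) = (x \<in> \<Omega>)" for x by (simp add: \<Omega>_def torus_of_real_periodic)
  show "\<Omega> \<noteq> {}"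
  proof -
   obtain x where x: "x \<in> \<omega>" using \<omega>(2) by blast
   obtain z where "x = torus_of_real z" by (rule torus_of_real_surj)
   with x show ?thesis by (auto simp: \<Omega>_def)
  qed
  show "\<mu> k \<noteq> 0" for k using diagQ(4)[of k] mu_pos by auto
 qed (fact diagQ \<kappa>)+
 have mode: "system_mode A' A12 A21 A22 K11 K12 n = - adjm (gen n)" for n
  unfolding A_def K_def B_def C_def E_def D_def by (rule mode_matrix_adjoint)
 show ?case
 proof (intro allI impI, elim conjE, goal_cases)
  case prems: (1 T f01 f02)
  obtain T0 where T0: "0 < T0" "T0 < T" "gap_length \<omega> < ennreal (mu_star A' * T0)"
   by (rule time_below[OF prems(1) mu_pos])
  have hit: "\<exists>t\<in>{0<..<T0}. y - \<mu> k * t \<in> \<Omega>" for k y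
   unfolding \<Omega>_def by (rule characteristic_hits[OF \<omega> mu_pos diagQ(4) T0(1,3)])
  show ?case
  proof (rule null_controllable[OF \<omega>(1) \<Omega>_def T0(1) hit T0(2) prems(2-4)], goal_cases)
   case (1 U f)
   have "system_solution A' A12 A21 A22 K11 K12 T
     (\<lambda>x. block_vec (f01 x) (f02 x)) (\<lambda>t x. block_vec (indicator \<omega> x *R U (t, x)) 0) f"
    unfolding mild_solution_def mode by (intro conjI ballI allI 1(2-4))
   with 1(1,5) show ?case by (intro exI[of _ U] exI[of _ f]) simp
  qed
 qed
qed

end
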